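(* Let $\Omega=\mathbb{R}^d$ or $\Omega=\mathbb{T}^d=(\mathbb{R}/\mathbb{Z})^d$, let $\sigma>d/2$, let $H^\sigma=H^\sigma(\Omega;\mathbb{C})$, and let $L=\Delta$ or $L=i\Delta$. Let $N:H^\sigma\to H^\sigma$ be a map that sends bounded sets of $H^\sigma$ to bounded sets of $H^\sigma$ and is Lipschitz continuous on bounded sets of $H^\sigma$. Fix $u^0\in H^\sigma$ and let $u$ be the unique solution of $$\partial_t u = Lu+N(u)u,\qquad u(0)=u^0,$$ on an interval $(T_\star,T^\star)$ with $T_\star<0<T^\star$. Let $s\geq 1$ be an integer. Assume that $u$ has $s+2$ continuous derivatives with values in $H^\sigma$ on $(T_\star,T^\star)$ and that $t\mapsto N(u(t))$ has $s$ continuous derivatives with values in $H^\sigma$ on $(T_\star,T^\star)$. Let $T\in(0,T^\star)$, $r>0$, and $$V=\{u(t)+v \;:\; t\in[0,T],\ v\in H^\sigma,\ \|v\|_{H^\sigma}\leq r\}.$$ Let $M>0$ be such that $\|N(u(t))\|_{H^\sigma}\leq M$ for all $t\in[0,T]$, and let $m>0$ be such that $\|N(v)\|_{H^\sigma}<M+m$ for all $v\in V$. Let $(A,b,c)$ be an $s$-stage collocation Runge--Kutta method with nodes $0\leq c_1<\dots<c_s\leq 1$. Let $D\in\mathcal{M}_s(\mathbb{C})$ and $\Theta\in\mathbb{C}^s$ be such that the step $\Gamma_n=D\Gamma_{n-1}+\Theta N(u_n)$ is strongly stable and consistent of order $s$. Assume that either $L=i\Delta$ and the Runge--Kutta method is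 $\hat I$-stable, or $L=\Delta$ and the Runge--Kutta method is $\hat A$-stable. Then there exist a constant $C>0$, some $h_0\in(0,T)$, a neighbourhood $\mathcal{U}$ of $u^0$ in $H^\sigma$ and some $\eta>0$ such that for all $u_0\in\mathcal{U}$, all $h\in(0,h_0)$, and all $\gamma_{-1,1},\dots,\gamma_{-1,s}\in H^\sigma$ with $\max_{1\leq i\leq s}\|\gamma_{-1,i}-N(u(t_{-1}+c_ih))\|_{H^\sigma}<\eta$ (where $t_k=kh$ for integers $k\ge -1$), the linearly implicit method (see context) is well defined for all $n\in\mathbb{N}$ such that $0\leq nh\leq T$. Moreover, for all such $n$ and $h$, one has $$\forall i\in\{1,\dots,s\},\qquad \|\gamma_{n-1,i}\|_{H^\sigma}\leq M+m,$$ and $$\max_{0\leq k\leq n}\|u(t_k)-u_k\|_{H^\sigma}\leq e^{Cnh}\Big(\|u^0-u_0\|_{H^\sigma}+C\Big(\max_{1\leq i\leq s}\|N(u(t_{-1}+c_ih))-\gamma_{-1,i}\|_{H^\sigma}+h^s\Big)\Big).$$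
   Context: Sobolev spaces. For $\Omega=\mathbb{R}^d$, $\|f\|_{H^\sigma}^2=\int_{\mathbb{R}^d}|\hat f(\xi)|^2(1+|\xi|^2)^\sigma\,d\xi$ with $\hat f$ the Fourier transform; for $\Omega=\mathbb{T}^d$, $\|f\|_{H^\sigma}^2=\sum_{k\in\mathbb{Z}^d}|\hat f(k)|^2(1+|k|^2)^\sigma$ with $\hat f$ the Fourier coefficients. Since $\sigma>d/2$, $H^\sigma$ is an algebra; $N(u)u$ and $\gamma u$ denote pointwise products. The operator $L$ is unbounded on $H^\sigma$ and maps $H^{\sigma}$ to $H^{\sigma-2}$; equations involving $L$ are understood in this sense. Collocation method. An $s$-stage Runge--Kutta method with real coefficients $A=(a_{ij})\in\mathcal{M}_s(\mathbb{R})$, $b=(b_i)$, $c=(c_i)\in\mathbb{R}^s$ is of collocation if $c_1,\dots,c_s$ are distinct and, with $\ell_i(\tau)=\prod_{j\neq i}\frac{\tau-c_j}{c_i-c_j}$, one has $a_{ij}=\int_0^{c_i}\ell_j(\tau)\,d\tau$ and $b_i=\int_0^1\ell_i(\tau)\,d\tau$. Linearly implicit method with time step $h>0$. Given $u_0\in H^\sigma$ and $\Gamma_{-1}=(\gamma_{-1,1},\dots,\gamma_{-1,s})^t\in(H^\sigma)^s$, for $n\geq 0$, knowing $u_n$ and $\Gamma_{n-1}$: (1) compute $\Gamma_n=(\gamma_{n,1},\dots,\gamma_{n,s})^t=D\Gamma_{n-1}+\Theta N(u_n)$ (pointwise in space); (2) solve for $(u_{n,i})_{1\leq i\leq s}\in(H^\sigma)^s$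 the linear system $u_{n,i}=u_n+h\sum_{j=1}^s a_{ij}(L+\gamma_{n,j})u_{n,j}$, $1\leq i\leq s$; (3) set $u_{n+1}=u_n+h\sum_{i=1}^s b_i(L+\gamma_{n,i})u_{n,i}$. The method is well defined as long as the system in (2) has a unique solution in $(H^\sigma)^s$ and $u_{n+1}\in H^\sigma$. Step (1) is strongly stable if the spectral radius satisfies $\rho(D)<1$. It is consistent of order $s$ if $V_c=DV_{c-\mathds{1}}+\vartheta$, where $(V_c)_{i,j}=c_i^{j-1}$, $(V_{c-\mathds{1}})_{i,j}=(c_i-1)^{j-1}$, and $\vartheta$ is the $s\times s$ matrix with first column $\Theta$ and zeros elsewhere. Stability notions. Let $\mathds{1}=(1,\dots,1)^t\in\mathbb{R}^s$, $R(\lambda)=1+\lambda b^t(I-\lambda A)^{-1}\mathds{1}$ (a rational function), and $\mathbb{C}^-=\{\lambda\in\mathbb{C}:\mathrm{Re}\,\lambda\leq 0\}$. The method is: $A$-stable if $|R|\leq 1$ on $\mathbb{C}^-$; $AS$-stable if $\lambda\mapsto\lambda b^t(I-\lambda A)^{-1}$ has only removable singularities in $\mathbb{C}^-$ and is bounded on $\mathbb{C}^-$; $ASI$-stable if $I-\lambda A$ is invertible for all $\lambda\in\mathbb{C}^-$ and $\lambda\mapsto(I-\lambda A)^{-1}$ is bounded on $\mathbb{C}^-$. $I$-, $IS$- and $ISI$-stability are defined in the same way with $\mathbb{C}^-$ replaced by $i\mathbb{R}$. $\hat A$-stable means $A$-, $AS$- and $ASI$-stable; $\hat I$-stable means $I$-,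 $IS$- and $ISI$-stable. *)

theory Defs
  imports
    "HOL-Analysis.Analysis"
    "Jordan_Normal_Form.Spectral_Radius"
    "Jordan_Normal_Form.Gauss_Jordan_Elimination"
begin

(* The infix "$" is used below for the vectors of Jordan_Normal_Form only. *)
unbundle no vec_syntax


section \<open>Sobolev spaces on the whole space and on the torus\<close>

text \<open>
  The two possible domains are \<open>\<real>\<^sup>d\<close> (\<open>Whole\<close>) and \<open>(\<real>/\<int>)\<^sup>d\<close> (\<open>Torus\<close>), with \<open>d = CARD('d)\<close>.
  A function on the torus is a function on \<open>\<real>\<^sup>d\<close> that is 1-periodic in every coordinate.
  As for the Lebesgue spaces of the library, elements of a space are functions, which stand for
  their classes modulo equality almost everywhere (\<open>ae_eq\<close>); accordingly, the norms below are
  seminorms on functions.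
\<close>

datatype domain = Whole | Torus

definition lattice :: "(real^'d) set" where
  "lattice = {k. \<forall>i. vec_nth k i \<in> \<int>}"

definition unit_cube :: "(real^'d) set" where
  "unit_cube = {x. \<forall>i. 0 \<le> vec_nth x i \<and> vec_nth x i \<le> 1}"

fun space_measure :: "domain \<Rightarrow> (real^'d) measure" where
  "space_measure Whole = lborel"
| "space_measure Torus = restrict_space lborel unit_cube"

text \<open>
  The measure on frequencies: an integral with respect to \<open>freq_measure Torus\<close> is a sum
  over \<open>\<int>\<^sup>d\<close>, and almost everywhere means at all points of \<open>\<int>\<^sup>d\<close>.
\<close>

fun freq_measure :: "domain \<Rightarrow> (real^'d) measure" where
  "freq_measure Whole = lborel"
| "freq_measure Torus = count_space lattice"

definition ae_eq :: "domain \<Rightarrow> (real^'d \<Rightarrow> complex) \<Rightarrow> (real^'d \<Rightarrow> complex) \<Rightarrow> bool" where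
  "ae_eq \<Omega> f g \<longleftrightarrow> (AE x in space_measure \<Omega>. f x = g x)"

definition L2 :: "domain \<Rightarrow> (real^'d \<Rightarrow> complex) set" where
  "L2 \<Omega> = {f. f \<in> borel_measurable borel \<and>
     integrable (space_measure \<Omega>) (\<lambda>x. (cmod (f x))\<^sup>2) \<and>
     (\<Omega> = Torus \<longrightarrow> (\<forall>x. \<forall>k\<in>lattice. f (x + k) = f x))}"

text \<open>
  The Fourier transform with kernel \<open>exp (- 2 \<pi> \<i> \<xi> \<cdot> x)\<close>. For \<open>f\<close> square integrable on the whole
  space, it is the Plancherel transform: the limit in \<open>L\<^sup>2\<close> of the Fourier integrals of the
  truncations of \<open>f\<close> to balls.
\<close>

definition plancherel :: "(real^'d \<Rightarrow> complex) \<Rightarrow> (real^'d \<Rightarrow> complex) \<Rightarrow> bool" where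
  "plancherel f g \<longleftrightarrow>
     g \<in> borel_measurable borel \<and> integrable lborel (\<lambda>\<xi>. (cmod (g \<xi>))\<^sup>2) \<and>
     (\<lambda>n. \<integral>\<^sup>+ \<xi>. ennreal ((cmod (g \<xi> -
         (LINT x:cball 0 (real n)|lborel. f x * cis (- 2 * pi * inner \<xi> x))))\<^sup>2) \<partial>lborel)
       \<longlonglongrightarrow> 0"

fun fourier :: "domain \<Rightarrow> (real^'d \<Rightarrow> complex) \<Rightarrow> real^'d \<Rightarrow> complex" where
  "fourier Whole f = (SOME g. plancherel f g)"
| "fourier Torus f = (\<lambda>k. LINT x|space_measure Torus. f x * cis (- 2 * pi * inner k x))"

text \<open>
  For every real \<open>\<tau>\<close>, elements of \<open>H\<^sup>\<tau>\<close> (distributions in general if \<open>\<tau> < 0\<close>) can be given by their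
  Fourier transforms, which are the functions \<open>g\<close> in \<open>Hhat \<Omega> \<tau>\<close>, with norm \<open>Hhat_norm \<Omega> \<tau> g\<close>.
  Two of them are equal if their Fourier transforms agree almost everywhere.
\<close>

definition Hhat :: "domain \<Rightarrow> real \<Rightarrow> (real^'d \<Rightarrow> complex) set" where
  "Hhat \<Omega> \<tau> = {g. g \<in> borel_measurable (freq_measure \<Omega>) \<and>
     integrable (freq_measure \<Omega>) (\<lambda>\<xi>. (cmod (g \<xi>))\<^sup>2 * (1 + (norm \<xi>)\<^sup>2) powr \<tau>)}"

definition Hhat_norm :: "domain \<Rightarrow> real \<Rightarrow> (real^'d \<Rightarrow> complex) \<Rightarrow> real" where
  "Hhat_norm \<Omega> \<tau> g = sqrt (LINT \<xi>|freq_measure \<Omega>. (cmod (g \<xi>))\<^sup>2 * (1 + (norm \<xi>)\<^sup>2) powr \<tau>)"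

text \<open>\<open>H\<^sup>\<sigma>\<close> as a space of functions, for \<open>\<sigma> \<ge> 0\<close>.\<close>

definition Hspace :: "domain \<Rightarrow> real \<Rightarrow> (real^'d \<Rightarrow> complex) set" where
  "Hspace \<Omega> \<sigma> = {f \<in> L2 \<Omega>. fourier \<Omega> f \<in> Hhat \<Omega> \<sigma>}"

definition Hnorm :: "domain \<Rightarrow> real \<Rightarrow> (real^'d \<Rightarrow> complex) \<Rightarrow> real" where
  "Hnorm \<Omega> \<sigma> f = Hhat_norm \<Omega> \<sigma> (fourier \<Omega> f)"

definition Hdist :: "domain \<Rightarrow> real \<Rightarrow> (real^'d \<Rightarrow> complex) \<Rightarrow> (real^'d \<Rightarrow> complex) \<Rightarrow> real" where
  "Hdist \<Omega> \<sigma> f g = Hnorm \<Omega> \<sigma> (\<lambda>x. f x - g x)"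

definition Hbounded :: "domain \<Rightarrow> real \<Rightarrow> (real^'d \<Rightarrow> complex) set \<Rightarrow> bool" where
  "Hbounded \<Omega> \<sigma> B \<longleftrightarrow> B \<subseteq> Hspace \<Omega> \<sigma> \<and> (\<exists>K. \<forall>v\<in>B. Hnorm \<Omega> \<sigma> v \<le> K)"

definition Hneighbourhood ::
  "domain \<Rightarrow> real \<Rightarrow> (real^'d \<Rightarrow> complex) \<Rightarrow> (real^'d \<Rightarrow> complex) set \<Rightarrow> bool" where
  "Hneighbourhood \<Omega> \<sigma> f U \<longleftrightarrow>
     U \<subseteq> Hspace \<Omega> \<sigma> \<and> (\<exists>\<epsilon>>0. \<forall>g\<in>Hspace \<Omega> \<sigma>. Hdist \<Omega> \<sigma> g f < \<epsilon> \<longrightarrow> g \<in> U)"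

text \<open>
  The Fourier transform of \<open>\<kappa> \<Delta> f\<close>, where \<open>\<kappa> \<Delta>\<close> maps \<open>H\<^sup>\<sigma>\<close> to \<open>H\<^bsup>\<sigma>-2\<^esup>\<close>; the factor \<open>4 \<pi>\<^sup>2\<close> comes
  from the kernel of the Fourier transform.
\<close>

definition Lhat ::
  "domain \<Rightarrow> complex \<Rightarrow> (real^'d \<Rightarrow> complex) \<Rightarrow> real^'d \<Rightarrow> complex" where
  "Lhat \<Omega> \<kappa> f = (\<lambda>\<xi>. \<kappa> * complex_of_real (- 4 * pi\<^sup>2 * (norm \<xi>)\<^sup>2) * fourier \<Omega> f \<xi>)"


section \<open>The evolution equation\<close>

definition Hcontinuous_on ::
  "domain \<Rightarrow> real \<Rightarrow> real set \<Rightarrow> (real \<Rightarrow> real^'d \<Rightarrow> complex) \<Rightarrow> bool" where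
  "Hcontinuous_on \<Omega> \<sigma> I f \<longleftrightarrow>
     (\<forall>t\<in>I. ((\<lambda>t'. Hdist \<Omega> \<sigma> (f t') (f t)) \<longlongrightarrow> 0) (at t within I))"

definition has_Hderivative_on ::
  "domain \<Rightarrow> real \<Rightarrow> real set \<Rightarrow> (real \<Rightarrow> real^'d \<Rightarrow> complex) \<Rightarrow> (real \<Rightarrow> real^'d \<Rightarrow> complex) \<Rightarrow> bool"
  where
  "has_Hderivative_on \<Omega> \<sigma> I f f' \<longleftrightarrow>
     (\<forall>t\<in>I. ((\<lambda>t'. Hdist \<Omega> \<sigma> (\<lambda>x. (f t' x - f t x) / complex_of_real (t' - t)) (f' t)) \<longlongrightarrow> 0)
        (at t within I))"

definition Hck ::
  "domain \<Rightarrow> real \<Rightarrow> real set \<Rightarrow> nat \<Rightarrow> (real \<Rightarrow> real^'d \<Rightarrow> complex) \<Rightarrow> bool" where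
  "Hck \<Omega> \<sigma> I k f \<longleftrightarrow>
     (\<exists>w :: nat \<Rightarrow> real \<Rightarrow> real^'d \<Rightarrow> complex.
        w 0 = f \<and>
        (\<forall>j\<le>k. \<forall>t\<in>I. w j t \<in> Hspace \<Omega> \<sigma>) \<and>
        (\<forall>j<k. has_Hderivative_on \<Omega> \<sigma> I (w j) (w (Suc j))) \<and>
        (\<forall>j\<le>k. Hcontinuous_on \<Omega> \<sigma> I (w j)))"

text \<open>
  \<open>u\<close> takes values in \<open>H\<^sup>\<sigma>\<close> and, at each time of \<open>I\<close>, has the derivative \<open>\<kappa> \<Delta> u + N(u) u\<close>
  with respect to the norm of \<open>H\<^bsup>\<sigma>-2\<^esup>\<close>.
\<close>

definition solves_equation ::
  "domain \<Rightarrow> real \<Rightarrow> complex \<Rightarrow> ((real^'d \<Rightarrow> complex) \<Rightarrow> (real^'d \<Rightarrow> complex)) \<Rightarrow> real set \<Rightarrow>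
   (real \<Rightarrow> real^'d \<Rightarrow> complex) \<Rightarrow> bool" where
  "solves_equation \<Omega> \<sigma> \<kappa> N I u \<longleftrightarrow>
     (\<forall>t\<in>I. u t \<in> Hspace \<Omega> \<sigma>) \<and>
     (\<forall>t\<in>I. ((\<lambda>t'. Hhat_norm \<Omega> (\<sigma> - 2)
          (\<lambda>\<xi>. (fourier \<Omega> (u t') \<xi> - fourier \<Omega> (u t) \<xi>) / complex_of_real (t' - t)
             - (Lhat \<Omega> \<kappa> (u t) \<xi> + fourier \<Omega> (\<lambda>x. N (u t) x * u t x) \<xi>))) \<longlongrightarrow> 0)
        (at t within I))"


section \<open>Collocation methods and their stability\<close>

text \<open>
  Stages are numbered \<open>0, \<dots>, s - 1\<close>.
\<close>

definition lagrange_basis :: "nat \<Rightarrow> real Matrix.vec \<Rightarrow> nat \<Rightarrow> real \<Rightarrow> real" where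
  "lagrange_basis s c i \<tau> = (\<Prod>j\<in>{..<s} - {i}. (\<tau> - c $ j) / (c $ i - c $ j))"

definition collocation ::
  "nat \<Rightarrow> real Matrix.mat \<Rightarrow> real Matrix.vec \<Rightarrow> real Matrix.vec \<Rightarrow> bool" where
  "collocation s A b c \<longleftrightarrow>
     A \<in> carrier_mat s s \<and> b \<in> carrier_vec s \<and> c \<in> carrier_vec s \<and>
     inj_on (\<lambda>i. c $ i) {..<s} \<and>
     (\<forall>i<s. \<forall>j<s. A $$ (i, j) = (LBINT \<tau>=ereal 0..ereal (c $ i). lagrange_basis s c j \<tau>)) \<and>
     (\<forall>i<s. b $ i = (LBINT \<tau>=ereal 0..ereal 1. lagrange_basis s c i \<tau>))"

definition stab_matrix :: "nat \<Rightarrow> real Matrix.mat \<Rightarrow> complex \<Rightarrow> complex Matrix.mat" where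
  "stab_matrix s A z = 1\<^sub>m s - z \<cdot>\<^sub>m map_mat complex_of_real A"

definition stab_inverse :: "nat \<Rightarrow> real Matrix.mat \<Rightarrow> complex \<Rightarrow> complex Matrix.mat" where
  "stab_inverse s A z = the (mat_inverse (stab_matrix s A z))"

text \<open>The \<open>j\<close>-th entry of the row vector \<open>z b\<^sup>t (I - z A)\<^sup>-\<^sup>1\<close>, and the stability function \<open>R\<close>.\<close>

definition stab_row ::
  "nat \<Rightarrow> real Matrix.mat \<Rightarrow> real Matrix.vec \<Rightarrow> nat \<Rightarrow> complex \<Rightarrow> complex" where
  "stab_row s A b j z = z * (\<Sum>i<s. complex_of_real (b $ i) * stab_inverse s A z $$ (i, j))"

definition stab_function ::
  "nat \<Rightarrow> real Matrix.mat \<Rightarrow> real Matrix.vec \<Rightarrow> complex \<Rightarrow> complex" where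
  "stab_function s A b z = 1 + (\<Sum>j<s. stab_row s A b j z)"

text \<open>
  The three notions of stability relative to a set \<open>S\<close>, which is the closed left half-plane or the
  imaginary axis. At the finitely many \<open>z\<close> where \<open>I - z A\<close> is not invertible, the value of the
  rational function \<open>R\<close> is its limit, which is required to exist.
\<close>

definition stable_on :: "complex set \<Rightarrow> nat \<Rightarrow> real Matrix.mat \<Rightarrow> real Matrix.vec \<Rightarrow> bool" where
  "stable_on S s A b \<longleftrightarrow>
     (\<forall>z\<in>S. if invertible_mat (stab_matrix s A z) then cmod (stab_function s A b z) \<le> 1
             else (\<exists>l. (stab_function s A b \<longlongrightarrow> l) (at z) \<and> cmod l \<le> 1))"

definition S_stable_on :: "complex set \<Rightarrow> nat \<Rightarrow> real Matrix.mat \<Rightarrow> real Matrix.vec \<Rightarrow> bool" where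
  "S_stable_on S s A b \<longleftrightarrow>
     (\<exists>K. \<forall>j<s. \<forall>z\<in>S.
        if invertible_mat (stab_matrix s A z) then cmod (stab_row s A b j z) \<le> K
        else (\<exists>l. (stab_row s A b j \<longlongrightarrow> l) (at z) \<and> cmod l \<le> K))"

definition SI_stable_on :: "complex set \<Rightarrow> nat \<Rightarrow> real Matrix.mat \<Rightarrow> bool" where
  "SI_stable_on S s A \<longleftrightarrow>
     (\<forall>z\<in>S. invertible_mat (stab_matrix s A z)) \<and>
     (\<exists>K. \<forall>z\<in>S. \<forall>i<s. \<forall>j<s. cmod (stab_inverse s A z $$ (i, j)) \<le> K)"

definition A_hat_stable :: "nat \<Rightarrow> real Matrix.mat \<Rightarrow> real Matrix.vec \<Rightarrow> bool" where
  "A_hat_stable s A b \<longleftrightarrow>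
     stable_on {z. Re z \<le> 0} s A b \<and> S_stable_on {z. Re z \<le> 0} s A b \<and> SI_stable_on {z. Re z \<le> 0} s A"

definition I_hat_stable :: "nat \<Rightarrow> real Matrix.mat \<Rightarrow> real Matrix.vec \<Rightarrow> bool" where
  "I_hat_stable s A b \<longleftrightarrow>
     stable_on {z. Re z = 0} s A b \<and> S_stable_on {z. Re z = 0} s A b \<and> SI_stable_on {z. Re z = 0} s A"

definition strongly_stable :: "complex Matrix.mat \<Rightarrow> bool" where
  "strongly_stable D \<longleftrightarrow> spectral_radius D < 1"

definition consistent_step ::
  "nat \<Rightarrow> real Matrix.vec \<Rightarrow> complex Matrix.mat \<Rightarrow> complex Matrix.vec \<Rightarrow> bool" where
  "consistent_step s c D \<Theta> \<longleftrightarrow>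
     Matrix.mat s s (\<lambda>(i, j). complex_of_real (c $ i) ^ j) =
       D * Matrix.mat s s (\<lambda>(i, j). complex_of_real (c $ i - 1) ^ j)
       + Matrix.mat s s (\<lambda>(i, j). if j = 0 then \<Theta> $ i else 0)"


section \<open>The linearly implicit method\<close>

text \<open>
  Families of \<open>s\<close> functions are indexed by the natural numbers \<open>i < s\<close>; the values at other
  indices are irrelevant.
\<close>

definition next_gamma ::
  "nat \<Rightarrow> complex Matrix.mat \<Rightarrow> complex Matrix.vec \<Rightarrow>
   ((real^'d \<Rightarrow> complex) \<Rightarrow> (real^'d \<Rightarrow> complex)) \<Rightarrow>
   (real^'d \<Rightarrow> complex) \<Rightarrow> (nat \<Rightarrow> real^'d \<Rightarrow> complex) \<Rightarrow> nat \<Rightarrow> real^'d \<Rightarrow> complex" where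
  "next_gamma s D \<Theta> N v \<gamma> = (\<lambda>i x. (\<Sum>j<s. D $$ (i, j) * \<gamma> j x) + \<Theta> $ i * N v x)"

text \<open>
  The equations of the stages and of the update hold in \<open>H\<^bsup>\<sigma>-2\<^esup>\<close>.
\<close>

definition solves_stages ::
  "domain \<Rightarrow> real \<Rightarrow> complex \<Rightarrow> nat \<Rightarrow> real Matrix.mat \<Rightarrow> real \<Rightarrow>
   (real^'d \<Rightarrow> complex) \<Rightarrow> (nat \<Rightarrow> real^'d \<Rightarrow> complex) \<Rightarrow> (nat \<Rightarrow> real^'d \<Rightarrow> complex) \<Rightarrow> bool" where
  "solves_stages \<Omega> \<sigma> \<kappa> s A h v \<gamma> U \<longleftrightarrow>
     (\<forall>i<s. U i \<in> Hspace \<Omega> \<sigma>) \<and>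
     (\<forall>i<s. AE \<xi> in freq_measure \<Omega>.
        fourier \<Omega> (U i) \<xi> = fourier \<Omega> v \<xi> + complex_of_real h *
          (\<Sum>j<s. complex_of_real (A $$ (i, j)) *
             (Lhat \<Omega> \<kappa> (U j) \<xi> + fourier \<Omega> (\<lambda>x. \<gamma> j x * U j x) \<xi>)))"

definition is_update ::
  "domain \<Rightarrow> real \<Rightarrow> complex \<Rightarrow> nat \<Rightarrow> real Matrix.vec \<Rightarrow> real \<Rightarrow>
   (real^'d \<Rightarrow> complex) \<Rightarrow> (nat \<Rightarrow> real^'d \<Rightarrow> complex) \<Rightarrow> (nat \<Rightarrow> real^'d \<Rightarrow> complex) \<Rightarrow>
   (real^'d \<Rightarrow> complex) \<Rightarrow> bool" where
  "is_update \<Omega> \<sigma> \<kappa> s b h v \<gamma> U w \<longleftrightarrow>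
     w \<in> Hspace \<Omega> \<sigma> \<and>
     (AE \<xi> in freq_measure \<Omega>.
        fourier \<Omega> w \<xi> = fourier \<Omega> v \<xi> + complex_of_real h *
          (\<Sum>i<s. complex_of_real (b $ i) *
             (Lhat \<Omega> \<kappa> (U i) \<xi> + fourier \<Omega> (\<lambda>x. \<gamma> i x * U i x) \<xi>)))"

text \<open>
  \<open>v\<close> and \<open>\<gamma>\<close> stand for \<open>u\<^sub>n\<close> and \<open>\<Gamma>\<^sub>n\<close>: the system of the stages has one and only one solution in
  \<open>(H\<^sup>\<sigma>)\<^sup>s\<close>, and the function \<open>u\<^bsub>n+1\<^esub>\<close> computed from it belongs to \<open>H\<^sup>\<sigma>\<close>.
\<close>

definition step_well_defined ::
  "domain \<Rightarrow> real \<Rightarrow> complex \<Rightarrow> nat \<Rightarrow> real Matrix.mat \<Rightarrow> real Matrix.vec \<Rightarrow> real \<Rightarrow>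
   (real^'d \<Rightarrow> complex) \<Rightarrow> (nat \<Rightarrow> real^'d \<Rightarrow> complex) \<Rightarrow> bool" where
  "step_well_defined \<Omega> \<sigma> \<kappa> s A b h v \<gamma> \<longleftrightarrow>
     (\<exists>U. solves_stages \<Omega> \<sigma> \<kappa> s A h v \<gamma> U) \<and>
     (\<forall>U U'. solves_stages \<Omega> \<sigma> \<kappa> s A h v \<gamma> U \<and> solves_stages \<Omega> \<sigma> \<kappa> s A h v \<gamma> U' \<longrightarrow>
        (\<forall>i<s. ae_eq \<Omega> (U i) (U' i))) \<and>
     (\<forall>U. solves_stages \<Omega> \<sigma> \<kappa> s A h v \<gamma> U \<longrightarrow> (\<exists>w. is_update \<Omega> \<sigma> \<kappa> s b h v \<gamma> U w))"

definition next_u ::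
  "domain \<Rightarrow> real \<Rightarrow> complex \<Rightarrow> nat \<Rightarrow> real Matrix.mat \<Rightarrow> real Matrix.vec \<Rightarrow> real \<Rightarrow>
   (real^'d \<Rightarrow> complex) \<Rightarrow> (nat \<Rightarrow> real^'d \<Rightarrow> complex) \<Rightarrow> real^'d \<Rightarrow> complex" where
  "next_u \<Omega> \<sigma> \<kappa> s A b h v \<gamma> =
     (SOME w. \<exists>U. solves_stages \<Omega> \<sigma> \<kappa> s A h v \<gamma> U \<and> is_update \<Omega> \<sigma> \<kappa> s b h v \<gamma> U w)"

text \<open>
  The state before step \<open>n\<close> is the pair \<open>(u\<^sub>n, \<Gamma>\<^bsub>n-1\<^esub>)\<close>. It is meaningful as long as the
  preceding steps are well defined.
\<close>

fun method_state ::
  "domain \<Rightarrow> real \<Rightarrow> complex \<Rightarrow> ((real^'d \<Rightarrow> complex) \<Rightarrow> (real^'d \<Rightarrow> complex)) \<Rightarrow>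
   nat \<Rightarrow> real Matrix.mat \<Rightarrow> real Matrix.vec \<Rightarrow> complex Matrix.mat \<Rightarrow> complex Matrix.vec \<Rightarrow> real \<Rightarrow>
   (real^'d \<Rightarrow> complex) \<Rightarrow> (nat \<Rightarrow> real^'d \<Rightarrow> complex) \<Rightarrow> nat \<Rightarrow>
   (real^'d \<Rightarrow> complex) \<times> (nat \<Rightarrow> real^'d \<Rightarrow> complex)" where
  "method_state \<Omega> \<sigma> \<kappa> N s A b D \<Theta> h v0 \<gamma>0 0 = (v0, \<gamma>0)"
| "method_state \<Omega> \<sigma> \<kappa> N s A b D \<Theta> h v0 \<gamma>0 (Suc n) =
     (let (v, \<gamma>) = method_state \<Omega> \<sigma> \<kappa> N s A b D \<Theta> h v0 \<gamma>0 n;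
          \<gamma>' = next_gamma s D \<Theta> N v \<gamma>
      in (next_u \<Omega> \<sigma> \<kappa> s A b h v \<gamma>', \<gamma>'))"

definition method_u where
  "method_u \<Omega> \<sigma> \<kappa> N s A b D \<Theta> h v0 \<gamma>0 n = fst (method_state \<Omega> \<sigma> \<kappa> N s A b D \<Theta> h v0 \<gamma>0 n)"

text \<open>Index \<open>n\<close> gives \<open>\<Gamma>\<^bsub>n-1\<^esub>\<close>.\<close>

definition method_gamma_prev where
  "method_gamma_prev \<Omega> \<sigma> \<kappa> N s A b D \<Theta> h v0 \<gamma>0 n =
     snd (method_state \<Omega> \<sigma> \<kappa> N s A b D \<Theta> h v0 \<gamma>0 n)"

definition method_well_defined_at where
  "method_well_defined_at \<Omega> \<sigma> \<kappa> N s A b D \<Theta> h v0 \<gamma>0 n \<longleftrightarrow>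
     step_well_defined \<Omega> \<sigma> \<kappa> s A b h
       (method_u \<Omega> \<sigma> \<kappa> N s A b D \<Theta> h v0 \<gamma>0 n)
       (method_gamma_prev \<Omega> \<sigma> \<kappa> N s A b D \<Theta> h v0 \<gamma>0 (Suc n))"

end

theory Submission
  imports Defs
begin

text \<open>
  The Fourier transform diagonalises \<open>L\<close>, so that one step of the linear part is, at every frequency, the
  Runge--Kutta method applied to a scalar test equation whose \<open>\<lambda>\<close> lies in the stability region; the three
  stability assumptions bound, uniformly in the frequency, the stages, the row vector
  \<open>\<lambda> b\<^sup>t (I - \<lambda> A)\<^sup>-\<^sup>1\<close> and \<open>R(\<lambda>)\<close>, the latter by 1. As \<open>H\<^sup>\<sigma>\<close> is an algebra, the terms \<open>\<gamma>\<^sub>n\<^sub>,\<^sub>i u\<^sub>n\<^sub>,\<^sub>i\<close> are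
  bounded perturbations of size \<open>h\<close>: for small \<open>h\<close> the stages are the fixed point of a contraction, and the
  error of \<open>u\<^sub>n\<close> grows in one step by at most \<open>O(h)\<close> times itself, the error of \<open>\<Gamma>\<^sub>n\<close> and \<open>h\<^sup>s\<close>.
  The error of \<open>\<Gamma>\<^sub>n\<close> satisfies a recursion with matrix \<open>D\<close>, whose powers decay, and with a right-hand side
  controlled by the error of \<open>u\<^sub>n\<close> and by \<open>h\<^sup>s\<close>. A discrete Gronwall argument concludes; the smallness of the
  data keeps the numerical solution in the set where the Lipschitz constants are valid.
\<close>

section \<open>Square integrable functions\<close>

text \<open>Elements of \<open>Hspace\<close> are functions carrying a seminorm, so completeness,
  products and derivatives are treated on the Fourier side, where \<open>Hspace\<close> becomes a
  weighted L2 space over \<open>freq_measure\<close>. The obstacle on the whole space is that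
  \<open>fourier Whole\<close> is a choice by \<open>SOME\<close>: nothing is known about it until
  the Fourier integrals of the truncations are shown to converge in L2. The isometry needed for that
  is drawn from Parseval on the torus, applied to all twists by a character of a function supported
  in the unit cube. What has to be protected in the error estimate is the coefficient 1 of the old
  error in one step, since only then does the n-fold product stay below e^(Cnh). It comes from |R|
  <= 1; every other constant may be crude as long as a factor h stands before it. The recursion of
  the potentials has no factor h, and \<open>D\<close> may have norm larger than 1, so their error
  is bounded through powers of \<open>D\<close> by the largest earlier error of u, and not by a
  one-step estimate.\<close>

definition sq_int :: "'a measure \<Rightarrow> ('a \<Rightarrow> complex) set" where
  "sq_int M = {f \<in> borel_measurable M. integrable M (\<lambda>x. (cmod (f x))\<^sup>2)}"

definition sq_norm :: "'a measure \<Rightarrow> ('a \<Rightarrow> complex) \<Rightarrow> real" where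
  "sq_norm M f = sqrt (LINT x|M. (cmod (f x))\<^sup>2)"

definition sq_inner :: "'a measure \<Rightarrow> ('a \<Rightarrow> complex) \<Rightarrow> ('a \<Rightarrow> complex) \<Rightarrow> complex" where
  "sq_inner M f g = (LINT x|M. f x * cnj (g x))"

lemma sq_int_measurable [measurable_dest]: "f \<in> sq_int M \<Longrightarrow> f \<in> borel_measurable M"
  by (simp add: sq_int_def)

lemma sq_int_integrable: "f \<in> sq_int M \<Longrightarrow> integrable M (\<lambda>x. (cmod (f x))\<^sup>2)"
  by (simp add: sq_int_def)

lemma sq_norm_nonneg [simp]: "0 \<le> sq_norm M f"
  by (simp add: sq_norm_def)

lemma sq_norm_power2: "(sq_norm M f)\<^sup>2 = (LINT x|M. (cmod (f x))\<^sup>2)"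
  by (simp add: sq_norm_def integral_nonneg_AE)

lemma nn_integral_sq_norm:
  "f \<in> sq_int M \<Longrightarrow> (\<integral>\<^sup>+x. ennreal ((cmod (f x))\<^sup>2) \<partial>M) = ennreal ((sq_norm M f)\<^sup>2)"
  unfolding sq_norm_power2 by (intro nn_integral_eq_integral sq_int_integrable) auto

lemma sq_intI_nn:
  assumes [measurable]: "f \<in> borel_measurable M" and "(\<integral>\<^sup>+x. ennreal ((cmod (f x))\<^sup>2) \<partial>M) < \<infinity>"
  shows "f \<in> sq_int M"
  using assms by (auto simp: sq_int_def intro!: integrableI_bounded)

lemma sq_norm_le_nn:
  assumes "f \<in> borel_measurable M" "(\<integral>\<^sup>+x. ennreal ((cmod (f x))\<^sup>2) \<partial>M) \<le> ennreal (K\<^sup>2)" "0 \<le> K"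
  shows "f \<in> sq_int M" "sq_norm M f \<le> K"
proof -
  have "(\<integral>\<^sup>+x. ennreal ((cmod (f x))\<^sup>2) \<partial>M) < \<infinity>"
    by (rule le_less_trans[OF assms(2)]) simp
  then show f: "f \<in> sq_int M" by (rule sq_intI_nn[OF assms(1)])
  have "(sq_norm M f)\<^sup>2 \<le> K\<^sup>2" using assms(2) unfolding nn_integral_sq_norm[OF f] by simp
  then show "sq_norm M f \<le> K" using assms(3) by (rule power2_le_imp_le)
qed

lemma sq_int_cong_AE:
  assumes [measurable]: "f \<in> borel_measurable M" "g \<in> borel_measurable M" and "AE x in M. f x = g x"
  shows "f \<in> sq_int M \<longleftrightarrow> g \<in> sq_int M" "sq_norm M f = sq_norm M g"
proof -
  have e: "AE x in M. (cmod (f x))\<^sup>2 = (cmod (g x))\<^sup>2" using assms(3) by eventually_elim simp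
  show "f \<in> sq_int M \<longleftrightarrow> g \<in> sq_int M" using integrable_cong_AE[OF _ _ e] by (simp add: sq_int_def)
  show "sq_norm M f = sq_norm M g" unfolding sq_norm_def using integral_cong_AE[OF _ _ e] by simp
qed

lemma sq_int_mult_integrable:
  assumes "f \<in> sq_int M" "g \<in> sq_int M"
  shows "integrable M (\<lambda>x. f x * g x)"
proof -
  note [measurable] = assms[THEN sq_int_measurable]
  show ?thesis
  proof (rule Bochner_Integration.integrable_bound)
    show "integrable M (\<lambda>x. (cmod (f x))\<^sup>2 + (cmod (g x))\<^sup>2)"
      using assms by (auto intro: sq_int_integrable)
    show "AE x in M. norm (f x * g x) \<le> norm ((cmod (f x))\<^sup>2 + (cmod (g x))\<^sup>2)"
    proof (rule AE_I2)
      fix x show "norm (f x * g x) \<le> norm ((cmod (f x))\<^sup>2 + (cmod (g x))\<^sup>2)"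
        using sum_squares_bound[of "cmod (f x)" "cmod (g x)"] mult_nonneg_nonneg[of "cmod (f x)" "cmod (g x)"] by (simp add: norm_mult del: mult_nonneg_nonneg)
    qed
  qed measurable
qed

lemma borel_measurable_cnj [measurable (raw)]:
  "f \<in> borel_measurable M \<Longrightarrow> (\<lambda>x. cnj (f x)) \<in> borel_measurable M"
  by (rule measurable_compose[OF _ borel_measurable_continuous_onI]) (auto intro: continuous_intros)

lemma sq_int_cnj: "f \<in> sq_int M \<Longrightarrow> (\<lambda>x. cnj (f x)) \<in> sq_int M"
  by (auto simp: sq_int_def)

lemma sq_norm_cnj [simp]: "sq_norm M (\<lambda>x. cnj (f x)) = sq_norm M f"
  by (simp add: sq_norm_def)

lemma sq_inner_integrable:
  "f \<in> sq_int M \<Longrightarrow> g \<in> sq_int M \<Longrightarrow> integrable M (\<lambda>x. f x * cnj (g x))"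
  by (rule sq_int_mult_integrable[OF _ sq_int_cnj])

lemma integral_norm_mult_le:
  assumes "f \<in> sq_int M" "g \<in> sq_int M"
  shows "(LINT x|M. cmod (f x) * cmod (g x)) \<le> sq_norm M f * sq_norm M g"
proof -
  note [measurable] = assms[THEN sq_int_measurable]
  have i: "integrable M (\<lambda>x. cmod (f x) * cmod (g x))"
    using integrable_norm[OF sq_int_mult_integrable[OF assms]] by (simp add: norm_mult)
  let ?I = "LINT x|M. cmod (f x) * cmod (g x)"
  have "ennreal (?I\<^sup>2) = (\<integral>\<^sup>+x. ennreal (cmod (f x)) * ennreal (cmod (g x)) \<partial>M)\<^sup>2"
    using nn_integral_eq_integral[OF i] by (simp add: ennreal_mult ennreal_power[symmetric])
  also have "\<dots> \<le> (\<integral>\<^sup>+x. (ennreal (cmod (f x)))\<^sup>2 \<partial>M) * (\<integral>\<^sup>+x. (ennreal (cmod (g x)))\<^sup>2 \<partial>M)"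
    by (rule Cauchy_Schwarz_nn_integral) auto
  also have "\<dots> = ennreal ((sq_norm M f * sq_norm M g)\<^sup>2)"
    using nn_integral_sq_norm[OF assms(1)] nn_integral_sq_norm[OF assms(2)]
    by (simp add: ennreal_power ennreal_mult power_mult_distrib)
  finally have "?I\<^sup>2 \<le> (sq_norm M f * sq_norm M g)\<^sup>2" by simp
  then show ?thesis by (rule power2_le_imp_le) simp
qed

lemma integral_mult_le:
  assumes "f \<in> sq_int M" "g \<in> sq_int M"
  shows "cmod (LINT x|M. f x * g x) \<le> sq_norm M f * sq_norm M g"
proof -
  have "cmod (LINT x|M. f x * g x) \<le> (LINT x|M. cmod (f x * g x))"
    by (rule integral_norm_bound)
  also have "\<dots> \<le> sq_norm M f * sq_norm M g"
    using integral_norm_mult_le[OF assms] by (simp add: norm_mult)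
  finally show ?thesis .
qed

lemma sq_inner_le:
  assumes "f \<in> sq_int M" "g \<in> sq_int M"
  shows "cmod (sq_inner M f g) \<le> sq_norm M f * sq_norm M g"
  using integral_mult_le[OF assms(1) sq_int_cnj[OF assms(2)]] by (simp add: sq_inner_def)

lemma sq_inner_self: "sq_inner M f f = complex_of_real ((sq_norm M f)\<^sup>2)"
  unfolding sq_inner_def sq_norm_power2 complex_norm_square[symmetric] integral_complex_of_real ..

text \<open>The bridge from pointwise inequalities at almost every frequency to inequalities between
  norms, with the same coefficients. The square of the majorant is expanded and Cauchy-Schwarz is
  applied to each cross term.\<close>

lemma sq_norm_dominated:
  assumes [measurable]: "f \<in> borel_measurable M" and fin: "finite K"
    and g: "\<And>k. k \<in> K \<Longrightarrow> g k \<in> sq_int M" and c: "\<And>k. k \<in> K \<Longrightarrow> 0 \<le> c k"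
    and le: "AE x in M. cmod (f x) \<le> (\<Sum>k\<in>K. c k * cmod (g k x))"
  shows "f \<in> sq_int M" "sq_norm M f \<le> (\<Sum>k\<in>K. c k * sq_norm M (g k))"
proof -
  define G where "G x = (\<Sum>k\<in>K. c k * cmod (g k x))" for x
  have int: "integrable M (\<lambda>x. cmod (g k x) * cmod (g l x))" if "k \<in> K" "l \<in> K" for k l
    using integrable_norm[OF sq_int_mult_integrable[OF g g, OF that]] by (simp add: norm_mult)
  have G2: "(G x)\<^sup>2 = (\<Sum>k\<in>K. \<Sum>l\<in>K. c k * c l * (cmod (g k x) * cmod (g l x)))" for x
    unfolding G_def power2_eq_square sum_product by (intro sum.cong) auto
  have Gint: "integrable M (\<lambda>x. (G x)\<^sup>2)" unfolding G2
    by (intro Bochner_Integration.integrable_sum integrable_mult_right int)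
  have le2: "AE x in M. (cmod (f x))\<^sup>2 \<le> (G x)\<^sup>2"
    using le unfolding G_def[symmetric] by eventually_elim (simp add: power_mono)
  show f: "f \<in> sq_int M" unfolding sq_int_def mem_Collect_eq
  proof (intro conjI)
    show "integrable M (\<lambda>x. (cmod (f x))\<^sup>2)"
      by (rule Bochner_Integration.integrable_bound[OF Gint]) (use le2 in auto)
  qed simp
  have "(sq_norm M f)\<^sup>2 \<le> (LINT x|M. (G x)\<^sup>2)"
    unfolding sq_norm_power2 by (rule integral_mono_AE[OF sq_int_integrable[OF f] Gint le2])
  also have "\<dots> = (\<Sum>k\<in>K. \<Sum>l\<in>K. c k * c l * (LINT x|M. cmod (g k x) * cmod (g l x)))"
    unfolding G2 by (simp add: int)
  also have "\<dots> \<le> (\<Sum>k\<in>K. \<Sum>l\<in>K. c k * c l * (sq_norm M (g k) * sq_norm M (g l)))"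
    by (intro sum_mono mult_left_mono integral_norm_mult_le g mult_nonneg_nonneg c)
  also have "\<dots> = (\<Sum>k\<in>K. c k * sq_norm M (g k))\<^sup>2"
    unfolding power2_eq_square sum_product by (intro sum.cong) auto
  finally show "sq_norm M f \<le> (\<Sum>k\<in>K. c k * sq_norm M (g k))"
    by (rule power2_le_imp_le) (intro sum_nonneg mult_nonneg_nonneg c; simp)
qed

lemma sq_norm_mono:
  assumes "f \<in> borel_measurable M" "g \<in> sq_int M" "AE x in M. cmod (f x) \<le> cmod (g x)"
  shows "f \<in> sq_int M" "sq_norm M f \<le> sq_norm M g"
  using sq_norm_dominated[of f M "{()}" "\<lambda>_. g" "\<lambda>_. 1"] assms by auto

lemma sq_int_add:
  assumes "f \<in> sq_int M" "g \<in> sq_int M"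
  shows "(\<lambda>x. f x + g x) \<in> sq_int M" "sq_norm M (\<lambda>x. f x + g x) \<le> sq_norm M f + sq_norm M g"
  using sq_norm_dominated[of "\<lambda>x. f x + g x" M UNIV "\<lambda>b. if b then f else g" "\<lambda>_. 1"] assms
  by (auto simp: UNIV_bool norm_triangle_ineq add.commute intro!: AE_I2 borel_measurable_add sq_int_measurable)

lemma sq_int_diff:
  assumes "f \<in> sq_int M" "g \<in> sq_int M"
  shows "(\<lambda>x. f x - g x) \<in> sq_int M" "sq_norm M (\<lambda>x. f x - g x) \<le> sq_norm M f + sq_norm M g"
  using sq_norm_dominated[of "\<lambda>x. f x - g x" M UNIV "\<lambda>b. if b then f else g" "\<lambda>_. 1"] assms
  by (auto simp: UNIV_bool norm_triangle_ineq4 add.commute intro!: AE_I2 borel_measurable_diff sq_int_measurable)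

lemma sq_int_cmult:
  assumes "f \<in> sq_int M"
  shows "(\<lambda>x. c * f x) \<in> sq_int M" "sq_norm M (\<lambda>x. c * f x) = cmod c * sq_norm M f"
  using assms by (auto simp: sq_int_def sq_norm_def norm_mult power_mult_distrib real_sqrt_mult)

lemma sq_norm_minus_commute: "sq_norm M (\<lambda>x. f x - g x) = sq_norm M (\<lambda>x. g x - f x)"
  by (simp add: sq_norm_def norm_minus_commute)

lemma sq_norm_diff_le:
  assumes "f \<in> sq_int M" "g \<in> sq_int M"
  shows "\<bar>sq_norm M f - sq_norm M g\<bar> \<le> sq_norm M (\<lambda>x. f x - g x)"
proof -
  have "sq_norm M f \<le> sq_norm M (\<lambda>x. f x - g x) + sq_norm M g"
    using sq_int_add(2)[OF sq_int_diff(1)[OF assms] assms(2)] by simp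
  moreover have "sq_norm M g \<le> sq_norm M (\<lambda>x. g x - f x) + sq_norm M f"
    using sq_int_add(2)[OF sq_int_diff(1)[OF assms(2,1)] assms(1)] by simp
  ultimately show ?thesis using sq_norm_minus_commute[of M f g] by linarith
qed

lemma sq_norm_eq_0_iff:
  assumes "f \<in> sq_int M"
  shows "sq_norm M f = 0 \<longleftrightarrow> (AE x in M. f x = 0)"
  using integral_nonneg_eq_0_iff_AE[OF sq_int_integrable[OF assms]] by (simp add: sq_norm_def)

lemma sq_norm_triangle_diff:
  assumes "f \<in> sq_int M" "g \<in> sq_int M" "h \<in> sq_int M"
  shows "sq_norm M (\<lambda>x. f x - h x) \<le> sq_norm M (\<lambda>x. f x - g x) + sq_norm M (\<lambda>x. g x - h x)"
  using sq_int_add(2)[OF sq_int_diff(1)[OF assms(1,2)] sq_int_diff(1)[OF assms(2,3)]] by simp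

section \<open>Limits in L2 and completeness\<close>

lemma sq_norm_Fatou:
  assumes f: "\<And>n. f n \<in> sq_int M" and [measurable]: "g \<in> borel_measurable M"
    and lim: "AE x in M. (\<lambda>n. f n x) \<longlonglongrightarrow> g x"
    and K: "\<And>n. n \<ge> n0 \<Longrightarrow> sq_norm M (f n) \<le> K"
  shows "g \<in> sq_int M" "sq_norm M g \<le> K"
proof -
  note [measurable] = sq_int_measurable[OF f]
  have K0: "0 \<le> K" using K[of n0] sq_norm_nonneg[of M "f n0"] by linarith
  have "AE x in M. ennreal ((cmod (g x))\<^sup>2) = liminf (\<lambda>n. ennreal ((cmod (f n x))\<^sup>2))"
    using lim
  proof eventually_elim
    fix x assume "(\<lambda>n. f n x) \<longlonglongrightarrow> g x"
    then have "(\<lambda>n. ennreal ((cmod (f n x))\<^sup>2)) \<longlonglongrightarrow> ennreal ((cmod (g x))\<^sup>2)"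
      by (intro tendsto_ennrealI tendsto_intros)
    from lim_imp_Liminf[OF _ this] show "ennreal ((cmod (g x))\<^sup>2) = liminf (\<lambda>n. ennreal ((cmod (f n x))\<^sup>2))"
      by simp
  qed
  then have "(\<integral>\<^sup>+x. ennreal ((cmod (g x))\<^sup>2) \<partial>M) = (\<integral>\<^sup>+x. liminf (\<lambda>n. ennreal ((cmod (f n x))\<^sup>2)) \<partial>M)"
    by (intro nn_integral_cong_AE)
  also have "\<dots> \<le> liminf (\<lambda>n. \<integral>\<^sup>+x. ennreal ((cmod (f n x))\<^sup>2) \<partial>M)"
    by (rule nn_integral_liminf) simp
  also have "\<dots> = liminf (\<lambda>n. ennreal ((sq_norm M (f n))\<^sup>2))" using nn_integral_sq_norm[OF f] by simp
  also have "\<dots> \<le> ennreal (K\<^sup>2)"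
  proof -
    have "liminf (\<lambda>n. ennreal ((sq_norm M (f n))\<^sup>2)) \<le> liminf (\<lambda>n. ennreal (K\<^sup>2))"
      by (intro Liminf_mono eventually_sequentiallyI[of n0] ennreal_leI power_mono K) auto
    then show ?thesis by (simp add: Liminf_const)
  qed
  finally have le: "(\<integral>\<^sup>+x. ennreal ((cmod (g x))\<^sup>2) \<partial>M) \<le> ennreal (K\<^sup>2)" .
  show "g \<in> sq_int M" "sq_norm M g \<le> K" using sq_norm_le_nn[OF _ le K0] by auto
qed

text \<open>Fatou bounds the norm of g' - g by every tail bound of the norms of f n - g. This later
  identifies the Plancherel transform of an integrable function with its Fourier integral.\<close>

lemma sq_norm_limit_unique:
  assumes f: "\<And>n. f n \<in> sq_int M" and g: "g \<in> sq_int M" and g': "g' \<in> borel_measurable M"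
    and lim: "(\<lambda>n. sq_norm M (\<lambda>x. f n x - g x)) \<longlonglongrightarrow> 0" and ae: "AE x in M. (\<lambda>n. f n x) \<longlonglongrightarrow> g' x"
  shows "AE x in M. g' x = g x"
proof -
  have d: "(\<lambda>x. f n x - g x) \<in> sq_int M" for n by (rule sq_int_diff(1)[OF f g])
  have ae': "AE x in M. (\<lambda>n. f n x - g x) \<longlonglongrightarrow> g' x - g x"
    using ae by eventually_elim (intro tendsto_intros)
  have m: "(\<lambda>x. g' x - g x) \<in> borel_measurable M"
    by (rule borel_measurable_diff[OF g' sq_int_measurable[OF g]])
  have le: "sq_norm M (\<lambda>x. g' x - g x) \<le> e" if "e > 0" for e
  proof -
    from LIMSEQ_D[OF lim that] obtain n0 where "\<And>n. n \<ge> n0 \<Longrightarrow> sq_norm M (\<lambda>x. f n x - g x) \<le> e" by force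
    from sq_norm_Fatou(2)[OF d m ae' this] show ?thesis .
  qed
  obtain n0 where "\<And>n. n \<ge> n0 \<Longrightarrow> sq_norm M (\<lambda>x. f n x - g x) \<le> 1" using LIMSEQ_D[OF lim, of 1] by force
  from sq_norm_Fatou(1)[OF d m ae' this] have "(\<lambda>x. g' x - g x) \<in> sq_int M" .
  moreover have "sq_norm M (\<lambda>x. g' x - g x) = 0"
    using field_le_epsilon[of "sq_norm M (\<lambda>x. g' x - g x)" 0] le sq_norm_nonneg[of M "\<lambda>x. g' x - g x"] by force
  ultimately show ?thesis using sq_norm_eq_0_iff by force
qed

text \<open>Riesz-Fischer: a fast Cauchy subsequence converges almost everywhere, and Fatou turns
  its pointwise limit into the limit in norm of the whole sequence.\<close>

theorem sq_int_complete:
  assumes f: "\<And>n. f n \<in> sq_int M"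
    and Cauchy: "\<And>e. e > 0 \<Longrightarrow> \<exists>n0. \<forall>m\<ge>n0. \<forall>n\<ge>n0. sq_norm M (\<lambda>x. f m x - f n x) < e"
  shows "\<exists>g\<in>sq_int M. (\<lambda>n. sq_norm M (\<lambda>x. f n x - g x)) \<longlonglongrightarrow> 0"
proof -
  note [measurable] = sq_int_measurable[OF f]
  obtain N where N: "\<And>k m n. m \<ge> N k \<Longrightarrow> n \<ge> N k \<Longrightarrow> sq_norm M (\<lambda>x. f m x - f n x) < (1/2)^k"
    using Cauchy[of "(1/2)^_"] by (metis zero_less_divide_1_iff zero_less_numeral zero_less_power)
  \<comment> \<open>Summing the thresholds makes \<open>r\<close> nondecreasing, at least
    \<open>N k\<close> and at least \<open>k\<close>, so no strictly increasing choice is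
    required.\<close>
  define r where "r k = (\<Sum>j\<le>k. N j) + k" for k
  have rN: "r k \<ge> N k" for k unfolding r_def using member_le_sum[of k "{..k}" N] by simp
  have rm: "r k \<le> r (Suc k)" "k \<le> r k" for k unfolding r_def by auto
  define d where "d k x = f (r (Suc k)) x - f (r k) x" for k x
  have dsq: "d k \<in> sq_int M" for k unfolding d_def by (rule sq_int_diff(1)[OF f f])
  note [measurable] = sq_int_measurable[OF dsq]
  have dn: "sq_norm M (d k) \<le> (1/2)^k" for k unfolding d_def
    using N[of k "r (Suc k)" "r k"] rN[of k] rm(1)[of k] by (force intro: less_imp_le)
  \<comment> \<open>The weight 2^k leaves a convergent geometric series, because the squared norms
    decay like 4^(-k). Where the weighted sum is finite, its terms are bounded, so that
    \<open>d k x\<close> decays geometrically and the telescoping series converges.\<close>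
  have "(\<integral>\<^sup>+x. (\<Sum>k. ennreal (2^k * (cmod (d k x))\<^sup>2)) \<partial>M) = (\<Sum>k. \<integral>\<^sup>+x. ennreal (2^k * (cmod (d k x))\<^sup>2) \<partial>M)"
    by (intro nn_integral_suminf) simp
  also have "\<dots> = (\<Sum>k. ennreal (2^k * (sq_norm M (d k))\<^sup>2))"
    using nn_integral_sq_norm[OF dsq] by (simp add: ennreal_mult nn_integral_cmult)
  also have "\<dots> \<le> (\<Sum>k. ennreal ((1/2)^k))"
  proof (intro suminf_le ennreal_leI)
    fix k show "2^k * (sq_norm M (d k))\<^sup>2 \<le> (1/2)^k"
    proof -
      have "2^k * (sq_norm M (d k))\<^sup>2 \<le> 2^k * ((1/2)^k)\<^sup>2"
        by (intro mult_left_mono power_mono dn) auto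
      also have "\<dots> = (2 * (1/2)) ^ k * (1/2::real)^k" unfolding power_mult_distrib power2_eq_square by simp
      finally show ?thesis by simp
    qed
  qed auto
  also have "\<dots> = ennreal (\<Sum>k. (1/2)^k)" by (intro suminf_ennreal2 summable_geometric) auto
  also have "\<dots> < \<infinity>" by simp
  finally have "AE x in M. (\<Sum>k. ennreal (2^k * (cmod (d k x))\<^sup>2)) \<noteq> \<infinity>"
    by (intro nn_integral_PInf_AE) auto
  then have conv: "AE x in M. convergent (\<lambda>k. f (r k) x)"
  proof eventually_elim
    fix x assume "(\<Sum>k. ennreal (2^k * (cmod (d k x))\<^sup>2)) \<noteq> \<infinity>"
    then have "summable (\<lambda>k. 2^k * (cmod (d k x))\<^sup>2)" by (intro summable_suminf_not_top) auto
    then have "(\<lambda>k. 2^k * (cmod (d k x))\<^sup>2) \<longlonglongrightarrow> 0" by (rule summable_LIMSEQ_zero)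
    then have "Bseq (\<lambda>k. 2^k * (cmod (d k x))\<^sup>2)" by (rule convergent_imp_Bseq[OF convergentI])
    then obtain B where B: "B > 0" "\<And>k. 2^k * (cmod (d k x))\<^sup>2 \<le> B" unfolding Bseq_def by force
    have "cmod (d k x) \<le> sqrt B * (sqrt (1/2))^k" for k
    proof -
      have "(cmod (d k x))\<^sup>2 \<le> B * (1/2)^k" using B(2)[of k] by (simp add: field_simps power_one_over)
      then have "cmod (d k x) \<le> sqrt (B * (1/2)^k)" by (rule real_le_rsqrt)
      also have "\<dots> = sqrt B * (sqrt (1/2))^k" by (simp only: real_sqrt_mult real_sqrt_power)
      finally show ?thesis .
    qed
    note bnd = this
    have "summable (\<lambda>k. sqrt B * (sqrt (1/2))^k)"
      by (intro summable_mult summable_geometric) simp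
    then have "summable (\<lambda>k. d k x)" by (rule summable_comparison_test'[where N=0]) (rule bnd)
    then have "convergent (\<lambda>n. f (r 0) x + (\<Sum>k<n. d k x))"
      by (intro convergent_add convergent_const) (simp add: summable_iff_convergent)
    moreover have "f (r 0) x + (\<Sum>k<n. d k x) = f (r n) x" for n unfolding d_def
      using sum_lessThan_telescope[of "\<lambda>k. f (r k) x" n] by simp
    ultimately show "convergent (\<lambda>k. f (r k) x)" by simp
  qed
  define g where "g x = lim (\<lambda>k. f (r k) x)" for x
  have gm[measurable]: "g \<in> borel_measurable M" unfolding g_def by measurable
  have lim: "AE x in M. (\<lambda>k. f (r k) x) \<longlonglongrightarrow> g x"
    using conv by eventually_elim (simp add: g_def convergent_LIMSEQ_iff)
  have est: "(\<lambda>x. f n x - g x) \<in> sq_int M \<and> sq_norm M (\<lambda>x. f n x - g x) \<le> e"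
    if n0: "\<forall>m\<ge>n0. \<forall>n\<ge>n0. sq_norm M (\<lambda>x. f m x - f n x) < e" and n: "n \<ge> n0" for e n n0
  proof -
    have 1: "AE x in M. (\<lambda>k. f n x - f (r k) x) \<longlonglongrightarrow> f n x - g x"
      using lim by eventually_elim (intro tendsto_intros)
    have 2: "sq_norm M (\<lambda>x. f n x - f (r k) x) \<le> e" if "k \<ge> n0" for k
      using n0 n that rm(2)[of k] by (meson le_trans less_imp_le)
    have m: "(\<lambda>x. f n x - g x) \<in> borel_measurable M" by measurable
    show ?thesis using sq_norm_Fatou[OF sq_int_diff(1)[OF f f] m 1 2] by blast
  qed
  obtain n1 where n1: "\<forall>m\<ge>n1. \<forall>n\<ge>n1. sq_norm M (\<lambda>x. f m x - f n x) < 1" using Cauchy[of 1] by auto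
  have "(\<lambda>x. f n1 x - (f n1 x - g x)) \<in> sq_int M"
    by (rule sq_int_diff(1)[OF f]) (use est[OF n1, of n1] in auto)
  then have g: "g \<in> sq_int M" by simp
  have "(\<lambda>n. sq_norm M (\<lambda>x. f n x - g x)) \<longlonglongrightarrow> 0"
  proof (rule LIMSEQ_I)
    fix e :: real assume "e > 0"
    then obtain n0 where n0: "\<forall>m\<ge>n0. \<forall>n\<ge>n0. sq_norm M (\<lambda>x. f m x - f n x) < e/2" using Cauchy[of "e/2"] by auto
    show "\<exists>no. \<forall>n\<ge>no. norm (sq_norm M (\<lambda>x. f n x - g x) - 0) < e"
      using est[OF n0] \<open>e > 0\<close> by (intro exI[of _ n0]) force
  qed
  with g show ?thesis by blast
qed

section \<open>Fourier series\<close>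

text \<open>The conjugate of the Fourier kernel, which is therefore \<open>echar (- \<xi>)\<close>.
  Putting the sign into the frequency keeps the addition formulas uniform.\<close>

definition echar :: "real^'d \<Rightarrow> real^'d \<Rightarrow> complex" where
  "echar \<xi> x = cis (2 * pi * inner \<xi> x)"

lemma echar_minus_eq: "cis (- 2 * pi * inner \<xi> x) = echar (- \<xi>) x"
  by (simp add: echar_def)

lemma norm_echar [simp]: "cmod (echar \<xi> x) = 1"
  by (simp add: echar_def)

lemma echar_0 [simp]: "echar 0 x = 1" "echar \<xi> 0 = 1"
  by (simp_all add: echar_def)

lemma echar_add: "echar (\<xi> + \<eta>) x = echar \<xi> x * echar \<eta> x"
  by (simp add: echar_def inner_add_left ring_distribs cis_mult)

lemma echar_add_right: "echar \<xi> (x + y) = echar \<xi> x * echar \<xi> y"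
  by (simp add: echar_def inner_add_right ring_distribs cis_mult)

lemma cnj_echar: "cnj (echar \<xi> x) = echar (- \<xi>) x"
  by (simp add: echar_def cis_cnj)

lemma echar_commute: "echar \<xi> x = echar x \<xi>"
  by (simp add: echar_def inner_commute)

lemma borel_measurable_echar [measurable (raw)]:
  fixes f g :: "'a \<Rightarrow> real^'d"
  assumes [measurable]: "f \<in> borel_measurable M" "g \<in> borel_measurable M"
  shows "(\<lambda>x. echar (f x) (g x)) \<in> borel_measurable M"
proof -
  have [measurable]: "cis \<in> borel_measurable borel"
    by (intro borel_measurable_continuous_onI continuous_intros)
  show ?thesis unfolding echar_def by measurable
qed

section \<open>The lattice of frequencies\<close>

lemma lattice_0 [simp]: "0 \<in> lattice"
  by (simp add: lattice_def)

lemma lattice_add: "k \<in> lattice \<Longrightarrow> l \<in> lattice \<Longrightarrow> k + l \<in> lattice"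
  by (simp add: lattice_def)

lemma lattice_minus: "k \<in> lattice \<Longrightarrow> - k \<in> lattice"
  by (simp add: lattice_def)

lemma lattice_diff: "k \<in> lattice \<Longrightarrow> l \<in> lattice \<Longrightarrow> k - l \<in> lattice"
  by (simp add: lattice_def)

lemma inner_lattice: 
  assumes "k \<in> lattice" "l \<in> lattice" shows "inner k l \<in> \<int>"
  using assms by (auto simp: lattice_def inner_vec_def intro!: Ints_sum Ints_mult)

lemma echar_lattice: "k \<in> lattice \<Longrightarrow> l \<in> lattice \<Longrightarrow> echar k l = 1"
  using inner_lattice[of k l] by (auto simp: echar_def complex_eq_iff elim!: Ints_cases)

lemma lattice_image: "lattice = range (\<lambda>z :: 'd::finite \<Rightarrow> int. vec_lambda (\<lambda>i. real_of_int (z i)))"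
proof (intro Set.set_eqI iffI)
  fix k :: "real^'d" assume "k \<in> lattice"
  then have "\<forall>i. \<exists>z. vec_nth k i = of_int z" by (auto simp: lattice_def elim: Ints_cases)
  then obtain z where "\<And>i. vec_nth k i = of_int (z i)" by metis
  then show "k \<in> range (\<lambda>z :: 'd \<Rightarrow> int. vec_lambda (\<lambda>i. real_of_int (z i)))"
    by (intro image_eqI[of _ _ z]) (auto simp: Finite_Cartesian_Product.vec_eq_iff)
qed (auto simp: lattice_def)

lemma countable_lattice [simp]: "countable (lattice :: (real^'d) set)"
  unfolding lattice_image by (rule countable_image) simp

text \<open>Finiteness provides the partial sums of Fourier series; the count controls the Sobolev
  weight on dyadic balls.\<close>

lemma lattice_cball:
  "finite (lattice \<inter> cball (0::real^'d) (real n))"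
  "card (lattice \<inter> cball (0::real^'d) (real n)) \<le> (2 * n + 1) ^ CARD('d)"
proof -
  define F where "F = (PiE UNIV (\<lambda>_. {- int n..int n}) :: ('d \<Rightarrow> int) set)"
  have fin: "finite F" unfolding F_def by (intro finite_PiE) auto
  have sub: "lattice \<inter> cball (0::real^'d) (real n) \<subseteq> (\<lambda>z. vec_lambda (\<lambda>i. real_of_int (z i))) ` F"
  proof
    fix k :: "real^'d" assume k: "k \<in> lattice \<inter> cball 0 (real n)"
    then obtain z :: "'d \<Rightarrow> int" where z: "k = vec_lambda (\<lambda>i. real_of_int (z i))" unfolding lattice_image by auto
    have "\<bar>z i\<bar> \<le> int n" for i
      using order_trans[OF component_le_norm_cart[of k i], of n] k by (simp add: z)
    then have "z \<in> F" unfolding F_def by (auto simp: abs_le_iff) (metis minus_le_iff)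
    then show "k \<in> (\<lambda>z. vec_lambda (\<lambda>i. real_of_int (z i))) ` F" using z by blast
  qed
  show "finite (lattice \<inter> cball (0::real^'d) (real n))" using finite_subset[OF sub] fin by blast
  have "card (lattice \<inter> cball (0::real^'d) (real n)) \<le> card F"
    by (rule surj_card_le[OF fin sub])
  also have "\<dots> = (2 * n + 1) ^ CARD('d)" unfolding F_def by (simp add: card_PiE nat_add_distrib nat_mult_distrib)
  finally show "card (lattice \<inter> cball (0::real^'d) (real n)) \<le> (2 * n + 1) ^ CARD('d)" .
qed

section \<open>The unit cube and the orthogonality of the characters\<close>

lemma unit_cube_cbox: "unit_cube = cbox 0 (vec_lambda (\<lambda>_. 1) :: real^'d)"
  by (auto simp: unit_cube_def mem_box_cart)

lemma unit_cube_borel [measurable]: "unit_cube \<in> sets (borel :: (real^'d) measure)"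
  by (simp add: unit_cube_cbox)

lemma emeasure_unit_cube: "emeasure lborel (unit_cube :: (real^'d) set) = 1"
proof -
  have "measure lborel (unit_cube :: (real^'d) set) = 1" unfolding unit_cube_cbox
    by (subst content_cbox_cart) (auto simp: interval_ne_empty_cart)
  moreover have "emeasure lborel (unit_cube :: (real^'d) set) \<noteq> \<infinity>" unfolding unit_cube_cbox
    using emeasure_lborel_cbox_finite[of "0::real^'d" "vec_lambda (\<lambda>_. 1)"] by auto
  ultimately show ?thesis by (simp add: emeasure_eq_ennreal_measure)
qed

lemma finite_measure_torus: "finite_measure (space_measure Torus :: (real^'d) measure)"
  by (rule finite_measureI) (simp add: emeasure_restrict_space space_restrict_space emeasure_unit_cube)

lemma measure_torus: "measure (space_measure Torus :: (real^'d) measure) (space (space_measure Torus)) = 1"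
  by (simp add: measure_def emeasure_restrict_space space_restrict_space emeasure_unit_cube)

lemma measurable_torus: "f \<in> borel_measurable borel \<Longrightarrow> f \<in> borel_measurable (space_measure Torus)"
  by (simp add: measurable_restrict_space1)

text \<open>A fundamental domain of \<open>lattice\<close>: its translates are disjoint, and it
  differs from \<open>unit_cube\<close> by a null set only. The half-open form is also where the
  angle of a point on the circle is unique.\<close>

definition half_cube :: "(real^'d) set" where
  "half_cube = {x. \<forall>i. 0 \<le> vec_nth x i \<and> vec_nth x i < 1}"

lemma half_cube_borel [measurable]: "half_cube \<in> sets (borel :: (real^'d) measure)"
  unfolding half_cube_def by measurable

lemma AE_half_cube: "AE x in (lborel :: (real^'d) measure). x \<in> half_cube \<longleftrightarrow> x \<in> unit_cube"
proof -
  define N where "N i = {x :: real^'d. inner x (axis i 1) = 1}" for i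
  have [measurable]: "N i \<in> sets borel" for i unfolding N_def by measurable
  have "N i \<in> null_sets lborel" for i
  proof -
    have "negligible (N i)" unfolding N_def by (rule negligible_standard_hyperplane) (simp add: axis_in_Basis_iff)
    then have "N i \<in> null_sets (completion lborel)" by (simp add: negligible_iff_null_sets)
    then show ?thesis by (subst (asm) null_sets_completion_iff) auto
  qed
  then have "AE x in lborel. \<forall>i. x \<notin> N i" by (simp add: AE_all_countable AE_not_in)
  then show ?thesis
  proof eventually_elim
    fix x :: "real^'d" assume "\<forall>i. x \<notin> N i"
    then have "vec_nth x i \<noteq> 1" for i by (simp add: N_def inner_axis)
    then show "x \<in> half_cube \<longleftrightarrow> x \<in> unit_cube"
      unfolding half_cube_def unit_cube_def by (auto simp: less_le)
  qed
qed

lemma AE_torus_half_cube: "AE x in (space_measure Torus :: (real^'d) measure). x \<in> half_cube"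
  unfolding space_measure.simps
  by (subst AE_restrict_space_iff, simp) (use AE_half_cube in eventually_elim, auto)

text \<open>Lebesgue measure is the image of a product of one-dimensional measures, which reduces
  the orthogonality of the characters to integrals over [0, 1].\<close>

lemma integral_lborel_prod:
  fixes f :: "'a::euclidean_space \<Rightarrow> real \<Rightarrow> complex"
  assumes f: "\<And>b. b \<in> Basis \<Longrightarrow> integrable lborel (f b)"
  shows "(LINT x|lborel. (\<Prod>b\<in>Basis. f b (inner x b))) = (\<Prod>b\<in>Basis. (LINT t|lborel. f b t))"
proof -
  interpret product_sigma_finite "\<lambda>_::'a. lborel :: real measure" ..
  have m: "(\<lambda>x::'a. f b (inner x b)) \<in> borel_measurable borel" if "b \<in> Basis" for b
  proof -
    have "f b \<in> borel_measurable borel" using borel_measurable_integrable[OF f[OF that]] by simp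
    then show ?thesis by (rule measurable_compose[rotated]) simp
  qed
  have "(LINT x|lborel. (\<Prod>b\<in>Basis. f b (inner x b))) =
      (LINT x|(\<Pi>\<^sub>M b\<in>(Basis::'a set). lborel). (\<Prod>b\<in>Basis. f b (inner (\<Sum>b\<in>Basis. x b *\<^sub>R b) b)))"
    by (subst lborel_eq, subst integral_distr) (auto intro!: borel_measurable_prod m)
  also have "\<dots> = (LINT x|(\<Pi>\<^sub>M b\<in>(Basis::'a set). lborel). (\<Prod>b\<in>Basis. f b (x b)))"
    by (intro Bochner_Integration.integral_cong prod.cong refl arg_cong[of _ _ "f _"]) simp
  also have "\<dots> = (\<Prod>b\<in>Basis. (LINT t|lborel. f b t))"
    by (rule product_integral_prod) (auto intro: f)
  finally show ?thesis .
qed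

lemma integral_cis_period:
  assumes "m \<in> \<int>" "m \<noteq> 0"
  shows "(LINT t|lborel. indicator {0..1} t *\<^sub>R cis (2 * pi * (m * t))) = 0"
proof -
  define F where "F t = cis (2 * pi * m * t) / (\<i> * complex_of_real (2 * pi * m))" for t
  have "(LINT t|lborel. indicator {0..1} t *\<^sub>R cis (2 * pi * m * t)) = F 1 - F 0"
  proof (rule integral_FTC_Icc)
    fix x :: real
    define G where "G z = exp (\<i> * complex_of_real (2 * pi * m) * z) / (\<i> * complex_of_real (2 * pi * m))" for z
    have "(G has_field_derivative exp (\<i> * complex_of_real (2 * pi * m) * of_real x)) (at (of_real x))"
      unfolding G_def using assms(2) by (auto intro!: derivative_eq_intros)
    then have "((\<lambda>x. G (of_real x)) has_vector_derivative exp (\<i> * complex_of_real (2 * pi * m) * of_real x)) (at x within {0..1})"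
      by (rule has_vector_derivative_real_field)
    then show "(F has_vector_derivative cis (2 * pi * m * x)) (at x within {0..1})"
      by (simp add: F_def[abs_def] G_def cis_conv_exp mult.assoc)
  qed (auto intro!: continuous_intros)
  also have "F 1 = F 0"
    using assms(1) by (auto simp: F_def complex_eq_iff elim!: Ints_cases)
  finally show ?thesis by (simp add: mult.assoc)
qed

text \<open>Both the indicator of the cube and the character factor over the coordinates; a
  coordinate with k_i nonzero contributes the integral of a full number of periods.\<close>

lemma integral_torus_echar:
  assumes k: "k \<in> lattice"
  shows "(LINT x|space_measure Torus. echar k x) = (if k = (0::real^'d) then 1 else 0)"
proof (cases "k = 0")
  case True
  show ?thesis using True measure_torus[where 'd='d] by simp
next
  case False
  then obtain i where i: "vec_nth k i \<noteq> 0" by (auto simp: Finite_Cartesian_Product.vec_eq_iff)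
  let ?f = "\<lambda>b t. indicator {0..1} t *\<^sub>R cis (2 * pi * (inner k b * t))"
  have eq: "indicator unit_cube x *\<^sub>R echar k x = (\<Prod>b\<in>Basis. ?f b (inner x b))" for x :: "real^'d"
  proof -
    have "(\<Prod>b\<in>Basis. ?f b (inner x b)) = 
        of_real (\<Prod>b\<in>Basis. indicator {0..1} (inner x b)) * (\<Prod>b\<in>Basis. cis (2 * pi * (inner k b * inner x b)))"
      by (simp add: scaleR_conv_of_real prod.distrib)
    also have "(\<Prod>b\<in>Basis. indicator {0..1} (inner x b)) = (indicator unit_cube x :: real)"
    proof (cases "x \<in> unit_cube")
      case True
      then have "inner x b \<in> {0..1}" if "b \<in> Basis" for b using that
        by (auto simp: unit_cube_def Basis_vec_def inner_axis)
      then show ?thesis using True by simp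
    next
      case False
      then obtain j where "vec_nth x j \<notin> {0..1}" by (auto simp: unit_cube_def)
      then show ?thesis using False
        by (subst prod_zero) (auto intro!: bexI[of _ "axis j 1"] simp: inner_axis axis_in_Basis_iff)
    qed
    also have "(\<Prod>b\<in>Basis. cis (2 * pi * (inner k b * inner x b))) = cis (\<Sum>b\<in>Basis. 2 * pi * (inner k b * inner x b))"
      by (induction rule: finite_induct[OF finite_Basis]) (simp_all add: cis_mult)
    also have "(\<Sum>b\<in>Basis. 2 * pi * (inner k b * inner x b)) = 2 * pi * inner k x"
      by (simp add: euclidean_inner[of k x] sum_distrib_left)
    finally show ?thesis by (simp add: echar_def scaleR_conv_of_real)
  qed
  have "(LINT x|space_measure Torus. echar k x) = (LINT x|lborel. indicator unit_cube x *\<^sub>R echar k x)"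
    by (simp add: integral_restrict_space)
  also have "\<dots> = (\<Prod>b\<in>Basis. (LINT t|lborel. ?f b t))" unfolding eq
  proof (rule integral_lborel_prod)
    fix b :: "real^'d"
    have "continuous_on {0..1} (\<lambda>t. cis (2 * pi * (inner k b * t)))" by (intro continuous_intros)
    from borel_integrable_atLeastAtMost'[OF this] show "integrable lborel (?f b)"
      by (simp add: set_integrable_def)
  qed
  also have "\<dots> = 0"
  proof (rule prod_zero)
    have "(LINT t|lborel. ?f (axis i 1) t) = 0"
      using i k by (intro integral_cis_period) (auto simp: inner_axis lattice_def)
    then show "\<exists>b\<in>Basis. (LINT t|lborel. ?f b t) = 0" by (auto intro!: bexI[of _ "axis i 1"] simp: axis_in_Basis_iff)
  qed simp
  finally show ?thesis using False by simp
qed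

section \<open>Uniqueness of Fourier coefficients\<close>

text \<open>A moment problem on a compact set: Weierstrass approximation yields vanishing integrals
  over open sets, Dynkin's pi-lambda argument extends this to Borel sets, and testing on sets where
  a real part is positive gives F = 0.\<close>

lemma polynomial_determining:
  fixes F :: "'a::euclidean_space \<Rightarrow> complex"
  assumes sets[measurable_cong]: "sets \<mu> = sets borel" and K: "compact K" "AE x in \<mu>. x \<in> K"
    and F: "integrable \<mu> F"
    and poly: "\<And>p. real_polynomial_function p \<Longrightarrow> (LINT x|\<mu>. complex_of_real (p x) * F x) = 0"
  shows "AE x in \<mu>. F x = 0"
proof -
  note [measurable] = borel_measurable_integrable[OF F]
  have sp: "space \<mu> = UNIV" using sets_eq_imp_space_eq[OF sets] by simp
  have pm: "p \<in> borel_measurable borel" if "real_polynomial_function p" for p :: "'a \<Rightarrow> real"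
    using that by (intro borel_measurable_continuous_onI continuous_on_polymonial_function) (simp add: real_polynomial_function_eq)
  have si: "set_integrable \<mu> B F" if "B \<in> sets borel" for B
    unfolding set_integrable_def using that F sets by (intro integrable_mult_indicator) auto
  have UN: "(LINT x:UNIV|\<mu>. F x) = 0"
    using poly[of "\<lambda>_. 1"] by (simp add: set_lebesgue_integral_def real_polynomial_function.intros)
  have op: "(LINT x:W|\<mu>. F x) = 0" if W: "open W" for W
  proof (cases "W = UNIV")
    case True then show ?thesis using UN by simp
  next
    case False
    \<comment> \<open>Continuous functions increasing to the indicator of W. The case of the whole
      space is separate because \<open>infdist\<close> to the empty set is 0, which would make every
      \<psi> vanish.\<close>
    define \<psi> where "\<psi> n x = min 1 (real n * infdist x (- W))" for n x
    have "\<exists>p. real_polynomial_function p \<and> (\<forall>x\<in>K. \<bar>\<psi> n x - p x\<bar> < 1 / real (Suc n))" for n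
    proof -
      have "continuous_on K (\<psi> n)" unfolding \<psi>_def by (intro continuous_intros)
      moreover have "0 < 1 / real (Suc n)" by simp
      ultimately obtain q where "real_polynomial_function q" "\<And>x. x \<in> K \<Longrightarrow> \<bar>\<psi> n x - q x\<bar> < 1 / real (Suc n)"
        by (rule Stone_Weierstrass_real_polynomial_function[OF K(1)]) blast
      then show ?thesis by blast
    qed
    then obtain p where p: "\<And>n. real_polynomial_function (p n)" "\<And>n x. x \<in> K \<Longrightarrow> \<bar>\<psi> n x - p n x\<bar> < 1 / real (Suc n)"
      by metis
    note [measurable] = pm[OF p(1)]
    have lim\<psi>: "(\<lambda>n. \<psi> n x) \<longlonglongrightarrow> indicator W x" for x
    proof (cases "x \<in> W")
      case True
      have pos: "infdist x (- W) > 0" using True W False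
        using in_closed_iff_infdist_zero[of "- W" x] infdist_nonneg[of x "- W"] by (auto simp: less_le)
      obtain n0 where n0: "1 / infdist x (- W) < real n0" using reals_Archimedean2 by blast
      have "\<psi> n x = 1" if "n \<ge> n0" for n
      proof -
        have "1 / infdist x (- W) \<le> real n" using n0 that by linarith
        then show ?thesis using pos by (simp add: \<psi>_def field_simps min_def)
      qed
      then have "eventually (\<lambda>n. \<psi> n x = 1) sequentially" unfolding eventually_sequentially by blast
      then show ?thesis using True by (simp add: tendsto_eventually)
    qed (simp add: \<psi>_def)
    have limp: "(\<lambda>n. p n x) \<longlonglongrightarrow> indicator W x" if "x \<in> K" for x
    proof -
      have "(\<lambda>n. \<psi> n x - p n x) \<longlonglongrightarrow> 0"
        \<comment> \<open>The accuracy 1 / (n + 1) on K transfers the limit from \<psi> to the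
          polynomials, and also bounds them by 2 on K, as dominated convergence requires.\<close>
        by (rule Lim_null_comparison[OF _ LIMSEQ_Suc[OF lim_1_over_n]]) (use p(2)[OF that] in \<open>simp add: less_imp_le\<close>)
      from tendsto_diff[OF lim\<psi>[of x] this] show ?thesis by simp
    qed
    have bd: "\<bar>p n x\<bar> \<le> 2" if "x \<in> K" for n x
    proof -
      have "0 \<le> \<psi> n x" "\<psi> n x \<le> 1" unfolding \<psi>_def by (auto simp: infdist_nonneg)
      moreover have "1 / real (Suc n) \<le> 1" by simp
      ultimately show ?thesis using p(2)[OF that, of n] by linarith
    qed
    have Wm: "W \<in> sets borel" using W by simp
    note [measurable] = Wm
    have "(\<lambda>n. LINT x|\<mu>. complex_of_real (p n x) * F x) \<longlonglongrightarrow> (LINT x|\<mu>. complex_of_real (indicator W x) * F x)"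
    proof (rule integral_dominated_convergence[where w="\<lambda>x. 2 * cmod (F x)"])
      show "AE x in \<mu>. (\<lambda>n. complex_of_real (p n x) * F x) \<longlonglongrightarrow> complex_of_real (indicator W x) * F x"
        using K(2) by eventually_elim (intro tendsto_intros limp)
      show "AE x in \<mu>. cmod (complex_of_real (p n x) * F x) \<le> 2 * cmod (F x)" for n
        using K(2) by eventually_elim (auto simp: norm_mult intro!: mult_right_mono bd)
      show "integrable \<mu> (\<lambda>x. 2 * cmod (F x))" using F by auto
    qed measurable
    then have "(LINT x|\<mu>. complex_of_real (indicator W x) * F x) = 0"
      using poly[OF p(1)] by (simp add: LIMSEQ_const_iff)
    then show ?thesis by (simp add: set_lebesgue_integral_def scaleR_conv_of_real)
  qed
  have all: "(LINT x:B|\<mu>. F x) = 0" if "B \<in> sets borel" for B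
  proof -
    have "Int_stable {S::'a set. open S}" by (auto simp: Int_stable_def)
    moreover have "{S::'a set. open S} \<subseteq> Pow UNIV" by simp
    moreover have "B \<in> sigma_sets UNIV {S. open S}" using that by (simp add: borel_def)
    ultimately show ?thesis
    proof (induct rule: sigma_sets_induct_disjoint)
      case (basic A) then show ?case using op by simp
    next
      case empty then show ?case by (simp add: set_lebesgue_integral_def)
    next
      case (compl A)
      then have A: "A \<in> sets borel" by (simp add: borel_def)
      have "(LINT x:(A \<union> (UNIV - A))|\<mu>. F x) = (LINT x:A|\<mu>. F x) + (LINT x:(UNIV - A)|\<mu>. F x)"
        using A by (intro set_integral_Un si) auto
      then show ?case using UN compl by simp
    next
      case (union A)
      then have "range A \<subseteq> sets borel" by (simp add: borel_def)
      then have A: "\<And>i. A i \<in> sets borel" by blast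
      have "(LINT x:(\<Union>i. A i)|\<mu>. F x) = (\<Sum>i. (LINT x:(A i)|\<mu>. F x))"
        using A sets by (intro lebesgue_integral_countable_add si) (use union in \<open>auto simp: disjoint_family_on_def\<close>)
      then show ?case using union by simp
    qed
  qed
  \<comment> \<open>Testing on the set where Re (c F) is positive; the four values 1, -1, i and -i
    of c then force both parts of F to vanish.\<close>
  have le: "AE x in \<mu>. Re (c * F x) \<le> 0" for c
  proof -
    define B where "B = {x. Re (c * F x) > 0}"
    have "{x \<in> space \<mu>. Re (c * F x) > 0} \<in> sets \<mu>" by measurable
    then have B: "B \<in> sets borel" unfolding B_def using sets sp by simp
    then have Bm[measurable]: "B \<in> sets \<mu>" using sets by simp
    have i: "integrable \<mu> (\<lambda>x. c * (indicator B x *\<^sub>R F x))"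
      using si[OF B] unfolding set_integrable_def by (rule integrable_mult_right)
    have "(LINT x|\<mu>. Re (c * (indicator B x *\<^sub>R F x))) = Re (LINT x|\<mu>. c * (indicator B x *\<^sub>R F x))"
      by (rule integral_Re[OF i])
    also have "\<dots> = Re (c * (LINT x:B|\<mu>. F x))"
      unfolding set_lebesgue_integral_def by (simp only: integral_mult_right_zero)
    finally have z: "(LINT x|\<mu>. Re (c * (indicator B x *\<^sub>R F x))) = 0" using all[OF B] by simp
    have nn: "0 \<le> Re (c * (indicator B x *\<^sub>R F x))" for x
      by (auto simp: indicator_def B_def simp del: times_complex.sel)
    have "AE x in \<mu>. Re (c * (indicator B x *\<^sub>R F x)) = 0"
      using z integral_nonneg_eq_0_iff_AE[OF integrable_Re[OF i]] nn by blast
    then show ?thesis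
      by eventually_elim (auto simp: indicator_def B_def not_less simp del: times_complex.sel split: if_splits)
  qed
  have "AE x in \<mu>. Re (1 * F x) \<le> 0 \<and> Re ((-1) * F x) \<le> 0 \<and> Re (\<i> * F x) \<le> 0 \<and> Re ((-\<i>) * F x) \<le> 0"
    by (intro AE_conjI le)
  then show ?thesis by eventually_elim (auto simp: complex_eq_iff)
qed


inductive trig_poly :: "(real^'d \<Rightarrow> complex) \<Rightarrow> bool" where
  trig_char: "k \<in> lattice \<Longrightarrow> trig_poly (\<lambda>x. a * echar k x)"
| trig_add: "trig_poly f \<Longrightarrow> trig_poly g \<Longrightarrow> trig_poly (\<lambda>x. f x + g x)"

lemma trig_const: "trig_poly (\<lambda>x. a)"
  using trig_char[of 0 a] by simp

lemma trig_mult: "trig_poly f \<Longrightarrow> trig_poly g \<Longrightarrow> trig_poly (\<lambda>x. f x * g x)"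
proof (induction rule: trig_poly.induct)
  case (trig_char k a)
  from trig_char(2,1) show ?case
  proof (induction rule: trig_poly.induct)
    case (trig_char l b)
    then show ?case using trig_poly.trig_char[of "k + l" "a * b"] by (simp add: lattice_add echar_add mult_ac)
  next
    case (trig_add f g)
    then show ?case by (simp add: distrib_left trig_poly.trig_add)
  qed
next
  case (trig_add f g)
  then show ?case by (simp add: distrib_right trig_poly.trig_add)
qed

lemma trig_sum: "finite S \<Longrightarrow> (\<And>i. i \<in> S \<Longrightarrow> trig_poly (f i)) \<Longrightarrow> trig_poly (\<lambda>x. \<Sum>i\<in>S. f i x)"
  by (induction S rule: finite_induct) (auto intro: trig_const trig_add)

text \<open>Integrability is carried along in the induction because the integral of a sum splits
  only for integrable summands.\<close>

lemma trig_poly_integral: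
  assumes "trig_poly p" and f: "integrable (space_measure Torus) f"
    and z: "\<And>k. k \<in> lattice \<Longrightarrow> (LINT x|space_measure Torus. f x * echar k x) = 0"
  shows "integrable (space_measure Torus) (\<lambda>x. p x * f x) \<and> (LINT x|space_measure Torus. p x * f x) = 0"
  using assms(1)
proof (induction rule: trig_poly.induct)
  case (trig_char k a)
  have "integrable (space_measure Torus) (\<lambda>x. f x * echar k x)"
  proof (rule Bochner_Integration.integrable_bound[OF f])
    have "(\<lambda>x. echar k x) \<in> borel_measurable (space_measure Torus)" by (intro measurable_torus) measurable
    then show "(\<lambda>x. f x * echar k x) \<in> borel_measurable (space_measure Torus)"
      using f by (intro borel_measurable_times) (auto dest: borel_measurable_integrable)
  qed (simp add: norm_mult)
  then have "integrable (space_measure Torus) (\<lambda>x. a * (f x * echar k x))" by simp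
  moreover have "(LINT x|space_measure Torus. a * (f x * echar k x)) = 0" using z[OF trig_char] by simp
  ultimately show ?case by (simp add: mult_ac)
next
  case (trig_add p q)
  then show ?case by (simp add: distrib_right)
qed

definition torus_embed :: "real^'d \<Rightarrow> complex^'d" where
  "torus_embed x = vec_lambda (\<lambda>i. cis (2 * pi * vec_nth x i))"

text \<open>A Borel left inverse of t -> cis (2 pi t) on [0, 1), extended to all complex numbers.
  The clamping keeps the argument of \<open>arccos\<close> in [-1, 1], where \<open>arccos\<close>
  is continuous.\<close>

definition circle_angle :: "complex \<Rightarrow> real" where
  "circle_angle z = (if Im z \<ge> 0 then arccos (max (- 1) (min 1 (Re z)))
     else 2 * pi - arccos (max (- 1) (min 1 (Re z)))) / (2 * pi)"

lemma circle_angle_cis: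
  assumes "0 \<le> t" "t < 1"
  shows "circle_angle (cis (2 * pi * t)) = t"
proof (cases "t \<le> 1/2")
  case True
  then have "2 * pi * t \<le> 2 * pi * (1/2)" by (intro mult_left_mono) auto
  then have t: "0 \<le> 2 * pi * t" "2 * pi * t \<le> pi" using assms by auto
  then have "sin (2 * pi * t) \<ge> 0" by (rule sin_ge_zero)
  then show ?thesis using arccos_cos[OF t] by (simp add: circle_angle_def)
next
  case False
  have "pi * t < pi * 1" "pi * (1/2) < pi * t" using assms False by (auto intro!: mult_strict_left_mono)
  then have t: "pi < 2 * pi * t" "2 * pi * t < 2 * pi" by auto
  then have s: "sin (2 * pi * t) < 0" by (rule sin_lt_zero)
  have "arccos (cos (2 * pi - 2 * pi * t)) = 2 * pi - 2 * pi * t" using t by (intro arccos_cos) auto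
  moreover have "cos (2 * pi - 2 * pi * t) = cos (2 * pi * t)" by (simp add: cos_diff)
  ultimately show ?thesis using s by (simp add: circle_angle_def field_simps)
qed

lemma circle_angle_borel [measurable]: "circle_angle \<in> borel_measurable borel"
proof -
  have "continuous_on UNIV (\<lambda>z. arccos (max (- 1) (min 1 (Re z))))"
    by (intro continuous_intros) auto
  then have [measurable]: "(\<lambda>z. arccos (max (- 1) (min 1 (Re z)))) \<in> borel_measurable borel"
    by (rule borel_measurable_continuous_onI)
  show ?thesis unfolding circle_angle_def by measurable
qed

lemma continuous_torus_embed: "continuous_on S torus_embed"
  unfolding torus_embed_def[abs_def] by (intro continuous_intros continuous_on_vec_lambda)

text \<open>The real coordinates of an embedded point are cosines and sines, each a combination of
  the two characters with frequencies plus and minus a unit vector; trigonometric polynomials are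
  closed under sums and products.\<close>

lemma trig_poly_embed:
  assumes "real_polynomial_function p"
  shows "trig_poly (\<lambda>x::real^'d. complex_of_real (p (torus_embed x)))"
  using assms
proof (induction rule: real_polynomial_function.induct)
  case (linear f)
  interpret bounded_linear f by fact
  have cc: "trig_poly (\<lambda>x::real^'d. complex_of_real (inner (torus_embed x) b))" if b: "b \<in> Basis" for b
  proof -
    obtain i v where iv: "b = axis i v" "v = 1 \<or> v = \<i>"
      using b by (auto simp: Basis_vec_def Basis_complex_def)
    have lat: "axis i 1 \<in> (lattice :: (real^'d) set)" by (simp add: lattice_def axis_def)
    have ax: "inner (axis i 1) x = vec_nth x i" for x :: "real^'d" by (simp add: inner_axis')
    show ?thesis using iv(2)
    proof
      assume v: "v = 1"
      have "complex_of_real (inner (torus_embed x) b) = (1/2) * echar (axis i 1) x + (1/2) * echar (- axis i 1) x" for x :: "real^'d"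
        by (simp add: iv(1) v inner_axis torus_embed_def echar_def inner_complex_def complex_eq_iff ax)
      then show ?thesis by (simp only:) (intro trig_add trig_char lat lattice_minus)
    next
      assume v: "v = \<i>"
      have "complex_of_real (inner (torus_embed x) b) = (- \<i>/2) * echar (axis i 1) x + (\<i>/2) * echar (- axis i 1) x" for x :: "real^'d"
        by (simp add: iv(1) v inner_axis torus_embed_def echar_def inner_complex_def complex_eq_iff ax)
      then show ?thesis by (simp only:) (intro trig_add trig_char lat lattice_minus)
    qed
  qed
  have "complex_of_real (f z) = (\<Sum>b\<in>Basis. complex_of_real (f b) * complex_of_real (inner z b))" for z
  proof -
    have "f z = f (\<Sum>b\<in>Basis. inner z b *\<^sub>R b)" by (simp add: euclidean_representation)
    also have "\<dots> = (\<Sum>b\<in>Basis. inner z b * f b)" by (simp add: sum scaleR)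
    finally show ?thesis by (simp add: mult.commute)
  qed
  then have eq: "(\<lambda>x::real^'d. complex_of_real (f (torus_embed x))) =
      (\<lambda>x. \<Sum>b\<in>Basis. complex_of_real (f b) * complex_of_real (inner (torus_embed x) b))" by (intro ext)
  show ?case unfolding eq by (intro trig_sum trig_mult trig_const cc finite_Basis)
next
  case (const c)
  then show ?case by (rule trig_const)
next
  case (add f g)
  then show ?case by (simp add: trig_add)
next
  case (mult f g)
  then show ?case by (simp add: trig_mult)
qed

text \<open>The torus is embedded in C^d, where polynomials restrict to trigonometric polynomials
  and hence integrate to 0 against f. The Borel inverse \<open>P\<close> of the embedding turns f
  into a function on the image, to which \<open>polynomial_determining\<close> applies.\<close>

theorem fourier_coefficients_unique:
  fixes f :: "real^'d \<Rightarrow> complex"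
  assumes f[measurable]: "f \<in> borel_measurable borel" and fi: "integrable (space_measure Torus) f"
    and z: "\<And>k. k \<in> lattice \<Longrightarrow> (LINT x|space_measure Torus. f x * echar k x) = 0"
  shows "AE x in space_measure Torus. f x = 0"
proof -
  let ?C = "space_measure Torus :: (real^'d) measure"
  define P where "P z = vec_lambda (\<lambda>i. circle_angle (vec_nth z i))" for z :: "complex^'d"
  define F where "F z = f (P z)" for z
  define \<mu> where "\<mu> = distr ?C borel torus_embed"
  have [measurable]: "torus_embed \<in> borel_measurable borel"
    by (intro borel_measurable_continuous_onI continuous_torus_embed)
  have Em[measurable]: "torus_embed \<in> borel_measurable ?C" by (intro measurable_torus) measurable
  have [measurable]: "P \<in> borel_measurable borel"
  proof -
    have "(\<lambda>z::complex^'d. vec_nth z i) \<in> borel_measurable borel" for i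
      by (intro borel_measurable_continuous_onI continuous_intros)
    then have "(\<lambda>z. vec_nth (P z) i) \<in> borel_measurable borel" for i
      unfolding P_def by (simp add: measurable_compose[OF _ circle_angle_borel])
    then show ?thesis
      by (intro borel_measurable_euclidean_space[THEN iffD2]) (auto simp: Basis_vec_def inner_axis)
  qed
  have Fm[measurable]: "F \<in> borel_measurable borel" unfolding F_def by measurable
  have PE: "P (torus_embed x) = x" if "x \<in> half_cube" for x
    using that by (auto simp: P_def torus_embed_def half_cube_def circle_angle_cis Finite_Cartesian_Product.vec_eq_iff)
  have FE: "AE x in ?C. F (torus_embed x) = f x"
    using AE_torus_half_cube by eventually_elim (simp add: F_def PE)
  have FEi: "integrable ?C (\<lambda>x. F (torus_embed x))"
  proof -
    have "(\<lambda>x. F (torus_embed x)) \<in> borel_measurable ?C" by measurable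
    from integrable_cong_AE[OF this measurable_torus[OF f] FE] fi show ?thesis by blast
  qed
  define K where "K = torus_embed ` (unit_cube :: (real^'d) set)"
  have K: "compact K" unfolding K_def unit_cube_cbox
    by (intro compact_continuous_image continuous_torus_embed compact_cbox)
  have Km: "K \<in> sets borel" using K by (rule borel_compact)
  have "AE z in \<mu>. F z = 0"
  proof (rule polynomial_determining[OF _ K])
    show "sets \<mu> = sets borel" by (simp add: \<mu>_def)
    have "AE x in ?C. torus_embed x \<in> K"
      by (rule AE_I2) (simp add: K_def space_restrict_space)
    then show "AE x in \<mu>. x \<in> K" unfolding \<mu>_def using Km Em by (subst AE_distr_iff) (auto simp del: space_measure.simps)
    show "integrable \<mu> F" unfolding \<mu>_def using FEi Em by (subst integrable_distr_eq) (auto simp del: space_measure.simps)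
    fix p :: "complex^'d \<Rightarrow> real" assume p: "real_polynomial_function p"
    then have [measurable]: "p \<in> borel_measurable borel"
      by (intro borel_measurable_continuous_onI continuous_on_polymonial_function) (simp add: real_polynomial_function_eq)
    have m1: "(\<lambda>x. complex_of_real (p (torus_embed x)) * F (torus_embed x)) \<in> borel_measurable ?C"
      by (intro measurable_torus) measurable
    have m2: "(\<lambda>x. complex_of_real (p (torus_embed x)) * f x) \<in> borel_measurable ?C"
      by (intro measurable_torus) measurable
    have "(LINT x|\<mu>. complex_of_real (p x) * F x) = (LINT x|?C. complex_of_real (p (torus_embed x)) * F (torus_embed x))"
      unfolding \<mu>_def by (rule integral_distr[OF Em]) measurable
    also have "\<dots> = (LINT x|?C. complex_of_real (p (torus_embed x)) * f x)"
    proof (rule integral_cong_AE[OF m1 m2])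
      show "AE x in ?C. complex_of_real (p (torus_embed x)) * F (torus_embed x) = complex_of_real (p (torus_embed x)) * f x"
        using FE by eventually_elim simp
    qed
    also have "\<dots> = 0"
      using trig_poly_integral[OF trig_poly_embed[OF p] fi] z by blast
    finally show "(LINT x|\<mu>. complex_of_real (p x) * F x) = 0" .
  qed
  moreover have "(AE z in \<mu>. F z = 0) = (AE x in ?C. F (torus_embed x) = 0)"
    unfolding \<mu>_def by (rule AE_distr_iff[OF Em]) measurable
  ultimately have "AE x in ?C. F (torus_embed x) = 0" by simp
  with FE show ?thesis by eventually_elim simp
qed


section \<open>Parseval's identity on the torus\<close>

lemma sq_int_integrable_torus:
  assumes "f \<in> sq_int (space_measure Torus :: (real^'d) measure)"
  shows "integrable (space_measure Torus) f"
proof -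
  interpret finite_measure "space_measure Torus :: (real^'d) measure" by (rule finite_measure_torus)
  have "(\<lambda>_. 1) \<in> sq_int (space_measure Torus :: (real^'d) measure)" unfolding sq_int_def
    using integrable_const[of "1::real"] by simp
  from sq_int_mult_integrable[OF assms this] show ?thesis by simp
qed

lemma sq_int_mult_echar:
  assumes "f \<in> sq_int M" "(\<lambda>x. echar \<xi> x) \<in> borel_measurable M"
  shows "(\<lambda>x. f x * echar \<xi> x) \<in> sq_int M"
  using assms by (auto simp: sq_int_def norm_mult)

lemma echar_measurable_torus: "echar \<xi> \<in> borel_measurable (space_measure Torus)"
proof -
  have "(\<lambda>x. echar \<xi> x) \<in> borel_measurable borel" by measurable
  from measurable_torus[OF this] show ?thesis by simp
qed

lemma nn_integral_count_space_LIMSEQ: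
  fixes g :: "'a \<Rightarrow> real"
  assumes S: "\<And>n. finite (S n)" "incseq S" "(\<Union>n. S n) = X" and g: "\<And>x. 0 \<le> g x"
  shows "(\<lambda>n. ennreal (\<Sum>x\<in>S n. g x)) \<longlonglongrightarrow> (\<integral>\<^sup>+x. ennreal (g x) \<partial>count_space X)"
proof -
  have sub: "S n \<subseteq> X" for n using S(3) by auto
  have 1: "incseq (\<lambda>n x. ennreal (g x) * indicator (S n) x)"
    using S(2) by (auto simp: incseq_def le_fun_def indicator_def)
  have 2: "(SUP n. ennreal (g x) * indicator (S n) x) = ennreal (g x)" if x: "x \<in> X" for x
  proof (rule antisym)
    obtain n where "x \<in> S n" using x S(3) by blast
    then show "ennreal (g x) \<le> (SUP n. ennreal (g x) * indicator (S n) x)"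
      by (intro SUP_upper2[of n]) auto
  qed (auto intro!: SUP_least simp: indicator_def)
  have 3: "(\<integral>\<^sup>+x. ennreal (g x) * indicator (S n) x \<partial>count_space X) = ennreal (\<Sum>x\<in>S n. g x)" for n
  proof -
    have "(\<integral>\<^sup>+x. ennreal (g x) * indicator (S n) x \<partial>count_space X) = (\<integral>\<^sup>+x. ennreal (g x) \<partial>count_space (S n))"
      by (subst (1 2) nn_integral_count_space_indicator)
        (auto intro!: nn_integral_cong simp: indicator_def sub[THEN subsetD])
    also have "\<dots> = ennreal (\<Sum>x\<in>S n. g x)" using S(1) g by (simp add: nn_integral_count_space_finite)
    finally show ?thesis .
  qed
  have "(\<integral>\<^sup>+x. ennreal (g x) \<partial>count_space X) = (\<integral>\<^sup>+x. (SUP n. ennreal (g x) * indicator (S n) x) \<partial>count_space X)"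
    using 2 by (intro nn_integral_cong) simp
  also have "\<dots> = (SUP n. \<integral>\<^sup>+x. ennreal (g x) * indicator (S n) x \<partial>count_space X)"
    by (intro nn_integral_monotone_convergence_SUP 1) auto
  also have "\<dots> = (SUP n. ennreal (\<Sum>x\<in>S n. g x))" unfolding 3 ..
  finally show ?thesis
    using LIMSEQ_SUP[of "\<lambda>n. ennreal (\<Sum>x\<in>S n. g x)"] S(1,2) g
    by (simp add: incseq_def sum_mono2 ennreal_leI)
qed

text \<open>Bessel's identity makes the partial sums Cauchy. Their limit in L2 has the same Fourier
  coefficients as f, hence equals f almost everywhere, and the defect in Bessel's identity tends to
  0.\<close>

theorem parseval_torus:
  fixes f :: "real^'d \<Rightarrow> complex"
  assumes f[measurable]: "f \<in> borel_measurable borel" and fs: "f \<in> sq_int (space_measure Torus)"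
  shows "(\<integral>\<^sup>+k. ennreal ((cmod (LINT x|space_measure Torus. f x * echar (- k) x))\<^sup>2) \<partial>count_space lattice)
    = (\<integral>\<^sup>+x. ennreal ((cmod (f x))\<^sup>2) \<partial>space_measure Torus)"
proof -
  let ?C = "space_measure Torus :: (real^'d) measure"
  interpret finite_measure ?C by (rule finite_measure_torus)
  define c where "c k = (LINT x|?C. f x * echar (- k) x)" for k
  define S where "S n = lattice \<inter> cball (0::real^'d) (real n)" for n
  define P where "P X x = (\<Sum>k\<in>X. c k * echar k x)" for X x
  have finS: "finite (S n)" for n unfolding S_def by (rule lattice_cball)
  have incS: "incseq S" unfolding S_def incseq_def by auto
  have UnS: "(\<Union>n. S n) = lattice" unfolding S_def
    by (auto simp: dist_norm intro: real_arch_simple)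
  have Slat: "S n \<subseteq> lattice" for n unfolding S_def by auto
  have es: "echar k \<in> sq_int ?C" for k
    using echar_measurable_torus[of k] integrable_const[of "1::real"]
    unfolding sq_int_def mem_Collect_eq norm_echar power_one by blast
  have Ps: "P X \<in> sq_int ?C" if "finite X" for X unfolding P_def
  proof (rule sq_norm_dominated(1)[where g=echar and c="\<lambda>k. cmod (c k)" and K=X])
    show "(\<lambda>x. \<Sum>k\<in>X. c k * echar k x) \<in> borel_measurable ?C"
      using echar_measurable_torus by (intro borel_measurable_sum borel_measurable_times) auto
    show "AE x in ?C. cmod (\<Sum>k\<in>X. c k * echar k x) \<le> (\<Sum>k\<in>X. cmod (c k) * cmod (echar k x))"
      by (intro AE_I2 order_trans[OF norm_sum]) (simp add: norm_mult)
  qed (use that es in auto)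
  have ei: "integrable ?C (\<lambda>x. g x * echar l x)" if "g \<in> sq_int ?C" for g l
    using sq_int_mult_integrable[OF that es] .
  have coefP: "(LINT x|?C. P X x * echar (- k) x) = (if k \<in> X then c k else 0)"
    if X: "finite X" "X \<subseteq> lattice" and k: "k \<in> lattice" for X k
  proof -
    have "(LINT x|?C. P X x * echar (- k) x) = (LINT x|?C. (\<Sum>l\<in>X. c l * (echar l x * echar (- k) x)))"
      by (simp add: P_def sum_distrib_right mult.assoc)
    also have "\<dots> = (\<Sum>l\<in>X. c l * (LINT x|?C. echar l x * echar (- k) x))"
      using ei[OF es] by simp
    also have "\<dots> = (\<Sum>l\<in>X. c l * (if l = k then 1 else 0))"
    proof (intro sum.cong refl arg_cong2[where f="(*)"])
      fix l assume "l \<in> X"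
      then have "l - k \<in> lattice" using X k by (auto intro: lattice_diff)
      from integral_torus_echar[OF this] show "(LINT x|?C. echar l x * echar (- k) x) = (if l = k then 1 else 0)"
        by (simp add: echar_add[symmetric])
    qed
    also have "\<dots> = (if k \<in> X then c k else 0)" using X by (simp add: if_distrib[of "\<lambda>x. _ * x"] cong: if_cong)
    finally show ?thesis .
  qed
  have normP: "(sq_norm ?C (P X))\<^sup>2 = (\<Sum>k\<in>X. (cmod (c k))\<^sup>2)" if X: "finite X" "X \<subseteq> lattice" for X
  proof -
    have "complex_of_real ((sq_norm ?C (P X))\<^sup>2) = (LINT x|?C. P X x * cnj (P X x))"
      using sq_inner_self[of ?C "P X"] by (simp add: sq_inner_def)
    also have "\<dots> = (LINT x|?C. (\<Sum>k\<in>X. cnj (c k) * (P X x * echar (- k) x)))"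
      by (intro Bochner_Integration.integral_cong refl)
        (subst (2) P_def, simp add: sum_distrib_left cnj_echar mult_ac)
    also have "\<dots> = (\<Sum>k\<in>X. cnj (c k) * (LINT x|?C. P X x * echar (- k) x))"
      using ei[OF Ps[OF X(1)]] by simp
    also have "\<dots> = (\<Sum>k\<in>X. cnj (c k) * c k)"
      using coefP[OF X] X(2) by (intro sum.cong refl) auto
    also have "\<dots> = complex_of_real (\<Sum>k\<in>X. (cmod (c k))\<^sup>2)"
      by (simp only: of_real_sum complex_norm_square mult.commute)
    finally show ?thesis by (simp only: of_real_eq_iff)
  qed
  \<comment> \<open>Pythagoras: f minus its partial sum is orthogonal to the partial sum, since both
    have the coefficients \<open>c k\<close> for k in X.\<close>
  have bessel: "(sq_norm ?C f)\<^sup>2 = (sq_norm ?C (\<lambda>x. f x - P X x))\<^sup>2 + (\<Sum>k\<in>X. (cmod (c k))\<^sup>2)"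
    if X: "finite X" "X \<subseteq> lattice" for X
  proof -
    have d: "(\<lambda>x. f x - P X x) \<in> sq_int ?C" by (rule sq_int_diff(1)[OF fs Ps[OF X(1)]])
    have orth: "(LINT x|?C. (f x - P X x) * cnj (P X x)) = 0"
    proof -
      have "(LINT x|?C. (f x - P X x) * cnj (P X x)) = (LINT x|?C. (\<Sum>k\<in>X. cnj (c k) * (f x * echar (- k) x - P X x * echar (- k) x)))"
        by (intro Bochner_Integration.integral_cong refl)
          (subst (2) P_def, simp add: sum_distrib_left cnj_echar algebra_simps)
      also have "\<dots> = (\<Sum>k\<in>X. cnj (c k) * (c k - (LINT x|?C. P X x * echar (- k) x)))"
        using ei[OF Ps[OF X(1)]] ei[OF fs] by (simp add: c_def)
      also have "\<dots> = 0" using coefP[OF X] X(2) by (intro sum.neutral) auto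
      finally show ?thesis .
    qed
    have i: "integrable ?C (\<lambda>x. (f x - P X x) * cnj (P X x))" by (rule sq_inner_integrable[OF d Ps[OF X(1)]])
    have re: "integrable ?C (\<lambda>x. Re ((f x - P X x) * cnj (P X x)))" by (rule integrable_Re[OF i])
    have pt: "(cmod (f x))\<^sup>2 = (cmod (f x - P X x))\<^sup>2 + 2 * Re ((f x - P X x) * cnj (P X x)) + (cmod (P X x))\<^sup>2" for x
      unfolding cmod_power2 by (simp add: power2_eq_square algebra_simps)
    have "(sq_norm ?C f)\<^sup>2 = (LINT x|?C. (cmod (f x - P X x))\<^sup>2 + 2 * Re ((f x - P X x) * cnj (P X x)) + (cmod (P X x))\<^sup>2)"
      unfolding sq_norm_power2 using pt by simp
    also have "\<dots> = (sq_norm ?C (\<lambda>x. f x - P X x))\<^sup>2 + 2 * (LINT x|?C. Re ((f x - P X x) * cnj (P X x))) + (sq_norm ?C (P X))\<^sup>2"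
      unfolding sq_norm_power2
      by (subst Bochner_Integration.integral_add, intro Bochner_Integration.integrable_add integrable_mult_right re sq_int_integrable[OF d], rule sq_int_integrable[OF Ps[OF X(1)]],
        subst Bochner_Integration.integral_add, rule sq_int_integrable[OF d], intro integrable_mult_right re, simp only: integral_mult_right_zero)
    also have "(LINT x|?C. Re ((f x - P X x) * cnj (P X x))) = 0"
      using integral_Re[OF i] orth by simp
    finally show ?thesis using normP[OF X] by simp
  qed
  define a where "a n = (\<Sum>k\<in>S n. (cmod (c k))\<^sup>2)" for n
  have "incseq a" unfolding a_def incseq_def using incS finS by (auto simp: incseq_def intro!: sum_mono2)
  moreover have "a n \<le> (sq_norm ?C f)\<^sup>2" for n
    using bessel[OF finS Slat, of n] zero_le_power2[of "sq_norm ?C (\<lambda>x. f x - P (S n) x)"]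
    unfolding a_def by linarith
  ultimately obtain L where L: "a \<longlonglongrightarrow> L" using incseq_convergent[of a "(sq_norm ?C f)\<^sup>2"] by metis
  have diffP: "(sq_norm ?C (\<lambda>x. P (S m) x - P (S n) x))\<^sup>2 = a m - a n" if "n \<le> m" for m n
  proof -
    have sub: "S n \<subseteq> S m" using incS that by (auto simp: incseq_def)
    have "P (S m) x - P (S n) x = P (S m - S n) x" for x
      unfolding P_def using sub finS by (simp add: sum_diff)
    then have "(sq_norm ?C (\<lambda>x. P (S m) x - P (S n) x))\<^sup>2 = (sq_norm ?C (P (S m - S n)))\<^sup>2" by simp
    also have "\<dots> = (\<Sum>k\<in>S m - S n. (cmod (c k))\<^sup>2)" using finS Slat by (intro normP) auto
    finally show ?thesis using sub finS by (simp add: a_def sum_diff)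
  qed
  have "\<exists>g\<in>sq_int ?C. (\<lambda>n. sq_norm ?C (\<lambda>x. P (S n) x - g x)) \<longlonglongrightarrow> 0"
  proof (rule sq_int_complete)
    fix e :: real assume e: "e > 0"
    then obtain n0 where n0: "\<And>m n. m \<ge> n0 \<Longrightarrow> n \<ge> n0 \<Longrightarrow> \<bar>a m - a n\<bar> < e\<^sup>2"
      using LIMSEQ_imp_Cauchy[OF L, THEN CauchyD, of "e\<^sup>2"] by auto
    have 1: "sq_norm ?C (\<lambda>x. P (S m) x - P (S n) x) < e" if "m \<ge> n0" "n \<ge> n0" "n \<le> m" for m n
    proof -
      have "(sq_norm ?C (\<lambda>x. P (S m) x - P (S n) x))\<^sup>2 < e\<^sup>2" using diffP[OF that(3)] n0[OF that(1,2)] by linarith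
      then show ?thesis by (rule power_less_imp_less_base) (use e in simp)
    qed
    have "sq_norm ?C (\<lambda>x. P (S m) x - P (S n) x) < e" if "m \<ge> n0" "n \<ge> n0" for m n
      using 1[OF that] 1[OF that(2,1)] sq_norm_minus_commute[of ?C "P (S m)" "P (S n)"] by (cases "n \<le> m") auto
    then show "\<exists>n0. \<forall>m\<ge>n0. \<forall>n\<ge>n0. sq_norm ?C (\<lambda>x. P (S m) x - P (S n) x) < e" by blast
  qed (rule Ps[OF finS])
  then obtain g where g: "g \<in> sq_int ?C" and lim: "(\<lambda>n. sq_norm ?C (\<lambda>x. P (S n) x - g x)) \<longlonglongrightarrow> 0" by blast
  \<comment> \<open>The limit is only measurable on the cube; extended by 0 it becomes Borel on the
    whole space, the form in which uniqueness of the coefficients is stated.\<close>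
  define g' where "g' x = (if x \<in> unit_cube then g x else 0)" for x
  have g'm[measurable]: "g' \<in> borel_measurable borel"
  proof -
    have "(\<lambda>x. indicator unit_cube x *\<^sub>R g x) \<in> borel_measurable lborel"
      using sq_int_measurable[OF g] by (subst (asm) space_measure.simps, subst (asm) borel_measurable_restrict_space_iff) auto
    moreover have "(\<lambda>x. indicator unit_cube x *\<^sub>R g x) = g'" by (auto simp: g'_def indicator_def)
    ultimately show ?thesis by simp
  qed
  have gg: "\<And>x. x \<in> space ?C \<Longrightarrow> g' x = g x" by (simp add: g'_def space_restrict_space)
  have g's: "g' \<in> sq_int ?C" and g'lim: "(\<lambda>n. sq_norm ?C (\<lambda>x. P (S n) x - g' x)) \<longlonglongrightarrow> 0"
  proof -
    show "g' \<in> sq_int ?C" using sq_int_cong_AE(1)[OF measurable_torus[OF g'm] sq_int_measurable[OF g] AE_I2[OF gg]] g by blast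
    have "sq_norm ?C (\<lambda>x. P (S n) x - g' x) = sq_norm ?C (\<lambda>x. P (S n) x - g x)" for n
      unfolding sq_norm_def using gg by (intro arg_cong[of _ _ sqrt] Bochner_Integration.integral_cong) auto
    then show "(\<lambda>n. sq_norm ?C (\<lambda>x. P (S n) x - g' x)) \<longlonglongrightarrow> 0" using lim by simp
  qed
  have "AE x in ?C. f x - g' x = 0"
  proof (rule fourier_coefficients_unique)
    show "integrable ?C (\<lambda>x. f x - g' x)"
      by (intro Bochner_Integration.integrable_diff sq_int_integrable_torus fs g's)
    fix l :: "real^'d" assume "l \<in> lattice"
    then have k: "- l \<in> lattice" by (rule lattice_minus)
    define k where "k = - l"
    have kl: "k \<in> lattice" using k by (simp add: k_def)
    have "(LINT x|?C. g' x * echar (- k) x) = c k"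
    proof -
      have "(\<lambda>n. (LINT x|?C. (P (S n) x - g' x) * echar (- k) x)) \<longlonglongrightarrow> 0"
      proof (rule Lim_null_comparison)
        have 1: "sq_norm ?C (echar (- k)) = 1" using measure_torus[where 'd='d] by (simp add: sq_norm_def)
        have "norm (LINT x|?C. (P (S n) x - g' x) * echar (- k) x) \<le> sq_norm ?C (\<lambda>x. P (S n) x - g' x) * sq_norm ?C (echar (- k))" for n
          by (rule integral_mult_le[OF sq_int_diff(1)[OF Ps[OF finS] g's] es])
        then show "\<forall>\<^sub>F n in sequentially. norm (LINT x|?C. (P (S n) x - g' x) * echar (- k) x) \<le> sq_norm ?C (\<lambda>x. P (S n) x - g' x)"
          unfolding 1 mult_1_right by (intro always_eventually allI)
      qed (rule g'lim)
      \<comment> \<open>A fixed coefficient of the partial sums is stationary as soon as k belongs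
        to S n.\<close>
      moreover have "\<forall>\<^sub>F n in sequentially. (LINT x|?C. (P (S n) x - g' x) * echar (- k) x) = c k - (LINT x|?C. g' x * echar (- k) x)"
      proof -
        obtain n0 where n0: "k \<in> S n0" using UnS kl by blast
        have "(LINT x|?C. (P (S n) x - g' x) * echar (- k) x) = c k - (LINT x|?C. g' x * echar (- k) x)" if "n \<ge> n0" for n
        proof -
          have "k \<in> S n" using incS n0 that by (auto simp: incseq_def)
          then show ?thesis using coefP[OF finS Slat kl, of n] ei[OF Ps[OF finS]] ei[OF g's]
            by (simp add: left_diff_distrib)
        qed
        then show ?thesis unfolding eventually_sequentially by blast
      qed
      ultimately have "(\<lambda>n::nat. c k - (LINT x|?C. g' x * echar (- k) x)) \<longlonglongrightarrow> 0"
        by (rule Lim_transform_eventually)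
      then show ?thesis by (simp add: LIMSEQ_const_iff)
    qed
    then have "(LINT x|?C. g' x * echar l x) = (LINT x|?C. f x * echar l x)" by (simp add: c_def k_def)
    then show "(LINT x|?C. (f x - g' x) * echar l x) = 0"
      using ei[OF fs] ei[OF g's] by (simp add: left_diff_distrib)
  qed measurable
  then have fg: "AE x in ?C. f x = g' x" by eventually_elim simp
  have "sq_norm ?C (\<lambda>x. f x - P (S n) x) = sq_norm ?C (\<lambda>x. P (S n) x - g' x)" for n
  proof -
    have "sq_norm ?C (\<lambda>x. f x - P (S n) x) = sq_norm ?C (\<lambda>x. g' x - P (S n) x)"
    proof (rule sq_int_cong_AE(2))
      show "AE x in ?C. f x - P (S n) x = g' x - P (S n) x" using fg by eventually_elim simp
    qed (intro borel_measurable_diff sq_int_measurable fs g's Ps finS)+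
    then show ?thesis using sq_norm_minus_commute by metis
  qed
  then have "(\<lambda>n. (sq_norm ?C f)\<^sup>2 - (sq_norm ?C (\<lambda>x. f x - P (S n) x))\<^sup>2) \<longlonglongrightarrow> (sq_norm ?C f)\<^sup>2 - 0\<^sup>2"
    using g'lim by (intro tendsto_intros) simp
  moreover have "(sq_norm ?C f)\<^sup>2 - (sq_norm ?C (\<lambda>x. f x - P (S n) x))\<^sup>2 = a n" for n
    using bessel[OF finS Slat, of n] unfolding a_def by linarith
  ultimately have "a \<longlonglongrightarrow> (sq_norm ?C f)\<^sup>2" by simp
  then have "(\<lambda>n. ennreal (a n)) \<longlonglongrightarrow> ennreal ((sq_norm ?C f)\<^sup>2)" by (intro tendsto_ennrealI)
  moreover have "(\<lambda>n. ennreal (a n)) \<longlonglongrightarrow> (\<integral>\<^sup>+k. ennreal ((cmod (c k))\<^sup>2) \<partial>count_space lattice)"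
    unfolding a_def by (rule nn_integral_count_space_LIMSEQ[OF finS incS UnS]) simp
  ultimately have "(\<integral>\<^sup>+k. ennreal ((cmod (c k))\<^sup>2) \<partial>count_space lattice) = ennreal ((sq_norm ?C f)\<^sup>2)"
    by (rule LIMSEQ_unique[rotated])
  then show ?thesis using nn_integral_sq_norm[OF fs] by (simp add: c_def)
qed


section \<open>The Plancherel transform\<close>

lemma lborel_translate: "distr lborel borel (\<lambda>x. t + x) = (lborel :: 'a::euclidean_space measure)"
  using lborel_affine[of 1 t] by (simp add: density_1)

lemma nn_integral_translate:
  fixes g :: "'a::euclidean_space \<Rightarrow> ennreal"
  assumes [measurable]: "g \<in> borel_measurable borel"
  shows "(\<integral>\<^sup>+x. g (t + x) \<partial>lborel) = (\<integral>\<^sup>+x. g x \<partial>lborel)"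
  by (subst (2) lborel_translate[of t, symmetric], subst nn_integral_distr) simp_all

text \<open>The translates of \<open>half_cube\<close> by the lattice cover every point exactly
  once, so inserting their sum of indicators changes nothing; Tonelli and translation invariance do
  the rest.\<close>

lemma nn_integral_tiling:
  fixes F :: "real^'d \<Rightarrow> ennreal"
  assumes F[measurable]: "F \<in> borel_measurable borel"
  shows "(\<integral>\<^sup>+x. F x \<partial>lborel) = (\<integral>\<^sup>+x. (\<integral>\<^sup>+k. F (x + k) \<partial>count_space lattice) \<partial>space_measure Torus)"
proof -
  have one: "(\<integral>\<^sup>+k. indicator half_cube (x - k) \<partial>count_space lattice) = 1" for x :: "real^'d"
  proof -
    define z where "z = (vec_lambda (\<lambda>i. of_int \<lfloor>vec_nth x i\<rfloor>) :: real^'d)"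
    have z: "z \<in> lattice" by (simp add: z_def lattice_def)
    have iff: "x - k \<in> half_cube \<longleftrightarrow> k = z" if kl: "k \<in> lattice" for k
    proof
      assume h: "x - k \<in> half_cube"
      show "k = z" unfolding Finite_Cartesian_Product.vec_eq_iff
      proof
        fix i
        obtain m where m: "vec_nth k i = of_int m" using kl by (auto simp: lattice_def elim: Ints_cases)
        have "0 \<le> vec_nth x i - of_int m" "vec_nth x i - of_int m < 1" using h m by (auto simp: half_cube_def dest!: spec[of _ i])
        then have "\<lfloor>vec_nth x i\<rfloor> = m" by linarith
        then show "vec_nth k i = vec_nth z i" by (simp add: z_def m)
      qed
    next
      assume "k = z"
      then show "x - k \<in> half_cube" unfolding half_cube_def z_def by (simp add: algebra_simps) linarith
    qed
    have "(\<integral>\<^sup>+k. indicator half_cube (x - k) \<partial>count_space lattice) = (\<integral>\<^sup>+k. indicator {z} k \<partial>count_space lattice)"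
      by (intro nn_integral_cong) (auto simp: indicator_def iff)
    also have "\<dots> = 1" using z by (simp add: nn_integral_indicator_singleton)
    finally show ?thesis .
  qed
  have "(\<integral>\<^sup>+x. (\<integral>\<^sup>+k. F (x + k) \<partial>count_space lattice) \<partial>space_measure Torus)
      = (\<integral>\<^sup>+x. (\<integral>\<^sup>+k. F (x + k) \<partial>count_space lattice) * indicator unit_cube x \<partial>lborel)"
    unfolding space_measure.simps by (rule nn_integral_restrict_space) simp
  also have "\<dots> = (\<integral>\<^sup>+x. (\<integral>\<^sup>+k. F (x + k) * indicator half_cube x \<partial>count_space lattice) \<partial>lborel)"
  proof (rule nn_integral_cong_AE)
    show "AE x in lborel. (\<integral>\<^sup>+k. F (x + k) \<partial>count_space lattice) * indicator unit_cube x =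
        (\<integral>\<^sup>+k. F (x + k) * indicator half_cube x \<partial>count_space lattice)"
      using AE_half_cube by eventually_elim (simp add: indicator_def nn_integral_multc)
  qed
  also have "\<dots> = (\<integral>\<^sup>+k. (\<integral>\<^sup>+x. F (x + k) * indicator half_cube x \<partial>lborel) \<partial>count_space lattice)"
    by (rule nn_integral_count_space_nn_integral) auto
  also have "\<dots> = (\<integral>\<^sup>+k. (\<integral>\<^sup>+x. F x * indicator half_cube (x - k) \<partial>lborel) \<partial>count_space lattice)"
  proof (rule nn_integral_cong)
    fix k :: "real^'d"
    have "(\<integral>\<^sup>+x. F (k + x) * indicator half_cube ((k + x) - k) \<partial>lborel) = (\<integral>\<^sup>+x. F x * indicator half_cube (x - k) \<partial>lborel)"
      by (rule nn_integral_translate) measurable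
    then show "(\<integral>\<^sup>+x. F (x + k) * indicator half_cube x \<partial>lborel) = (\<integral>\<^sup>+x. F x * indicator half_cube (x - k) \<partial>lborel)"
      by (simp add: add.commute)
  qed
  also have "\<dots> = (\<integral>\<^sup>+x. (\<integral>\<^sup>+k. F x * indicator half_cube (x - k) \<partial>count_space lattice) \<partial>lborel)"
    by (rule nn_integral_count_space_nn_integral[symmetric]) auto
  also have "\<dots> = (\<integral>\<^sup>+x. F x \<partial>lborel)"
    by (simp add: nn_integral_cmult one)
  finally show ?thesis ..
qed

definition fourier_integral :: "(real^'d \<Rightarrow> complex) \<Rightarrow> real^'d \<Rightarrow> complex" where
  "fourier_integral f \<xi> = (LINT x|lborel. f x * echar (- \<xi>) x)"

lemma fourier_integral_measurable [measurable]:
  assumes [measurable]: "f \<in> borel_measurable borel"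
  shows "fourier_integral f \<in> borel_measurable borel"
  unfolding fourier_integral_def[abs_def] by measurable

text \<open>Parseval for \<open>x \<mapsto> f x * echar (- \<theta>) x\<close> on the torus gives the values of the Fourier
  integral on \<open>\<theta> + \<int>\<^sup>d\<close>; averaging over \<open>\<theta>\<close> gives the Plancherel identity.\<close>

lemma plancherel_unit_cube:
  fixes f :: "real^'d \<Rightarrow> complex"
  assumes f[measurable]: "f \<in> borel_measurable borel" and fs: "f \<in> sq_int lborel"
    and supp: "\<And>x. x \<notin> unit_cube \<Longrightarrow> f x = 0"
  shows "(\<integral>\<^sup>+\<xi>. ennreal ((cmod (fourier_integral f \<xi>))\<^sup>2) \<partial>lborel) = (\<integral>\<^sup>+x. ennreal ((cmod (f x))\<^sup>2) \<partial>lborel)"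
proof -
  let ?C = "space_measure Torus :: (real^'d) measure"
  have C: "(\<integral>\<^sup>+x. ennreal ((cmod (f x))\<^sup>2) \<partial>?C) = (\<integral>\<^sup>+x. ennreal ((cmod (f x))\<^sup>2) \<partial>lborel)"
    unfolding space_measure.simps
    by (subst nn_integral_restrict_space) (auto intro!: nn_integral_cong simp: indicator_def supp)
  have fC: "(\<lambda>x. f x * echar (- \<theta>) x) \<in> sq_int ?C" for \<theta>
  proof (rule sq_intI_nn)
    show "(\<lambda>x. f x * echar (- \<theta>) x) \<in> borel_measurable ?C" by (rule measurable_torus) measurable
    show "(\<integral>\<^sup>+x. ennreal ((cmod (f x * echar (- \<theta>) x))\<^sup>2) \<partial>?C) < \<infinity>"
      using C nn_integral_sq_norm[OF fs] by (simp add: norm_mult del: space_measure.simps)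
  qed
  have eq: "fourier_integral f (\<theta> + k) = (LINT x|?C. (f x * echar (- \<theta>) x) * echar (- k) x)" for \<theta> k
  proof -
    have "(LINT x|?C. (f x * echar (- \<theta>) x) * echar (- k) x) = (LINT x|lborel. indicator unit_cube x *\<^sub>R ((f x * echar (- \<theta>) x) * echar (- k) x))"
      unfolding space_measure.simps by (rule integral_restrict_space) simp
    also have "\<dots> = fourier_integral f (\<theta> + k)" unfolding fourier_integral_def
      by (intro Bochner_Integration.integral_cong refl) (auto simp: indicator_def supp mult.assoc echar_add[symmetric] algebra_simps)
    finally show ?thesis ..
  qed
  have "(\<integral>\<^sup>+\<xi>. ennreal ((cmod (fourier_integral f \<xi>))\<^sup>2) \<partial>lborel)
      = (\<integral>\<^sup>+\<theta>. (\<integral>\<^sup>+k. ennreal ((cmod (fourier_integral f (\<theta> + k)))\<^sup>2) \<partial>count_space lattice) \<partial>?C)"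
    by (rule nn_integral_tiling) measurable
  also have "\<dots> = (\<integral>\<^sup>+\<theta>. (\<integral>\<^sup>+x. ennreal ((cmod (f x))\<^sup>2) \<partial>lborel) \<partial>?C)"
  proof (rule nn_integral_cong)
    fix \<theta> :: "real^'d"
    have "(\<integral>\<^sup>+k. ennreal ((cmod (fourier_integral f (\<theta> + k)))\<^sup>2) \<partial>count_space lattice)
        = (\<integral>\<^sup>+x. ennreal ((cmod (f x * echar (- \<theta>) x))\<^sup>2) \<partial>?C)"
      unfolding eq by (rule parseval_torus[OF _ fC]) measurable
    then show "(\<integral>\<^sup>+k. ennreal ((cmod (fourier_integral f (\<theta> + k)))\<^sup>2) \<partial>count_space lattice) = (\<integral>\<^sup>+x. ennreal ((cmod (f x))\<^sup>2) \<partial>lborel)"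
      using C by (simp add: norm_mult del: space_measure.simps)
  qed
  also have "\<dots> = (\<integral>\<^sup>+x. ennreal ((cmod (f x))\<^sup>2) \<partial>lborel)"
    by (simp add: emeasure_restrict_space space_restrict_space emeasure_unit_cube)
  finally show ?thesis .
qed

declare space_measure.simps [simp del] freq_measure.simps [simp del] fourier.simps [simp del]

lemma nn_integral_affine:
  fixes h :: "'a::euclidean_space \<Rightarrow> ennreal"
  assumes [measurable]: "h \<in> borel_measurable borel" and c: "c \<noteq> 0"
  shows "(\<integral>\<^sup>+x. h x \<partial>lborel) = ennreal (\<bar>c\<bar> ^ DIM('a)) * (\<integral>\<^sup>+x. h (t + c *\<^sub>R x) \<partial>lborel)"
proof -
  have "(\<integral>\<^sup>+x. h x \<partial>lborel) = (\<integral>\<^sup>+x. h x \<partial>density (distr lborel borel (\<lambda>x. t + c *\<^sub>R x)) (\<lambda>_. \<bar>c\<bar> ^ DIM('a)))"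
    by (simp only: lborel_affine[OF c, symmetric])
  also have "\<dots> = (\<integral>\<^sup>+x. ennreal (\<bar>c\<bar> ^ DIM('a)) * h x \<partial>distr lborel borel (\<lambda>x. t + c *\<^sub>R x))"
    by (subst nn_integral_density) auto
  also have "\<dots> = (\<integral>\<^sup>+x. ennreal (\<bar>c\<bar> ^ DIM('a)) * h (t + c *\<^sub>R x) \<partial>lborel)"
    by (subst nn_integral_distr) auto
  finally show ?thesis by (simp add: nn_integral_cmult)
qed

lemma lebesgue_integral_affine:
  fixes h :: "'a::euclidean_space \<Rightarrow> complex"
  assumes [measurable]: "h \<in> borel_measurable borel" and c: "c \<noteq> 0"
  shows "(LINT x|lborel. h x) = of_real (\<bar>c\<bar> ^ DIM('a)) * (LINT x|lborel. h (t + c *\<^sub>R x))"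
proof -
  have "(LINT x|lborel. h x) = (LINT x|density (distr lborel borel (\<lambda>x. t + c *\<^sub>R x)) (\<lambda>_. \<bar>c\<bar> ^ DIM('a)). h x)"
    by (simp only: lborel_affine[OF c, symmetric])
  also have "\<dots> = (LINT x|distr lborel borel (\<lambda>x. t + c *\<^sub>R x). (\<bar>c\<bar> ^ DIM('a)) *\<^sub>R h x)"
    by (rule integral_density) auto
  also have "\<dots> = (LINT x|lborel. (\<bar>c\<bar> ^ DIM('a)) *\<^sub>R h (t + c *\<^sub>R x))"
    by (rule integral_distr) auto
  finally show ?thesis by (simp add: scaleR_conv_of_real)
qed

text \<open>An affine map carries the unit cube onto a cube containing the support. The transform
  picks up the Jacobian K, hence K^2 after squaring: one factor is absorbed by the substitution in
  the frequency, the other by the one in x.\<close>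

lemma plancherel_bounded_support:
  fixes f :: "real^'d \<Rightarrow> complex"
  assumes fs: "f \<in> sq_int lborel" and R: "R > 0" and supp: "\<And>x. norm x > R \<Longrightarrow> f x = 0"
  shows "fourier_integral f \<in> sq_int lborel" "sq_norm lborel (fourier_integral f) = sq_norm lborel f"
proof -
  have f[measurable]: "f \<in> borel_measurable borel" using sq_int_measurable[OF fs] by simp
  define c where "c = 2 * R"
  define a where "a = (vec_lambda (\<lambda>_. - R) :: real^'d)"
  define g where "g x = f (a + c *\<^sub>R x)" for x
  have c: "c > 0" "c \<noteq> 0" using R by (auto simp: c_def)
  define K where "K = \<bar>c\<bar> ^ DIM(real^'d)"
  have K: "K > 0" using c by (simp add: K_def)
  have gm[measurable]: "g \<in> borel_measurable borel" unfolding g_def by measurable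
  have fg: "(\<integral>\<^sup>+x. ennreal ((cmod (f x))\<^sup>2) \<partial>lborel) = ennreal K * (\<integral>\<^sup>+x. ennreal ((cmod (g x))\<^sup>2) \<partial>lborel)"
    unfolding g_def K_def by (rule nn_integral_affine[OF _ c(2)]) measurable
  have gs: "g \<in> sq_int lborel"
  proof (rule sq_intI_nn)
    have "ennreal K * (\<integral>\<^sup>+x. ennreal ((cmod (g x))\<^sup>2) \<partial>lborel) < \<infinity>"
      unfolding fg[symmetric] nn_integral_sq_norm[OF fs] by simp
    then show "(\<integral>\<^sup>+x. ennreal ((cmod (g x))\<^sup>2) \<partial>lborel) < \<infinity>"
      using K by (auto simp: ennreal_mult_less_top)
  qed simp
  have "g x = 0" if x: "x \<notin> unit_cube" for x
  proof -
    obtain i where "vec_nth x i < 0 \<or> vec_nth x i > 1" using x by (auto simp: unit_cube_def not_le)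
    then have "R * vec_nth x i < R * 0 \<or> R * vec_nth x i > R * 1" using R by (auto simp: mult_less_0_iff)
    then have "\<bar>vec_nth (a + c *\<^sub>R x) i\<bar> > R" unfolding a_def c_def by auto
    then have "norm (a + c *\<^sub>R x) > R" using component_le_norm_cart[of "a + c *\<^sub>R x" i] by linarith
    then show ?thesis unfolding g_def by (rule supp)
  qed
  then have P: "(\<integral>\<^sup>+\<xi>. ennreal ((cmod (fourier_integral g \<xi>))\<^sup>2) \<partial>lborel) = (\<integral>\<^sup>+x. ennreal ((cmod (g x))\<^sup>2) \<partial>lborel)"
    by (rule plancherel_unit_cube[OF gm gs])
  have ft: "fourier_integral f \<xi> = of_real K * (echar (- \<xi>) a * fourier_integral g (0 + c *\<^sub>R \<xi>))" for \<xi>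
  proof -
    have "fourier_integral f \<xi> = of_real K * (LINT x|lborel. f (a + c *\<^sub>R x) * echar (- \<xi>) (a + c *\<^sub>R x))"
      unfolding fourier_integral_def K_def by (rule lebesgue_integral_affine[OF _ c(2)]) measurable
    also have "(LINT x|lborel. f (a + c *\<^sub>R x) * echar (- \<xi>) (a + c *\<^sub>R x)) = (LINT x|lborel. echar (- \<xi>) a * (g x * echar (- (0 + c *\<^sub>R \<xi>)) x))"
      by (intro Bochner_Integration.integral_cong refl) (simp add: g_def echar_add_right, simp add: echar_def)
    also have "\<dots> = echar (- \<xi>) a * fourier_integral g (0 + c *\<^sub>R \<xi>)" by (simp add: fourier_integral_def)
    finally show ?thesis .
  qed
  have "(\<integral>\<^sup>+\<xi>. ennreal ((cmod (fourier_integral f \<xi>))\<^sup>2) \<partial>lborel) = (\<integral>\<^sup>+\<xi>. ennreal K * (ennreal K * ennreal ((cmod (fourier_integral g (0 + c *\<^sub>R \<xi>)))\<^sup>2)) \<partial>lborel)"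
    using K by (simp only: ft) (simp add: norm_mult power_mult_distrib ennreal_mult power2_eq_square mult_ac)
  also have "\<dots> = ennreal K * (ennreal K * (\<integral>\<^sup>+\<xi>. ennreal ((cmod (fourier_integral g (0 + c *\<^sub>R \<xi>)))\<^sup>2) \<partial>lborel))"
    by (subst nn_integral_cmult; measurable)+
  also have "ennreal K * (\<integral>\<^sup>+\<xi>. ennreal ((cmod (fourier_integral g (0 + c *\<^sub>R \<xi>)))\<^sup>2) \<partial>lborel) = (\<integral>\<^sup>+\<xi>. ennreal ((cmod (fourier_integral g \<xi>))\<^sup>2) \<partial>lborel)"
    unfolding K_def by (rule nn_integral_affine[OF _ c(2), symmetric]) measurable
  finally have eq: "(\<integral>\<^sup>+\<xi>. ennreal ((cmod (fourier_integral f \<xi>))\<^sup>2) \<partial>lborel) = ennreal ((sq_norm lborel f)\<^sup>2)"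
    by (simp only: P fg[symmetric] nn_integral_sq_norm[OF fs])
  show fi: "fourier_integral f \<in> sq_int lborel" by (rule sq_intI_nn) (auto simp: eq)
  have "(sq_norm lborel (fourier_integral f))\<^sup>2 = (sq_norm lborel f)\<^sup>2" using eq unfolding nn_integral_sq_norm[OF fi] by simp
  then show "sq_norm lborel (fourier_integral f) = sq_norm lborel f" by (rule power2_eq_imp_eq) simp_all
qed

section \<open>From bounded support to all square integrable functions\<close>

definition trunc :: "nat \<Rightarrow> ('a::real_normed_vector \<Rightarrow> complex) \<Rightarrow> 'a \<Rightarrow> complex" where
  "trunc n f x = (if norm x \<le> real n then f x else 0)"

lemma trunc_sq_int:
  fixes f :: "'a::euclidean_space \<Rightarrow> complex"
  assumes "f \<in> sq_int lborel"
  shows "trunc n f \<in> sq_int lborel"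
proof (rule sq_norm_mono(1)[OF _ assms])
  have [measurable]: "f \<in> borel_measurable borel" using sq_int_measurable[OF assms] by simp
  show "trunc n f \<in> borel_measurable lborel" unfolding trunc_def[abs_def] by measurable
qed (simp add: trunc_def)

lemma trunc_integrable:
  fixes f :: "'a::euclidean_space \<Rightarrow> complex"
  assumes "f \<in> sq_int lborel"
  shows "integrable lborel (trunc n f)"
proof -
  have "(\<lambda>x. indicator (cball 0 (real n)) x) \<in> sq_int (lborel :: 'a measure)"
  proof (rule sq_intI_nn)
    have "(\<integral>\<^sup>+x. ennreal ((cmod (indicator (cball 0 (real n)) x))\<^sup>2) \<partial>(lborel :: 'a measure)) = (\<integral>\<^sup>+x. indicator (cball 0 (real n)) x \<partial>(lborel :: 'a measure))"
      by (intro nn_integral_cong) (simp add: indicator_def)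
    then show "(\<integral>\<^sup>+x. ennreal ((cmod (indicator (cball 0 (real n)) x))\<^sup>2) \<partial>(lborel :: 'a measure)) < \<infinity>"
      using emeasure_lborel_cball_finite[of "0::'a" "real n"] by simp
  qed (auto intro!: borel_measurable_indicator)
  note i = sq_int_mult_integrable[OF trunc_sq_int[OF assms, of n] this]
  have "(\<lambda>x. trunc n f x * indicator (cball 0 (real n)) x) = trunc n f"
    by (auto simp: fun_eq_iff trunc_def indicator_def)
  with i show ?thesis by simp
qed

lemma trunc_tendsto:
  fixes f :: "'a::euclidean_space \<Rightarrow> complex"
  assumes "f \<in> sq_int lborel"
  shows "(\<lambda>n. sq_norm lborel (\<lambda>x. trunc n f x - f x)) \<longlonglongrightarrow> 0"
proof -
  have [measurable]: "f \<in> borel_measurable borel" using sq_int_measurable[OF assms] by simp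
  have [measurable]: "trunc n f \<in> borel_measurable borel" for n unfolding trunc_def[abs_def] by measurable
  have "(\<lambda>n. LINT x|lborel. (cmod (trunc n f x - f x))\<^sup>2) \<longlonglongrightarrow> (LINT x|(lborel :: 'a measure). 0)"
  proof (rule integral_dominated_convergence[where w="\<lambda>x. (cmod (f x))\<^sup>2"])
    show "AE x in lborel. (\<lambda>n. (cmod (trunc n f x - f x))\<^sup>2) \<longlonglongrightarrow> 0"
    proof (rule AE_I2)
      fix x :: 'a
      obtain n0 where n0: "norm x \<le> real n0" using real_arch_simple by blast
      have "\<forall>n\<ge>n0. (cmod (trunc n f x - f x))\<^sup>2 = 0" using n0 by (auto simp: trunc_def)
      then show "(\<lambda>n. (cmod (trunc n f x - f x))\<^sup>2) \<longlonglongrightarrow> 0"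
        by (intro tendsto_eventually) (auto simp: eventually_sequentially)
    qed
  qed (use sq_int_integrable[OF assms] in \<open>auto simp: trunc_def\<close>)
  from tendsto_real_sqrt[OF this] show ?thesis by (simp add: sq_norm_def)
qed

lemma fourier_integral_trunc:
  "(LINT x:cball 0 (real n)|lborel. f x * cis (- 2 * pi * inner \<xi> x)) = fourier_integral (trunc n f) \<xi>"
  unfolding set_lebesgue_integral_def fourier_integral_def echar_minus_eq
  by (intro Bochner_Integration.integral_cong refl) (auto simp: trunc_def indicator_def)

lemma fourier_integral_integrable:
  fixes f :: "real^'d \<Rightarrow> complex"
  assumes "integrable lborel f"
  shows "integrable lborel (\<lambda>x. f x * echar (- \<xi>) x)"
proof (rule Bochner_Integration.integrable_bound[OF assms])
  have [measurable]: "f \<in> borel_measurable borel" using borel_measurable_integrable[OF assms] by simp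
  show "(\<lambda>x. f x * echar (- \<xi>) x) \<in> borel_measurable lborel" by measurable
qed (simp add: norm_mult)

lemma fourier_integral_diff:
  assumes "integrable lborel f" "integrable lborel g"
  shows "fourier_integral (\<lambda>x. f x - g x) \<xi> = fourier_integral f \<xi> - fourier_integral g \<xi>"
  using assms[THEN fourier_integral_integrable] by (simp add: fourier_integral_def left_diff_distrib)

lemma fourier_integral_trunc_isometry:
  assumes "f \<in> sq_int lborel" "\<And>x. norm x > real n \<Longrightarrow> f x = 0"
  shows "fourier_integral f \<in> sq_int lborel" "sq_norm lborel (fourier_integral f) = sq_norm lborel f"
  using plancherel_bounded_support[OF assms(1), of "real n + 1"] assms(2) by auto

lemma fourier_integral_trunc_sq:
  "f \<in> sq_int lborel \<Longrightarrow> fourier_integral (trunc n f) \<in> sq_int lborel"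
  by (rule fourier_integral_trunc_isometry(1)[OF trunc_sq_int, where n=n]) (simp_all add: trunc_def)

text \<open>Restates the limit of extended nonnegative integrals as convergence of
  \<open>sq_norm\<close>, to which the completeness theorem applies.\<close>

lemma plancherel_iff:
  assumes f: "f \<in> sq_int lborel"
  shows "plancherel f g \<longleftrightarrow> g \<in> sq_int lborel \<and>
    (\<lambda>n. sq_norm lborel (\<lambda>\<xi>. fourier_integral (trunc n f) \<xi> - g \<xi>)) \<longlonglongrightarrow> 0"
proof -
  have "((\<lambda>n. \<integral>\<^sup>+\<xi>. ennreal ((cmod (g \<xi> - fourier_integral (trunc n f) \<xi>))\<^sup>2) \<partial>lborel) \<longlonglongrightarrow> 0)
    \<longleftrightarrow> (\<lambda>n. sq_norm lborel (\<lambda>\<xi>. fourier_integral (trunc n f) \<xi> - g \<xi>)) \<longlonglongrightarrow> 0" if g: "g \<in> sq_int lborel"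
  proof -
    define a where "a n = sq_norm lborel (\<lambda>\<xi>. fourier_integral (trunc n f) \<xi> - g \<xi>)" for n
    have "(\<integral>\<^sup>+\<xi>. ennreal ((cmod (g \<xi> - fourier_integral (trunc n f) \<xi>))\<^sup>2) \<partial>lborel) = ennreal ((a n)\<^sup>2)" for n
      using nn_integral_sq_norm[OF sq_int_diff(1)[OF g fourier_integral_trunc_sq[OF f]]]
      by (simp add: a_def sq_norm_minus_commute)
    then have "((\<lambda>n. \<integral>\<^sup>+\<xi>. ennreal ((cmod (g \<xi> - fourier_integral (trunc n f) \<xi>))\<^sup>2) \<partial>lborel) \<longlonglongrightarrow> 0)
      \<longleftrightarrow> (\<lambda>n. (a n)\<^sup>2) \<longlonglongrightarrow> 0"
      using tendsto_ennreal_iff[of "\<lambda>n. (a n)\<^sup>2" sequentially 0] by simp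
    also have "\<dots> \<longleftrightarrow> a \<longlonglongrightarrow> 0"
    proof
      assume "(\<lambda>n. (a n)\<^sup>2) \<longlonglongrightarrow> 0"
      moreover have "\<bar>a n\<bar> = a n" for n by (simp add: a_def)
      ultimately show "a \<longlonglongrightarrow> 0" using tendsto_real_sqrt[of "\<lambda>n. (a n)\<^sup>2" 0 sequentially] by simp
    next
      assume "a \<longlonglongrightarrow> 0"
      from tendsto_power[OF this, of 2] show "(\<lambda>n. (a n)\<^sup>2) \<longlonglongrightarrow> 0" by simp
    qed
    finally show ?thesis unfolding a_def .
  qed
  then show ?thesis unfolding plancherel_def fourier_integral_trunc sq_int_def[of lborel] by auto
qed

text \<open>This gives content to the choice in \<open>fourier Whole\<close>: differences of
  truncations have bounded support, so their transforms have the same norm and the sequence of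
  transforms is Cauchy.\<close>

lemma fourier_whole:
  assumes f: "f \<in> sq_int lborel"
  shows "fourier Whole f \<in> sq_int lborel"
    "(\<lambda>n. sq_norm lborel (\<lambda>\<xi>. fourier_integral (trunc n f) \<xi> - fourier Whole f \<xi>)) \<longlonglongrightarrow> 0"
proof -
  have d: "sq_norm lborel (\<lambda>\<xi>. fourier_integral (trunc m f) \<xi> - fourier_integral (trunc n f) \<xi>)
      = sq_norm lborel (\<lambda>x. trunc m f x - trunc n f x)" for m n
  proof -
    have "(\<lambda>\<xi>. fourier_integral (trunc m f) \<xi> - fourier_integral (trunc n f) \<xi>) = fourier_integral (\<lambda>x. trunc m f x - trunc n f x)"
      using fourier_integral_diff[OF trunc_integrable[OF f] trunc_integrable[OF f]] by auto
    moreover have "sq_norm lborel (fourier_integral (\<lambda>x. trunc m f x - trunc n f x)) = sq_norm lborel (\<lambda>x. trunc m f x - trunc n f x)"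
    proof (rule fourier_integral_trunc_isometry(2)[where n="max m n"])
      show "(\<lambda>x. trunc m f x - trunc n f x) \<in> sq_int lborel" by (intro sq_int_diff(1) trunc_sq_int f)
    qed (auto simp: trunc_def)
    ultimately show ?thesis by simp
  qed
  have "\<exists>g\<in>sq_int lborel. (\<lambda>n. sq_norm lborel (\<lambda>\<xi>. fourier_integral (trunc n f) \<xi> - g \<xi>)) \<longlonglongrightarrow> 0"
  proof (rule sq_int_complete)
    show "fourier_integral (trunc n f) \<in> sq_int lborel" for n by (rule fourier_integral_trunc_sq[OF f])
    fix e :: real assume "e > 0"
    then obtain n0 where n0: "\<And>n. n \<ge> n0 \<Longrightarrow> sq_norm lborel (\<lambda>x. trunc n f x - f x) < e / 2"
      using LIMSEQ_D[OF trunc_tendsto[OF f], of "e/2"] by auto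
    have "sq_norm lborel (\<lambda>\<xi>. fourier_integral (trunc m f) \<xi> - fourier_integral (trunc n f) \<xi>) < e" if "m \<ge> n0" "n \<ge> n0" for m n
      unfolding d using sq_norm_triangle_diff[OF trunc_sq_int[OF f, of m] f trunc_sq_int[OF f, of n]]
        n0[OF that(1)] n0[OF that(2)] sq_norm_minus_commute[of lborel f "trunc n f"] by linarith
    then show "\<exists>n0. \<forall>m\<ge>n0. \<forall>n\<ge>n0. sq_norm lborel (\<lambda>\<xi>. fourier_integral (trunc m f) \<xi> - fourier_integral (trunc n f) \<xi>) < e" by blast
  qed
  then have "\<exists>g. plancherel f g" using plancherel_iff[OF f] by blast
  then have "plancherel f (fourier Whole f)" unfolding fourier.simps by (rule someI_ex)
  then show "fourier Whole f \<in> sq_int lborel"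
    "(\<lambda>n. sq_norm lborel (\<lambda>\<xi>. fourier_integral (trunc n f) \<xi> - fourier Whole f \<xi>)) \<longlonglongrightarrow> 0"
    unfolding plancherel_iff[OF f] by auto
qed

lemma sq_norm_LIMSEQ:
  assumes "\<And>n. f n \<in> sq_int M" "g \<in> sq_int M" "(\<lambda>n. sq_norm M (\<lambda>x. f n x - g x)) \<longlonglongrightarrow> 0"
  shows "(\<lambda>n. sq_norm M (f n)) \<longlonglongrightarrow> sq_norm M g"
proof -
  have "(\<lambda>n. sq_norm M (f n) - sq_norm M g) \<longlonglongrightarrow> 0"
    by (rule Lim_null_comparison[OF _ assms(3)]) (use sq_norm_diff_le[OF assms(1,2)] in auto)
  then show ?thesis by (simp add: LIM_zero_iff)
qed

lemma sq_norm_limits_eq: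
  assumes f: "\<And>n. f n \<in> sq_int M" and g: "g \<in> sq_int M" "g' \<in> sq_int M"
    and "(\<lambda>n. sq_norm M (\<lambda>x. f n x - g x)) \<longlonglongrightarrow> 0" "(\<lambda>n. sq_norm M (\<lambda>x. f n x - g' x)) \<longlonglongrightarrow> 0"
  shows "AE x in M. g x = g' x"
proof -
  have "sq_norm M (\<lambda>x. g x - g' x) \<le> sq_norm M (\<lambda>x. f n x - g x) + sq_norm M (\<lambda>x. f n x - g' x)" for n
    using sq_norm_triangle_diff[OF g(1) f[of n] g(2)] sq_norm_minus_commute[of M g "f n"] by linarith
  moreover have "(\<lambda>n. sq_norm M (\<lambda>x. f n x - g x) + sq_norm M (\<lambda>x. f n x - g' x)) \<longlonglongrightarrow> 0 + 0"
    by (intro tendsto_add assms)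
  ultimately have "sq_norm M (\<lambda>x. g x - g' x) \<le> 0 + 0"
    by (intro LIMSEQ_le_const) auto
  then have "sq_norm M (\<lambda>x. g x - g' x) = 0" using sq_norm_nonneg[of M "\<lambda>x. g x - g' x"] by linarith
  then show ?thesis using sq_norm_eq_0_iff[OF sq_int_diff(1)[OF g]] by simp
qed

theorem fourier_whole_isometry:
  assumes f: "f \<in> sq_int lborel"
  shows "sq_norm lborel (fourier Whole f) = sq_norm lborel f"
proof -
  have "(\<lambda>n. sq_norm lborel (fourier_integral (trunc n f))) \<longlonglongrightarrow> sq_norm lborel (fourier Whole f)"
    by (rule sq_norm_LIMSEQ[OF fourier_integral_trunc_sq[OF f] fourier_whole[OF f]])
  moreover have "sq_norm lborel (fourier_integral (trunc n f)) = sq_norm lborel (trunc n f)" for n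
    by (rule fourier_integral_trunc_isometry(2)[OF trunc_sq_int[OF f], where n=n]) (simp add: trunc_def)
  moreover have "(\<lambda>n. sq_norm lborel (trunc n f)) \<longlonglongrightarrow> sq_norm lborel f"
    by (rule sq_norm_LIMSEQ[OF trunc_sq_int[OF f] f trunc_tendsto[OF f]])
  ultimately show ?thesis using LIMSEQ_unique by auto
qed

lemma fourier_whole_linear:
  fixes f g :: "real^'d \<Rightarrow> complex"
  assumes f: "f \<in> sq_int lborel" and g: "g \<in> sq_int lborel"
  shows "AE \<xi> in lborel. fourier Whole (\<lambda>x. a * f x + b * g x) \<xi> = a * fourier Whole f \<xi> + b * fourier Whole g \<xi>"
proof -
  define h where "h = (\<lambda>x. a * f x + b * g x)"
  have h: "h \<in> sq_int lborel" unfolding h_def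
    by (intro sq_int_add(1) sq_int_cmult(1) f g)
  have eq: "fourier_integral (trunc n h) \<xi> = a * fourier_integral (trunc n f) \<xi> + b * fourier_integral (trunc n g) \<xi>" for n \<xi>
  proof -
    have "fourier_integral (trunc n h) \<xi> = (LINT x|lborel. a * (trunc n f x * echar (- \<xi>) x) + b * (trunc n g x * echar (- \<xi>) x))"
      unfolding fourier_integral_def by (intro Bochner_Integration.integral_cong refl) (simp add: h_def trunc_def algebra_simps)
    then show ?thesis using fourier_integral_integrable[OF trunc_integrable[OF f]] fourier_integral_integrable[OF trunc_integrable[OF g]]
      by (simp add: fourier_integral_def)
  qed
  let ?G = "\<lambda>\<xi>. a * fourier Whole f \<xi> + b * fourier Whole g \<xi>"
  let ?df = "\<lambda>n \<xi>. fourier_integral (trunc n f) \<xi> - fourier Whole f \<xi>" and ?dg = "\<lambda>n \<xi>. fourier_integral (trunc n g) \<xi> - fourier Whole g \<xi>"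
  have df: "?df n \<in> sq_int lborel" for n by (intro sq_int_diff(1) fourier_integral_trunc_sq fourier_whole(1) f)
  have dg: "?dg n \<in> sq_int lborel" for n by (intro sq_int_diff(1) fourier_integral_trunc_sq fourier_whole(1) g)
  have G: "?G \<in> sq_int lborel" by (intro sq_int_add(1) sq_int_cmult(1) fourier_whole(1) f g)
  have "(\<lambda>n. sq_norm lborel (\<lambda>\<xi>. fourier_integral (trunc n h) \<xi> - ?G \<xi>)) \<longlonglongrightarrow> 0"
  proof (rule Lim_null_comparison)
    have "sq_norm lborel (\<lambda>\<xi>. fourier_integral (trunc n h) \<xi> - ?G \<xi>) \<le> cmod a * sq_norm lborel (?df n) + cmod b * sq_norm lborel (?dg n)" for n
    proof -
      have "(\<lambda>\<xi>. fourier_integral (trunc n h) \<xi> - ?G \<xi>) = (\<lambda>\<xi>. a * ?df n \<xi> + b * ?dg n \<xi>)"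
        by (simp add: eq algebra_simps)
      then show ?thesis using sq_int_add(2)[OF sq_int_cmult(1)[OF df] sq_int_cmult(1)[OF dg], of a n b n]
        by (simp add: sq_int_cmult(2)[OF df] sq_int_cmult(2)[OF dg])
    qed
    then show "\<forall>\<^sub>F n in sequentially. norm (sq_norm lborel (\<lambda>\<xi>. fourier_integral (trunc n h) \<xi> - ?G \<xi>))
        \<le> cmod a * sq_norm lborel (?df n) + cmod b * sq_norm lborel (?dg n)" by simp
    show "(\<lambda>n. cmod a * sq_norm lborel (?df n) + cmod b * sq_norm lborel (?dg n)) \<longlonglongrightarrow> 0"
      using tendsto_add[OF tendsto_mult_left[OF fourier_whole(2)[OF f], of "cmod a"] tendsto_mult_left[OF fourier_whole(2)[OF g], of "cmod b"]] by simp
  qed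
  from sq_norm_limits_eq[OF fourier_integral_trunc_sq[OF h] fourier_whole(1)[OF h] G fourier_whole(2)[OF h] this]
  show ?thesis unfolding h_def .
qed

lemma fourier_whole_cong_AE:
  assumes f: "f \<in> sq_int lborel" and g: "g \<in> sq_int lborel" and fg: "AE x in lborel. f x = g x"
  shows "AE \<xi> in lborel. fourier Whole f \<xi> = fourier Whole g \<xi>"
proof -
  have d: "(\<lambda>x. 1 * f x + (-1) * g x) \<in> sq_int lborel" by (intro sq_int_add(1) sq_int_cmult(1) f g)
  have "sq_norm lborel (\<lambda>x. 1 * f x + (-1) * g x) = 0"
    unfolding sq_norm_eq_0_iff[OF d] using fg by eventually_elim simp
  then have "AE \<xi> in lborel. fourier Whole (\<lambda>x. 1 * f x + (-1) * g x) \<xi> = 0"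
    using sq_norm_eq_0_iff[OF fourier_whole(1)[OF d]] fourier_whole_isometry[OF d] by simp
  with fourier_whole_linear[OF f g, of 1 "-1"] show ?thesis by eventually_elim simp
qed

text \<open>Dominated convergence gives the limit of the truncated transforms at every frequency,
  the definition of the transform gives their limit in L2, and the two must agree.\<close>

lemma fourier_whole_integrable:
  fixes f :: "real^'d \<Rightarrow> complex"
  assumes f: "f \<in> sq_int lborel" and fi: "integrable lborel f"
  shows "AE \<xi> in lborel. fourier_integral f \<xi> = fourier Whole f \<xi>"
proof (rule sq_norm_limit_unique[OF fourier_integral_trunc_sq[OF f] fourier_whole(1)[OF f] _ fourier_whole(2)[OF f]])
  have fm[measurable]: "f \<in> borel_measurable borel" using sq_int_measurable[OF f] by simp
  show "fourier_integral f \<in> borel_measurable lborel" by simp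
  have "(\<lambda>n. fourier_integral (trunc n f) \<xi>) \<longlonglongrightarrow> fourier_integral f \<xi>" for \<xi>
    unfolding fourier_integral_def
  proof (rule integral_dominated_convergence[where w="\<lambda>x. cmod (f x)"])
    show "AE x in lborel. (\<lambda>n. trunc n f x * echar (- \<xi>) x) \<longlonglongrightarrow> f x * echar (- \<xi>) x"
    proof (rule AE_I2)
      fix x :: "real^'d"
      obtain n0 where n0: "norm x \<le> real n0" using real_arch_simple by blast
      have "\<forall>n\<ge>n0. trunc n f x * echar (- \<xi>) x = f x * echar (- \<xi>) x" using n0 by (auto simp: trunc_def)
      then show "(\<lambda>n. trunc n f x * echar (- \<xi>) x) \<longlonglongrightarrow> f x * echar (- \<xi>) x"
        by (intro tendsto_eventually) (auto simp: eventually_sequentially)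
    qed
    show "(\<lambda>x. trunc n f x * echar (- \<xi>) x) \<in> borel_measurable lborel" for n
      unfolding trunc_def[abs_def] by measurable
  qed (use fi in \<open>auto simp: trunc_def norm_mult\<close>)
  then show "AE \<xi> in lborel. (\<lambda>n. fourier_integral (trunc n f) \<xi>) \<longlonglongrightarrow> fourier_integral f \<xi>" by simp
qed

section \<open>Multiplication formula, inversion and synthesis\<close>

lemma integral_mult_LIMSEQ:
  assumes f: "\<And>n. f n \<in> sq_int M" "f' \<in> sq_int M" "(\<lambda>n. sq_norm M (\<lambda>x. f n x - f' x)) \<longlonglongrightarrow> 0"
    and g: "\<And>n. g n \<in> sq_int M" "g' \<in> sq_int M" "(\<lambda>n. sq_norm M (\<lambda>x. g n x - g' x)) \<longlonglongrightarrow> 0"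
  shows "(\<lambda>n. LINT x|M. f n x * g n x) \<longlonglongrightarrow> (LINT x|M. f' x * g' x)"
proof (rule LIM_zero_cancel, rule Lim_null_comparison)
  have df: "(\<lambda>x. f n x - f' x) \<in> sq_int M" for n by (rule sq_int_diff(1)[OF f(1,2)])
  have dg: "(\<lambda>x. g n x - g' x) \<in> sq_int M" for n by (rule sq_int_diff(1)[OF g(1,2)])
  have "norm ((LINT x|M. f n x * g n x) - (LINT x|M. f' x * g' x))
      \<le> sq_norm M (\<lambda>x. f n x - f' x) * sq_norm M (g n) + sq_norm M f' * sq_norm M (\<lambda>x. g n x - g' x)" for n
  proof -
    have "(LINT x|M. f n x * g n x) - (LINT x|M. f' x * g' x) = (LINT x|M. f n x * g n x - f' x * g' x)"
      by (intro Bochner_Integration.integral_diff[symmetric] sq_int_mult_integrable f g)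
    also have "\<dots> = (LINT x|M. (f n x - f' x) * g n x + f' x * (g n x - g' x))"
      by (intro Bochner_Integration.integral_cong refl) (simp add: algebra_simps)
    also have "\<dots> = (LINT x|M. (f n x - f' x) * g n x) + (LINT x|M. f' x * (g n x - g' x))"
      by (intro Bochner_Integration.integral_add sq_int_mult_integrable df dg f g)
    also have "norm \<dots> \<le> sq_norm M (\<lambda>x. f n x - f' x) * sq_norm M (g n) + sq_norm M f' * sq_norm M (\<lambda>x. g n x - g' x)"
      by (rule order_trans[OF norm_triangle_ineq add_mono[OF integral_mult_le[OF df g(1)] integral_mult_le[OF f(2) dg]]])
    finally show ?thesis .
  qed
  then show "\<forall>\<^sub>F n in sequentially. norm ((LINT x|M. f n x * g n x) - (LINT x|M. f' x * g' x))
      \<le> sq_norm M (\<lambda>x. f n x - f' x) * sq_norm M (g n) + sq_norm M f' * sq_norm M (\<lambda>x. g n x - g' x)" by simp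
  show "(\<lambda>n. sq_norm M (\<lambda>x. f n x - f' x) * sq_norm M (g n) + sq_norm M f' * sq_norm M (\<lambda>x. g n x - g' x)) \<longlonglongrightarrow> 0"
    using tendsto_add[OF tendsto_mult[OF f(3) sq_norm_LIMSEQ[OF g]] tendsto_mult_left[OF g(3), of "sq_norm M f'"]] by simp
qed

text \<open>Fubini and the symmetry of the kernel in its two variables. Integrability of both
  functions makes the double integral absolutely convergent; the square integrable case follows by
  truncation.\<close>

lemma fourier_integral_multiplication:
  fixes f g :: "real^'d \<Rightarrow> complex"
  assumes f: "integrable lborel f" and g: "integrable lborel g"
  shows "(LINT x|lborel. fourier_integral f x * g x) = (LINT x|lborel. f x * fourier_integral g x)"
proof -
  have [measurable]: "f \<in> borel_measurable borel" "g \<in> borel_measurable borel"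
    using borel_measurable_integrable[OF f] borel_measurable_integrable[OF g] by auto
  have i: "integrable (lborel \<Otimes>\<^sub>M lborel) (\<lambda>(x, y). f x * g y * echar (- x) y)"
  proof (rule Bochner_Integration.integrable_bound)
    show "integrable (lborel \<Otimes>\<^sub>M lborel) (\<lambda>(x, y). f x * g y)"
    proof (rule lborel_pair.Fubini_integrable)
      show "integrable lborel (\<lambda>x. LINT y|lborel. norm (case (x, y) of (x, y) \<Rightarrow> f x * g y))"
        using f by (simp add: norm_mult)
    qed (use g in auto)
  qed (auto simp: norm_mult)
  have "(LINT x|lborel. f x * fourier_integral g x) = (LINT x|lborel. (LINT y|lborel. f x * g y * echar (- x) y))"
    by (simp add: fourier_integral_def mult.assoc)
  also have "\<dots> = (LINT y|lborel. (LINT x|lborel. f x * g y * echar (- x) y))"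
    by (rule lborel_pair.Fubini_integral[OF i, symmetric])
  also have "\<dots> = (LINT y|lborel. (LINT x|lborel. g y * (f x * echar (- y) x)))"
    by (intro Bochner_Integration.integral_cong refl) (simp add: echar_def inner_commute mult_ac)
  also have "\<dots> = (LINT y|lborel. fourier_integral f y * g y)"
    by (simp add: fourier_integral_def mult.commute)
  finally show ?thesis ..
qed

lemma fourier_whole_multiplication:
  assumes f: "f \<in> sq_int lborel" and g: "g \<in> sq_int lborel"
  shows "(LINT x|lborel. fourier Whole f x * g x) = (LINT x|lborel. f x * fourier Whole g x)"
proof -
  have 1: "(\<lambda>n. LINT x|lborel. fourier_integral (trunc n f) x * trunc n g x) \<longlonglongrightarrow> (LINT x|lborel. fourier Whole f x * g x)"
    by (rule integral_mult_LIMSEQ[OF fourier_integral_trunc_sq[OF f] fourier_whole[OF f] trunc_sq_int[OF g] g trunc_tendsto[OF g]])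
  have 2: "(\<lambda>n. LINT x|lborel. trunc n f x * fourier_integral (trunc n g) x) \<longlonglongrightarrow> (LINT x|lborel. f x * fourier Whole g x)"
    by (rule integral_mult_LIMSEQ[OF trunc_sq_int[OF f] f trunc_tendsto[OF f] fourier_integral_trunc_sq[OF g] fourier_whole[OF g]])
  show ?thesis using LIMSEQ_unique[OF 1] 2
    unfolding fourier_integral_multiplication[OF trunc_integrable[OF f] trunc_integrable[OF g]] by simp
qed

text \<open>The adjoint of the isometry \<open>F\<close> is its conjugate \<open>F*\<close>, again an isometry, so that
  \<open>\<parallel>F F* g - g\<parallel>\<^sup>2 = \<parallel>g\<parallel>\<^sup>2 - 2 \<parallel>F* g\<parallel>\<^sup>2 + \<parallel>g\<parallel>\<^sup>2 = 0\<close>.\<close>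

lemma fourier_whole_inversion:
  assumes g: "g \<in> sq_int lborel"
  shows "AE \<xi> in lborel. fourier Whole (\<lambda>x. cnj (fourier Whole (\<lambda>y. cnj (g y)) x)) \<xi> = g \<xi>"
proof -
  define G where "G x = cnj (fourier Whole (\<lambda>y. cnj (g y)) x)" for x
  have G: "G \<in> sq_int lborel" unfolding G_def[abs_def] by (intro sq_int_cnj fourier_whole(1) g)
  have nG: "sq_norm lborel G = sq_norm lborel g"
    unfolding G_def using fourier_whole_isometry[OF sq_int_cnj[OF g]] by simp
  have FG: "fourier Whole G \<in> sq_int lborel" by (rule fourier_whole(1)[OF G])
  have ip: "(LINT x|lborel. fourier Whole G x * cnj (g x)) = complex_of_real ((sq_norm lborel g)\<^sup>2)"
  proof -
    have "(LINT x|lborel. fourier Whole G x * cnj (g x)) = (LINT x|lborel. G x * fourier Whole (\<lambda>y. cnj (g y)) x)"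
      by (rule fourier_whole_multiplication[OF G sq_int_cnj[OF g]])
    also have "\<dots> = sq_inner lborel G G" by (simp add: sq_inner_def G_def)
    finally show ?thesis by (simp add: sq_inner_self nG)
  qed
  have i: "integrable lborel (\<lambda>x. fourier Whole G x * cnj (g x))" by (rule sq_inner_integrable[OF FG g])
  have pt: "(cmod (a - b))\<^sup>2 = (cmod a)\<^sup>2 + (cmod b)\<^sup>2 - 2 * Re (a * cnj b)" for a b
    unfolding cmod_power2 by (simp add: power2_eq_square algebra_simps)
  have "(sq_norm lborel (\<lambda>x. fourier Whole G x - g x))\<^sup>2
      = (LINT x|lborel. (cmod (fourier Whole G x))\<^sup>2 + (cmod (g x))\<^sup>2 - 2 * Re (fourier Whole G x * cnj (g x)))"
    unfolding sq_norm_power2 pt ..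
  also have "\<dots> = (sq_norm lborel (fourier Whole G))\<^sup>2 + (sq_norm lborel g)\<^sup>2 - 2 * Re (LINT x|lborel. fourier Whole G x * cnj (g x))"
    unfolding sq_norm_power2 integral_Re[OF i, symmetric]
    by (subst Bochner_Integration.integral_diff, intro Bochner_Integration.integrable_add sq_int_integrable FG g, intro integrable_mult_right integrable_Re i,
      subst Bochner_Integration.integral_add, intro sq_int_integrable FG, intro sq_int_integrable g, simp only: integral_mult_right_zero)
  also have "\<dots> = 0" unfolding ip fourier_whole_isometry[OF G] nG by simp
  finally have "sq_norm lborel (\<lambda>x. fourier Whole G x - g x) = 0" by simp
  then show ?thesis unfolding sq_norm_eq_0_iff[OF sq_int_diff(1)[OF FG g]] G_def by simp
qed

text \<open>The inverse Fourier integral of g is the conjugate of the Fourier integral of the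
  conjugate of g, which is how the inversion formula above is written.\<close>

lemma fourier_whole_synthesis:
  assumes g: "g \<in> sq_int lborel" and gi: "integrable lborel g"
  shows "(\<lambda>x. LINT \<xi>|lborel. g \<xi> * echar \<xi> x) \<in> sq_int lborel"
    "AE \<xi> in lborel. fourier Whole (\<lambda>x. LINT \<xi>|lborel. g \<xi> * echar \<xi> x) \<xi> = g \<xi>"
proof -
  let ?S = "\<lambda>x. LINT \<xi>|lborel. g \<xi> * echar \<xi> x" and ?cg = "\<lambda>y. cnj (g y)"
  have [measurable]: "g \<in> borel_measurable borel" using sq_int_measurable[OF g] by simp
  have ci: "integrable lborel ?cg" using gi by simp
  have S: "?S x = cnj (fourier_integral ?cg x)" for x
  proof -
    have "cnj (fourier_integral ?cg x) = (LINT \<xi>|lborel. cnj (cnj (g \<xi>) * echar (- x) \<xi>))"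
      unfolding fourier_integral_def by (rule Bochner_Integration.integral_cnj[symmetric])
    also have "\<dots> = ?S x" by (simp add: cnj_echar echar_commute[of x])
    finally show ?thesis ..
  qed
  have m: "?S \<in> borel_measurable lborel" by measurable
  have G: "(\<lambda>x. cnj (fourier Whole ?cg x)) \<in> sq_int lborel" by (intro sq_int_cnj fourier_whole(1) g)
  have ae: "AE x in lborel. ?S x = cnj (fourier Whole ?cg x)"
    using fourier_whole_integrable[OF sq_int_cnj[OF g] ci] unfolding S by eventually_elim simp
  show Ss: "?S \<in> sq_int lborel" using sq_int_cong_AE(1)[OF m sq_int_measurable[OF G] ae] G by blast
  show "AE \<xi> in lborel. fourier Whole ?S \<xi> = g \<xi>"
    using fourier_whole_cong_AE[OF Ss G ae] fourier_whole_inversion[OF g] by eventually_elim simp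
qed

section \<open>Frequency measures\<close>

lemma sigma_finite_freq: "sigma_finite_measure (freq_measure \<Omega> :: (real^'d) measure)"
  by (cases \<Omega>) (auto simp: freq_measure.simps sigma_finite_measure_count_space_countable sigma_finite_lborel)

lemma freq_ident_measurable [measurable]: "(\<lambda>x. x) \<in> measurable (freq_measure \<Omega>) (borel :: (real^'d) measure)"
  by (cases \<Omega>) (auto simp: freq_measure.simps)

lemma freq_borel_measurable: "f \<in> borel_measurable borel \<Longrightarrow> f \<in> borel_measurable (freq_measure \<Omega>)"
  using measurable_compose[OF freq_ident_measurable] by simp

lemma freq_diff_measurable: 
  "(\<lambda>p. fst p - snd p) \<in> measurable (freq_measure \<Omega> \<Otimes>\<^sub>M freq_measure \<Omega>) (freq_measure \<Omega> :: (real^'d) measure)"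
proof (cases \<Omega>)
  case Whole then show ?thesis by (simp add: freq_measure.simps)
next
  case Torus then show ?thesis
    by (auto simp: freq_measure.simps pair_measure_countable intro: lattice_diff)
qed

lemma freq_diff_measurable' [measurable (raw)]:
  assumes "f \<in> measurable M (freq_measure \<Omega>)" "g \<in> measurable M (freq_measure \<Omega> :: (real^'d) measure)"
  shows "(\<lambda>x. f x - g x) \<in> measurable M (freq_measure \<Omega>)"
  using measurable_compose[OF measurable_Pair[OF assms] freq_diff_measurable] by simp

text \<open>Invariance under reflections and translations holds for Lebesgue measure and for
  counting measure on the lattice alike, and lets the convolution estimates be proved for both
  domains at once.\<close>

lemma freq_reflect:
  assumes "\<eta> \<in> space (freq_measure \<Omega>)"
  shows "distr (freq_measure \<Omega>) (freq_measure \<Omega>) (\<lambda>\<xi>. \<eta> - \<xi>) = (freq_measure \<Omega> :: (real^'d) measure)"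
proof (cases \<Omega>)
  case Whole
  have "distr lborel lborel (\<lambda>\<xi>. \<eta> - \<xi>) = distr lborel borel (\<lambda>\<xi>. \<eta> + (-1) *\<^sub>R \<xi>)" by (rule distr_cong) auto
  also have "\<dots> = lborel" using lborel_affine[of "-1" \<eta>] by (simp add: density_1)
  finally show ?thesis using Whole by (simp add: freq_measure.simps)
next
  case Torus
  have "bij_betw (\<lambda>\<xi>. \<eta> - \<xi>) lattice lattice" using assms Torus
    by (intro bij_betw_byWitness[where f'="\<lambda>\<xi>. \<eta> - \<xi>"]) (auto simp: freq_measure.simps intro: lattice_diff)
  then show ?thesis using Torus by (simp add: freq_measure.simps distr_bij_count_space)
qed

lemma freq_translate:
  assumes "\<eta> \<in> space (freq_measure \<Omega>)"
  shows "distr (freq_measure \<Omega>) (freq_measure \<Omega>) (\<lambda>\<xi>. \<xi> - \<eta>) = (freq_measure \<Omega> :: (real^'d) measure)"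
proof (cases \<Omega>)
  case Whole
  have "distr lborel lborel (\<lambda>\<xi>. \<xi> - \<eta>) = distr lborel borel (\<lambda>\<xi>. (- \<eta>) + \<xi>)" by (rule distr_cong) auto
  also have "\<dots> = lborel" by (rule lborel_translate)
  finally show ?thesis using Whole by (simp add: freq_measure.simps)
next
  case Torus
  have "bij_betw (\<lambda>\<xi>. \<xi> - \<eta>) lattice lattice" using assms Torus
    by (intro bij_betw_byWitness[where f'="\<lambda>\<xi>. \<xi> + \<eta>"]) (auto simp: freq_measure.simps intro: lattice_diff lattice_add)
  then show ?thesis using Torus by (simp add: freq_measure.simps distr_bij_count_space)
qed

lemma freq_minus_const_measurable:
  assumes "\<eta> \<in> space (freq_measure \<Omega>)"
  shows "(\<lambda>\<xi>. \<eta> - \<xi>) \<in> measurable (freq_measure \<Omega>) (freq_measure \<Omega> :: (real^'d) measure)"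
    "(\<lambda>\<xi>. \<xi> - \<eta>) \<in> measurable (freq_measure \<Omega>) (freq_measure \<Omega> :: (real^'d) measure)"
  using assms by auto

lemma nn_integral_freq_reflect:
  assumes "\<eta> \<in> space (freq_measure \<Omega> :: (real^'d) measure)" "q \<in> borel_measurable (freq_measure \<Omega>)"
  shows "(\<integral>\<^sup>+\<xi>. q (\<eta> - \<xi>) \<partial>freq_measure \<Omega>) = (\<integral>\<^sup>+\<xi>. q \<xi> \<partial>freq_measure \<Omega>)"
  by (subst (2) freq_reflect[OF assms(1), symmetric], subst nn_integral_distr[OF freq_minus_const_measurable(1)[OF assms(1)]])
    (simp_all add: assms)

lemma nn_integral_freq_translate:
  assumes "\<eta> \<in> space (freq_measure \<Omega> :: (real^'d) measure)" "q \<in> borel_measurable (freq_measure \<Omega>)"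
  shows "(\<integral>\<^sup>+\<xi>. q (\<xi> - \<eta>) \<partial>freq_measure \<Omega>) = (\<integral>\<^sup>+\<xi>. q \<xi> \<partial>freq_measure \<Omega>)"
  by (subst (2) freq_translate[OF assms(1), symmetric], subst nn_integral_distr[OF freq_minus_const_measurable(2)[OF assms(1)]])
    (simp_all add: assms)

lemma integral_freq_translate:
  fixes q :: "real^'d \<Rightarrow> complex"
  assumes "\<eta> \<in> space (freq_measure \<Omega> :: (real^'d) measure)" "q \<in> borel_measurable (freq_measure \<Omega>)"
  shows "(LINT \<xi>|freq_measure \<Omega>. q (\<xi> - \<eta>)) = (LINT \<xi>|freq_measure \<Omega>. q \<xi>)"
  by (subst (2) freq_translate[OF assms(1), symmetric], subst integral_distr[OF freq_minus_const_measurable(2)[OF assms(1)]])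
    (simp_all add: assms)

text \<open>The constant 3 serves both cases: a cube of side 2 * 2^j contains the ball, and a ball
  contains at most (2 * 2^j + 1)^d lattice points.\<close>

lemma emeasure_freq_cball:
  "emeasure (freq_measure \<Omega>) (cball (0::real^'d) (2 ^ j) \<inter> space (freq_measure \<Omega>)) \<le> ennreal (3 ^ CARD('d) * (2 ^ j) ^ CARD('d))"
proof (cases \<Omega>)
  case Whole
  let ?c = "vec_lambda (\<lambda>_. 2 ^ j) :: real^'d"
  have "cball (0::real^'d) (2 ^ j) \<subseteq> cbox (- ?c) ?c"
  proof
    fix x :: "real^'d" assume "x \<in> cball 0 (2 ^ j)"
    then have "\<bar>vec_nth x i\<bar> \<le> 2 ^ j" for i using component_le_norm_cart[of x i] by simp
    then show "x \<in> cbox (- ?c) ?c" by (auto simp: mem_box_cart abs_le_iff minus_le_iff)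
  qed
  then have "emeasure lborel (cball (0::real^'d) (2 ^ j)) \<le> emeasure lborel (cbox (- ?c) ?c)"
    by (intro emeasure_mono) auto
  also have "\<dots> = ennreal (measure lborel (cbox (- ?c) ?c))"
    using emeasure_lborel_cbox_finite[of "- ?c" ?c] by (intro emeasure_eq_ennreal_measure) auto
  also have "measure lborel (cbox (- ?c) ?c) = (2 * 2 ^ j) ^ CARD('d)"
    by (subst content_cbox_cart) (auto simp: interval_ne_empty_cart order_trans[of "- (2 ^ j)" 0])
  also have "ennreal ((2 * 2 ^ j) ^ CARD('d)) \<le> ennreal ((3 * 2 ^ j) ^ CARD('d))"
    by (intro ennreal_leI power_mono) auto
  finally show ?thesis using Whole by (simp add: freq_measure.simps power_mult_distrib)
next
  case Torus
  have "real (card (lattice \<inter> cball (0::real^'d) (real (2^j)))) \<le> real ((2 * 2 ^ j + 1) ^ CARD('d))"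
    using lattice_cball(2)[of "2^j", where 'd='d] by (intro of_nat_mono)
  also have "\<dots> \<le> (3 * 2 ^ j) ^ CARD('d)" by (subst of_nat_power, intro power_mono) auto
  finally show ?thesis using Torus lattice_cball(1)[of "2^j", where 'd='d]
    by (simp add: freq_measure.simps emeasure_count_space Int_commute power_mult_distrib ennreal_leI flip: ennreal_of_nat_eq_real_of_nat)
qed

section \<open>Sobolev weights and weighted measures\<close>

definition sob_weight :: "real \<Rightarrow> real^'d \<Rightarrow> real" where
  "sob_weight \<tau> \<xi> = (1 + (norm \<xi>)\<^sup>2) powr \<tau>"

lemma sob_weight_pos [simp]: "0 < sob_weight \<tau> \<xi>"
proof -
  have "0 < 1 + (norm \<xi>)\<^sup>2" by (simp add: add_pos_nonneg)
  then show ?thesis unfolding sob_weight_def by simp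
qed

lemma sob_weight_nonneg [simp]: "0 \<le> sob_weight \<tau> \<xi>"
  by (rule less_imp_le) simp

lemma sob_weight_borel [measurable]: "sob_weight \<tau> \<in> borel_measurable borel"
  unfolding sob_weight_def[abs_def] by measurable

lemma sob_weight_mult: "sob_weight \<sigma> \<xi> * sob_weight \<tau> \<xi> = sob_weight (\<sigma> + \<tau>) \<xi>"
  by (simp add: sob_weight_def powr_add)

lemma sob_weight_0 [simp]: "sob_weight 0 \<xi> = 1"
  by (simp add: sob_weight_def add_nonneg_eq_0_iff)

lemma sob_weight_half: "(sob_weight (\<tau> / 2) \<xi>)\<^sup>2 = sob_weight \<tau> \<xi>"
  unfolding power2_eq_square sob_weight_mult by simp

lemma sob_weight_mono: "\<sigma> \<le> \<tau> \<Longrightarrow> sob_weight \<sigma> \<xi> \<le> sob_weight \<tau> \<xi>"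
  by (simp add: sob_weight_def powr_mono)

lemma ennreal_power2_le: "x\<^sup>2 \<le> (ennreal r)\<^sup>2 \<Longrightarrow> 0 \<le> r \<Longrightarrow> x \<le> ennreal r"
proof (cases x)
  case (real a)
  assume "x\<^sup>2 \<le> (ennreal r)\<^sup>2" "0 \<le> r"
  then have "a\<^sup>2 \<le> r\<^sup>2" using real by (simp add: ennreal_power)
  from power2_le_imp_le[OF this \<open>0 \<le> r\<close>] show ?thesis using real by (simp add: ennreal_leI)
next
  case top
  assume "x\<^sup>2 \<le> (ennreal r)\<^sup>2" "0 \<le> r"
  then show ?thesis using top by (simp add: ennreal_power top_unique)
qed

lemma le_suminf_ennreal: "F j \<le> (\<Sum>j. F j)" for F :: "nat \<Rightarrow> ennreal"
  using sum_le_suminf[of F "{j}"] by simp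

text \<open>Dyadic decomposition: the balls grow like 2^(jd) and the weight decays like 4^(-j
  \<sigma>), so the assumption \<sigma> > d/2 says exactly that the ratio \<open>q\<close> of the
  geometric series is below 1.\<close>

lemma sob_weight_integral_finite:
  assumes s: "\<sigma> > real CARD('d) / 2"
  shows "(\<integral>\<^sup>+\<xi>. ennreal (sob_weight (- \<sigma>) \<xi>) \<partial>(freq_measure \<Omega> :: (real^'d) measure)) < \<infinity>"
proof -
  let ?\<nu> = "freq_measure \<Omega> :: (real^'d) measure"
  \<comment> \<open>The factor 4^\<sigma> repairs an index shift: for minimal j > 0, the norm
    exceeds only 2^(j-1), so the weight is bounded with the exponent j - 1.\<close>
  define a where "a j = 4 powr \<sigma> * (4 powr - \<sigma>) ^ j" for j :: nat
  define B where "B j = cball (0::real^'d) (2 ^ j) \<inter> space ?\<nu>" for j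
  have s0: "\<sigma> > 0" using s by (rule le_less_trans[rotated]) simp
  have Bm[measurable]: "B j \<in> sets ?\<nu>" for j
    unfolding B_def using measurable_sets[OF freq_ident_measurable, of "cball 0 (2^j)" \<Omega>] by (simp add: vimage_def Int_def conj_commute)
  have pt: "ennreal (sob_weight (- \<sigma>) \<xi>) \<le> (\<Sum>j. ennreal (a j) * indicator (B j) \<xi>)" if \<xi>: "\<xi> \<in> space ?\<nu>" for \<xi>
  proof -
    obtain n where n: "norm \<xi> < 2 ^ n" using real_arch_pow[of 2 "norm \<xi>"] by auto
    define j where "j = (LEAST n. norm \<xi> \<le> 2 ^ n)"
    have j: "norm \<xi> \<le> 2 ^ j" unfolding j_def by (rule LeastI[of _ n]) (use n in simp)
    have "sob_weight (- \<sigma>) \<xi> \<le> a j"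
    proof (cases j)
      case 0
      have "sob_weight (- \<sigma>) \<xi> \<le> sob_weight 0 \<xi>" using s0 by (intro sob_weight_mono) simp
      also have "\<dots> \<le> 4 powr \<sigma>" using s0 by (simp add: ge_one_powr_ge_zero)
      finally show ?thesis using 0 by (simp add: a_def)
    next
      case (Suc i)
      have "\<not> norm \<xi> \<le> 2 ^ i" using not_less_Least[of i "\<lambda>n. norm \<xi> \<le> 2 ^ n"] Suc by (simp add: j_def)
      then have "(2 ^ i)\<^sup>2 \<le> (norm \<xi>)\<^sup>2" by (intro power_mono) auto
      then have "4 ^ i \<le> 1 + (norm \<xi>)\<^sup>2" by (simp add: power2_eq_square flip: power_mult_distrib)
      then have "sob_weight (- \<sigma>) \<xi> \<le> (4 ^ i) powr (- \<sigma>)" unfolding sob_weight_def using s0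
        by (intro powr_mono2') auto
      also have "\<dots> = (4 powr - \<sigma>) ^ i" by (simp add: powr_realpow[symmetric] powr_powr mult.commute)
      also have "\<dots> = a j" using Suc by (simp add: a_def powr_minus field_simps)
      finally show ?thesis .
    qed
    then have "ennreal (sob_weight (- \<sigma>) \<xi>) \<le> ennreal (a j) * indicator (B j) \<xi>"
      using j \<xi> by (simp add: B_def ennreal_leI)
    also have "\<dots> \<le> (\<Sum>j. ennreal (a j) * indicator (B j) \<xi>)" by (rule le_suminf_ennreal)
    finally show ?thesis .
  qed
  define q where "q = (4 powr - \<sigma>) * 2 ^ CARD('d)"
  have q: "0 \<le> q" "q < 1"
  proof -
    have "4 powr - \<sigma> < 4 powr - (real CARD('d) / 2)" using s by (intro powr_less_mono) auto
    also have "4 powr - (real CARD('d) / 2) = inverse (2 ^ CARD('d))"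
    proof -
      have "(4::real) powr (real CARD('d) / 2) = (4 powr (1/2)) powr real CARD('d)" by (simp add: powr_powr)
      also have "(4::real) powr (1/2) = 2" using powr_half_sqrt[of 4] by simp
      finally show ?thesis by (simp add: powr_minus powr_realpow)
    qed
    finally show "q < 1" by (simp add: q_def field_simps)
  qed (simp add: q_def)
  have "(\<integral>\<^sup>+\<xi>. ennreal (sob_weight (- \<sigma>) \<xi>) \<partial>?\<nu>) \<le> (\<integral>\<^sup>+\<xi>. (\<Sum>j. ennreal (a j) * indicator (B j) \<xi>) \<partial>?\<nu>)"
    by (intro nn_integral_mono pt)
  also have "\<dots> = (\<Sum>j. \<integral>\<^sup>+\<xi>. ennreal (a j) * indicator (B j) \<xi> \<partial>?\<nu>)"
    by (rule nn_integral_suminf) measurable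
  also have "\<dots> = (\<Sum>j. ennreal (a j) * emeasure ?\<nu> (B j))"
    by (simp add: nn_integral_cmult_indicator)
  also have "\<dots> \<le> (\<Sum>j. ennreal (4 powr \<sigma> * 3 ^ CARD('d) * q ^ j))"
  proof (intro suminf_le allI)
    fix j
    have "ennreal (a j) * emeasure ?\<nu> (B j) \<le> ennreal (a j) * ennreal (3 ^ CARD('d) * (2 ^ j) ^ CARD('d))"
      unfolding B_def by (intro mult_left_mono emeasure_freq_cball) simp
    also have "\<dots> = ennreal (4 powr \<sigma> * 3 ^ CARD('d) * q ^ j)"
      by (simp add: a_def q_def power_mult_distrib mult_ac flip: ennreal_mult power_mult)
    finally show "ennreal (a j) * emeasure ?\<nu> (B j) \<le> ennreal (4 powr \<sigma> * 3 ^ CARD('d) * q ^ j)" .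
  qed auto
  also have "\<dots> = ennreal (\<Sum>j. 4 powr \<sigma> * 3 ^ CARD('d) * q ^ j)"
    using q by (intro suminf_ennreal2 summable_mult summable_geometric) auto
  also have "\<dots> < \<infinity>" by simp
  finally show ?thesis .
qed

text \<open>With the weight inside the measure, every H^\<tau> norm becomes a plain
  \<open>sq_norm\<close>. As the weight is positive, the null sets are those of
  \<open>freq_measure\<close>.\<close>

definition sob_measure :: "domain \<Rightarrow> real \<Rightarrow> (real^'d) measure" where
  "sob_measure \<Omega> \<tau> = density (freq_measure \<Omega>) (\<lambda>\<xi>. ennreal (sob_weight \<tau> \<xi>))"

lemma sets_sob_measure [measurable_cong, simp]: "sets (sob_measure \<Omega> \<tau>) = sets (freq_measure \<Omega>)"
  by (simp add: sob_measure_def)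

lemma AE_sob_measure: "(AE \<xi> in sob_measure \<Omega> \<tau>. P \<xi>) \<longleftrightarrow> (AE \<xi> in freq_measure \<Omega>. P \<xi>)"
  unfolding sob_measure_def by (subst AE_density) auto

lemma sob_measurable: "f \<in> borel_measurable (sob_measure \<Omega> \<tau>) \<longleftrightarrow> f \<in> borel_measurable (freq_measure \<Omega>)"
  by (subst measurable_cong_sets[OF sets_sob_measure refl]) (rule refl)

lemma Hhat_sq_int: "Hhat \<Omega> \<tau> = sq_int (sob_measure \<Omega> \<tau>)"
proof -
  have "integrable (freq_measure \<Omega>) (\<lambda>\<xi>. (cmod (g \<xi>))\<^sup>2 * (1 + (norm \<xi>)\<^sup>2) powr \<tau>)
    \<longleftrightarrow> integrable (sob_measure \<Omega> \<tau>) (\<lambda>\<xi>. (cmod (g \<xi>))\<^sup>2)" if [measurable]: "g \<in> borel_measurable (freq_measure \<Omega>)" for g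
  proof -
    have "integrable (sob_measure \<Omega> \<tau>) (\<lambda>\<xi>. (cmod (g \<xi>))\<^sup>2) \<longleftrightarrow> integrable (freq_measure \<Omega>) (\<lambda>\<xi>. sob_weight \<tau> \<xi> *\<^sub>R (cmod (g \<xi>))\<^sup>2)"
      unfolding sob_measure_def by (rule integrable_density) auto
    then show ?thesis by (simp add: sob_weight_def mult.commute)
  qed
  then show ?thesis unfolding Hhat_def sq_int_def sob_measurable by blast
qed

lemma Hhat_norm_sq_norm: "g \<in> borel_measurable (freq_measure \<Omega>) \<Longrightarrow> Hhat_norm \<Omega> \<tau> g = sq_norm (sob_measure \<Omega> \<tau>) g"
proof -
  assume [measurable]: "g \<in> borel_measurable (freq_measure \<Omega>)"
  have "(LINT \<xi>|sob_measure \<Omega> \<tau>. (cmod (g \<xi>))\<^sup>2) = (LINT \<xi>|freq_measure \<Omega>. sob_weight \<tau> \<xi> *\<^sub>R (cmod (g \<xi>))\<^sup>2)"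
    unfolding sob_measure_def by (rule integral_density) auto
  then show ?thesis by (simp add: Hhat_norm_def sq_norm_def sob_weight_def mult.commute)
qed

lemma nn_integral_sob_measure:
  assumes [measurable]: "g \<in> borel_measurable (freq_measure \<Omega>)"
  shows "(\<integral>\<^sup>+\<xi>. ennreal ((cmod (g \<xi>))\<^sup>2) \<partial>sob_measure \<Omega> \<tau>)
    = (\<integral>\<^sup>+\<xi>. (ennreal (sob_weight (\<tau> / 2) \<xi> * cmod (g \<xi>)))\<^sup>2 \<partial>freq_measure \<Omega>)"
  unfolding sob_measure_def
  by (subst nn_integral_density) (auto intro!: nn_integral_cong simp: ennreal_power power_mult_distrib sob_weight_half ennreal_mult)

lemma sq_norm_sob_mono:
  assumes "\<sigma> \<le> \<tau>" "g \<in> sq_int (sob_measure \<Omega> \<tau>)"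
  shows "g \<in> sq_int (sob_measure \<Omega> \<sigma>)" "sq_norm (sob_measure \<Omega> \<sigma>) g \<le> sq_norm (sob_measure \<Omega> \<tau>) g"
proof -
  have [measurable]: "g \<in> borel_measurable (freq_measure \<Omega>)" using sq_int_measurable[OF assms(2)] by (simp add: sob_measurable)
  have gm: "g \<in> borel_measurable (sob_measure \<Omega> \<sigma>)" by simp
  have "(\<integral>\<^sup>+\<xi>. ennreal ((cmod (g \<xi>))\<^sup>2) \<partial>sob_measure \<Omega> \<sigma>) \<le> (\<integral>\<^sup>+\<xi>. ennreal ((cmod (g \<xi>))\<^sup>2) \<partial>sob_measure \<Omega> \<tau>)"
    unfolding sob_measure_def using sob_weight_mono[OF assms(1)]
    by (subst (1 2) nn_integral_density) (auto intro!: nn_integral_mono mult_right_mono ennreal_leI)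
  also have "\<dots> = ennreal ((sq_norm (sob_measure \<Omega> \<tau>) g)\<^sup>2)" by (rule nn_integral_sq_norm[OF assms(2)])
  finally have le: "(\<integral>\<^sup>+\<xi>. ennreal ((cmod (g \<xi>))\<^sup>2) \<partial>sob_measure \<Omega> \<sigma>) \<le> ennreal ((sq_norm (sob_measure \<Omega> \<tau>) g)\<^sup>2)" .
  show "g \<in> sq_int (sob_measure \<Omega> \<sigma>)" "sq_norm (sob_measure \<Omega> \<sigma>) g \<le> sq_norm (sob_measure \<Omega> \<tau>) g"
    by (rule sq_norm_le_nn(1)[OF gm le sq_norm_nonneg], rule sq_norm_le_nn(2)[OF gm le sq_norm_nonneg])
qed

lemma sob_measure_0: "sob_measure \<Omega> 0 = freq_measure \<Omega>"
  unfolding sob_measure_def by (simp add: density_1)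

text \<open>The Cauchy-Schwarz constant in the bound of the L1 norm of a transform by the H^\<sigma>
  norm: the L2 norm of the weight with exponent -\<sigma>/2.\<close>

definition sob_const :: "real \<Rightarrow> domain \<Rightarrow> 'd::finite itself \<Rightarrow> real" where
  "sob_const \<sigma> \<Omega> _ = sqrt (enn2real (\<integral>\<^sup>+\<xi>. ennreal (sob_weight (- \<sigma>) \<xi>) \<partial>(freq_measure \<Omega> :: (real^'d) measure)))"

lemma sob_const_nonneg: "0 \<le> sob_const \<sigma> \<Omega> TYPE('d::finite)"
  by (simp add: sob_const_def)

lemma Hhat_L1:
  fixes g :: "real^'d \<Rightarrow> complex"
  assumes s: "\<sigma> > real CARD('d) / 2" and g: "g \<in> sq_int (sob_measure \<Omega> \<sigma>)"
  shows "(\<integral>\<^sup>+\<xi>. ennreal (cmod (g \<xi>)) \<partial>freq_measure \<Omega>) \<le> ennreal (sob_const \<sigma> \<Omega> TYPE('d) * sq_norm (sob_measure \<Omega> \<sigma>) g)"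
proof -
  let ?\<nu> = "freq_measure \<Omega> :: (real^'d) measure"
  have [measurable]: "g \<in> borel_measurable ?\<nu>" using sq_int_measurable[OF g] by (simp add: sob_measurable)
  define I where "I = (\<integral>\<^sup>+\<xi>. ennreal (sob_weight (- \<sigma>) \<xi>) \<partial>?\<nu>)"
  have I: "I = ennreal ((sob_const \<sigma> \<Omega> TYPE('d))\<^sup>2)"
    using sob_weight_integral_finite[OF s, of \<Omega>] by (simp add: sob_const_def I_def)
  have "(\<integral>\<^sup>+\<xi>. ennreal (cmod (g \<xi>)) \<partial>?\<nu>)\<^sup>2 = (\<integral>\<^sup>+\<xi>. ennreal (sob_weight (- \<sigma> / 2) \<xi>) * ennreal (sob_weight (\<sigma> / 2) \<xi> * cmod (g \<xi>)) \<partial>?\<nu>)\<^sup>2"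
    by (intro arg_cong[where f="\<lambda>x. x\<^sup>2"] nn_integral_cong) (simp add: sob_weight_mult flip: ennreal_mult mult.assoc)
  also have "\<dots> \<le> (\<integral>\<^sup>+\<xi>. (ennreal (sob_weight (- \<sigma> / 2) \<xi>))\<^sup>2 \<partial>?\<nu>) * (\<integral>\<^sup>+\<xi>. (ennreal (sob_weight (\<sigma> / 2) \<xi> * cmod (g \<xi>)))\<^sup>2 \<partial>?\<nu>)"
    by (rule Cauchy_Schwarz_nn_integral) measurable
  also have "(\<integral>\<^sup>+\<xi>. (ennreal (sob_weight (- \<sigma> / 2) \<xi>))\<^sup>2 \<partial>?\<nu>) = I"
    using sob_weight_half[of "- \<sigma>" "_ :: real^'d"] by (simp only: I_def ennreal_power sob_weight_nonneg)
  also have "(\<integral>\<^sup>+\<xi>. (ennreal (sob_weight (\<sigma> / 2) \<xi> * cmod (g \<xi>)))\<^sup>2 \<partial>?\<nu>) = ennreal ((sq_norm (sob_measure \<Omega> \<sigma>) g)\<^sup>2)"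
    using nn_integral_sq_norm[OF g] by (simp add: nn_integral_sob_measure)
  finally have "(\<integral>\<^sup>+\<xi>. ennreal (cmod (g \<xi>)) \<partial>?\<nu>)\<^sup>2 \<le> (ennreal (sob_const \<sigma> \<Omega> TYPE('d) * sq_norm (sob_measure \<Omega> \<sigma>) g))\<^sup>2"
    by (simp add: I ennreal_power sob_const_nonneg power_mult_distrib flip: ennreal_mult)
  then show ?thesis by (rule ennreal_power2_le) (simp add: sob_const_nonneg)
qed

lemma Hhat_integrable:
  fixes g :: "real^'d \<Rightarrow> complex"
  assumes s: "\<sigma> > real CARD('d) / 2" and g: "g \<in> sq_int (sob_measure \<Omega> \<sigma>)"
  shows "integrable (freq_measure \<Omega>) g"
proof (rule integrableI_bounded)
  show "g \<in> borel_measurable (freq_measure \<Omega>)" using sq_int_measurable[OF g] by (simp add: sob_measurable)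
  show "(\<integral>\<^sup>+\<xi>. ennreal (cmod (g \<xi>)) \<partial>freq_measure \<Omega>) < \<infinity>" by (rule le_less_trans[OF Hhat_L1[OF s g]]) simp
qed


section \<open>Sobolev spaces\<close>

lemma measurable_space_measure: "f \<in> borel_measurable borel \<Longrightarrow> f \<in> borel_measurable (space_measure \<Omega>)"
  by (cases \<Omega>) (simp_all add: measurable_torus space_measure.simps(1))

lemma L2_iff: "f \<in> L2 \<Omega> \<longleftrightarrow> f \<in> borel_measurable borel \<and> f \<in> sq_int (space_measure \<Omega>) \<and>
    (\<Omega> = Torus \<longrightarrow> (\<forall>x. \<forall>k\<in>lattice. f (x + k) = f x))"
  using measurable_space_measure[of f \<Omega>] unfolding L2_def sq_int_def by blast

lemma L2_sq_int: "f \<in> L2 \<Omega> \<Longrightarrow> f \<in> sq_int (space_measure \<Omega>)"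
  by (simp add: L2_iff)

lemma L2_lin: "f \<in> L2 \<Omega> \<Longrightarrow> g \<in> L2 \<Omega> \<Longrightarrow> (\<lambda>x. a * f x + b * g x) \<in> L2 \<Omega>"
  unfolding L2_iff using sq_int_add(1)[OF sq_int_cmult(1) sq_int_cmult(1)] by auto

lemma L2_mult_bounded:
  assumes f: "f \<in> L2 \<Omega>" and g: "g \<in> L2 \<Omega>" and K: "AE x in space_measure \<Omega>. cmod (g x) \<le> K"
  shows "(\<lambda>x. f x * g x) \<in> L2 \<Omega>"
proof -
  have [measurable]: "f \<in> borel_measurable borel" "g \<in> borel_measurable borel" using f g by (auto simp: L2_iff)
  have "(\<lambda>x. f x * g x) \<in> sq_int (space_measure \<Omega>)"
  proof (rule sq_norm_mono(1)[OF _ sq_int_cmult(1)[OF L2_sq_int[OF f]]])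
    show "(\<lambda>x. f x * g x) \<in> borel_measurable (space_measure \<Omega>)" by (rule measurable_space_measure) measurable
    show "AE x in space_measure \<Omega>. cmod (f x * g x) \<le> cmod (complex_of_real \<bar>K\<bar> * f x)"
      using K by eventually_elim (simp add: norm_mult mult.commute[of "cmod (f _)"] mult_right_mono)
  qed
  then show ?thesis using f g by (auto simp: L2_iff)
qed

lemma fourier_torus: "fourier Torus f k = (LINT x|space_measure Torus. f x * echar (- k) x)"
  by (simp add: fourier.simps flip: echar_minus_eq)

lemma fourier_measurable: "f \<in> L2 \<Omega> \<Longrightarrow> fourier \<Omega> f \<in> borel_measurable (freq_measure \<Omega>)"
  using sq_int_measurable[OF fourier_whole(1)[of f]] L2_sq_int[of f \<Omega>]
  by (cases \<Omega>) (auto simp: freq_measure.simps space_measure.simps(1))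

lemma sq_int_torus_echar_integrable:
  "f \<in> sq_int (space_measure Torus) \<Longrightarrow> integrable (space_measure Torus) (\<lambda>x. f x * echar k x)"
  by (intro sq_int_integrable_torus sq_int_mult_echar) (auto simp: echar_measurable_torus)

lemma fourier_linear:
  fixes f g :: "real^'d \<Rightarrow> complex"
  assumes "f \<in> L2 \<Omega>" "g \<in> L2 \<Omega>"
  shows "AE \<xi> in freq_measure \<Omega>. fourier \<Omega> (\<lambda>x. a * f x + b * g x) \<xi> = a * fourier \<Omega> f \<xi> + b * fourier \<Omega> g \<xi>"
proof (cases \<Omega>)
  case Whole
  have "f \<in> sq_int lborel" "g \<in> sq_int lborel" using assms[THEN L2_sq_int] by (simp_all add: Whole space_measure.simps)
  then show ?thesis unfolding Whole freq_measure.simps by (rule fourier_whole_linear)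
next
  case Torus
  have "fourier \<Omega> (\<lambda>x. a * f x + b * g x) \<xi> = a * fourier \<Omega> f \<xi> + b * fourier \<Omega> g \<xi>" for \<xi>
  proof -
    note i = assms[THEN L2_sq_int, unfolded Torus, THEN sq_int_torus_echar_integrable, of "- \<xi>"]
    have "fourier \<Omega> (\<lambda>x. a * f x + b * g x) \<xi> = (LINT x|space_measure Torus. a * (f x * echar (- \<xi>) x) + b * (g x * echar (- \<xi>) x))"
      unfolding Torus fourier_torus by (intro Bochner_Integration.integral_cong refl) (simp add: algebra_simps)
    then show ?thesis using i by (simp add: Torus fourier_torus)
  qed
  then show ?thesis by simp
qed

lemma fourier_eq_0:
  fixes f :: "real^'d \<Rightarrow> complex"
  assumes f: "f \<in> L2 \<Omega>" and z: "AE \<xi> in freq_measure \<Omega>. fourier \<Omega> f \<xi> = 0"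
  shows "AE x in space_measure \<Omega>. f x = 0"
proof (cases \<Omega>)
  case Whole
  then have fs: "f \<in> sq_int lborel" using L2_sq_int[OF f] by (simp add: space_measure.simps)
  have "sq_norm lborel (fourier Whole f) = 0"
    unfolding sq_norm_eq_0_iff[OF fourier_whole(1)[OF fs]] using z unfolding Whole freq_measure.simps .
  then have "sq_norm lborel f = 0" using fourier_whole_isometry[OF fs] by simp
  then show ?thesis unfolding Whole space_measure.simps sq_norm_eq_0_iff[OF fs] .
next
  case Torus
  have "(LINT x|space_measure Torus. f x * echar k x) = 0" if "k \<in> lattice" for k
  proof -
    have "\<forall>\<xi>\<in>lattice. fourier Torus f \<xi> = 0" using z unfolding Torus freq_measure.simps AE_count_space .
    then have "fourier \<Omega> f (- k) = 0" using lattice_minus[OF that] by (simp add: Torus)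
    then show ?thesis by (simp add: Torus fourier_torus)
  qed
  then show ?thesis unfolding Torus using f Torus
    by (intro fourier_coefficients_unique sq_int_integrable_torus) (auto simp: L2_iff)
qed

lemma fourier_cong_AE:
  fixes f g :: "real^'d \<Rightarrow> complex"
  assumes f: "f \<in> L2 \<Omega>" and g: "g \<in> L2 \<Omega>" and fg: "AE x in space_measure \<Omega>. f x = g x"
  shows "AE \<xi> in freq_measure \<Omega>. fourier \<Omega> f \<xi> = fourier \<Omega> g \<xi>"
proof (cases \<Omega>)
  case Whole
  have "f \<in> sq_int lborel" "g \<in> sq_int lborel" using L2_sq_int[OF f] L2_sq_int[OF g] by (simp_all add: Whole space_measure.simps)
  then show ?thesis using fg unfolding Whole freq_measure.simps space_measure.simps by (rule fourier_whole_cong_AE)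
next
  case Torus
  have "fourier \<Omega> f \<xi> = fourier \<Omega> g \<xi>" for \<xi>
  proof -
    have "(\<lambda>x. f x * echar (- \<xi>) x) \<in> borel_measurable (space_measure Torus)" "(\<lambda>x. g x * echar (- \<xi>) x) \<in> borel_measurable (space_measure Torus)"
      using f g by (auto intro!: measurable_torus borel_measurable_times borel_measurable_echar simp: L2_iff)
    then show ?thesis unfolding Torus fourier_torus
      by (rule integral_cong_AE) (use fg Torus in \<open>auto elim: eventually_mono\<close>)
  qed
  then show ?thesis by simp
qed

section \<open>Functions with a prescribed Fourier transform\<close>

definition synth :: "domain \<Rightarrow> (real^'d \<Rightarrow> complex) \<Rightarrow> real^'d \<Rightarrow> complex" where
  "synth \<Omega> g x = (LINT \<xi>|freq_measure \<Omega>. g \<xi> * echar \<xi> x)"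

lemma synth_measurable:
  assumes g[measurable]: "g \<in> borel_measurable (freq_measure \<Omega>)"
  shows "synth \<Omega> g \<in> borel_measurable borel"
proof -
  interpret sigma_finite_measure "freq_measure \<Omega> :: (real^'d) measure" by (rule sigma_finite_freq)
  have "(\<lambda>p. g (snd p) * echar (snd p) (fst p)) \<in> borel_measurable (borel \<Otimes>\<^sub>M freq_measure \<Omega>)" by measurable
  then show ?thesis unfolding synth_def[abs_def] by (intro borel_measurable_lebesgue_integral) (simp add: split_beta')
qed

lemma norm_synth_le:
  assumes "integrable (freq_measure \<Omega>) g"
  shows "cmod (synth \<Omega> g x) \<le> (LINT \<xi>|freq_measure \<Omega>. cmod (g \<xi>))"
  unfolding synth_def using integral_norm_bound[of "freq_measure \<Omega>" "\<lambda>\<xi>. g \<xi> * echar \<xi> x"] by (simp add: norm_mult)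

text \<open>On the whole space this is the inversion formula; on the torus Fubini exchanges sum and
  integral, and orthogonality of the characters isolates one coefficient.\<close>

theorem synthesis:
  fixes g :: "real^'d \<Rightarrow> complex"
  assumes gi: "integrable (freq_measure \<Omega>) g" and gs: "g \<in> sq_int (freq_measure \<Omega>)"
  shows "synth \<Omega> g \<in> L2 \<Omega>" "AE \<xi> in freq_measure \<Omega>. fourier \<Omega> (synth \<Omega> g) \<xi> = g \<xi>"
proof -
  have gm: "g \<in> borel_measurable (freq_measure \<Omega>)" using gi by auto
  note sm = synth_measurable[OF gm]
  have "synth \<Omega> g \<in> L2 \<Omega> \<and> (AE \<xi> in freq_measure \<Omega>. fourier \<Omega> (synth \<Omega> g) \<xi> = g \<xi>)"
  proof (cases \<Omega>)
    case Whole
    have "synth Whole g = (\<lambda>x. LINT \<xi>|lborel. g \<xi> * echar \<xi> x)" by (simp add: synth_def[abs_def] freq_measure.simps)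
    moreover have "g \<in> sq_int lborel" "integrable lborel g" using gi gs by (simp_all add: Whole freq_measure.simps)
    ultimately show ?thesis using fourier_whole_synthesis[of g] sm
      unfolding Whole L2_iff freq_measure.simps space_measure.simps by simp
  next
    case Torus
    let ?C = "space_measure Torus :: (real^'d) measure" and ?L = "count_space lattice :: (real^'d) measure"
    interpret C: finite_measure ?C by (rule finite_measure_torus)
    interpret L: sigma_finite_measure ?L by (rule sigma_finite_measure_count_space_countable) simp
    interpret pair_sigma_finite ?C ?L ..
    have giL: "integrable ?L g" using gi by (simp add: Torus freq_measure.simps)
    have bs: "synth \<Omega> g \<in> sq_int ?C"
    proof -
      let ?K = "LINT \<xi>|freq_measure \<Omega>. cmod (g \<xi>)"
      have "(\<lambda>_. complex_of_real ?K) \<in> sq_int ?C" by (simp add: sq_int_def)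
      then show ?thesis using norm_synth_le[OF gi]
        by (intro sq_norm_mono(1)[OF measurable_torus[OF sm]]) (auto intro!: AE_I2)
    qed
    have per: "synth \<Omega> g (x + k) = synth \<Omega> g x" if k: "k \<in> lattice" for x k
      unfolding synth_def by (intro Bochner_Integration.integral_cong refl)
        (simp add: Torus freq_measure.simps echar_add_right echar_lattice k)
    have four: "fourier \<Omega> (synth \<Omega> g) k = g k" if k: "k \<in> lattice" for k
    proof -
      have mm: "(\<lambda>p. g (snd p) * echar (snd p - k) (fst p)) \<in> borel_measurable (?C \<Otimes>\<^sub>M ?L)"
      proof -
        have 1: "(\<lambda>p. g (snd p)) \<in> borel_measurable (?C \<Otimes>\<^sub>M ?L)" by (rule measurable_compose[OF measurable_snd]) simp
        have 2: "(\<lambda>p. snd p - k) \<in> borel_measurable (?C \<Otimes>\<^sub>M ?L)" by (rule measurable_compose[OF measurable_snd]) simp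
        have 3: "fst \<in> borel_measurable (?C \<Otimes>\<^sub>M ?L)"
          using measurable_compose[OF measurable_fst measurable_torus[of "\<lambda>x. x"]] by simp
        show ?thesis by (intro borel_measurable_times borel_measurable_echar 1 2 3)
      qed
      have i: "integrable (?C \<Otimes>\<^sub>M ?L) (\<lambda>(x, \<xi>). g \<xi> * echar (\<xi> - k) x)"
      proof (rule Fubini_integrable)
        show "(\<lambda>(x, \<xi>). g \<xi> * echar (\<xi> - k) x) \<in> borel_measurable (?C \<Otimes>\<^sub>M ?L)" using mm by (simp add: split_beta')
        show "integrable ?C (\<lambda>x. LINT \<xi>|?L. norm (case (x, \<xi>) of (x, \<xi>) \<Rightarrow> g \<xi> * echar (\<xi> - k) x))"
          by (simp add: norm_mult)
        show "AE x in ?C. integrable ?L (\<lambda>\<xi>. case (x, \<xi>) of (x, \<xi>) \<Rightarrow> g \<xi> * echar (\<xi> - k) x)"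
          by (intro AE_I2) (auto intro!: Bochner_Integration.integrable_bound[OF giL] simp: norm_mult)
      qed
      have "fourier \<Omega> (synth \<Omega> g) k = (LINT x|?C. (LINT \<xi>|?L. g \<xi> * echar \<xi> x) * echar (- k) x)"
        by (simp add: Torus fourier_torus synth_def freq_measure.simps)
      also have "\<dots> = (LINT x|?C. (LINT \<xi>|?L. g \<xi> * echar (\<xi> - k) x))"
        by (simp add: echar_add diff_conv_add_uminus flip: integral_mult_left_zero mult.assoc del: add_uminus_conv_diff)
      also have "\<dots> = (LINT \<xi>|?L. (LINT x|?C. g \<xi> * echar (\<xi> - k) x))"
        by (rule Fubini_integral[OF i, symmetric])
      also have "\<dots> = (LINT \<xi>|?L. g \<xi> * indicator {k} \<xi>)"
      proof (intro Bochner_Integration.integral_cong refl)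
        fix \<xi> assume "\<xi> \<in> space ?L"
        then have "\<xi> - k \<in> lattice" using k by (simp add: lattice_diff)
        from integral_torus_echar[OF this] show "(LINT x|?C. g \<xi> * echar (\<xi> - k) x) = g \<xi> * indicator {k} \<xi>"
          by (simp add: indicator_def)
      qed
      also have "\<dots> = (LINT \<xi>|?L. indicator {k} \<xi> *\<^sub>R g k)"
        by (intro Bochner_Integration.integral_cong refl) (simp add: indicator_def)
      also have "\<dots> = g k" using k by (simp add: measure_count_space)
      finally show ?thesis .
    qed
    show ?thesis using sm bs per four
      by (auto simp: Torus L2_iff freq_measure.simps AE_count_space)
  qed
  then show "synth \<Omega> g \<in> L2 \<Omega>" "AE \<xi> in freq_measure \<Omega>. fourier \<Omega> (synth \<Omega> g) \<xi> = g \<xi>" by auto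
qed

lemma Hspace_iff: "f \<in> Hspace \<Omega> \<sigma> \<longleftrightarrow> f \<in> L2 \<Omega> \<and> fourier \<Omega> f \<in> sq_int (sob_measure \<Omega> \<sigma>)"
  by (simp add: Hspace_def Hhat_sq_int)

lemma Hspace_L2: "f \<in> Hspace \<Omega> \<sigma> \<Longrightarrow> f \<in> L2 \<Omega>"
  by (simp add: Hspace_iff)

lemma Hspace_sq: "f \<in> Hspace \<Omega> \<sigma> \<Longrightarrow> fourier \<Omega> f \<in> sq_int (sob_measure \<Omega> \<sigma>)"
  by (simp add: Hspace_iff)

lemma Hnorm_eq: "f \<in> L2 \<Omega> \<Longrightarrow> Hnorm \<Omega> \<sigma> f = sq_norm (sob_measure \<Omega> \<sigma>) (fourier \<Omega> f)"
  by (simp add: Hnorm_def Hhat_norm_sq_norm fourier_measurable)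

lemma Hnorm_nonneg [simp]: "0 \<le> Hnorm \<Omega> \<sigma> f"
  unfolding Hnorm_def Hhat_norm_def by (simp add: integral_nonneg_AE)

lemma Hnorm_dominated:
  assumes f: "f \<in> L2 \<Omega>" and fin: "finite K" and g: "\<And>k. k \<in> K \<Longrightarrow> g k \<in> Hspace \<Omega> \<sigma>" and c: "\<And>k. k \<in> K \<Longrightarrow> 0 \<le> c k"
    and le: "AE \<xi> in freq_measure \<Omega>. cmod (fourier \<Omega> f \<xi>) \<le> (\<Sum>k\<in>K. c k * cmod (fourier \<Omega> (g k) \<xi>))"
  shows "f \<in> Hspace \<Omega> \<sigma>" "Hnorm \<Omega> \<sigma> f \<le> (\<Sum>k\<in>K. c k * Hnorm \<Omega> \<sigma> (g k))"
proof -
  have m: "fourier \<Omega> f \<in> borel_measurable (sob_measure \<Omega> \<sigma>)" using fourier_measurable[OF f] by (simp add: sob_measurable)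
  note D = sq_norm_dominated[OF m fin Hspace_sq[OF g] c le[folded AE_sob_measure[of _ _ \<sigma>]]]
  show "f \<in> Hspace \<Omega> \<sigma>" using D(1) f by (simp add: Hspace_iff)
  show "Hnorm \<Omega> \<sigma> f \<le> (\<Sum>k\<in>K. c k * Hnorm \<Omega> \<sigma> (g k))"
    using D(2) by (simp add: Hnorm_eq[OF f] Hnorm_eq[OF Hspace_L2[OF g]])
qed

lemma Hspace_lin:
  assumes f: "f \<in> Hspace \<Omega> \<sigma>" and g: "g \<in> Hspace \<Omega> \<sigma>"
  shows "(\<lambda>x. a * f x + b * g x) \<in> Hspace \<Omega> \<sigma>"
    "Hnorm \<Omega> \<sigma> (\<lambda>x. a * f x + b * g x) \<le> cmod a * Hnorm \<Omega> \<sigma> f + cmod b * Hnorm \<Omega> \<sigma> g"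
proof -
  let ?g = "\<lambda>k. if k then f else g" and ?c = "\<lambda>k. if k then cmod a else cmod b"
  have L: "(\<lambda>x. a * f x + b * g x) \<in> L2 \<Omega>" by (rule L2_lin[OF Hspace_L2[OF f] Hspace_L2[OF g]])
  have "AE \<xi> in freq_measure \<Omega>. cmod (fourier \<Omega> (\<lambda>x. a * f x + b * g x) \<xi>) \<le> (\<Sum>k\<in>UNIV. ?c k * cmod (fourier \<Omega> (?g k) \<xi>))"
    using fourier_linear[OF Hspace_L2[OF f] Hspace_L2[OF g], of a b]
  proof eventually_elim
    case (elim \<xi>)
    show ?case unfolding elim UNIV_bool using norm_triangle_ineq[of "a * fourier \<Omega> f \<xi>" "b * fourier \<Omega> g \<xi>"]
      by (simp add: norm_mult)
  qed
  from Hnorm_dominated[OF L _ _ _ this, of \<sigma>]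
  show "(\<lambda>x. a * f x + b * g x) \<in> Hspace \<Omega> \<sigma>"
    "Hnorm \<Omega> \<sigma> (\<lambda>x. a * f x + b * g x) \<le> cmod a * Hnorm \<Omega> \<sigma> f + cmod b * Hnorm \<Omega> \<sigma> g"
    using f g by (auto simp: UNIV_bool add.commute)
qed

text \<open>For \<sigma> > d/2 the weighted bound makes g integrable, so every element of
  \<open>Hhat\<close> is the transform of a function. Limits, stages and updates are all constructed
  on the Fourier side and brought back this way.\<close>

lemma Hspace_synth:
  fixes g :: "real^'d \<Rightarrow> complex"
  assumes s: "\<sigma> > real CARD('d) / 2" and g: "g \<in> sq_int (sob_measure \<Omega> \<sigma>)"
  shows "synth \<Omega> g \<in> Hspace \<Omega> \<sigma>" "AE \<xi> in freq_measure \<Omega>. fourier \<Omega> (synth \<Omega> g) \<xi> = g \<xi>"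
proof -
  have s0: "0 \<le> \<sigma>" using s by (rule order_trans[OF _ less_imp_le, rotated]) simp
  have g0: "g \<in> sq_int (freq_measure \<Omega>)" using sq_norm_sob_mono(1)[OF s0 g] by (simp add: sob_measure_0)
  note S = synthesis[OF Hhat_integrable[OF s g] g0]
  show "AE \<xi> in freq_measure \<Omega>. fourier \<Omega> (synth \<Omega> g) \<xi> = g \<xi>" by (rule S(2))
  have "fourier \<Omega> (synth \<Omega> g) \<in> sq_int (sob_measure \<Omega> \<sigma>)"
    using sq_int_cong_AE(1)[of "fourier \<Omega> (synth \<Omega> g)" "sob_measure \<Omega> \<sigma>" g] S g fourier_measurable[OF S(1)] sq_int_measurable[OF g]
    by (simp add: AE_sob_measure sob_measurable)
  then show "synth \<Omega> g \<in> Hspace \<Omega> \<sigma>" using S(1) by (simp add: Hspace_iff)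
qed

lemma AE_eq_synth_fourier:
  fixes f :: "real^'d \<Rightarrow> complex"
  assumes s: "\<sigma> > real CARD('d) / 2" and f: "f \<in> Hspace \<Omega> \<sigma>"
  shows "AE x in space_measure \<Omega>. f x = synth \<Omega> (fourier \<Omega> f) x"
proof -
  let ?S = "synth \<Omega> (fourier \<Omega> f)"
  note S = Hspace_synth[OF s Hspace_sq[OF f]]
  have "AE \<xi> in freq_measure \<Omega>. fourier \<Omega> (\<lambda>x. 1 * f x + (-1) * ?S x) \<xi> = 0"
    using fourier_linear[OF Hspace_L2[OF f] Hspace_L2[OF S(1)], of 1 "-1"] S(2) by eventually_elim simp
  from fourier_eq_0[OF L2_lin[OF Hspace_L2[OF f] Hspace_L2[OF S(1)]] this] show ?thesis by eventually_elim simp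
qed


section \<open>The algebra property\<close>

definition convolve :: "domain \<Rightarrow> (real^'d \<Rightarrow> complex) \<Rightarrow> (real^'d \<Rightarrow> complex) \<Rightarrow> real^'d \<Rightarrow> complex" where
  "convolve \<Omega> f g \<eta> = (LINT \<xi>|freq_measure \<Omega>. f \<xi> * g (\<eta> - \<xi>))"

text \<open>Young's inequality for L2 convolved with L1: q is split as the product of two square
  roots, Cauchy-Schwarz leaves the mass \<open>Q\<close> of q, and Tonelli produces the second
  factor \<open>Q\<close>.\<close>

lemma young_nn_integral:
  fixes p q :: "real^'d \<Rightarrow> real"
  assumes [measurable]: "p \<in> borel_measurable (freq_measure \<Omega>)" "q \<in> borel_measurable (freq_measure \<Omega>)"
    and nn: "\<And>x. 0 \<le> p x" "\<And>x. 0 \<le> q x"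
  shows "(\<integral>\<^sup>+\<eta>. (\<integral>\<^sup>+\<xi>. ennreal (p \<xi> * q (\<eta> - \<xi>)) \<partial>freq_measure \<Omega>)\<^sup>2 \<partial>freq_measure \<Omega>)
    \<le> (\<integral>\<^sup>+\<xi>. ennreal ((p \<xi>)\<^sup>2) \<partial>freq_measure \<Omega>) * (\<integral>\<^sup>+\<xi>. ennreal (q \<xi>) \<partial>freq_measure \<Omega>)\<^sup>2"
proof -
  let ?\<nu> = "freq_measure \<Omega> :: (real^'d) measure"
  interpret N: sigma_finite_measure ?\<nu> by (rule sigma_finite_freq)
  interpret pair_sigma_finite ?\<nu> ?\<nu> ..
  define Q where "Q = (\<integral>\<^sup>+\<xi>. ennreal (q \<xi>) \<partial>?\<nu>)"
  have qm[measurable]: "(\<lambda>\<xi>. q (\<eta> - \<xi>)) \<in> borel_measurable ?\<nu>" if "\<eta> \<in> space ?\<nu>" for \<eta>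
    by (rule measurable_compose[OF freq_minus_const_measurable(1)[OF that]]) measurable
  have q2[measurable]: "(\<lambda>x. q (fst x - snd x)) \<in> borel_measurable (?\<nu> \<Otimes>\<^sub>M ?\<nu>)" "(\<lambda>x. q (snd x - fst x)) \<in> borel_measurable (?\<nu> \<Otimes>\<^sub>M ?\<nu>)"
    by (rule measurable_compose[of _ _ ?\<nu>], measurable)+
  have "(\<integral>\<^sup>+\<eta>. (\<integral>\<^sup>+\<xi>. ennreal (p \<xi> * q (\<eta> - \<xi>)) \<partial>?\<nu>)\<^sup>2 \<partial>?\<nu>) \<le> (\<integral>\<^sup>+\<eta>. (\<integral>\<^sup>+\<xi>. ennreal ((p \<xi>)\<^sup>2 * q (\<eta> - \<xi>)) \<partial>?\<nu>) * Q \<partial>?\<nu>)"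
  proof (rule nn_integral_mono)
    fix \<eta> assume \<eta>: "\<eta> \<in> space ?\<nu>"
    note [measurable] = qm[OF \<eta>]
    have "(\<integral>\<^sup>+\<xi>. ennreal (p \<xi> * q (\<eta> - \<xi>)) \<partial>?\<nu>)\<^sup>2
        = (\<integral>\<^sup>+\<xi>. ennreal (p \<xi> * sqrt (q (\<eta> - \<xi>))) * ennreal (sqrt (q (\<eta> - \<xi>))) \<partial>?\<nu>)\<^sup>2"
      using nn by (intro arg_cong[where f="\<lambda>x. x\<^sup>2"] nn_integral_cong) (simp flip: ennreal_mult)
    also have "\<dots> \<le> (\<integral>\<^sup>+\<xi>. (ennreal (p \<xi> * sqrt (q (\<eta> - \<xi>))))\<^sup>2 \<partial>?\<nu>) * (\<integral>\<^sup>+\<xi>. (ennreal (sqrt (q (\<eta> - \<xi>))))\<^sup>2 \<partial>?\<nu>)"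
      by (rule Cauchy_Schwarz_nn_integral) measurable
    also have "(\<integral>\<^sup>+\<xi>. (ennreal (p \<xi> * sqrt (q (\<eta> - \<xi>))))\<^sup>2 \<partial>?\<nu>) = (\<integral>\<^sup>+\<xi>. ennreal ((p \<xi>)\<^sup>2 * q (\<eta> - \<xi>)) \<partial>?\<nu>)"
      using nn by (intro nn_integral_cong) (simp add: ennreal_power power_mult_distrib)
    also have "(\<integral>\<^sup>+\<xi>. (ennreal (sqrt (q (\<eta> - \<xi>))))\<^sup>2 \<partial>?\<nu>) = (\<integral>\<^sup>+\<xi>. ennreal (q (\<eta> - \<xi>)) \<partial>?\<nu>)"
      using nn by (intro nn_integral_cong) (simp add: ennreal_power)
    also have "\<dots> = Q" unfolding Q_def by (rule nn_integral_freq_reflect[OF \<eta>]) measurable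
    finally show "(\<integral>\<^sup>+\<xi>. ennreal (p \<xi> * q (\<eta> - \<xi>)) \<partial>?\<nu>)\<^sup>2 \<le> (\<integral>\<^sup>+\<xi>. ennreal ((p \<xi>)\<^sup>2 * q (\<eta> - \<xi>)) \<partial>?\<nu>) * Q" .
  qed
  also have "\<dots> = (\<integral>\<^sup>+\<eta>. (\<integral>\<^sup>+\<xi>. ennreal ((p \<xi>)\<^sup>2 * q (\<eta> - \<xi>)) \<partial>?\<nu>) \<partial>?\<nu>) * Q"
    by (rule nn_integral_multc) measurable
  also have "(\<integral>\<^sup>+\<eta>. (\<integral>\<^sup>+\<xi>. ennreal ((p \<xi>)\<^sup>2 * q (\<eta> - \<xi>)) \<partial>?\<nu>) \<partial>?\<nu>) = (\<integral>\<^sup>+\<xi>. (\<integral>\<^sup>+\<eta>. ennreal ((p \<xi>)\<^sup>2 * q (\<eta> - \<xi>)) \<partial>?\<nu>) \<partial>?\<nu>)"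
    by (rule Fubini'[symmetric]) measurable
  also have "\<dots> = (\<integral>\<^sup>+\<xi>. ennreal ((p \<xi>)\<^sup>2) * Q \<partial>?\<nu>)"
  proof (rule nn_integral_cong)
    fix \<xi> assume \<xi>: "\<xi> \<in> space ?\<nu>"
    have m: "(\<lambda>\<eta>. q (\<eta> - \<xi>)) \<in> borel_measurable ?\<nu>"
      by (rule measurable_compose[OF freq_minus_const_measurable(2)[OF \<xi>]]) measurable
    have "(\<integral>\<^sup>+\<eta>. ennreal (q (\<eta> - \<xi>)) \<partial>?\<nu>) = Q" unfolding Q_def
      by (rule nn_integral_freq_translate[OF \<xi>]) measurable
    then show "(\<integral>\<^sup>+\<eta>. ennreal ((p \<xi>)\<^sup>2 * q (\<eta> - \<xi>)) \<partial>?\<nu>) = ennreal ((p \<xi>)\<^sup>2) * Q"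
      using m nn by (simp add: ennreal_mult nn_integral_cmult)
  qed
  also have "\<dots> = (\<integral>\<^sup>+\<xi>. ennreal ((p \<xi>)\<^sup>2) \<partial>?\<nu>) * Q" by (rule nn_integral_multc) measurable
  finally show ?thesis by (simp add: Q_def power2_eq_square mult.assoc)
qed

lemma ennreal_norm_integral_le:
  fixes f :: "'a \<Rightarrow> complex"
  shows "ennreal (cmod (LINT x|M. f x)) \<le> (\<integral>\<^sup>+x. ennreal (cmod (f x)) \<partial>M)"
  by (cases "integrable M f") (auto simp: integral_norm_bound_ennreal not_integrable_integral_eq)

lemma convolve_measurable:
  assumes [measurable]: "f \<in> borel_measurable (freq_measure \<Omega>)" "g \<in> borel_measurable (freq_measure \<Omega>)"
  shows "convolve \<Omega> f g \<in> borel_measurable (freq_measure \<Omega> :: (real^'d) measure)"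
proof -
  let ?\<nu> = "freq_measure \<Omega> :: (real^'d) measure"
  interpret sigma_finite_measure ?\<nu> by (rule sigma_finite_freq)
  have [measurable]: "(\<lambda>x. g (fst x - snd x)) \<in> borel_measurable (?\<nu> \<Otimes>\<^sub>M ?\<nu>)"
    by (rule measurable_compose[of _ _ ?\<nu>]) measurable
  have "(\<lambda>x. f (snd x) * g (fst x - snd x)) \<in> borel_measurable (?\<nu> \<Otimes>\<^sub>M ?\<nu>)" by measurable
  then show ?thesis unfolding convolve_def[abs_def]
    by (intro borel_measurable_lebesgue_integral) (simp add: split_beta')
qed

text \<open>From |\<eta>|^2 <= 2 |\<xi>|^2 + 2 |\<eta> - \<xi>|^2 follows 1 + |\<eta>|^2 <= 4 M with
  M the larger of the two weights' bases; 4^(\<sigma>/2) = 2^\<sigma> is the constant, and a maximum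
  is at most the sum.\<close>

lemma sob_weight_triangle:
  assumes "0 \<le> \<sigma>"
  shows "sob_weight (\<sigma> / 2) \<eta> \<le> 2 powr \<sigma> * (sob_weight (\<sigma> / 2) \<xi> + sob_weight (\<sigma> / 2) (\<eta> - \<xi>))"
proof -
  define M where "M = max (1 + (norm \<xi>)\<^sup>2) (1 + (norm (\<eta> - \<xi>))\<^sup>2)"
  have "norm \<eta> \<le> norm \<xi> + norm (\<eta> - \<xi>)" using norm_triangle_ineq[of \<xi> "\<eta> - \<xi>"] by simp
  then have "(norm \<eta>)\<^sup>2 \<le> (norm \<xi> + norm (\<eta> - \<xi>))\<^sup>2" by (intro power_mono) auto
  also have "\<dots> \<le> 2 * (norm \<xi>)\<^sup>2 + 2 * (norm (\<eta> - \<xi>))\<^sup>2"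
    using sum_squares_bound[of "norm \<xi>" "norm (\<eta> - \<xi>)"] by (simp add: power2_sum)
  moreover have "1 + (norm \<xi>)\<^sup>2 \<le> M" "1 + (norm (\<eta> - \<xi>))\<^sup>2 \<le> M" unfolding M_def by auto
  ultimately have 1: "1 + (norm \<eta>)\<^sup>2 \<le> 4 * M" by linarith
  have "sob_weight (\<sigma> / 2) \<eta> \<le> (4 * M) powr (\<sigma> / 2)" unfolding sob_weight_def using 1 assms by (intro powr_mono2) auto
  also have "\<dots> = 4 powr (\<sigma> / 2) * M powr (\<sigma> / 2)" by (rule powr_mult)
  also have "(4::real) powr (\<sigma> / 2) = 2 powr \<sigma>"
    using powr_powr[of 2 2 "\<sigma> / 2"] by simp
  also have "M powr (\<sigma> / 2) \<le> sob_weight (\<sigma> / 2) \<xi> + sob_weight (\<sigma> / 2) (\<eta> - \<xi>)"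
    unfolding M_def by (auto simp: max_def sob_weight_def)
  finally show ?thesis by simp
qed

text \<open>The weight falls on one of the two factors, which is then measured in weighted L2, while
  the other is measured in L1 through \<open>sob_const\<close>; Young's inequality combines them.
  The extra factor 2 comes from the sum of these two symmetric contributions.\<close>

lemma convolve_Hhat:
  fixes f g :: "real^'d \<Rightarrow> complex"
  assumes s: "\<sigma> > real CARD('d) / 2" and f: "f \<in> sq_int (sob_measure \<Omega> \<sigma>)" and g: "g \<in> sq_int (sob_measure \<Omega> \<sigma>)"
  shows "convolve \<Omega> f g \<in> sq_int (sob_measure \<Omega> \<sigma>)"
    "sq_norm (sob_measure \<Omega> \<sigma>) (convolve \<Omega> f g) \<le> (2 * 2 powr \<sigma> * sob_const \<sigma> \<Omega> TYPE('d)) * sq_norm (sob_measure \<Omega> \<sigma>) f * sq_norm (sob_measure \<Omega> \<sigma>) g"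
proof -
  let ?\<nu> = "freq_measure \<Omega> :: (real^'d) measure" and ?W = "sob_weight (\<sigma> / 2)"
  define S where "S = sob_const \<sigma> \<Omega> TYPE('d)"
  define F where "F = sq_norm (sob_measure \<Omega> \<sigma>) f"
  define G where "G = sq_norm (sob_measure \<Omega> \<sigma>) g"
  have nn: "0 \<le> S" "0 \<le> F" "0 \<le> G" by (auto simp: S_def F_def G_def sob_const_nonneg)
  have s0: "0 \<le> \<sigma>" using s by (rule order_trans[OF _ less_imp_le, rotated]) simp
  have fm[measurable]: "f \<in> borel_measurable ?\<nu>" and gm[measurable]: "g \<in> borel_measurable ?\<nu>"
    using sq_int_measurable[OF f] sq_int_measurable[OF g] by (simp_all add: sob_measurable)
  define P where "P u v \<eta> = (\<integral>\<^sup>+\<xi>. ennreal (u \<xi> * v (\<eta> - \<xi>)) \<partial>?\<nu>)" for u v \<eta>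
  define wf where "wf \<xi> = ?W \<xi> * cmod (f \<xi>)" for \<xi>
  define wg where "wg \<xi> = ?W \<xi> * cmod (g \<xi>)" for \<xi>
  have [measurable]: "wf \<in> borel_measurable ?\<nu>" "wg \<in> borel_measurable ?\<nu>" unfolding wf_def wg_def by measurable
  have wnn: "0 \<le> wf \<xi>" "0 \<le> wg \<xi>" for \<xi> by (auto simp: wf_def wg_def)
  have wf2: "(\<integral>\<^sup>+\<xi>. ennreal ((wf \<xi>)\<^sup>2) \<partial>?\<nu>) = ennreal (F\<^sup>2)" and wg2: "(\<integral>\<^sup>+\<xi>. ennreal ((wg \<xi>)\<^sup>2) \<partial>?\<nu>) = ennreal (G\<^sup>2)"
    using nn_integral_sob_measure[OF fm, of \<sigma>] nn_integral_sob_measure[OF gm, of \<sigma>] nn_integral_sq_norm[OF f] nn_integral_sq_norm[OF g]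
    by (simp_all add: wf_def wg_def F_def G_def ennreal_power)
  have pt: "ennreal (?W \<eta> * cmod (convolve \<Omega> f g \<eta>)) \<le> ennreal (2 powr \<sigma>) * (P wf (\<lambda>\<xi>. cmod (g \<xi>)) \<eta> + P wg (\<lambda>\<xi>. cmod (f \<xi>)) \<eta>)"
    if \<eta>: "\<eta> \<in> space ?\<nu>" for \<eta>
  proof -
    have cm[measurable]: "(\<lambda>\<xi>. h (\<eta> - \<xi>)) \<in> borel_measurable ?\<nu>" if "h \<in> borel_measurable ?\<nu>" for h :: "real^'d \<Rightarrow> 'z::{topological_space}"
      by (rule measurable_compose[OF freq_minus_const_measurable(1)[OF \<eta>] that])
    note [measurable] = cm[OF fm] cm[OF gm]
    have wgm[measurable]: "(\<lambda>\<xi>. wg (\<eta> - \<xi>)) \<in> borel_measurable ?\<nu>" by (rule cm) measurable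
    have "ennreal (?W \<eta> * cmod (convolve \<Omega> f g \<eta>)) \<le> ennreal (?W \<eta>) * (\<integral>\<^sup>+\<xi>. ennreal (cmod (f \<xi> * g (\<eta> - \<xi>))) \<partial>?\<nu>)"
      unfolding convolve_def ennreal_mult[OF sob_weight_nonneg norm_ge_zero] by (intro mult_left_mono ennreal_norm_integral_le) simp_all
    also have "\<dots> = (\<integral>\<^sup>+\<xi>. ennreal (?W \<eta> * (cmod (f \<xi>) * cmod (g (\<eta> - \<xi>)))) \<partial>?\<nu>)"
      by (simp add: ennreal_mult nn_integral_cmult norm_mult)
    also have "\<dots> \<le> (\<integral>\<^sup>+\<xi>. ennreal (2 powr \<sigma>) * (ennreal (wf \<xi> * cmod (g (\<eta> - \<xi>))) + ennreal (cmod (f \<xi>) * wg (\<eta> - \<xi>))) \<partial>?\<nu>)"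
    proof (rule nn_integral_mono)
      fix \<xi>
      have "?W \<eta> * (cmod (f \<xi>) * cmod (g (\<eta> - \<xi>))) \<le> 2 powr \<sigma> * (?W \<xi> + ?W (\<eta> - \<xi>)) * (cmod (f \<xi>) * cmod (g (\<eta> - \<xi>)))"
        by (intro mult_right_mono sob_weight_triangle s0) simp
      also have "\<dots> = 2 powr \<sigma> * (wf \<xi> * cmod (g (\<eta> - \<xi>)) + cmod (f \<xi>) * wg (\<eta> - \<xi>))"
        by (simp add: wf_def wg_def algebra_simps)
      finally show "ennreal (?W \<eta> * (cmod (f \<xi>) * cmod (g (\<eta> - \<xi>)))) \<le> ennreal (2 powr \<sigma>) * (ennreal (wf \<xi> * cmod (g (\<eta> - \<xi>))) + ennreal (cmod (f \<xi>) * wg (\<eta> - \<xi>)))"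
        using wnn by (simp add: ennreal_leI flip: ennreal_mult ennreal_plus)
    qed
    also have "\<dots> = ennreal (2 powr \<sigma>) * (P wf (\<lambda>\<xi>. cmod (g \<xi>)) \<eta> + (\<integral>\<^sup>+\<xi>. ennreal (cmod (f \<xi>) * wg (\<eta> - \<xi>)) \<partial>?\<nu>))"
      unfolding P_def by (subst nn_integral_cmult, measurable, subst nn_integral_add, measurable)
    \<comment> \<open>The reflection \<xi> -> \<eta> - \<xi> exchanges the two factors, so that the
      weighted one always comes first, as in Young's inequality.\<close>
    also have "(\<integral>\<^sup>+\<xi>. ennreal (cmod (f \<xi>) * wg (\<eta> - \<xi>)) \<partial>?\<nu>) = P wg (\<lambda>\<xi>. cmod (f \<xi>)) \<eta>"
      unfolding P_def using nn_integral_freq_reflect[OF \<eta>, of "\<lambda>\<xi>. ennreal (wg \<xi> * cmod (f (\<eta> - \<xi>)))"]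
      by (simp add: mult.commute)
    finally show ?thesis .
  qed
  have Pm: "P u v \<in> borel_measurable ?\<nu>" if [measurable]: "u \<in> borel_measurable ?\<nu>" "v \<in> borel_measurable ?\<nu>" for u v
  proof -
    interpret sigma_finite_measure ?\<nu> by (rule sigma_finite_freq)
    have [measurable]: "(\<lambda>x. v (fst x - snd x)) \<in> borel_measurable (?\<nu> \<Otimes>\<^sub>M ?\<nu>)"
      by (rule measurable_compose[of _ _ ?\<nu>]) measurable
    have "(\<lambda>x. ennreal (u (snd x) * v (fst x - snd x))) \<in> borel_measurable (?\<nu> \<Otimes>\<^sub>M ?\<nu>)" by measurable
    then show ?thesis unfolding P_def[abs_def] by (intro borel_measurable_nn_integral) (simp add: split_beta')
  qed
  have Y1: "(\<integral>\<^sup>+\<eta>. (P wf (\<lambda>\<xi>. cmod (g \<xi>)) \<eta>)\<^sup>2 \<partial>?\<nu>) \<le> ennreal ((F * (S * G))\<^sup>2)"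
  proof -
    have "(\<integral>\<^sup>+\<eta>. (P wf (\<lambda>\<xi>. cmod (g \<xi>)) \<eta>)\<^sup>2 \<partial>?\<nu>) \<le> ennreal (F\<^sup>2) * (\<integral>\<^sup>+\<xi>. ennreal (cmod (g \<xi>)) \<partial>?\<nu>)\<^sup>2"
      unfolding P_def wf2[symmetric] by (rule young_nn_integral) (use wnn in auto)
    also have "\<dots> \<le> ennreal (F\<^sup>2) * (ennreal (S * G))\<^sup>2"
      unfolding S_def G_def by (intro mult_left_mono power_mono Hhat_L1[OF s g]) auto
    finally show ?thesis using nn by (simp add: ennreal_power power_mult_distrib flip: ennreal_mult)
  qed
  have Y2: "(\<integral>\<^sup>+\<eta>. (P wg (\<lambda>\<xi>. cmod (f \<xi>)) \<eta>)\<^sup>2 \<partial>?\<nu>) \<le> ennreal ((F * (S * G))\<^sup>2)"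
  proof -
    have "(\<integral>\<^sup>+\<eta>. (P wg (\<lambda>\<xi>. cmod (f \<xi>)) \<eta>)\<^sup>2 \<partial>?\<nu>) \<le> ennreal (G\<^sup>2) * (\<integral>\<^sup>+\<xi>. ennreal (cmod (f \<xi>)) \<partial>?\<nu>)\<^sup>2"
      unfolding P_def wg2[symmetric] by (rule young_nn_integral) (use wnn in auto)
    also have "\<dots> \<le> ennreal (G\<^sup>2) * (ennreal (S * F))\<^sup>2"
      unfolding S_def F_def by (intro mult_left_mono power_mono Hhat_L1[OF s f]) auto
    finally show ?thesis using nn by (simp add: ennreal_power power_mult_distrib mult_ac flip: ennreal_mult)
  qed
  have sq: "(x + y)\<^sup>2 \<le> 2 * (x\<^sup>2 + y\<^sup>2)" for x y :: ennreal
  proof (cases "x = \<infinity> \<or> y = \<infinity>")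
    case True then show ?thesis by (auto simp: power2_eq_square ennreal_mult_top ennreal_top_mult)
  next
    case False
    then obtain a b where ab: "x = ennreal a" "y = ennreal b" "0 \<le> a" "0 \<le> b"
      by (metis ennreal_cases infinity_ennreal_def)
    have "(a + b)\<^sup>2 \<le> 2 * (a\<^sup>2 + b\<^sup>2)" using sum_squares_bound[of a b] by (simp add: power2_sum)
    then have "ennreal ((a + b)\<^sup>2) \<le> ennreal (2 * (a\<^sup>2 + b\<^sup>2))" by (rule ennreal_leI)
    moreover have "(x + y)\<^sup>2 = ennreal ((a + b)\<^sup>2)" using ab by (simp add: ennreal_power flip: ennreal_plus)
    moreover have "ennreal (2 * (a\<^sup>2 + b\<^sup>2)) = 2 * (ennreal (a\<^sup>2) + ennreal (b\<^sup>2))"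
      by (subst ennreal_mult) simp_all
    then have "2 * (x\<^sup>2 + y\<^sup>2) = ennreal (2 * (a\<^sup>2 + b\<^sup>2))" using ab by (simp only: ennreal_power)
    ultimately show ?thesis by simp
  qed
  have cm: "convolve \<Omega> f g \<in> borel_measurable ?\<nu>" by (rule convolve_measurable[OF fm gm])
  let ?P1 = "P wf (\<lambda>\<xi>. cmod (g \<xi>))" and ?P2 = "P wg (\<lambda>\<xi>. cmod (f \<xi>))"
  have [measurable]: "?P1 \<in> borel_measurable ?\<nu>" "?P2 \<in> borel_measurable ?\<nu>" by (rule Pm; measurable)+
  have "(\<integral>\<^sup>+\<eta>. ennreal ((cmod (convolve \<Omega> f g \<eta>))\<^sup>2) \<partial>sob_measure \<Omega> \<sigma>) = (\<integral>\<^sup>+\<eta>. (ennreal (?W \<eta> * cmod (convolve \<Omega> f g \<eta>)))\<^sup>2 \<partial>?\<nu>)"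
    by (rule nn_integral_sob_measure[OF cm])
  also have "\<dots> \<le> (\<integral>\<^sup>+\<eta>. ennreal ((2 powr \<sigma>)\<^sup>2 * 2) * ((?P1 \<eta>)\<^sup>2 + (?P2 \<eta>)\<^sup>2) \<partial>?\<nu>)"
  proof (rule nn_integral_mono)
    fix \<eta> assume "\<eta> \<in> space ?\<nu>"
    from power_mono[OF pt[OF this], of 2]
    have "(ennreal (?W \<eta> * cmod (convolve \<Omega> f g \<eta>)))\<^sup>2 \<le> (ennreal (2 powr \<sigma>))\<^sup>2 * (?P1 \<eta> + ?P2 \<eta>)\<^sup>2"
      by (simp add: power_mult_distrib)
    also have "\<dots> \<le> (ennreal (2 powr \<sigma>))\<^sup>2 * (2 * ((?P1 \<eta>)\<^sup>2 + (?P2 \<eta>)\<^sup>2))" by (intro mult_left_mono sq) simp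
    also have "\<dots> = ennreal ((2 powr \<sigma>)\<^sup>2 * 2) * ((?P1 \<eta>)\<^sup>2 + (?P2 \<eta>)\<^sup>2)" by (simp add: ennreal_power ennreal_mult mult.assoc)
    finally show "(ennreal (?W \<eta> * cmod (convolve \<Omega> f g \<eta>)))\<^sup>2 \<le> ennreal ((2 powr \<sigma>)\<^sup>2 * 2) * ((?P1 \<eta>)\<^sup>2 + (?P2 \<eta>)\<^sup>2)" .
  qed
  also have "\<dots> = ennreal ((2 powr \<sigma>)\<^sup>2 * 2) * ((\<integral>\<^sup>+\<eta>. (?P1 \<eta>)\<^sup>2 \<partial>?\<nu>) + (\<integral>\<^sup>+\<eta>. (?P2 \<eta>)\<^sup>2 \<partial>?\<nu>))"
    by (subst nn_integral_cmult, measurable, subst nn_integral_add, measurable)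
  also have "\<dots> \<le> ennreal ((2 powr \<sigma>)\<^sup>2 * 2) * (ennreal ((F * (S * G))\<^sup>2) + ennreal ((F * (S * G))\<^sup>2))"
    by (intro mult_left_mono add_mono Y1 Y2) simp
  also have "\<dots> = ennreal ((2 * 2 powr \<sigma> * S * F * G)\<^sup>2)"
  proof -
    have "ennreal ((2 powr \<sigma>)\<^sup>2 * 2) * (ennreal ((F * (S * G))\<^sup>2) + ennreal ((F * (S * G))\<^sup>2))
        = ennreal (((2 powr \<sigma>)\<^sup>2 * 2) * ((F * (S * G))\<^sup>2 + (F * (S * G))\<^sup>2))"
      unfolding ennreal_plus[OF zero_le_power2 zero_le_power2, symmetric] by (rule ennreal_mult[symmetric]) simp_all
    also have "((2 powr \<sigma>)\<^sup>2 * 2) * ((F * (S * G))\<^sup>2 + (F * (S * G))\<^sup>2) = (2 * 2 powr \<sigma> * S * F * G)\<^sup>2"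
      by (simp add: power2_eq_square)
    finally show ?thesis .
  qed
  finally have le: "(\<integral>\<^sup>+\<eta>. ennreal ((cmod (convolve \<Omega> f g \<eta>))\<^sup>2) \<partial>sob_measure \<Omega> \<sigma>) \<le> ennreal ((2 * 2 powr \<sigma> * S * F * G)\<^sup>2)" .
  have cm': "convolve \<Omega> f g \<in> borel_measurable (sob_measure \<Omega> \<sigma>)" using cm by (simp add: sob_measurable)
  show "convolve \<Omega> f g \<in> sq_int (sob_measure \<Omega> \<sigma>)"
    "sq_norm (sob_measure \<Omega> \<sigma>) (convolve \<Omega> f g) \<le> (2 * 2 powr \<sigma> * sob_const \<sigma> \<Omega> TYPE('d)) * sq_norm (sob_measure \<Omega> \<sigma>) f * sq_norm (sob_measure \<Omega> \<sigma>) g"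
    using sq_norm_le_nn[OF cm' le] nn by (auto simp: S_def F_def G_def)
qed

text \<open>Fubini, after writing the character at \<eta> as the product of those at \<xi> and
  \<eta> - \<xi>.\<close>

lemma synth_convolve:
  fixes f g :: "real^'d \<Rightarrow> complex"
  assumes f: "integrable (freq_measure \<Omega>) f" and g: "integrable (freq_measure \<Omega>) g"
  shows "synth \<Omega> (convolve \<Omega> f g) x = synth \<Omega> f x * synth \<Omega> g x"
proof -
  let ?\<nu> = "freq_measure \<Omega> :: (real^'d) measure"
  interpret N: sigma_finite_measure ?\<nu> by (rule sigma_finite_freq)
  interpret pair_sigma_finite ?\<nu> ?\<nu> ..
  have fm[measurable]: "f \<in> borel_measurable ?\<nu>" and gm[measurable]: "g \<in> borel_measurable ?\<nu>" using f g by auto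
  have em[measurable]: "(\<lambda>\<xi>. echar \<xi> x) \<in> borel_measurable ?\<nu>"
    by (intro borel_measurable_echar freq_ident_measurable) simp
  have tr: "(\<lambda>\<eta>. h (\<eta> - \<xi>)) \<in> borel_measurable ?\<nu>" if "\<xi> \<in> space ?\<nu>" "h \<in> borel_measurable ?\<nu>" for h :: "real^'d \<Rightarrow> complex" and \<xi>
    by (rule measurable_compose[OF freq_minus_const_measurable(2)[OF that(1)] that(2)])
  have gtr: "integrable ?\<nu> (\<lambda>\<eta>. g (\<eta> - \<xi>))" if \<xi>: "\<xi> \<in> space ?\<nu>" for \<xi>
  proof (rule integrableI_bounded[OF tr[OF \<xi> gm]])
    show "(\<integral>\<^sup>+\<eta>. ennreal (norm (g (\<eta> - \<xi>))) \<partial>?\<nu>) < \<infinity>"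
      using nn_integral_freq_translate[OF \<xi>, of "\<lambda>\<eta>. ennreal (norm (g \<eta>))"] g by (simp add: integrable_iff_bounded)
  qed
  have [measurable]: "(\<lambda>p. g (snd p - fst p)) \<in> borel_measurable (?\<nu> \<Otimes>\<^sub>M ?\<nu>)"
    by (rule measurable_compose[of _ _ ?\<nu>]) measurable
  have m: "(\<lambda>(\<xi>, \<eta>). f \<xi> * g (\<eta> - \<xi>) * echar \<eta> x) \<in> borel_measurable (?\<nu> \<Otimes>\<^sub>M ?\<nu>)"
  proof -
    have "(\<lambda>p. echar (snd p) x) \<in> borel_measurable (?\<nu> \<Otimes>\<^sub>M ?\<nu>)" by (rule measurable_compose[OF measurable_snd em])
    then have "(\<lambda>p. f (fst p) * g (snd p - fst p) * echar (snd p) x) \<in> borel_measurable (?\<nu> \<Otimes>\<^sub>M ?\<nu>)" by measurable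
    then show ?thesis by (simp add: split_beta')
  qed
  have i: "integrable (?\<nu> \<Otimes>\<^sub>M ?\<nu>) (\<lambda>(\<xi>, \<eta>). f \<xi> * g (\<eta> - \<xi>) * echar \<eta> x)"
  proof (rule Fubini_integrable[OF m])
    have "(LINT \<eta>|?\<nu>. norm (case (\<xi>, \<eta>) of (\<xi>, \<eta>) \<Rightarrow> f \<xi> * g (\<eta> - \<xi>) * echar \<eta> x)) = norm (f \<xi>) * (LINT \<eta>|?\<nu>. norm (g \<eta>))" if \<xi>: "\<xi> \<in> space ?\<nu>" for \<xi>
    proof -
      have "of_real (LINT \<eta>|?\<nu>. norm (g (\<eta> - \<xi>))) = (LINT \<eta>|?\<nu>. complex_of_real (norm (g (\<eta> - \<xi>))))" by simp
      also have "\<dots> = (LINT \<eta>|?\<nu>. complex_of_real (norm (g \<eta>)))"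
        by (rule integral_freq_translate[OF \<xi>]) measurable
      finally have "(LINT \<eta>|?\<nu>. norm (g (\<eta> - \<xi>))) = (LINT \<eta>|?\<nu>. norm (g \<eta>))" by (simp only: integral_complex_of_real of_real_eq_iff)
      then show ?thesis by (simp add: norm_mult)
    qed
    then show "integrable ?\<nu> (\<lambda>\<xi>. LINT \<eta>|?\<nu>. norm (case (\<xi>, \<eta>) of (\<xi>, \<eta>) \<Rightarrow> f \<xi> * g (\<eta> - \<xi>) * echar \<eta> x))"
      using f by (subst Bochner_Integration.integrable_cong[OF refl, of _ _ "\<lambda>\<xi>. norm (f \<xi>) * (LINT \<eta>|?\<nu>. norm (g \<eta>))"]) auto
    show "AE \<xi> in ?\<nu>. integrable ?\<nu> (\<lambda>\<eta>. case (\<xi>, \<eta>) of (\<xi>, \<eta>) \<Rightarrow> f \<xi> * g (\<eta> - \<xi>) * echar \<eta> x)"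
    proof (rule AE_I2)
      fix \<xi> assume \<xi>: "\<xi> \<in> space ?\<nu>"
      have "integrable ?\<nu> (\<lambda>\<eta>. f \<xi> * g (\<eta> - \<xi>))" using gtr[OF \<xi>] by simp
      then show "integrable ?\<nu> (\<lambda>\<eta>. case (\<xi>, \<eta>) of (\<xi>, \<eta>) \<Rightarrow> f \<xi> * g (\<eta> - \<xi>) * echar \<eta> x)"
        using tr[OF \<xi> gm] by (elim Bochner_Integration.integrable_bound) (auto simp: norm_mult)
    qed
  qed
  have "synth \<Omega> (convolve \<Omega> f g) x = (LINT \<eta>|?\<nu>. (LINT \<xi>|?\<nu>. f \<xi> * g (\<eta> - \<xi>) * echar \<eta> x))"
    unfolding synth_def convolve_def by simp
  also have "\<dots> = (LINT \<xi>|?\<nu>. (LINT \<eta>|?\<nu>. f \<xi> * g (\<eta> - \<xi>) * echar \<eta> x))"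
    by (rule Fubini_integral[OF i])
  also have "\<dots> = (LINT \<xi>|?\<nu>. f \<xi> * echar \<xi> x * synth \<Omega> g x)"
  proof (intro Bochner_Integration.integral_cong refl)
    fix \<xi> assume \<xi>: "\<xi> \<in> space ?\<nu>"
    have "(LINT \<eta>|?\<nu>. f \<xi> * g (\<eta> - \<xi>) * echar \<eta> x) = (LINT \<eta>|?\<nu>. (f \<xi> * echar \<xi> x) * (g (\<eta> - \<xi>) * echar (\<eta> - \<xi>) x))"
      by (intro Bochner_Integration.integral_cong refl) (simp add: mult_ac flip: echar_add)
    also have "\<dots> = f \<xi> * echar \<xi> x * (LINT \<eta>|?\<nu>. g (\<eta> - \<xi>) * echar (\<eta> - \<xi>) x)" by simp
    also have "(LINT \<eta>|?\<nu>. g (\<eta> - \<xi>) * echar (\<eta> - \<xi>) x) = synth \<Omega> g x"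
      unfolding synth_def by (rule integral_freq_translate[OF \<xi>]) measurable
    finally show "(LINT \<eta>|?\<nu>. f \<xi> * g (\<eta> - \<xi>) * echar \<eta> x) = f \<xi> * echar \<xi> x * synth \<Omega> g x" .
  qed
  also have "\<dots> = synth \<Omega> f x * synth \<Omega> g x" by (simp add: synth_def)
  finally show ?thesis .
qed

text \<open>Both functions agree almost everywhere with their syntheses, so their product is the
  synthesis of the convolution. Since g is essentially bounded, the product lies in L2, which must
  be known before its transform can be identified.\<close>

theorem Hspace_mult:
  fixes f g :: "real^'d \<Rightarrow> complex"
  assumes s: "\<sigma> > real CARD('d) / 2" and f: "f \<in> Hspace \<Omega> \<sigma>" and g: "g \<in> Hspace \<Omega> \<sigma>"
  shows "(\<lambda>x. f x * g x) \<in> Hspace \<Omega> \<sigma>"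
    "Hnorm \<Omega> \<sigma> (\<lambda>x. f x * g x) \<le> (2 * 2 powr \<sigma> * sob_const \<sigma> \<Omega> TYPE('d)) * Hnorm \<Omega> \<sigma> f * Hnorm \<Omega> \<sigma> g"
proof -
  let ?f = "fourier \<Omega> f" and ?g = "fourier \<Omega> g"
  note fs = Hspace_sq[OF f] and gs = Hspace_sq[OF g]
  note C = convolve_Hhat[OF s fs gs]
  note S = Hspace_synth[OF s C(1)]
  have fg: "AE x in space_measure \<Omega>. f x * g x = synth \<Omega> (convolve \<Omega> ?f ?g) x"
    using AE_eq_synth_fourier[OF s f] AE_eq_synth_fourier[OF s g]
    by eventually_elim (simp add: synth_convolve[OF Hhat_integrable[OF s fs] Hhat_integrable[OF s gs]])
  have "AE x in space_measure \<Omega>. cmod (g x) \<le> (LINT \<xi>|freq_measure \<Omega>. cmod (?g \<xi>))"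
    using AE_eq_synth_fourier[OF s g] by eventually_elim (simp add: norm_synth_le[OF Hhat_integrable[OF s gs]])
  from L2_mult_bounded[OF Hspace_L2[OF f] Hspace_L2[OF g] this] have L: "(\<lambda>x. f x * g x) \<in> L2 \<Omega>" .
  have ae: "AE \<xi> in freq_measure \<Omega>. fourier \<Omega> (\<lambda>x. f x * g x) \<xi> = convolve \<Omega> ?f ?g \<xi>"
    using fourier_cong_AE[OF L Hspace_L2[OF S(1)] fg] S(2) by eventually_elim simp
  note eq = sq_int_cong_AE[of "fourier \<Omega> (\<lambda>x. f x * g x)" "sob_measure \<Omega> \<sigma>" "convolve \<Omega> ?f ?g"]
  have m: "fourier \<Omega> (\<lambda>x. f x * g x) \<in> borel_measurable (sob_measure \<Omega> \<sigma>)" "convolve \<Omega> ?f ?g \<in> borel_measurable (sob_measure \<Omega> \<sigma>)"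
    using fourier_measurable[OF L] sq_int_measurable[OF C(1)] by (simp_all add: sob_measurable)
  show "(\<lambda>x. f x * g x) \<in> Hspace \<Omega> \<sigma>" using L eq(1)[OF m] ae C(1) by (simp add: Hspace_iff AE_sob_measure)
  show "Hnorm \<Omega> \<sigma> (\<lambda>x. f x * g x) \<le> (2 * 2 powr \<sigma> * sob_const \<sigma> \<Omega> TYPE('d)) * Hnorm \<Omega> \<sigma> f * Hnorm \<Omega> \<sigma> g"
    using C(2) eq(2)[OF m] ae by (simp add: AE_sob_measure Hnorm_eq[OF L] Hnorm_eq[OF Hspace_L2[OF f]] Hnorm_eq[OF Hspace_L2[OF g]])
qed


section \<open>Operations on Sobolev functions\<close>

text \<open>The scalar product behind \<open>Hnorm\<close>; pairing with a fixed function reduces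
  calculus in H^\<sigma> to complex-valued functions of time.\<close>

definition Hinner :: "domain \<Rightarrow> real \<Rightarrow> (real^'d \<Rightarrow> complex) \<Rightarrow> (real^'d \<Rightarrow> complex) \<Rightarrow> complex" where
  "Hinner \<Omega> \<sigma> f g = sq_inner (sob_measure \<Omega> \<sigma>) (fourier \<Omega> f) (fourier \<Omega> g)"

lemma Hinner_lin:
  assumes f: "f \<in> Hspace \<Omega> \<sigma>" and g: "g \<in> Hspace \<Omega> \<sigma>" and h: "h \<in> Hspace \<Omega> \<sigma>"
  shows "Hinner \<Omega> \<sigma> (\<lambda>x. a * f x + b * g x) h = a * Hinner \<Omega> \<sigma> f h + b * Hinner \<Omega> \<sigma> g h"
proof -
  let ?M = "sob_measure \<Omega> \<sigma>" and ?F = "fourier \<Omega>"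
  note L = Hspace_lin(1)[OF f g, of a b]
  have ae: "AE \<xi> in ?M. ?F (\<lambda>x. a * f x + b * g x) \<xi> * cnj (?F h \<xi>) = a * (?F f \<xi> * cnj (?F h \<xi>)) + b * (?F g \<xi> * cnj (?F h \<xi>))"
    unfolding AE_sob_measure using fourier_linear[OF Hspace_L2[OF f] Hspace_L2[OF g], of a b]
    by eventually_elim (simp add: algebra_simps)
  note i = sq_inner_integrable[OF Hspace_sq Hspace_sq[OF h]]
  have "Hinner \<Omega> \<sigma> (\<lambda>x. a * f x + b * g x) h = (LINT \<xi>|?M. a * (?F f \<xi> * cnj (?F h \<xi>)) + b * (?F g \<xi> * cnj (?F h \<xi>)))"
    unfolding Hinner_def sq_inner_def
  proof (rule integral_cong_AE[OF _ _ ae])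
    show "(\<lambda>\<xi>. ?F (\<lambda>x. a * f x + b * g x) \<xi> * cnj (?F h \<xi>)) \<in> borel_measurable ?M"
      using i[OF L] by (rule borel_measurable_integrable)
    show "(\<lambda>\<xi>. a * (?F f \<xi> * cnj (?F h \<xi>)) + b * (?F g \<xi> * cnj (?F h \<xi>))) \<in> borel_measurable ?M"
      by (rule borel_measurable_integrable) (intro Bochner_Integration.integrable_add integrable_mult_right i f g)
  qed
  also have "\<dots> = a * Hinner \<Omega> \<sigma> f h + b * Hinner \<Omega> \<sigma> g h"
    using i[OF f] i[OF g] by (simp add: Hinner_def sq_inner_def)
  finally show ?thesis .
qed

lemma Hinner_le: "f \<in> Hspace \<Omega> \<sigma> \<Longrightarrow> g \<in> Hspace \<Omega> \<sigma> \<Longrightarrow> cmod (Hinner \<Omega> \<sigma> f g) \<le> Hnorm \<Omega> \<sigma> f * Hnorm \<Omega> \<sigma> g"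
  unfolding Hinner_def using sq_inner_le[OF Hspace_sq Hspace_sq] by (simp add: Hnorm_eq Hspace_L2)

lemma Hinner_self: "f \<in> Hspace \<Omega> \<sigma> \<Longrightarrow> Hinner \<Omega> \<sigma> f f = complex_of_real ((Hnorm \<Omega> \<sigma> f)\<^sup>2)"
  unfolding Hinner_def by (simp add: sq_inner_self Hnorm_eq Hspace_L2)

lemma Hspace_zero [simp]: "(\<lambda>_::real^'d. 0) \<in> Hspace \<Omega> \<sigma>" and Hnorm_zero [simp]: "Hnorm \<Omega> \<sigma> (\<lambda>_::real^'d. 0) = 0"
proof -
  have L: "(\<lambda>_::real^'d. 0) \<in> L2 \<Omega>" by (auto simp: L2_iff sq_int_def)
  have "AE \<xi> in freq_measure \<Omega>. fourier \<Omega> (\<lambda>_::real^'d. 0) \<xi> = 0"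
    using fourier_linear[OF L L, of 0 0] by simp
  then have "AE \<xi> in freq_measure \<Omega>. cmod (fourier \<Omega> (\<lambda>_::real^'d. 0) \<xi>) \<le> (\<Sum>k\<in>({} :: unit set). 0)"
    by eventually_elim simp
  note D = Hnorm_dominated[OF L, of "{} :: unit set" "\<lambda>_ _. 0" \<sigma> "\<lambda>_. 0"]
  show "(\<lambda>_::real^'d. 0) \<in> Hspace \<Omega> \<sigma>" by (rule D(1)) (use \<open>AE \<xi> in _. _ \<le> _\<close> in auto)
  have "Hnorm \<Omega> \<sigma> (\<lambda>_::real^'d. 0) \<le> 0" using D(2) \<open>AE \<xi> in _. _ \<le> _\<close> by auto
  then show "Hnorm \<Omega> \<sigma> (\<lambda>_::real^'d. 0) = 0" using Hnorm_nonneg[of \<Omega> \<sigma> "\<lambda>_::real^'d. 0"] by linarith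
qed

lemma Hspace_add: "f \<in> Hspace \<Omega> \<sigma> \<Longrightarrow> g \<in> Hspace \<Omega> \<sigma> \<Longrightarrow> (\<lambda>x. f x + g x) \<in> Hspace \<Omega> \<sigma>"
  using Hspace_lin(1)[of f \<Omega> \<sigma> g 1 1] by simp

lemma Hspace_diff: "f \<in> Hspace \<Omega> \<sigma> \<Longrightarrow> g \<in> Hspace \<Omega> \<sigma> \<Longrightarrow> (\<lambda>x. f x - g x) \<in> Hspace \<Omega> \<sigma>"
  using Hspace_lin(1)[of f \<Omega> \<sigma> g 1 "-1"] by simp

lemma Hspace_cmult: "f \<in> Hspace \<Omega> \<sigma> \<Longrightarrow> (\<lambda>x. a * f x) \<in> Hspace \<Omega> \<sigma>"
  using Hspace_lin(1)[of f \<Omega> \<sigma> f a 0] by simp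

lemma Hspace_divide: "f \<in> Hspace \<Omega> \<sigma> \<Longrightarrow> (\<lambda>x. f x / a) \<in> Hspace \<Omega> \<sigma>"
  using Hspace_cmult[of f \<Omega> \<sigma> "inverse a"] by (simp add: divide_inverse mult.commute)

lemma Hspace_sum: "finite S \<Longrightarrow> (\<And>i. i \<in> S \<Longrightarrow> f i \<in> Hspace \<Omega> \<sigma>) \<Longrightarrow> (\<lambda>x. \<Sum>i\<in>S. f i x) \<in> Hspace \<Omega> \<sigma>"
  by (induction S rule: finite_induct) (auto intro: Hspace_add)

lemma Hnorm_cmult_le: "f \<in> Hspace \<Omega> \<sigma> \<Longrightarrow> Hnorm \<Omega> \<sigma> (\<lambda>x. a * f x) \<le> cmod a * Hnorm \<Omega> \<sigma> f"
  using Hspace_lin(2)[of f \<Omega> \<sigma> f a 0] by simp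

text \<open>Equality follows by applying the inequality once to a and once to its inverse.\<close>

lemma Hnorm_cmult:
  assumes "f \<in> Hspace \<Omega> \<sigma>"
  shows "Hnorm \<Omega> \<sigma> (\<lambda>x. a * f x) = cmod a * Hnorm \<Omega> \<sigma> f"
proof (cases "a = 0")
  case False
  have "Hnorm \<Omega> \<sigma> (\<lambda>x. inverse a * (a * f x)) \<le> cmod (inverse a) * Hnorm \<Omega> \<sigma> (\<lambda>x. a * f x)"
    by (rule Hnorm_cmult_le[OF Hspace_cmult[OF assms]])
  then have "Hnorm \<Omega> \<sigma> f \<le> inverse (cmod a) * Hnorm \<Omega> \<sigma> (\<lambda>x. a * f x)"
    using False by (simp add: norm_inverse flip: mult.assoc)
  then have "cmod a * Hnorm \<Omega> \<sigma> f \<le> Hnorm \<Omega> \<sigma> (\<lambda>x. a * f x)" using False by (simp add: field_simps)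
  with Hnorm_cmult_le[OF assms, of a] show ?thesis by linarith
qed simp

lemma Hnorm_triangle: "f \<in> Hspace \<Omega> \<sigma> \<Longrightarrow> g \<in> Hspace \<Omega> \<sigma> \<Longrightarrow> Hnorm \<Omega> \<sigma> (\<lambda>x. f x + g x) \<le> Hnorm \<Omega> \<sigma> f + Hnorm \<Omega> \<sigma> g"
  using Hspace_lin(2)[of f \<Omega> \<sigma> g 1 1] by simp

lemma Hnorm_sum_le:
  assumes "finite S" "\<And>i. i \<in> S \<Longrightarrow> f i \<in> Hspace \<Omega> \<sigma>"
  shows "Hnorm \<Omega> \<sigma> (\<lambda>x. \<Sum>i\<in>S. a i * f i x) \<le> (\<Sum>i\<in>S. cmod (a i) * Hnorm \<Omega> \<sigma> (f i))"
  using assms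
proof (induction S rule: finite_induct)
  case (insert i S)
  have "Hnorm \<Omega> \<sigma> (\<lambda>x. a i * f i x + (\<Sum>i\<in>S. a i * f i x)) \<le> Hnorm \<Omega> \<sigma> (\<lambda>x. a i * f i x) + Hnorm \<Omega> \<sigma> (\<lambda>x. \<Sum>i\<in>S. a i * f i x)"
    using insert by (intro Hnorm_triangle Hspace_cmult Hspace_sum) auto
  with insert Hnorm_cmult_le[of "f i" \<Omega> \<sigma> "a i"] show ?case by fastforce
qed simp

lemma Hdist_commute: "f \<in> Hspace \<Omega> \<sigma> \<Longrightarrow> g \<in> Hspace \<Omega> \<sigma> \<Longrightarrow> Hdist \<Omega> \<sigma> f g = Hdist \<Omega> \<sigma> g f"
  using Hnorm_cmult[OF Hspace_diff[of f \<Omega> \<sigma> g], of "-1"] by (simp add: Hdist_def)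

lemma Hdist_nonneg [simp]: "0 \<le> Hdist \<Omega> \<sigma> f g"
  by (simp add: Hdist_def)

lemma Hdist_triangle:
  assumes "f \<in> Hspace \<Omega> \<sigma>" "g \<in> Hspace \<Omega> \<sigma>" "h \<in> Hspace \<Omega> \<sigma>"
  shows "Hdist \<Omega> \<sigma> f h \<le> Hdist \<Omega> \<sigma> f g + Hdist \<Omega> \<sigma> g h"
  using Hnorm_triangle[OF Hspace_diff[OF assms(1,2)] Hspace_diff[OF assms(2,3)]] by (simp add: Hdist_def)

lemma Hnorm_le_Hdist:
  assumes "f \<in> Hspace \<Omega> \<sigma>" "g \<in> Hspace \<Omega> \<sigma>"
  shows "Hnorm \<Omega> \<sigma> f \<le> Hnorm \<Omega> \<sigma> g + Hdist \<Omega> \<sigma> f g"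
  using Hnorm_triangle[OF assms(2) Hspace_diff[OF assms]] by (simp add: Hdist_def)

lemma fourier_diff:
  assumes "f \<in> L2 \<Omega>" "g \<in> L2 \<Omega>"
  shows "AE \<xi> in freq_measure \<Omega>. fourier \<Omega> (\<lambda>x. f x - g x) \<xi> = fourier \<Omega> f \<xi> - fourier \<Omega> g \<xi>"
  using fourier_linear[OF assms, of 1 "-1"] by simp

lemma fourier_sum:
  fixes f :: "'i \<Rightarrow> real^'d \<Rightarrow> complex"
  assumes "finite K" "\<And>k. k \<in> K \<Longrightarrow> f k \<in> Hspace \<Omega> \<sigma>"
  shows "AE \<xi> in freq_measure \<Omega>. fourier \<Omega> (\<lambda>x. \<Sum>k\<in>K. a k * f k x) \<xi> = (\<Sum>k\<in>K. a k * fourier \<Omega> (f k) \<xi>)"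
  using assms
proof (induction K rule: finite_induct)
  case empty
  show ?case using fourier_diff[OF Hspace_L2[OF Hspace_zero] Hspace_L2[OF Hspace_zero], of \<Omega>] by simp
next
  case (insert k K)
  have S: "(\<lambda>x. \<Sum>k\<in>K. a k * f k x) \<in> Hspace \<Omega> \<sigma>" using insert by (intro Hspace_sum Hspace_cmult) auto
  have "AE \<xi> in freq_measure \<Omega>. fourier \<Omega> (\<lambda>x. \<Sum>k\<in>K. a k * f k x) \<xi> = (\<Sum>k\<in>K. a k * fourier \<Omega> (f k) \<xi>)"
    using insert by simp
  moreover have "AE \<xi> in freq_measure \<Omega>. fourier \<Omega> (\<lambda>x. a k * f k x + 1 * (\<Sum>k\<in>K. a k * f k x)) \<xi>
      = a k * fourier \<Omega> (f k) \<xi> + 1 * fourier \<Omega> (\<lambda>x. \<Sum>k\<in>K. a k * f k x) \<xi>"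
    by (rule fourier_linear[OF Hspace_L2[OF insert.prems[of k]] Hspace_L2[OF S]]) simp
  ultimately show ?case by eventually_elim (simp add: insert.hyps)
qed

lemma Hdist_eq_sq_norm:
  assumes f: "f \<in> Hspace \<Omega> \<sigma>" and g: "g \<in> Hspace \<Omega> \<sigma>"
  shows "Hdist \<Omega> \<sigma> f g = sq_norm (sob_measure \<Omega> \<sigma>) (\<lambda>\<xi>. fourier \<Omega> f \<xi> - fourier \<Omega> g \<xi>)"
proof -
  note d = Hspace_diff[OF f g]
  have "Hdist \<Omega> \<sigma> f g = sq_norm (sob_measure \<Omega> \<sigma>) (fourier \<Omega> (\<lambda>x. f x - g x))"
    unfolding Hdist_def by (rule Hnorm_eq[OF Hspace_L2[OF d]])
  also have "\<dots> = sq_norm (sob_measure \<Omega> \<sigma>) (\<lambda>\<xi>. fourier \<Omega> f \<xi> - fourier \<Omega> g \<xi>)"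
    by (rule sq_int_cong_AE(2)[OF sq_int_measurable[OF Hspace_sq[OF d]] sq_int_measurable[OF sq_int_diff(1)[OF Hspace_sq[OF f] Hspace_sq[OF g]]]])
      (unfold AE_sob_measure, rule fourier_diff[OF Hspace_L2[OF f] Hspace_L2[OF g]])
  finally show ?thesis .
qed

lemma Hdist_eq_0_iff:
  assumes f: "f \<in> Hspace \<Omega> \<sigma>" and g: "g \<in> Hspace \<Omega> \<sigma>"
  shows "Hdist \<Omega> \<sigma> f g = 0 \<longleftrightarrow> (AE \<xi> in freq_measure \<Omega>. fourier \<Omega> f \<xi> = fourier \<Omega> g \<xi>)"
  unfolding Hdist_eq_sq_norm[OF assms] sq_norm_eq_0_iff[OF sq_int_diff(1)[OF Hspace_sq[OF f] Hspace_sq[OF g]]] AE_sob_measure by simp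

lemma ae_eq_iff_fourier:
  fixes f g :: "real^'d \<Rightarrow> complex"
  assumes f: "f \<in> L2 \<Omega>" and g: "g \<in> L2 \<Omega>"
  shows "ae_eq \<Omega> f g \<longleftrightarrow> (AE \<xi> in freq_measure \<Omega>. fourier \<Omega> f \<xi> = fourier \<Omega> g \<xi>)"
proof
  assume "ae_eq \<Omega> f g"
  then show "AE \<xi> in freq_measure \<Omega>. fourier \<Omega> f \<xi> = fourier \<Omega> g \<xi>"
    unfolding ae_eq_def by (rule fourier_cong_AE[OF f g])
next
  assume "AE \<xi> in freq_measure \<Omega>. fourier \<Omega> f \<xi> = fourier \<Omega> g \<xi>"
  then have "AE \<xi> in freq_measure \<Omega>. fourier \<Omega> (\<lambda>x. 1 * f x + (-1) * g x) \<xi> = 0"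
    using fourier_linear[OF f g, of 1 "-1"] by eventually_elim simp
  from fourier_eq_0[OF L2_lin[OF f g] this] show "ae_eq \<Omega> f g" unfolding ae_eq_def by eventually_elim simp
qed

text \<open>The transforms converge in weighted L2 and the limit is realised by
  \<open>synth\<close>. The fixed point of the stage equations rests on this.\<close>

theorem Hspace_complete:
  fixes f :: "nat \<Rightarrow> real^'d \<Rightarrow> complex"
  assumes s: "\<sigma> > real CARD('d) / 2" and f: "\<And>n. f n \<in> Hspace \<Omega> \<sigma>"
    and Cauchy: "\<And>e. e > 0 \<Longrightarrow> \<exists>n0. \<forall>m\<ge>n0. \<forall>n\<ge>n0. Hdist \<Omega> \<sigma> (f m) (f n) < e"
  shows "\<exists>g\<in>Hspace \<Omega> \<sigma>. (\<lambda>n. Hdist \<Omega> \<sigma> (f n) g) \<longlonglongrightarrow> 0"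
proof -
  let ?M = "sob_measure \<Omega> \<sigma>"
  obtain G where G: "G \<in> sq_int ?M" "(\<lambda>n. sq_norm ?M (\<lambda>\<xi>. fourier \<Omega> (f n) \<xi> - G \<xi>)) \<longlonglongrightarrow> 0"
  proof -
    have "\<exists>G\<in>sq_int ?M. (\<lambda>n. sq_norm ?M (\<lambda>\<xi>. fourier \<Omega> (f n) \<xi> - G \<xi>)) \<longlonglongrightarrow> 0"
      by (rule sq_int_complete[OF Hspace_sq[OF f]]) (rule Cauchy[unfolded Hdist_eq_sq_norm[OF f f]])
    then show thesis using that by blast
  qed
  note S = Hspace_synth[OF s G(1)]
  have "Hdist \<Omega> \<sigma> (f n) (synth \<Omega> G) = sq_norm ?M (\<lambda>\<xi>. fourier \<Omega> (f n) \<xi> - G \<xi>)" for n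
    unfolding Hdist_eq_sq_norm[OF f S(1)]
  proof (rule sq_int_cong_AE(2))
    show "AE \<xi> in ?M. fourier \<Omega> (f n) \<xi> - fourier \<Omega> (synth \<Omega> G) \<xi> = fourier \<Omega> (f n) \<xi> - G \<xi>"
      unfolding AE_sob_measure using S(2) by eventually_elim simp
  qed (intro sq_int_measurable sq_int_diff(1) Hspace_sq f S(1) G(1))+
  then show ?thesis using S(1) G(2) by (intro bexI[of _ "synth \<Omega> G"]) simp_all
qed

section \<open>Linear algebra and interpolation\<close>

lemma stab_matrix_carrier [simp]: "A \<in> carrier_mat s s \<Longrightarrow> stab_matrix s A z \<in> carrier_mat s s"
  unfolding stab_matrix_def by (intro carrier_matI) auto

text \<open>\<open>stab_inverse\<close> is \<open>the\<close> of an option; a two-sided inverse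
  makes the matrix a unit of the matrix ring, and then the option is not
  \<open>None\<close>.\<close>

lemma stab_inverse_props:
  assumes A: "A \<in> carrier_mat s s" and inv: "invertible_mat (stab_matrix s A z)"
  shows "stab_inverse s A z \<in> carrier_mat s s" "stab_matrix s A z * stab_inverse s A z = 1\<^sub>m s"
    "stab_inverse s A z * stab_matrix s A z = 1\<^sub>m s"
proof -
  let ?S = "stab_matrix s A z"
  have S: "?S \<in> carrier_mat s s" using A by simp
  from inv obtain B where B: "?S * B = 1\<^sub>m (dim_row ?S)" "B * ?S = 1\<^sub>m (dim_row B)"
    unfolding invertible_mat_def inverts_mat_def by blast
  have "dim_row B = s" using arg_cong[OF B(2), of dim_col] S by simp
  moreover have "dim_col B = s" using arg_cong[OF B(1), of dim_col] S by simp
  ultimately have "B \<in> carrier_mat s s" by auto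
  then have "?S \<in> Units (ring_mat TYPE(complex) s (0::nat))"
    using B S by (auto simp: Units_def ring_mat_def)
  then obtain C where C: "mat_inverse ?S = Some C" using mat_inverse(1)[OF S, where b="0::nat"] by (cases "mat_inverse ?S") auto
  then have "stab_inverse s A z = C" by (simp add: stab_inverse_def)
  then show "stab_inverse s A z \<in> carrier_mat s s" "?S * stab_inverse s A z = 1\<^sub>m s" "stab_inverse s A z * ?S = 1\<^sub>m s"
    using mat_inverse(2)[OF S C] by auto
qed

lemma mat_mult_entry:
  assumes "A \<in> carrier_mat n n" "B \<in> carrier_mat n n" "i < n" "j < n"
  shows "(A * B) $$ (i, j) = (\<Sum>k<n. A $$ (i, k) * B $$ (k, j))"
  using assms by (auto simp: scalar_prod_def lessThan_atLeast0 intro!: sum.cong)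

lemma stab_matrix_entry:
  assumes "A \<in> carrier_mat s s" "i < s" "j < s"
  shows "stab_matrix s A z $$ (i, j) = (if i = j then 1 else 0) - z * complex_of_real (A $$ (i, j))"
  using assms by (auto simp: stab_matrix_def)

text \<open>The stage system at one frequency, solved in components. One direction bounds given
  stages, the other shows that stages defined through the inverse solve the system.\<close>

lemma stab_solve:
  fixes x y :: "nat \<Rightarrow> complex"
  assumes A: "A \<in> carrier_mat s s" and inv: "invertible_mat (stab_matrix s A z)"
  shows "(\<forall>i<s. x i = y i + z * (\<Sum>j<s. complex_of_real (A $$ (i, j)) * x j))
    \<longleftrightarrow> (\<forall>i<s. x i = (\<Sum>j<s. stab_inverse s A z $$ (i, j) * y j))"
proof -
  let ?S = "stab_matrix s A z" and ?B = "stab_inverse s A z"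
  note P = stab_inverse_props[OF A inv]
  have S: "?S \<in> carrier_mat s s" using A by simp
  have row: "(\<Sum>j<s. ?S $$ (i, j) * v j) = v i - z * (\<Sum>j<s. complex_of_real (A $$ (i, j)) * v j)" if "i < s" for i v
  proof -
    have "(\<Sum>j<s. ?S $$ (i, j) * v j) = (\<Sum>j<s. (if i = j then v j else 0) - z * (complex_of_real (A $$ (i, j)) * v j))"
      using that A by (intro sum.cong refl) (auto simp: stab_matrix_entry algebra_simps)
    then show ?thesis using that by (simp add: sum_subtractf sum_distrib_left)
  qed
  have BS: "(\<Sum>k<s. ?B $$ (i, k) * ?S $$ (k, j)) = (if i = j then 1 else 0)" if "i < s" "j < s" for i j
    using mat_mult_entry[OF P(1) S that] P(3) that by simp
  have SB: "(\<Sum>k<s. ?S $$ (i, k) * ?B $$ (k, j)) = (if i = j then 1 else 0)" if "i < s" "j < s" for i j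
    using mat_mult_entry[OF S P(1) that] P(2) that by simp
  have comp: "(\<Sum>j<s. M i j * (\<Sum>k<s. M' j k * v k)) = v i"
    if "\<And>j. j < s \<Longrightarrow> (\<Sum>k<s. M i k * M' k j) = (if i = j then 1 else 0)" "i < s" for M M' :: "nat \<Rightarrow> nat \<Rightarrow> complex" and v i
  proof -
    have "(\<Sum>j<s. M i j * (\<Sum>k<s. M' j k * v k)) = (\<Sum>k<s. (\<Sum>j<s. M i j * M' j k) * v k)"
      by (simp add: sum_distrib_left sum_distrib_right mult.assoc) (rule sum.swap)
    also have "\<dots> = (\<Sum>k<s. (if i = k then v k else 0))" using that(1) by (intro sum.cong refl) auto
    finally show ?thesis using that(2) by simp
  qed
  show ?thesis
  proof (intro iffI allI impI)
    fix i assume h: "\<forall>i<s. x i = y i + z * (\<Sum>j<s. complex_of_real (A $$ (i, j)) * x j)" and i: "i < s"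
    have "(\<Sum>j<s. ?B $$ (i, j) * y j) = (\<Sum>j<s. ?B $$ (i, j) * (\<Sum>k<s. ?S $$ (j, k) * x k))"
    proof (intro sum.cong refl)
      fix j assume "j \<in> {..<s}"
      then have "x j = y j + z * (\<Sum>k<s. complex_of_real (A $$ (j, k)) * x k)" using h by blast
      then show "?B $$ (i, j) * y j = ?B $$ (i, j) * (\<Sum>k<s. ?S $$ (j, k) * x k)"
        using row[of j x] \<open>j \<in> {..<s}\<close> by simp
    qed
    also have "\<dots> = x i" by (rule comp[where M="\<lambda>i j. ?B $$ (i, j)" and M'="\<lambda>i j. ?S $$ (i, j)"]) (use BS i in auto)
    finally show "x i = (\<Sum>j<s. ?B $$ (i, j) * y j)" ..
  next
    fix i assume h: "\<forall>i<s. x i = (\<Sum>j<s. ?B $$ (i, j) * y j)" and i: "i < s"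
    have "(\<Sum>j<s. ?S $$ (i, j) * x j) = (\<Sum>j<s. ?S $$ (i, j) * (\<Sum>k<s. ?B $$ (j, k) * y k))"
      using h by (intro sum.cong refl) simp
    also have "\<dots> = y i" by (rule comp[where M="\<lambda>i j. ?S $$ (i, j)" and M'="\<lambda>i j. ?B $$ (i, j)"]) (use SB i in auto)
    finally show "x i = y i + z * (\<Sum>j<s. complex_of_real (A $$ (i, j)) * x j)"
      using row[OF i, of x] by (simp add: diff_eq_eq)
  qed
qed

lemma stab_row_apply:
  assumes "\<forall>i<s. x i = (\<Sum>j<s. stab_inverse s A z $$ (i, j) * y j)"
  shows "z * (\<Sum>i<s. complex_of_real (b $ i) * x i) = (\<Sum>j<s. stab_row s A b j z * y j)"
proof -
  have "(\<Sum>i<s. complex_of_real (b $ i) * x i) = (\<Sum>i<s. \<Sum>j<s. complex_of_real (b $ i) * stab_inverse s A z $$ (i, j) * y j)"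
    using assms by (simp add: sum_distrib_left mult.assoc)
  also have "\<dots> = (\<Sum>j<s. \<Sum>i<s. complex_of_real (b $ i) * stab_inverse s A z $$ (i, j) * y j)" by (rule sum.swap)
  finally show ?thesis by (simp add: stab_row_def sum_distrib_left sum_distrib_right mult.assoc)
qed

text \<open>The resolvent identity \<open>B z - B w = (z - w) B z A B w\<close> for \<open>B z = (1 - z A)\<^sup>-\<^sup>1\<close>.\<close>

lemma continuous_on_stab_inverse:
  assumes A: "A \<in> carrier_mat s s" and SI: "SI_stable_on S s A" and ij: "i < s" "j < s"
  shows "continuous_on S (\<lambda>z. stab_inverse s A z $$ (i, j))"
proof -
  let ?B = "stab_inverse s A"
  from SI obtain K where inv: "\<And>z. z \<in> S \<Longrightarrow> invertible_mat (stab_matrix s A z)"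
    and K: "\<And>z i j. z \<in> S \<Longrightarrow> i < s \<Longrightarrow> j < s \<Longrightarrow> cmod (?B z $$ (i, j)) \<le> K"
    unfolding SI_stable_on_def by blast
  define a where "a = (\<Sum>k<s. \<Sum>l<s. \<bar>A $$ (k, l)\<bar>)"
  have res: "?B z $$ (i, j) - ?B w $$ (i, j) = (z - w) * (\<Sum>k<s. \<Sum>l<s. ?B z $$ (i, k) * complex_of_real (A $$ (k, l)) * ?B w $$ (l, j))"
    if z: "z \<in> S" and w: "w \<in> S" for z w
  proof -
    \<comment> \<open>Column j of the inverse at w solves the system at w; read as a solution of the
      system at z with a perturbed right-hand side, it yields the identity.\<close>
    define v where "v k = ?B w $$ (k, j)" for k
    define e where "e k = (if k = j then 1 else 0 :: complex)" for k
    have "v k = (\<Sum>l<s. ?B w $$ (k, l) * e l)" for k using ij by (simp add: v_def e_def if_distrib[of "(*) _"] cong: if_cong)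
    then have v: "\<forall>k<s. v k = e k + w * (\<Sum>l<s. complex_of_real (A $$ (k, l)) * v l)"
      using stab_solve[OF A inv[OF w], of v e] by blast
    have "\<forall>k<s. v k = (e k - (z - w) * (\<Sum>l<s. complex_of_real (A $$ (k, l)) * v l)) + z * (\<Sum>l<s. complex_of_real (A $$ (k, l)) * v l)"
    proof (intro allI impI)
      fix k assume "k < s"
      then have "v k = e k + w * (\<Sum>l<s. complex_of_real (A $$ (k, l)) * v l)" using v by blast
      then show "v k = (e k - (z - w) * (\<Sum>l<s. complex_of_real (A $$ (k, l)) * v l)) + z * (\<Sum>l<s. complex_of_real (A $$ (k, l)) * v l)"
        by (simp add: algebra_simps)
    qed
    then have "v i = (\<Sum>k<s. ?B z $$ (i, k) * (e k - (z - w) * (\<Sum>l<s. complex_of_real (A $$ (k, l)) * v l)))"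
      using stab_solve[OF A inv[OF z], of v "\<lambda>k. e k - (z - w) * (\<Sum>l<s. complex_of_real (A $$ (k, l)) * v l)"] ij by blast
    also have "\<dots> = (\<Sum>k<s. ?B z $$ (i, k) * e k) - (z - w) * (\<Sum>k<s. \<Sum>l<s. ?B z $$ (i, k) * complex_of_real (A $$ (k, l)) * v l)"
      by (simp add: algebra_simps sum_subtractf sum_distrib_left sum.distrib)
    also have "(\<Sum>k<s. ?B z $$ (i, k) * e k) = ?B z $$ (i, j)" using ij by (simp add: e_def if_distrib[of "(*) _"] cong: if_cong)
    finally show ?thesis by (simp add: v_def)
  qed
  have K0: "0 \<le> K" if "z \<in> S" for z using K[OF that ij] norm_ge_zero order_trans by blast
  have lip: "cmod (?B z $$ (i, j) - ?B w $$ (i, j)) \<le> (K * a * K) * cmod (z - w)" if z: "z \<in> S" and w: "w \<in> S" for z w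
  proof -
    have "cmod (\<Sum>k<s. \<Sum>l<s. ?B z $$ (i, k) * complex_of_real (A $$ (k, l)) * ?B w $$ (l, j)) \<le> (\<Sum>k<s. \<Sum>l<s. K * \<bar>A $$ (k, l)\<bar> * K)"
      by (intro order_trans[OF norm_sum] sum_mono) (auto simp: norm_mult intro!: order_trans[OF norm_sum] sum_mono mult_mono K z w ij K0[OF z] mult_nonneg_nonneg)
    also have "\<dots> = K * a * K" by (simp add: a_def sum_distrib_left sum_distrib_right)
    finally have "cmod (z - w) * cmod (\<Sum>k<s. \<Sum>l<s. ?B z $$ (i, k) * complex_of_real (A $$ (k, l)) * ?B w $$ (l, j)) \<le> cmod (z - w) * (K * a * K)"
      by (rule mult_left_mono) simp
    then show ?thesis unfolding res[OF z w] norm_mult by (simp only: mult.commute[of "cmod (z - w)"])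
  qed
  show ?thesis unfolding continuous_on_iff
  proof (intro ballI allI impI)
    fix z e assume z: "z \<in> S" and e: "(0::real) < e"
    define C where "C = K * a * K + 1"
    have C: "C > 0" unfolding C_def using K0[OF z] by (intro add_nonneg_pos mult_nonneg_nonneg) (auto simp: a_def intro!: sum_nonneg)
    show "\<exists>d>0. \<forall>w\<in>S. dist w z < d \<longrightarrow> dist (?B w $$ (i, j)) (?B z $$ (i, j)) < e"
    proof (intro exI conjI ballI impI)
      show "0 < e / C" using e C by simp
      fix w assume w: "w \<in> S" and d: "dist w z < e / C"
      have "dist (?B w $$ (i, j)) (?B z $$ (i, j)) \<le> (K * a * K) * cmod (w - z)" using lip[OF w z] by (simp add: dist_norm)
      also have "\<dots> \<le> C * cmod (w - z)" unfolding C_def by (intro mult_right_mono) auto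
      also have "\<dots> < e" using d C by (simp add: dist_norm field_simps)
      finally show "dist (?B w $$ (i, j)) (?B z $$ (i, j)) < e" .
    qed
  qed
qed

text \<open>Dividing \<open>D\<close> by a number \<delta> between its spectral radius and 1 still
  leaves spectral radius below 1, so the powers of the quotient \<open>E\<close> are bounded and
  those of \<open>D\<close> decay like \<delta>^k.\<close>

lemma spectral_radius_power_decay:
  assumes D: "D \<in> carrier_mat s s" and s: "s \<ge> 1" and rho: "spectral_radius D < 1"
  shows "\<exists>C>0. \<exists>\<delta>. 0 < \<delta> \<and> \<delta> < 1 \<and> (\<forall>k. \<forall>i<s. \<forall>j<s. cmod ((D ^\<^sub>m k) $$ (i, j)) \<le> C * \<delta> ^ k)"
proof -
  \<comment> \<open>The midpoint between the spectral radius and 1; the maximum with 0 makes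
    \<delta> positive.\<close>
  define \<delta> where "\<delta> = (1 + max 0 (spectral_radius D)) / 2"
  have \<delta>: "0 < \<delta>" "\<delta> < 1" "spectral_radius D < \<delta>" using rho by (auto simp: \<delta>_def max_def)
  define c where "c = complex_of_real (inverse \<delta>)"
  have c: "c \<noteq> 0" "cmod c = inverse \<delta>" using \<delta> by (auto simp: c_def norm_inverse)
  define E where "E = c \<cdot>\<^sub>m D"
  have E: "E \<in> carrier_mat s s" using D by (simp add: E_def)
  have "spectral_radius E < 1"
  proof -
    obtain ev where ev: "ev \<in> spectrum E" "cmod ev = spectral_radius E" using spectral_radius_mem_max(1)[OF E] s by auto
    then obtain v where v: "v \<in> carrier_vec s" "v \<noteq> 0\<^sub>v s" "E *\<^sub>v v = ev \<cdot>\<^sub>v v"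
      using E by (auto simp: spectrum_def eigenvalue_def eigenvector_def)
    have "c \<cdot>\<^sub>v (D *\<^sub>v v) = ev \<cdot>\<^sub>v v" 
    proof -
      have "(c \<cdot>\<^sub>m D) *\<^sub>v v = c \<cdot>\<^sub>v (D *\<^sub>v v)"
        by (rule eq_vecI) (use D v(1) in \<open>auto simp: scalar_prod_def sum_distrib_left mult.assoc\<close>)
      then show ?thesis using v(3) by (simp add: E_def)
    qed
    then have "inverse c \<cdot>\<^sub>v (c \<cdot>\<^sub>v (D *\<^sub>v v)) = inverse c \<cdot>\<^sub>v (ev \<cdot>\<^sub>v v)" by simp
    then have "D *\<^sub>v v = (inverse c * ev) \<cdot>\<^sub>v v" using c by (simp add: smult_smult_assoc)
    then have "inverse c * ev \<in> spectrum D" using v D by (auto simp: spectrum_def eigenvalue_def eigenvector_def)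
    then have "cmod (inverse c * ev) \<le> spectral_radius D" using spectral_radius_mem_max(2)[OF D] s by auto
    then have "\<delta> * cmod ev \<le> spectral_radius D" using c by (simp add: norm_mult norm_inverse)
    then have "\<delta> * cmod ev < \<delta> * 1" using \<delta> by linarith
    then show ?thesis using \<delta> ev(2) by simp
  qed
  then obtain b where b: "\<And>k. norm_bound (E ^\<^sub>m k) b" using spectral_radius_jnf_norm_bound_less_1_upper_triangular[OF E] by blast
  have pow: "E ^\<^sub>m k = c ^ k \<cdot>\<^sub>m (D ^\<^sub>m k)" for k
  proof (induction k)
    case 0 then show ?case using D E by (auto intro!: eq_matI)
  next
    case (Suc k)
    have Dk: "D ^\<^sub>m k \<in> carrier_mat s s" using D by simp
    have "E ^\<^sub>m Suc k = (c ^ k \<cdot>\<^sub>m (D ^\<^sub>m k)) * (c \<cdot>\<^sub>m D)" using Suc by (simp add: E_def)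
    also have "\<dots> = c ^ Suc k \<cdot>\<^sub>m (D ^\<^sub>m k * D)"
      using D Dk by (simp add: mult_smult_assoc_mat[OF Dk] mult_smult_distrib[OF Dk D]) (auto intro!: eq_matI)
    finally show ?case by simp
  qed
  have "cmod ((D ^\<^sub>m k) $$ (i, j)) \<le> (\<bar>b\<bar> + 1) * \<delta> ^ k" if "i < s" "j < s" for k i j
  proof -
    have Ek: "E ^\<^sub>m k \<in> carrier_mat s s" "D ^\<^sub>m k \<in> carrier_mat s s" using E D by auto
    have "cmod ((E ^\<^sub>m k) $$ (i, j)) \<le> b" using b[of k] Ek E that unfolding norm_bound_def by auto
    moreover have "(E ^\<^sub>m k) $$ (i, j) = c ^ k * (D ^\<^sub>m k) $$ (i, j)"
      unfolding pow using carrier_matD[OF Ek(2)] that by (intro index_smult_mat(1)) auto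
    ultimately have "inverse \<delta> ^ k * cmod ((D ^\<^sub>m k) $$ (i, j)) \<le> \<bar>b\<bar> + 1" using c
      by (simp add: norm_mult norm_power)
    then show ?thesis using \<delta> by (simp add: field_simps)
  qed
  then show ?thesis using \<delta> by (intro exI[of _ "\<bar>b\<bar> + 1"] conjI exI[of _ \<delta>]) auto
qed

section \<open>Exactness of interpolation, moment conditions and Taylor's formula\<close>

text \<open>The difference of the two sides is a polynomial of degree below s with the s distinct
  nodes as roots.\<close>

lemma lagrange_monomial:
  assumes inj: "inj_on (\<lambda>i. c $ i) {..<s}" and q: "q < s"
  shows "\<tau> ^ q = (\<Sum>j<s. (c $ j) ^ q * lagrange_basis s c j \<tau>)"
proof -
  define l where "l j = (\<Prod>k\<in>{..<s} - {j}. [:- (c $ k) / (c $ j - c $ k), 1 / (c $ j - c $ k):])" for j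
  have l: "poly (l j) x = lagrange_basis s c j x" for j x
    unfolding l_def lagrange_basis_def poly_prod by (intro prod.cong refl) (simp add: diff_divide_distrib)
  have deg: "degree (l j) < s" if "j < s" for j
  proof -
    have "degree (l j) \<le> (\<Sum>k\<in>{..<s} - {j}. degree [:- (c $ k) / (c $ j - c $ k), 1 / (c $ j - c $ k):])"
      unfolding l_def by (rule degree_prod_sum_le[unfolded o_def]) simp
    also have "\<dots> \<le> (\<Sum>k\<in>{..<s} - {j}. 1)" by (intro sum_mono) simp
    also have "\<dots> < s" using that by simp
    finally show ?thesis .
  qed
  have val: "lagrange_basis s c j (c $ i) = (if i = j then 1 else 0)" if "i < s" "j < s" for i j
  proof (cases "i = j")
    case True
    have "c $ j - c $ k \<noteq> 0" if "k \<in> {..<s} - {j}" for k using inj \<open>j < s\<close> that by (auto simp: inj_on_def)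
    then show ?thesis using True by (auto simp: lagrange_basis_def intro!: prod.neutral)
  next
    case False
    then show ?thesis using that by (auto simp: lagrange_basis_def intro!: bexI[of _ i])
  qed
  define P where "P = monom 1 q - (\<Sum>j<s. Polynomial.smult ((c $ j) ^ q) (l j))"
  have Pv: "poly P x = x ^ q - (\<Sum>j<s. (c $ j) ^ q * lagrange_basis s c j x)" for x
    by (simp add: P_def poly_monom poly_sum l)
  have "P = 0"
  proof (rule ccontr)
    assume nz: "P \<noteq> 0"
    have "degree P < s" unfolding P_def
    proof (rule degree_diff_less)
      show "degree (monom (1::real) q) < s" using q by (simp add: degree_monom_eq)
      show "degree (\<Sum>j<s. Polynomial.smult ((c $ j) ^ q) (l j)) < s"
        by (rule degree_sum_less) (use q deg in \<open>auto intro: le_less_trans[OF degree_smult_le]\<close>)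
    qed
    moreover have "(\<lambda>i. c $ i) ` {..<s} \<subseteq> {x. poly P x = 0}"
      using val by (auto simp: Pv if_distrib[of "(*) _"] cong: if_cong)
    then have "card ((\<lambda>i. c $ i) ` {..<s}) \<le> card {x. poly P x = 0}"
      by (intro card_mono poly_roots_finite nz)
    then have "s \<le> card {x. poly P x = 0}" using card_image[OF inj] by simp
    moreover have "card {x. poly P x = 0} \<le> degree P" by (rule card_poly_roots_bound[OF nz])
    ultimately show False by linarith
  qed
  then show ?thesis using Pv[of \<tau>] by simp
qed

lemma lagrange_integral_moment:
  assumes inj: "inj_on (\<lambda>i. c $ i) {..<s}" and q: "q < s" and x: "0 \<le> x"
  shows "(\<Sum>j<s. (LBINT \<tau>=ereal 0..ereal x. lagrange_basis s c j \<tau>) * (c $ j) ^ q) = x ^ Suc q / real (Suc q)"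
proof -
  have cont: "continuous_on {0..x} (\<lambda>\<tau>. lagrange_basis s c j \<tau>)" for j
    unfolding lagrange_basis_def divide_inverse by (intro continuous_intros)
  have int: "(LBINT \<tau>=ereal 0..ereal x. lagrange_basis s c j \<tau>) = integral {0..x} (lagrange_basis s c j)" for j
    using x by (intro interval_integral_eq_integral borel_integrable_atLeastAtMost' cont) auto
  have "(\<Sum>j<s. (LBINT \<tau>=ereal 0..ereal x. lagrange_basis s c j \<tau>) * (c $ j) ^ q)
      = integral {0..x} (\<lambda>\<tau>. \<Sum>j<s. (c $ j) ^ q * lagrange_basis s c j \<tau>)"
    using integrable_continuous_real[OF cont]
    by (subst integral_sum) (auto simp: int mult.commute intro!: integrable_on_mult_left)
  also have "\<dots> = integral {0..x} (\<lambda>\<tau>. \<tau> ^ q)" by (simp only: lagrange_monomial[OF inj q, symmetric])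
  also have "\<dots> = x ^ Suc q / real (Suc q) - 0 ^ Suc q / real (Suc q)"
  proof (intro integral_unique fundamental_theorem_of_calculus x)
    fix y :: real
    have "((\<lambda>\<tau>. \<tau> ^ Suc q / real (Suc q)) has_real_derivative real (Suc q) * y ^ (Suc q - Suc 0) / real (Suc q)) (at y within {0..x})"
      by (intro DERIV_cdivide DERIV_pow)
    then show "((\<lambda>\<tau>. \<tau> ^ Suc q / real (Suc q)) has_vector_derivative y ^ q) (at y within {0..x})"
      by (simp add: has_real_derivative_iff_has_vector_derivative del: of_nat_Suc power_Suc)
  qed
  finally show ?thesis by simp
qed

text \<open>The form in which collocation enters the error analysis: the coefficients integrate
  polynomials of degree below s exactly over [0, c_i] and [0, 1].\<close>

lemma collocation_moments:
  assumes col: "collocation s A b c" and nodes: "\<And>i. i < s \<Longrightarrow> 0 \<le> c $ i" and q: "q < s"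
  shows "\<And>i. i < s \<Longrightarrow> (\<Sum>j<s. A $$ (i, j) * (c $ j) ^ q) = (c $ i) ^ Suc q / real (Suc q)"
    "(\<Sum>j<s. b $ j * (c $ j) ^ q) = 1 / real (Suc q)"
proof -
  have inj: "inj_on (\<lambda>i. c $ i) {..<s}" using col by (simp add: collocation_def)
  show "(\<Sum>j<s. A $$ (i, j) * (c $ j) ^ q) = (c $ i) ^ Suc q / real (Suc q)" if "i < s" for i
    using lagrange_integral_moment[OF inj q nodes[OF that]] col that by (simp add: collocation_def)
  show "(\<Sum>j<s. b $ j * (c $ j) ^ q) = 1 / real (Suc q)"
    using lagrange_integral_moment[OF inj q, of 1] col by (simp add: collocation_def one_ereal_def zero_ereal_def)
qed

text \<open>Column q of the matrix identity: polynomials of degree below s are carried from the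
  previous nodes to the new ones, and the value N(u_n), taken at time 0 of the step, is seen by the
  constant monomial only.\<close>

lemma consistent_step_moments:
  assumes c: "consistent_step s c D \<Theta>" and D: "D \<in> carrier_mat s s" and i: "i < s" and q: "q < s"
  shows "complex_of_real (c $ i) ^ q = (\<Sum>j<s. D $$ (i, j) * complex_of_real (c $ j - 1) ^ q) + (if q = 0 then \<Theta> $ i else 0)"
proof -
  let ?V = "Matrix.mat s s (\<lambda>(i, j). complex_of_real (c $ i - 1) ^ j)"
  have V: "?V \<in> carrier_mat s s" by simp
  have "Matrix.mat s s (\<lambda>(i, j). complex_of_real (c $ i) ^ j) $$ (i, q)
      = (D * ?V + Matrix.mat s s (\<lambda>(i, j). if j = 0 then \<Theta> $ i else 0)) $$ (i, q)"
    using c unfolding consistent_step_def by simp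
  also have "\<dots> = (D * ?V) $$ (i, q) + (if q = 0 then \<Theta> $ i else 0)" using D i q by simp
  also have "(D * ?V) $$ (i, q) = (\<Sum>k<s. D $$ (i, k) * ?V $$ (k, q))" by (rule mat_mult_entry[OF D V i q])
  finally show ?thesis using i q by simp
qed

text \<open>The derivative of the remainder is the remainder of one order less for the shifted
  family \<phi> (Suc j), so induction and the mean value inequality suffice. The segment may run to
  the left of t, as happens for nodes of the previous step.\<close>

lemma taylor_bound:
  fixes \<phi> :: "nat \<Rightarrow> real \<Rightarrow> complex"
  assumes "\<And>j \<tau>. j < p \<Longrightarrow> \<tau> \<in> I \<Longrightarrow> (\<phi> j has_vector_derivative \<phi> (Suc j) \<tau>) (at \<tau> within I)"
    and "\<And>\<tau>. \<tau> \<in> I \<Longrightarrow> cmod (\<phi> p \<tau>) \<le> K" and "closed_segment t (t + x) \<subseteq> I"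
  shows "cmod (\<phi> 0 (t + x) - (\<Sum>j<p. complex_of_real (x ^ j / fact j) * \<phi> j t)) \<le> K * \<bar>x\<bar> ^ p"
  using assms
proof (induction p arbitrary: \<phi> x)
  case 0
  then show ?case by auto
next
  case (Suc p)
  have K0: "0 \<le> K" using Suc.prems(2)[of t] Suc.prems(3) norm_ge_zero order_trans by (meson ends_in_segment(1) subsetD)
  define E where "E y = \<phi> 0 (t + y) - (\<Sum>j<Suc p. complex_of_real (y ^ j / fact j) * \<phi> j t)" for y
  define E' where "E' y = \<phi> 1 (t + y) - (\<Sum>j<p. complex_of_real (y ^ j / fact j) * \<phi> (Suc j) t)" for y
  let ?S = "closed_segment 0 x"
  have seg: "closed_segment t (t + y) \<subseteq> I" if "y \<in> ?S" for y
  proof -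
    have "t + y \<in> closed_segment t (t + x)" using that closed_segment_translation_eq[of t y 0 x] by simp
    then have "closed_segment t (t + y) \<subseteq> closed_segment t (t + x)" by (intro closed_segment_subset) auto
    then show ?thesis using Suc.prems(3) by blast
  qed
  have der: "(E has_vector_derivative E' y) (at y within ?S)" if y: "y \<in> ?S" for y
  proof -
    have ty: "t + y \<in> I" using seg[OF y] by auto
    have sub: "(\<lambda>y. t + y) ` ?S \<subseteq> I" using seg by auto
    have 1: "((\<lambda>y. \<phi> 0 (t + y)) has_vector_derivative \<phi> 1 (t + y)) (at y within ?S)"
    proof -
      have "(\<phi> 0 has_vector_derivative \<phi> 1 (t + y)) (at (t + y) within (\<lambda>y. t + y) ` ?S)"
        using has_vector_derivative_within_subset[OF Suc.prems(1)[of 0, OF _ ty] sub] by simp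
      then have "((\<phi> 0 \<circ> (\<lambda>y. t + y)) has_vector_derivative (1 *\<^sub>R \<phi> 1 (t + y))) (at y within ?S)"
        by (intro vector_diff_chain_within) (auto intro!: derivative_eq_intros)
      then show ?thesis by (simp add: o_def)
    qed
    have 2: "((\<lambda>y. \<Sum>j<Suc p. complex_of_real (y ^ j / fact j) * \<phi> j t) has_vector_derivative
        (\<Sum>j<p. complex_of_real (y ^ j / fact j) * \<phi> (Suc j) t)) (at y within ?S)"
    proof -
      have "((\<lambda>y. \<Sum>j<Suc p. complex_of_real (y ^ j / fact j) * \<phi> j t) has_vector_derivative
        (\<Sum>j<Suc p. complex_of_real (real j * y ^ (j - 1) / fact j) * \<phi> j t)) (at y within ?S)"
      proof (rule has_vector_derivative_sum)
        fix j
        have "((\<lambda>y. y ^ j / fact j) has_real_derivative real j * y ^ (j - 1) / fact j) (at y within ?S)"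
          by (auto intro!: derivative_eq_intros)
        then have "((\<lambda>y. complex_of_real (y ^ j / fact j)) has_vector_derivative complex_of_real (real j * y ^ (j - 1) / fact j)) (at y within ?S)"
          by (rule has_vector_derivative_of_real)
        then show "((\<lambda>y. complex_of_real (y ^ j / fact j) * \<phi> j t) has_vector_derivative complex_of_real (real j * y ^ (j - 1) / fact j) * \<phi> j t) (at y within ?S)"
          by (rule has_vector_derivative_mult_left)
      qed
      also have "(\<Sum>j<Suc p. complex_of_real (real j * y ^ (j - 1) / fact j) * \<phi> j t) = (\<Sum>j<p. complex_of_real (y ^ j / fact j) * \<phi> (Suc j) t)"
      proof -
          have "real (Suc j) * y ^ (Suc j - 1) / fact (Suc j) = y ^ j / fact j" for j
            by (simp del: of_nat_Suc)
          then show ?thesis by (simp only: sum.lessThan_Suc_shift) simp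
        qed
      finally show ?thesis .
    qed
    show ?thesis unfolding E_def[abs_def] E'_def by (rule has_vector_derivative_diff[OF 1 2])
  qed
  have bnd: "cmod (E' y) \<le> K * \<bar>x\<bar> ^ p" if y: "y \<in> ?S" for y
  proof -
    have "cmod (\<phi> (Suc 0) (t + y) - (\<Sum>j<p. complex_of_real (y ^ j / fact j) * \<phi> (Suc j) t)) \<le> K * \<bar>y\<bar> ^ p"
      by (rule Suc.IH[of "\<lambda>j. \<phi> (Suc j)"]) (use Suc.prems seg[OF y] in auto)
    also have "\<dots> \<le> K * \<bar>x\<bar> ^ p" using y K0
      by (intro mult_left_mono power_mono) (auto simp: closed_segment_eq_real_ivl split: if_splits)
    finally show ?thesis by (simp add: E'_def)
  qed
  have "norm (E x - E 0) \<le> (K * \<bar>x\<bar> ^ p) * norm (x - 0)"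
  proof (rule differentiable_bound[where S="?S" and f'="\<lambda>y h. h *\<^sub>R E' y"])
    show "onorm (\<lambda>h. h *\<^sub>R E' y) \<le> K * \<bar>x\<bar> ^ p" if "y \<in> ?S" for y
      using bnd[OF that] by (intro onorm_bound) (auto simp: K0 mult.commute intro: mult_left_mono)
  qed (use der in \<open>auto simp: has_vector_derivative_def\<close>)
  moreover have "E 0 = 0" unfolding E_def by (subst sum.lessThan_Suc_shift) simp
  ultimately show ?case by (simp add: E_def mult_ac)
qed

section \<open>Smooth curves and their defects\<close>

lemma Hinner_diff:
  "f \<in> Hspace \<Omega> \<sigma> \<Longrightarrow> g \<in> Hspace \<Omega> \<sigma> \<Longrightarrow> h \<in> Hspace \<Omega> \<sigma> \<Longrightarrow>
    Hinner \<Omega> \<sigma> (\<lambda>x. f x - g x) h = Hinner \<Omega> \<sigma> f h - Hinner \<Omega> \<sigma> g h"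
  using Hinner_lin[of f \<Omega> \<sigma> g h 1 "-1"] by simp

lemma Hinner_cmult:
  "f \<in> Hspace \<Omega> \<sigma> \<Longrightarrow> h \<in> Hspace \<Omega> \<sigma> \<Longrightarrow> Hinner \<Omega> \<sigma> (\<lambda>x. a * f x) h = a * Hinner \<Omega> \<sigma> f h"
  using Hinner_lin[of f \<Omega> \<sigma> f h a 0] by simp

lemma Hinner_sum:
  assumes "finite S" "\<And>i. i \<in> S \<Longrightarrow> f i \<in> Hspace \<Omega> \<sigma>" "h \<in> Hspace \<Omega> \<sigma>"
  shows "Hinner \<Omega> \<sigma> (\<lambda>x. \<Sum>i\<in>S. a i * f i x) h = (\<Sum>i\<in>S. a i * Hinner \<Omega> \<sigma> (f i) h)"
  using assms
proof (induction S rule: finite_induct)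
  case empty
  show ?case using Hinner_cmult[OF empty(2) empty(2), of 0] by simp
next
  case (insert i S)
  have "(\<lambda>x. \<Sum>i\<in>S. a i * f i x) \<in> Hspace \<Omega> \<sigma>" using insert by (intro Hspace_sum Hspace_cmult) auto
  with insert Hinner_lin[of "f i" \<Omega> \<sigma> "\<lambda>x. \<Sum>i\<in>S. a i * f i x" h "a i" 1] show ?case by simp
qed

text \<open>Pairing with R is linear and, by Cauchy-Schwarz, continuous, so it carries the limit of
  the difference quotients over.\<close>

lemma Hinner_has_vector_derivative:
  assumes d: "has_Hderivative_on \<Omega> \<sigma> I w w'" and w: "\<And>t. t \<in> I \<Longrightarrow> w t \<in> Hspace \<Omega> \<sigma>"
    and w': "\<And>t. t \<in> I \<Longrightarrow> w' t \<in> Hspace \<Omega> \<sigma>" and R: "R \<in> Hspace \<Omega> \<sigma>" and t: "t \<in> I"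
  shows "((\<lambda>t. Hinner \<Omega> \<sigma> (w t) R) has_vector_derivative Hinner \<Omega> \<sigma> (w' t) R) (at t within I)"
proof -
  define q where "q y x = (w y x - w t x) / complex_of_real (y - t)" for y x
  have lim: "((\<lambda>y. Hdist \<Omega> \<sigma> (q y) (w' t) * Hnorm \<Omega> \<sigma> R) \<longlongrightarrow> 0) (at t within I)"
    using d t unfolding has_Hderivative_on_def q_def[abs_def] by (auto intro!: tendsto_mult_left_zero)
  have est: "norm ((1 / norm (y - t)) *\<^sub>R (Hinner \<Omega> \<sigma> (w y) R - (Hinner \<Omega> \<sigma> (w t) R + (y - t) *\<^sub>R Hinner \<Omega> \<sigma> (w' t) R)))
      \<le> Hdist \<Omega> \<sigma> (q y) (w' t) * Hnorm \<Omega> \<sigma> R" if y: "y \<in> I" "y \<noteq> t" for y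
  proof -
    let ?c = "complex_of_real (y - t)"
    have c: "?c \<noteq> 0" using y by simp
    have dw: "(\<lambda>x. w y x - w t x) \<in> Hspace \<Omega> \<sigma>" by (intro Hspace_diff w y t)
    have qe: "q y = (\<lambda>x. inverse ?c * (w y x - w t x))" by (simp add: q_def fun_eq_iff divide_inverse mult.commute)
    have qH: "q y \<in> Hspace \<Omega> \<sigma>" unfolding qe by (rule Hspace_cmult[OF dw])
    have "Hinner \<Omega> \<sigma> (\<lambda>x. q y x - w' t x) R = inverse ?c * (Hinner \<Omega> \<sigma> (w y) R - Hinner \<Omega> \<sigma> (w t) R) - Hinner \<Omega> \<sigma> (w' t) R"
      unfolding Hinner_diff[OF qH w'[OF t] R] unfolding qe Hinner_cmult[OF dw R] Hinner_diff[OF w[OF y(1)] w[OF t] R] ..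
    also have "\<dots> = inverse ?c * (Hinner \<Omega> \<sigma> (w y) R - (Hinner \<Omega> \<sigma> (w t) R + (y - t) *\<^sub>R Hinner \<Omega> \<sigma> (w' t) R))"
      using c by (simp add: scaleR_conv_of_real field_simps)
    finally have "norm ((1 / norm (y - t)) *\<^sub>R (Hinner \<Omega> \<sigma> (w y) R - (Hinner \<Omega> \<sigma> (w t) R + (y - t) *\<^sub>R Hinner \<Omega> \<sigma> (w' t) R)))
        = cmod (Hinner \<Omega> \<sigma> (\<lambda>x. q y x - w' t x) R)"
      by (simp add: norm_mult norm_inverse divide_inverse flip: of_real_diff)
    also have "\<dots> \<le> Hdist \<Omega> \<sigma> (q y) (w' t) * Hnorm \<Omega> \<sigma> R"
      unfolding Hdist_def by (rule Hinner_le[OF Hspace_diff[OF qH w'[OF t]] R])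
    finally show ?thesis .
  qed
  show ?thesis unfolding has_vector_derivative_def has_derivative_within
  proof (intro conjI bounded_linear_scaleR_left Lim_null_comparison[OF _ lim])
    show "\<forall>\<^sub>F y in at t within I. norm ((1 / norm (y - t)) *\<^sub>R (Hinner \<Omega> \<sigma> (w y) R - (Hinner \<Omega> \<sigma> (w t) R + (y - t) *\<^sub>R Hinner \<Omega> \<sigma> (w' t) R)))
      \<le> Hdist \<Omega> \<sigma> (q y) (w' t) * Hnorm \<Omega> \<sigma> R"
      unfolding eventually_at by (intro exI[of _ 1]) (use est in auto)
  qed
qed

lemma Hcontinuous_norm:
  assumes c: "Hcontinuous_on \<Omega> \<sigma> I w" and w: "\<And>t. t \<in> I \<Longrightarrow> w t \<in> Hspace \<Omega> \<sigma>"
  shows "continuous_on I (\<lambda>t. Hnorm \<Omega> \<sigma> (w t))"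
  unfolding continuous_on_def
proof
  fix t assume t: "t \<in> I"
  have lim: "((\<lambda>t'. Hdist \<Omega> \<sigma> (w t') (w t)) \<longlongrightarrow> 0) (at t within I)" using c t by (simp add: Hcontinuous_on_def)
  have "norm (Hnorm \<Omega> \<sigma> (w y) - Hnorm \<Omega> \<sigma> (w t)) \<le> Hdist \<Omega> \<sigma> (w y) (w t)" if "y \<in> I" for y
    using Hnorm_le_Hdist[OF w[OF that] w[OF t]] Hnorm_le_Hdist[OF w[OF t] w[OF that]] Hdist_commute[OF w[OF that] w[OF t]] by (simp add: abs_le_iff)
  then have "\<forall>\<^sub>F y in at t within I. norm (Hnorm \<Omega> \<sigma> (w y) - Hnorm \<Omega> \<sigma> (w t)) \<le> Hdist \<Omega> \<sigma> (w y) (w t)"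
    unfolding eventually_at by (intro exI[of _ 1]) auto
  from LIM_zero_cancel[OF Lim_null_comparison[OF this lim]]
  show "((\<lambda>t. Hnorm \<Omega> \<sigma> (w t)) \<longlongrightarrow> Hnorm \<Omega> \<sigma> (w t)) (at t within I)" .
qed

lemma Hcontinuous_bounded:
  assumes "Hcontinuous_on \<Omega> \<sigma> I w" "\<And>t. t \<in> I \<Longrightarrow> w t \<in> Hspace \<Omega> \<sigma>" "compact J" "J \<subseteq> I"
  obtains B where "0 \<le> B" "\<And>t. t \<in> J \<Longrightarrow> Hnorm \<Omega> \<sigma> (w t) \<le> B"
proof -
  have "compact ((\<lambda>t. Hnorm \<Omega> \<sigma> (w t)) ` J)"
    by (intro compact_continuous_image continuous_on_subset[OF Hcontinuous_norm[OF assms(1,2)] assms(4)] assms(3))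
  then obtain B where "\<forall>y\<in>(\<lambda>t. Hnorm \<Omega> \<sigma> (w t)) ` J. norm y \<le> B" using compact_imp_bounded bounded_iff by metis
  then show thesis by (intro that[of "max 0 B"]) (auto simp: le_max_iff_disj)
qed

text \<open>Both \<phi> and its derivative are expanded about t; the moment conditions cancel the
  polynomial parts. What remains is one remainder of order s + 1 and h times remainders of order
  s.\<close>

lemma quadrature_scalar:
  fixes \<phi> :: "nat \<Rightarrow> real \<Rightarrow> complex" and a c :: "nat \<Rightarrow> real"
  assumes der: "\<And>j \<tau>. j \<le> s \<Longrightarrow> \<tau> \<in> J \<Longrightarrow> (\<phi> j has_vector_derivative \<phi> (Suc j) \<tau>) (at \<tau> within J)"
    and K: "\<And>\<tau>. \<tau> \<in> J \<Longrightarrow> cmod (\<phi> (Suc s) \<tau>) \<le> K"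
    and J: "{t..t + h} \<subseteq> J" and h: "0 \<le> h" and y: "0 \<le> y" "y \<le> 1" and c: "\<And>j. j < s \<Longrightarrow> 0 \<le> c j \<and> c j \<le> 1"
    and mom: "\<And>q. q < s \<Longrightarrow> (\<Sum>j<s. a j * c j ^ q) = y ^ Suc q / real (Suc q)"
  shows "cmod (\<phi> 0 (t + y * h) - \<phi> 0 t - complex_of_real h * (\<Sum>j<s. complex_of_real (a j) * \<phi> 1 (t + c j * h)))
    \<le> K * h ^ Suc s * (1 + (\<Sum>j<s. \<bar>a j\<bar>))"
proof -
  define T where "T x = (\<Sum>j<Suc s. complex_of_real (x ^ j / fact j) * \<phi> j t)" for x
  define T1 where "T1 x = (\<Sum>j<s. complex_of_real (x ^ j / fact j) * \<phi> (Suc j) t)" for x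
  have tJ: "t \<in> J" using J h by auto
  have K0: "0 \<le> K" using K[OF tJ] norm_ge_zero[of "\<phi> (Suc s) t"] by linarith
  have seg: "closed_segment t (t + x * h) \<subseteq> J" if "0 \<le> x" "x \<le> 1" for x
  proof -
    have "x * h \<le> 1 * h" "0 \<le> x * h" using that h mult_right_mono[of x 1 h] by auto
    then have "closed_segment t (t + x * h) \<subseteq> {t..t + h}" by (auto simp: closed_segment_eq_real_ivl)
    with J show ?thesis by blast
  qed
  have pw: "\<bar>x * h\<bar> ^ n \<le> h ^ n" if "0 \<le> x" "x \<le> 1" for x n
    using that h by (intro power_mono) (auto simp: abs_mult mult_left_le_one_le)
  have e0: "cmod (\<phi> 0 (t + y * h) - T (y * h)) \<le> K * h ^ Suc s"
  proof -
    have "cmod (\<phi> 0 (t + y * h) - T (y * h)) \<le> K * \<bar>y * h\<bar> ^ Suc s"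
      unfolding T_def by (rule taylor_bound[of "Suc s" J \<phi>, OF der K seg[OF y]]) auto
    also have "\<dots> \<le> K * h ^ Suc s" by (intro mult_left_mono pw y K0)
    finally show ?thesis .
  qed
  have e1: "cmod (\<phi> 1 (t + c j * h) - T1 (c j * h)) \<le> K * h ^ s" if j: "j < s" for j
  proof -
    note cj = c[OF j, THEN conjunct1] c[OF j, THEN conjunct2]
    have "cmod (\<phi> (Suc 0) (t + c j * h) - T1 (c j * h)) \<le> K * \<bar>c j * h\<bar> ^ s"
      unfolding T1_def by (rule taylor_bound[of s J "\<lambda>j. \<phi> (Suc j)", OF der K seg[OF cj]]) auto
    also have "\<dots> \<le> K * h ^ s" by (intro mult_left_mono pw cj K0)
    finally show ?thesis by simp
  qed
  have alg: "T (y * h) - \<phi> 0 t = complex_of_real h * (\<Sum>j<s. complex_of_real (a j) * T1 (c j * h))"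
  proof -
    have "complex_of_real h * (\<Sum>j<s. complex_of_real (a j) * T1 (c j * h))
        = (\<Sum>j<s. \<Sum>q<s. complex_of_real (h * (a j * ((c j * h) ^ q / fact q))) * \<phi> (Suc q) t)"
      by (simp add: T1_def sum_distrib_left mult_ac)
    also have "\<dots> = (\<Sum>q<s. \<Sum>j<s. complex_of_real (h * (a j * ((c j * h) ^ q / fact q))) * \<phi> (Suc q) t)" by (rule sum.swap)
    also have "\<dots> = (\<Sum>q<s. complex_of_real (h ^ Suc q / fact q * (\<Sum>j<s. a j * c j ^ q)) * \<phi> (Suc q) t)"
      by (intro sum.cong refl) (simp add: sum_distrib_left sum_distrib_right power_mult_distrib mult_ac)
    also have "\<dots> = (\<Sum>q<s. complex_of_real ((y * h) ^ Suc q / fact (Suc q)) * \<phi> (Suc q) t)"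
    proof (intro sum.cong refl arg_cong2[where f="(*)"] arg_cong[where f=complex_of_real])
      fix q assume "q \<in> {..<s}"
      then have "(\<Sum>j<s. a j * c j ^ q) = y ^ Suc q / real (Suc q)" using mom by simp
      then show "h ^ Suc q / fact q * (\<Sum>j<s. a j * c j ^ q) = (y * h) ^ Suc q / fact (Suc q)"
        by (simp only: fact_Suc power_mult_distrib of_nat_mult of_nat_fact) (simp add: mult_ac)
    qed
    also have "\<dots> = T (y * h) - \<phi> 0 t" unfolding T_def by (subst sum.lessThan_Suc_shift) simp
    finally show ?thesis ..
  qed
  have "\<phi> 0 (t + y * h) - \<phi> 0 t - complex_of_real h * (\<Sum>j<s. complex_of_real (a j) * \<phi> 1 (t + c j * h))
      = (\<phi> 0 (t + y * h) - T (y * h)) - complex_of_real h * (\<Sum>j<s. complex_of_real (a j) * (\<phi> 1 (t + c j * h) - T1 (c j * h)))"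
    using alg by (simp add: algebra_simps sum_subtractf)
  also have "cmod \<dots> \<le> K * h ^ Suc s + h * (\<Sum>j<s. \<bar>a j\<bar> * (K * h ^ s))"
  proof (rule order_trans[OF norm_triangle_ineq4 add_mono[OF e0]])
    show "cmod (complex_of_real h * (\<Sum>j<s. complex_of_real (a j) * (\<phi> 1 (t + c j * h) - T1 (c j * h)))) \<le> h * (\<Sum>j<s. \<bar>a j\<bar> * (K * h ^ s))"
      unfolding norm_mult using h
      by (auto intro!: mult_left_mono order_trans[OF norm_sum] sum_mono e1[unfolded One_nat_def] simp: norm_mult)
  qed
  also have "\<dots> = K * h ^ Suc s * (1 + (\<Sum>j<s. \<bar>a j\<bar>))"
    by (simp add: distrib_left sum_distrib_left mult_ac)
  finally show ?thesis .
qed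

text \<open>With t = t_n the old values sit at t + (c_j - 1) h and the new ones at t + c_i h. The
  coefficient b, which multiplies the value at t itself, therefore occurs only in the moment q =
  0.\<close>

lemma extrapolation_scalar:
  fixes \<phi> :: "nat \<Rightarrow> real \<Rightarrow> complex" and a :: "nat \<Rightarrow> complex" and c :: "nat \<Rightarrow> real"
  assumes der: "\<And>j \<tau>. j < s \<Longrightarrow> \<tau> \<in> J \<Longrightarrow> (\<phi> j has_vector_derivative \<phi> (Suc j) \<tau>) (at \<tau> within J)"
    and K: "\<And>\<tau>. \<tau> \<in> J \<Longrightarrow> cmod (\<phi> s \<tau>) \<le> K"
    and J: "{t - h..t + h} \<subseteq> J" and h: "0 \<le> h" and y: "0 \<le> y" "y \<le> 1" and c: "\<And>j. j < s \<Longrightarrow> 0 \<le> c j \<and> c j \<le> 1"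
    and s: "s \<ge> 1"
    and mom: "\<And>q. q < s \<Longrightarrow> complex_of_real y ^ q = (\<Sum>j<s. a j * complex_of_real (c j - 1) ^ q) + (if q = 0 then b else 0)"
  shows "cmod (\<phi> 0 (t + y * h) - (\<Sum>j<s. a j * \<phi> 0 (t + (c j - 1) * h)) - b * \<phi> 0 t) \<le> K * h ^ s * (1 + (\<Sum>j<s. cmod (a j)))"
proof -
  define T where "T x = (\<Sum>j<s. complex_of_real (x ^ j / fact j) * \<phi> j t)" for x
  have tJ: "t \<in> J" using J h by auto
  have K0: "0 \<le> K" using K[OF tJ] norm_ge_zero[of "\<phi> s t"] by linarith
  have e: "cmod (\<phi> 0 (t + x * h) - T (x * h)) \<le> K * h ^ s" if x: "\<bar>x\<bar> \<le> 1" for x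
  proof -
    have xh: "\<bar>x * h\<bar> \<le> h" using x h by (simp add: abs_mult mult_left_le_one_le)
    then have "closed_segment t (t + x * h) \<subseteq> {t - h..t + h}" by (auto simp: closed_segment_eq_real_ivl)
    then have sg: "closed_segment t (t + x * h) \<subseteq> J" using J by blast
    have "cmod (\<phi> 0 (t + x * h) - T (x * h)) \<le> K * \<bar>x * h\<bar> ^ s"
      unfolding T_def by (rule taylor_bound[of s J \<phi>, OF der K sg]) auto
    also have "\<dots> \<le> K * h ^ s" by (intro mult_left_mono power_mono xh K0) auto
    finally show ?thesis .
  qed
  have alg: "T (y * h) = (\<Sum>j<s. a j * T ((c j - 1) * h)) + b * \<phi> 0 t"
  proof -
    have "(\<Sum>j<s. a j * T ((c j - 1) * h)) = (\<Sum>j<s. \<Sum>q<s. a j * (complex_of_real (((c j - 1) * h) ^ q / fact q) * \<phi> q t))"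
      by (simp add: T_def sum_distrib_left)
    also have "\<dots> = (\<Sum>q<s. \<Sum>j<s. a j * (complex_of_real (((c j - 1) * h) ^ q / fact q) * \<phi> q t))" by (rule sum.swap)
    also have "\<dots> = (\<Sum>q<s. (\<Sum>j<s. a j * complex_of_real (c j - 1) ^ q) * (complex_of_real (h ^ q / fact q) * \<phi> q t))"
      by (intro sum.cong refl) (simp add: sum_distrib_left sum_distrib_right sum_divide_distrib power_mult_distrib mult_ac)
    also have "\<dots> = (\<Sum>q<s. (complex_of_real y ^ q - (if q = 0 then b else 0)) * (complex_of_real (h ^ q / fact q) * \<phi> q t))"
      using mom by (intro sum.cong refl) (simp add: algebra_simps)
    also have "\<dots> = T (y * h) - (\<Sum>q<s. (if q = 0 then b * \<phi> 0 t else 0))"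
      by (simp only: T_def sum_subtractf[symmetric]) (intro sum.cong refl, auto simp: power_mult_distrib algebra_simps)
    also have "(\<Sum>q<s. (if q = 0 then b * \<phi> 0 t else 0)) = b * \<phi> 0 t" using s by simp
    finally show ?thesis by simp
  qed
  have "\<phi> 0 (t + y * h) - (\<Sum>j<s. a j * \<phi> 0 (t + (c j - 1) * h)) - b * \<phi> 0 t
      = (\<phi> 0 (t + y * h) - T (y * h)) - (\<Sum>j<s. a j * (\<phi> 0 (t + (c j - 1) * h) - T ((c j - 1) * h)))"
    using alg by (simp add: algebra_simps sum_subtractf)
  also have "cmod \<dots> \<le> K * h ^ s + (\<Sum>j<s. cmod (a j) * (K * h ^ s))"
  proof (rule order_trans[OF norm_triangle_ineq4 add_mono])
    show "cmod (\<phi> 0 (t + y * h) - T (y * h)) \<le> K * h ^ s" using y by (intro e) auto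
    show "cmod (\<Sum>j<s. a j * (\<phi> 0 (t + (c j - 1) * h) - T ((c j - 1) * h))) \<le> (\<Sum>j<s. cmod (a j) * (K * h ^ s))"
    proof (rule order_trans[OF norm_sum sum_mono])
      fix j assume "j \<in> {..<s}"
      then have "\<bar>c j - 1\<bar> \<le> 1" using c[of j] by auto
      then show "cmod (a j * (\<phi> 0 (t + (c j - 1) * h) - T ((c j - 1) * h))) \<le> cmod (a j) * (K * h ^ s)"
        unfolding norm_mult by (intro mult_left_mono e) auto
    qed
  qed
  also have "\<dots> = K * h ^ s * (1 + (\<Sum>j<s. cmod (a j)))"
    by (simp add: distrib_left sum_distrib_left mult_ac)
  finally show ?thesis .
qed

text \<open>Tests R against itself: a scalar estimate proportional to the norm of R can be divided
  by that norm.\<close>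

lemma Hnorm_le_by_duality:
  assumes R: "R \<in> Hspace \<Omega> \<sigma>" and le: "cmod (Hinner \<Omega> \<sigma> R R) \<le> X * Hnorm \<Omega> \<sigma> R" and X: "0 \<le> X"
  shows "Hnorm \<Omega> \<sigma> R \<le> X"
proof (cases "Hnorm \<Omega> \<sigma> R = 0")
  case False
  have "Hnorm \<Omega> \<sigma> R * Hnorm \<Omega> \<sigma> R \<le> X * Hnorm \<Omega> \<sigma> R"
    using le unfolding Hinner_self[OF R] norm_of_real by (simp add: power2_eq_square)
  then show ?thesis using False Hnorm_nonneg[of \<Omega> \<sigma> R] by (simp add: mult_le_cancel_right less_le)
qed (use X in simp)

text \<open>The scalar estimate is applied to the pairings of the curve with the defect R, whose
  derivatives are bounded by B times the norm of R; duality then removes R.\<close>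

lemma quadrature_defect:
  fixes a c :: "nat \<Rightarrow> real"
  assumes w: "\<And>j t. j \<le> Suc s \<Longrightarrow> t \<in> I \<Longrightarrow> w j t \<in> Hspace \<Omega> \<sigma>"
    and d: "\<And>j. j \<le> s \<Longrightarrow> has_Hderivative_on \<Omega> \<sigma> I (w j) (w (Suc j))"
    and JI: "J \<subseteq> I" and B: "\<And>\<tau>. \<tau> \<in> J \<Longrightarrow> Hnorm \<Omega> \<sigma> (w (Suc s) \<tau>) \<le> B"
    and J: "{t..t + h} \<subseteq> J" and h: "0 \<le> h" and y: "0 \<le> y" "y \<le> 1" and c: "\<And>j. j < s \<Longrightarrow> 0 \<le> c j \<and> c j \<le> 1"
    and mom: "\<And>q. q < s \<Longrightarrow> (\<Sum>j<s. a j * c j ^ q) = y ^ Suc q / real (Suc q)"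
  shows "(\<lambda>x. w 0 (t + y * h) x - w 0 t x - complex_of_real h * (\<Sum>j<s. complex_of_real (a j) * w 1 (t + c j * h) x)) \<in> Hspace \<Omega> \<sigma>"
    "Hnorm \<Omega> \<sigma> (\<lambda>x. w 0 (t + y * h) x - w 0 t x - complex_of_real h * (\<Sum>j<s. complex_of_real (a j) * w 1 (t + c j * h) x))
      \<le> B * h ^ Suc s * (1 + (\<Sum>j<s. \<bar>a j\<bar>))"
proof -
  define R where "R = (\<lambda>x. w 0 (t + y * h) x - w 0 t x - complex_of_real h * (\<Sum>j<s. complex_of_real (a j) * w 1 (t + c j * h) x))"
  have pt: "t + x * h \<in> I" if "0 \<le> x" "x \<le> 1" for x
  proof -
    have "x * h \<le> 1 * h" "0 \<le> x * h" using that h mult_right_mono[of x 1 h] by auto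
    then have "t + x * h \<in> {t..t + h}" by auto
    with J JI show ?thesis by blast
  qed
  have tI: "t \<in> I" using pt[of 0] by simp
  have w0: "w 0 (t + y * h) \<in> Hspace \<Omega> \<sigma>" "w 0 t \<in> Hspace \<Omega> \<sigma>" using w pt[OF y] tI by auto
  have w1: "w 1 (t + c j * h) \<in> Hspace \<Omega> \<sigma>" if "j \<in> {..<s}" for j using w pt c that by auto
  have S: "(\<lambda>x. \<Sum>j<s. complex_of_real (a j) * w 1 (t + c j * h) x) \<in> Hspace \<Omega> \<sigma>"
    by (intro Hspace_sum Hspace_cmult w1) auto
  show RH: "R \<in> Hspace \<Omega> \<sigma>" unfolding R_def by (intro Hspace_diff Hspace_cmult w0 S)
  have tJ: "t \<in> J" using J h by auto
  have B0: "0 \<le> B" using B[OF tJ] Hnorm_nonneg[of \<Omega> \<sigma> "w (Suc s) t"] by linarith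
  let ?\<phi> = "\<lambda>j \<tau>. Hinner \<Omega> \<sigma> (w j \<tau>) R"
  have der: "(?\<phi> j has_vector_derivative ?\<phi> (Suc j) \<tau>) (at \<tau> within J)" if "j \<le> s" "\<tau> \<in> J" for j \<tau>
    by (rule has_vector_derivative_within_subset[OF Hinner_has_vector_derivative[OF d[OF that(1)] w w RH] JI]) (use that JI in auto)
  have K: "cmod (?\<phi> (Suc s) \<tau>) \<le> B * Hnorm \<Omega> \<sigma> R" if "\<tau> \<in> J" for \<tau>
    using Hinner_le[OF w[of "Suc s" \<tau>] RH] mult_right_mono[OF B[OF that] Hnorm_nonneg[of \<Omega> \<sigma> R]] that JI by fastforce
  have HS: "Hinner \<Omega> \<sigma> (\<lambda>x. \<Sum>j<s. complex_of_real (a j) * w 1 (t + c j * h) x) R = (\<Sum>j<s. complex_of_real (a j) * ?\<phi> 1 (t + c j * h))"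
    by (rule Hinner_sum[OF finite_lessThan w1 RH])
  have "Hinner \<Omega> \<sigma> R R = ?\<phi> 0 (t + y * h) - ?\<phi> 0 t - complex_of_real h * (\<Sum>j<s. complex_of_real (a j) * ?\<phi> 1 (t + c j * h))"
    by (subst (1) R_def) (simp add: Hinner_diff Hinner_cmult HS Hspace_diff Hspace_cmult w0 S RH del: One_nat_def)
  then have "cmod (Hinner \<Omega> \<sigma> R R) \<le> (B * Hnorm \<Omega> \<sigma> R) * h ^ Suc s * (1 + (\<Sum>j<s. \<bar>a j\<bar>))"
    using quadrature_scalar[of s J ?\<phi>, OF der K J h y c mom] by simp
  then have "cmod (Hinner \<Omega> \<sigma> R R) \<le> (B * h ^ Suc s * (1 + (\<Sum>j<s. \<bar>a j\<bar>))) * Hnorm \<Omega> \<sigma> R" by (simp add: mult_ac)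
  then show "Hnorm \<Omega> \<sigma> R \<le> B * h ^ Suc s * (1 + (\<Sum>j<s. \<bar>a j\<bar>))"
    by (rule Hnorm_le_by_duality[OF RH]) (intro mult_nonneg_nonneg B0 zero_le_power h add_nonneg_nonneg sum_nonneg; simp)
qed

lemma extrapolation_defect:
  fixes a :: "nat \<Rightarrow> complex" and c :: "nat \<Rightarrow> real"
  assumes w: "\<And>j t. j \<le> s \<Longrightarrow> t \<in> I \<Longrightarrow> w j t \<in> Hspace \<Omega> \<sigma>"
    and d: "\<And>j. j < s \<Longrightarrow> has_Hderivative_on \<Omega> \<sigma> I (w j) (w (Suc j))"
    and JI: "J \<subseteq> I" and B: "\<And>\<tau>. \<tau> \<in> J \<Longrightarrow> Hnorm \<Omega> \<sigma> (w s \<tau>) \<le> B"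
    and J: "{t - h..t + h} \<subseteq> J" and h: "0 \<le> h" and y: "0 \<le> y" "y \<le> 1" and c: "\<And>j. j < s \<Longrightarrow> 0 \<le> c j \<and> c j \<le> 1"
    and s: "s \<ge> 1"
    and mom: "\<And>q. q < s \<Longrightarrow> complex_of_real y ^ q = (\<Sum>j<s. a j * complex_of_real (c j - 1) ^ q) + (if q = 0 then b else 0)"
  shows "(\<lambda>x. w 0 (t + y * h) x - (\<Sum>j<s. a j * w 0 (t + (c j - 1) * h) x) - b * w 0 t x) \<in> Hspace \<Omega> \<sigma>"
    "Hnorm \<Omega> \<sigma> (\<lambda>x. w 0 (t + y * h) x - (\<Sum>j<s. a j * w 0 (t + (c j - 1) * h) x) - b * w 0 t x)
      \<le> B * h ^ s * (1 + (\<Sum>j<s. cmod (a j)))"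
proof -
  define R where "R = (\<lambda>x. w 0 (t + y * h) x - (\<Sum>j<s. a j * w 0 (t + (c j - 1) * h) x) - b * w 0 t x)"
  have pt: "t + x * h \<in> I" if "\<bar>x\<bar> \<le> 1" for x
  proof -
    have "\<bar>x * h\<bar> \<le> h" using that h by (simp add: abs_mult mult_left_le_one_le)
    then have "t + x * h \<in> {t - h..t + h}" by (auto simp: abs_le_iff)
    with J JI show ?thesis by blast
  qed
  have tI: "t \<in> I" using pt[of 0] by simp
  have w0: "w 0 (t + y * h) \<in> Hspace \<Omega> \<sigma>" "w 0 t \<in> Hspace \<Omega> \<sigma>" using w pt[of y] y tI by auto
  have w1: "w 0 (t + (c j - 1) * h) \<in> Hspace \<Omega> \<sigma>" if "j \<in> {..<s}" for j using w pt[of "c j - 1"] c[of j] that by auto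
  have S: "(\<lambda>x. \<Sum>j<s. a j * w 0 (t + (c j - 1) * h) x) \<in> Hspace \<Omega> \<sigma>"
    by (intro Hspace_sum Hspace_cmult w1) auto
  show RH: "R \<in> Hspace \<Omega> \<sigma>" unfolding R_def by (intro Hspace_diff Hspace_cmult w0 S)
  have tJ: "t \<in> J" using J h by auto
  have B0: "0 \<le> B" using B[OF tJ] Hnorm_nonneg[of \<Omega> \<sigma> "w s t"] by linarith
  let ?\<phi> = "\<lambda>j \<tau>. Hinner \<Omega> \<sigma> (w j \<tau>) R"
  have der: "(?\<phi> j has_vector_derivative ?\<phi> (Suc j) \<tau>) (at \<tau> within J)" if "j < s" "\<tau> \<in> J" for j \<tau>
    by (rule has_vector_derivative_within_subset[OF Hinner_has_vector_derivative[OF d[OF that(1)] w w RH] JI]) (use that JI in auto)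
  have K: "cmod (?\<phi> s \<tau>) \<le> B * Hnorm \<Omega> \<sigma> R" if "\<tau> \<in> J" for \<tau>
    using Hinner_le[OF w[of s \<tau>] RH] mult_right_mono[OF B[OF that] Hnorm_nonneg[of \<Omega> \<sigma> R]] that JI by fastforce
  have HS: "Hinner \<Omega> \<sigma> (\<lambda>x. \<Sum>j<s. a j * w 0 (t + (c j - 1) * h) x) R = (\<Sum>j<s. a j * ?\<phi> 0 (t + (c j - 1) * h))"
    by (rule Hinner_sum[OF finite_lessThan w1 RH])
  have "Hinner \<Omega> \<sigma> R R = ?\<phi> 0 (t + y * h) - (\<Sum>j<s. a j * ?\<phi> 0 (t + (c j - 1) * h)) - b * ?\<phi> 0 t"
    by (subst (1) R_def) (simp add: Hinner_diff Hinner_cmult HS Hspace_diff Hspace_cmult w0 S RH)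
  then have "cmod (Hinner \<Omega> \<sigma> R R) \<le> (B * Hnorm \<Omega> \<sigma> R) * h ^ s * (1 + (\<Sum>j<s. cmod (a j)))"
    using extrapolation_scalar[of s J ?\<phi>, OF der K J h y c s mom] by simp
  then have "cmod (Hinner \<Omega> \<sigma> R R) \<le> (B * h ^ s * (1 + (\<Sum>j<s. cmod (a j)))) * Hnorm \<Omega> \<sigma> R" by (simp add: mult_ac)
  then show "Hnorm \<Omega> \<sigma> R \<le> B * h ^ s * (1 + (\<Sum>j<s. cmod (a j)))"
    by (rule Hnorm_le_by_duality[OF RH]) (intro mult_nonneg_nonneg B0 zero_le_power h add_nonneg_nonneg sum_nonneg; simp)
qed

text \<open>As \<open>D\<close> may have norm above 1, a bound on G n alone does not propagate. The
  induction instead bounds D^k G n by \<delta>^k X for all k at once, and k = 0 is the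
  claim.\<close>

lemma power_decay_recursion:
  fixes D :: "complex Matrix.mat"
  assumes D: "D \<in> carrier_mat s s" and C: "\<And>k i j. i < s \<Longrightarrow> j < s \<Longrightarrow> cmod ((D ^\<^sub>m k) $$ (i, j)) \<le> C * \<delta> ^ k"
    and \<delta>: "0 < \<delta>" "\<delta> < 1" and C0: "0 \<le> C"
    and G: "\<And>n i. n \<le> m \<Longrightarrow> i < s \<Longrightarrow> G n i \<in> Hspace \<Omega> \<sigma>" and R: "\<And>n i. n < m \<Longrightarrow> i < s \<Longrightarrow> R n i \<in> Hspace \<Omega> \<sigma>"
    and rec: "\<And>n i. n < m \<Longrightarrow> i < s \<Longrightarrow> G (Suc n) i = (\<lambda>x. (\<Sum>j<s. D $$ (i, j) * G n j x) + R n i x)"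
    and g: "\<And>i. i < s \<Longrightarrow> Hnorm \<Omega> \<sigma> (G 0 i) \<le> g" and r: "\<And>n i. n < m \<Longrightarrow> i < s \<Longrightarrow> Hnorm \<Omega> \<sigma> (R n i) \<le> r"
    and g0: "0 \<le> g" and r0: "0 \<le> r" and n: "n \<le> m" and i: "i < s"
  shows "Hnorm \<Omega> \<sigma> (G n i) \<le> real s * C * (g + r / (1 - \<delta>))"
proof -
  define X where "X = real s * C * (g + r / (1 - \<delta>))"
  have pow: "Hnorm \<Omega> \<sigma> (\<lambda>x. \<Sum>j<s. (D ^\<^sub>m k) $$ (i, j) * F j x) \<le> real s * C * \<delta> ^ k * y"
    if F: "\<And>j. j < s \<Longrightarrow> F j \<in> Hspace \<Omega> \<sigma>" and y: "\<And>j. j < s \<Longrightarrow> Hnorm \<Omega> \<sigma> (F j) \<le> y" and i: "i < s" for F k y i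
  proof -
    have "Hnorm \<Omega> \<sigma> (\<lambda>x. \<Sum>j<s. (D ^\<^sub>m k) $$ (i, j) * F j x) \<le> (\<Sum>j<s. cmod ((D ^\<^sub>m k) $$ (i, j)) * Hnorm \<Omega> \<sigma> (F j))"
      using F by (intro Hnorm_sum_le) auto
    also have "\<dots> \<le> (\<Sum>j<s. (C * \<delta> ^ k) * y)"
      using C i y C0 \<delta> by (intro sum_mono mult_mono) auto
    finally show ?thesis by (simp add: mult.assoc)
  qed
  have "Hnorm \<Omega> \<sigma> (\<lambda>x. \<Sum>j<s. (D ^\<^sub>m k) $$ (i, j) * G n j x) \<le> \<delta> ^ k * X" if "n \<le> m" "i < s" for n k i
    using that
  proof (induction n arbitrary: k i)
    case 0
    have "Hnorm \<Omega> \<sigma> (\<lambda>x. \<Sum>j<s. (D ^\<^sub>m k) $$ (i, j) * G 0 j x) \<le> real s * C * \<delta> ^ k * g"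
      using 0 G g by (intro pow) auto
    also have "\<dots> \<le> real s * C * \<delta> ^ k * (g + r / (1 - \<delta>))"
      using C0 \<delta> r0 by (intro mult_left_mono) auto
    finally show ?case by (simp add: X_def mult_ac)
  next
    case (Suc n)
    have Dk: "D ^\<^sub>m k \<in> carrier_mat s s" using D by simp
    have nm: "n < m" "n \<le> m" using Suc.prems by auto
    have Gn: "G n j \<in> Hspace \<Omega> \<sigma>" "R n j \<in> Hspace \<Omega> \<sigma>" if "j < s" for j using G R nm that by auto
    have eq: "(\<Sum>j<s. (D ^\<^sub>m k) $$ (i, j) * G (Suc n) j x)
        = (\<Sum>j<s. (D ^\<^sub>m Suc k) $$ (i, j) * G n j x) + (\<Sum>j<s. (D ^\<^sub>m k) $$ (i, j) * R n j x)" for x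
    proof -
      have "(\<Sum>j<s. (D ^\<^sub>m k) $$ (i, j) * G (Suc n) j x) = (\<Sum>j<s. (D ^\<^sub>m k) $$ (i, j) * ((\<Sum>l<s. D $$ (j, l) * G n l x) + R n j x))"
        using rec nm by (intro sum.cong refl) simp
      also have "\<dots> = (\<Sum>j<s. \<Sum>l<s. (D ^\<^sub>m k) $$ (i, j) * D $$ (j, l) * G n l x) + (\<Sum>j<s. (D ^\<^sub>m k) $$ (i, j) * R n j x)"
        by (simp add: distrib_left sum.distrib sum_distrib_left mult.assoc)
      also have "(\<Sum>j<s. \<Sum>l<s. (D ^\<^sub>m k) $$ (i, j) * D $$ (j, l) * G n l x) = (\<Sum>l<s. \<Sum>j<s. (D ^\<^sub>m k) $$ (i, j) * D $$ (j, l) * G n l x)"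
        by (rule sum.swap)
      also have "\<dots> = (\<Sum>l<s. (D ^\<^sub>m Suc k) $$ (i, l) * G n l x)"
        using mat_mult_entry[OF Dk D \<open>i < s\<close>] by (intro sum.cong refl) (simp add: sum_distrib_right)
      finally show ?thesis .
    qed
    have "Hnorm \<Omega> \<sigma> (\<lambda>x. \<Sum>j<s. (D ^\<^sub>m k) $$ (i, j) * G (Suc n) j x)
        \<le> Hnorm \<Omega> \<sigma> (\<lambda>x. \<Sum>j<s. (D ^\<^sub>m Suc k) $$ (i, j) * G n j x) + Hnorm \<Omega> \<sigma> (\<lambda>x. \<Sum>j<s. (D ^\<^sub>m k) $$ (i, j) * R n j x)"
      unfolding eq using Gn by (intro Hnorm_triangle Hspace_sum Hspace_cmult) auto
    also have "\<dots> \<le> \<delta> ^ Suc k * X + real s * C * \<delta> ^ k * r"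
      using Suc Gn r nm by (intro add_mono pow Suc.IH) auto
    also have "\<dots> = \<delta> ^ k * (real s * C * (\<delta> * g + (\<delta> * (r / (1 - \<delta>)) + r)))"
      by (simp add: X_def algebra_simps)
    \<comment> \<open>The fixed point equation that dictates the summand r / (1 - \<delta>) of
      X.\<close>
    also have "\<delta> * (r / (1 - \<delta>)) + r = r / (1 - \<delta>)" using \<delta> by (simp add: field_simps)
    also have "\<delta> ^ k * (real s * C * (\<delta> * g + r / (1 - \<delta>))) \<le> \<delta> ^ k * X"
      unfolding X_def using C0 \<delta> g0 by (intro mult_left_mono add_right_mono mult_nonneg_nonneg) (auto simp: mult_left_le_one_le)
    finally show ?case .
  qed
  from this[OF n i, of 0] have "Hnorm \<Omega> \<sigma> (\<lambda>x. \<Sum>j<s. (D ^\<^sub>m 0) $$ (i, j) * G n j x) \<le> X" by simp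
  moreover have "(\<lambda>x. \<Sum>j<s. (D ^\<^sub>m 0) $$ (i, j) * G n j x) = G n i"
  proof
    fix x
    have "(\<Sum>j<s. (D ^\<^sub>m 0) $$ (i, j) * G n j x) = (\<Sum>j<s. if i = j then G n j x else 0)"
      using D i by (intro sum.cong refl) auto
    then show "(\<Sum>j<s. (D ^\<^sub>m 0) $$ (i, j) * G n j x) = G n i x" using i by simp
  qed
  ultimately show ?thesis by (simp add: X_def)
qed

section \<open>One step of the method\<close>

text \<open>The perturbed test equation at one frequency, with z = h times the symbol: e is the
  error at the start, E the stage errors, F the sources entering with a factor h, and Q the defects
  of the stages. C is uniform in z, and the update keeps e with coefficient 1.\<close>

definition step_bounds :: "complex set \<Rightarrow> nat \<Rightarrow> real Matrix.mat \<Rightarrow> real Matrix.vec \<Rightarrow> real \<Rightarrow> bool" where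
  "step_bounds S s A b C \<longleftrightarrow> 0 \<le> C \<and> (\<forall>z\<in>S. \<forall>h\<ge>0. \<forall>e E F Q.
     (\<forall>i<s. E i = e + z * (\<Sum>j<s. complex_of_real (A $$ (i, j)) * E j) + complex_of_real h * (\<Sum>j<s. complex_of_real (A $$ (i, j)) * F j) + Q i) \<longrightarrow>
     (\<forall>i<s. cmod (E i) \<le> C * (cmod e + h * (\<Sum>k<s. cmod (F k)) + (\<Sum>k<s. cmod (Q k)))) \<and>
     cmod (e + z * (\<Sum>i<s. complex_of_real (b $ i) * E i) + complex_of_real h * (\<Sum>i<s. complex_of_real (b $ i) * F i))
       \<le> cmod e + C * (h * (\<Sum>k<s. cmod (F k)) + (\<Sum>k<s. cmod (Q k))))"

text \<open>Solving for the stages gives E = B(z) (e + r), bounded by the third stability notion. In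
  the update, e is multiplied by R(z) and the perturbations r by the row z b^t B(z), bounded by the
  first and the second.\<close>

lemma step_bounds_exist:
  assumes A: "A \<in> carrier_mat s s"
    and stab: "stable_on S s A b" "S_stable_on S s A b" "SI_stable_on S s A"
  shows "\<exists>C. step_bounds S s A b C"
proof -
  have inv: "\<And>z. z \<in> S \<Longrightarrow> invertible_mat (stab_matrix s A z)" using stab(3) by (simp add: SI_stable_on_def)
  obtain KB0 where KB0: "\<forall>z\<in>S. \<forall>i<s. \<forall>j<s. cmod (stab_inverse s A z $$ (i, j)) \<le> KB0" using stab(3) by (auto simp: SI_stable_on_def)
  obtain KR0 where KR0: "\<forall>j<s. \<forall>z\<in>S. cmod (stab_row s A b j z) \<le> KR0" using stab(2) inv unfolding S_stable_on_def by auto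
  have R1: "cmod (stab_function s A b z) \<le> 1" if "z \<in> S" for z using stab(1) inv[OF that] that unfolding stable_on_def by auto
  define KB where "KB = max 0 KB0"
  define KR where "KR = max 0 KR0"
  have KB: "0 \<le> KB" "\<And>z i j. z \<in> S \<Longrightarrow> i < s \<Longrightarrow> j < s \<Longrightarrow> cmod (stab_inverse s A z $$ (i, j)) \<le> KB"
    using KB0 by (auto simp: KB_def le_max_iff_disj)
  have KR: "0 \<le> KR" "\<And>z j. z \<in> S \<Longrightarrow> j < s \<Longrightarrow> cmod (stab_row s A b j z) \<le> KR"
    using KR0 by (auto simp: KR_def le_max_iff_disj)
  define \<alpha> where "\<alpha> = (\<Sum>i<s. \<Sum>j<s. \<bar>A $$ (i, j)\<bar>)"
  define \<beta> where "\<beta> = (\<Sum>i<s. \<bar>b $ i\<bar>)"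
  have \<alpha>: "0 \<le> \<alpha>" "\<And>i j. i < s \<Longrightarrow> j < s \<Longrightarrow> \<bar>A $$ (i, j)\<bar> \<le> \<alpha>"
  proof -
    show "0 \<le> \<alpha>" unfolding \<alpha>_def by (intro sum_nonneg) auto
    fix i j assume ij: "i < s" "j < s"
    have "\<bar>A $$ (i, j)\<bar> \<le> (\<Sum>j<s. \<bar>A $$ (i, j)\<bar>)" using ij by (intro member_le_sum) auto
    also have "\<dots> \<le> \<alpha>" unfolding \<alpha>_def using ij by (intro member_le_sum[of i "{..<s}" "\<lambda>i. \<Sum>j<s. \<bar>A $$ (i, j)\<bar>"]) (auto intro: sum_nonneg)
    finally show "\<bar>A $$ (i, j)\<bar> \<le> \<alpha>" .
  qed
  have \<beta>: "0 \<le> \<beta>" "\<And>i. i < s \<Longrightarrow> \<bar>b $ i\<bar> \<le> \<beta>"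
    unfolding \<beta>_def by (auto intro: sum_nonneg member_le_sum)
  \<comment> \<open>The first summand bounds the stages; the bracket bounds the update, namely the
    row applied to r and the direct term h b F.\<close>
  define C where "C = real s * KB * (\<alpha> + 1) + (real s * KR * (\<alpha> + 1) + \<beta>)"
  have key: "(\<forall>i<s. cmod (E i) \<le> C * (cmod e + h * (\<Sum>k<s. cmod (F k)) + (\<Sum>k<s. cmod (Q k)))) \<and>
      cmod (e + z * (\<Sum>i<s. complex_of_real (b $ i) * E i) + complex_of_real h * (\<Sum>i<s. complex_of_real (b $ i) * F i))
        \<le> cmod e + C * (h * (\<Sum>k<s. cmod (F k)) + (\<Sum>k<s. cmod (Q k)))"
    if z: "z \<in> S" and h: "0 \<le> h"
      and eq: "\<forall>i<s. E i = e + z * (\<Sum>j<s. complex_of_real (A $$ (i, j)) * E j) + complex_of_real h * (\<Sum>j<s. complex_of_real (A $$ (i, j)) * F j) + Q i"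
    for z h e E F Q
  proof -
    define r where "r i = complex_of_real h * (\<Sum>j<s. complex_of_real (A $$ (i, j)) * F j) + Q i" for i
    define X where "X = h * (\<Sum>k<s. cmod (F k)) + (\<Sum>k<s. cmod (Q k))"
    have X: "0 \<le> X" unfolding X_def using h by (intro add_nonneg_nonneg mult_nonneg_nonneg sum_nonneg) auto
    have "\<forall>i<s. E i = (e + r i) + z * (\<Sum>j<s. complex_of_real (A $$ (i, j)) * E j)"
    proof (intro allI impI)
      fix i assume i: "i < s"
      have "E i = e + z * (\<Sum>j<s. complex_of_real (A $$ (i, j)) * E j) + complex_of_real h * (\<Sum>j<s. complex_of_real (A $$ (i, j)) * F j) + Q i"
        using eq i by blast
      also have "\<dots> = (e + r i) + z * (\<Sum>j<s. complex_of_real (A $$ (i, j)) * E j)" by (simp add: r_def)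
      finally show "E i = (e + r i) + z * (\<Sum>j<s. complex_of_real (A $$ (i, j)) * E j)" .
    qed
    then have sol: "\<forall>i<s. E i = (\<Sum>j<s. stab_inverse s A z $$ (i, j) * (e + r j))"
      using stab_solve[OF A inv[OF z], of E "\<lambda>i. e + r i"] by blast
    have r: "cmod (r i) \<le> (\<alpha> + 1) * X" if i: "i < s" for i
    proof -
      have "cmod (r i) \<le> h * (\<Sum>j<s. \<bar>A $$ (i, j)\<bar> * cmod (F j)) + cmod (Q i)"
        unfolding r_def using h
        by (intro order_trans[OF norm_triangle_ineq add_right_mono]) (auto simp: norm_mult intro!: mult_left_mono order_trans[OF norm_sum] sum_mono)
      also have "\<dots> \<le> h * (\<Sum>j<s. \<alpha> * cmod (F j)) + (\<Sum>k<s. cmod (Q k))"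
        using i h by (intro add_mono mult_left_mono sum_mono mult_right_mono \<alpha>(2) member_le_sum) auto
      also have "\<dots> = \<alpha> * (h * (\<Sum>k<s. cmod (F k))) + (\<Sum>k<s. cmod (Q k))" by (simp add: sum_distrib_left mult_ac)
      also have "\<dots> \<le> \<alpha> * X + X" unfolding X_def using \<alpha>(1) h
        by (intro add_mono mult_left_mono) (auto intro!: sum_nonneg mult_nonneg_nonneg)
      finally show ?thesis by (simp add: algebra_simps)
    qed
    have "cmod (E i) \<le> C * (cmod e + X)" if i: "i < s" for i
    proof -
      have "cmod (E i) \<le> (\<Sum>j<s. KB * (cmod e + (\<alpha> + 1) * X))"
      proof -
        have "cmod (E i) \<le> (\<Sum>j<s. cmod (stab_inverse s A z $$ (i, j) * (e + r j)))" 
        proof -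
          have "E i = (\<Sum>j<s. stab_inverse s A z $$ (i, j) * (e + r j))" using sol i by blast
          then show ?thesis by (simp only: norm_sum)
        qed
        also have "\<dots> \<le> (\<Sum>j<s. KB * (cmod e + (\<alpha> + 1) * X))"
        proof (rule sum_mono)
          fix j assume "j \<in> {..<s}"
          then have j: "j < s" by simp
          have "cmod (e + r j) \<le> cmod e + (\<alpha> + 1) * X" using norm_triangle_ineq[of e "r j"] r[OF j] by linarith
          then show "cmod (stab_inverse s A z $$ (i, j) * (e + r j)) \<le> KB * (cmod e + (\<alpha> + 1) * X)"
            unfolding norm_mult by (rule mult_mono[OF KB(2)[OF z i j]]) (use KB(1) in simp_all)
        qed
        finally show ?thesis .
      qed
      also have "\<dots> = real s * KB * (cmod e + (\<alpha> + 1) * X)" by simp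
      also have "\<dots> \<le> real s * KB * ((\<alpha> + 1) * (cmod e + X))"
      proof (intro mult_left_mono)
        show "cmod e + (\<alpha> + 1) * X \<le> (\<alpha> + 1) * (cmod e + X)" using \<alpha>(1) by (simp add: algebra_simps)
      qed (use KB in auto)
      also have "\<dots> = (real s * KB * (\<alpha> + 1)) * (cmod e + X)" by simp
      also have "\<dots> \<le> C * (cmod e + X)" unfolding C_def using KR \<alpha> \<beta> X
        by (intro mult_right_mono) auto
      finally show ?thesis .
    qed
    moreover have "cmod (e + z * (\<Sum>i<s. complex_of_real (b $ i) * E i) + complex_of_real h * (\<Sum>i<s. complex_of_real (b $ i) * F i)) \<le> cmod e + C * X"
    proof -
      have "z * (\<Sum>i<s. complex_of_real (b $ i) * E i) = (\<Sum>j<s. stab_row s A b j z * (e + r j))" by (rule stab_row_apply[OF sol])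
      then have "e + z * (\<Sum>i<s. complex_of_real (b $ i) * E i) = stab_function s A b z * e + (\<Sum>j<s. stab_row s A b j z * r j)"
        by (simp add: stab_function_def algebra_simps sum.distrib sum_distrib_left)
      then have "cmod (e + z * (\<Sum>i<s. complex_of_real (b $ i) * E i) + complex_of_real h * (\<Sum>i<s. complex_of_real (b $ i) * F i))
          \<le> cmod (stab_function s A b z * e) + cmod (\<Sum>j<s. stab_row s A b j z * r j) + cmod (complex_of_real h * (\<Sum>i<s. complex_of_real (b $ i) * F i))"
        by (simp only:) (intro order_trans[OF norm_triangle_ineq add_right_mono] norm_triangle_ineq)
      also have "\<dots> \<le> cmod e + (\<Sum>j<s. KR * ((\<alpha> + 1) * X)) + \<beta> * X"
      proof (intro add_mono)
        show "cmod (stab_function s A b z * e) \<le> cmod e" unfolding norm_mult by (rule mult_left_le_one_le) (use R1[OF z] in auto)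
        show "cmod (\<Sum>j<s. stab_row s A b j z * r j) \<le> (\<Sum>j<s. KR * ((\<alpha> + 1) * X))"
          
        proof (rule order_trans[OF norm_sum sum_mono])
          fix j assume "j \<in> {..<s}"
          then have j: "j < s" by simp
          show "cmod (stab_row s A b j z * r j) \<le> KR * ((\<alpha> + 1) * X)"
            unfolding norm_mult by (rule mult_mono[OF KR(2)[OF z j] r[OF j] KR(1)]) simp
        qed
        have "cmod (complex_of_real h * (\<Sum>i<s. complex_of_real (b $ i) * F i)) \<le> h * (\<Sum>i<s. \<beta> * cmod (F i))"
          using h by (auto simp: norm_mult intro!: mult_left_mono order_trans[OF norm_sum] sum_mono mult_right_mono \<beta>)
        also have "\<dots> = \<beta> * (h * (\<Sum>i<s. cmod (F i)))" by (simp add: sum_distrib_left mult_ac)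
        also have "\<dots> \<le> \<beta> * X" unfolding X_def using \<beta>(1) by (intro mult_left_mono) (auto intro: sum_nonneg)
        finally show "cmod (complex_of_real h * (\<Sum>i<s. complex_of_real (b $ i) * F i)) \<le> \<beta> * X" .
      qed
      also have "\<dots> = cmod e + (real s * KR * (\<alpha> + 1) + \<beta>) * X" by (simp add: algebra_simps)
      also have "\<dots> \<le> cmod e + C * X" unfolding C_def using KB \<alpha> X by (intro add_left_mono mult_right_mono) auto
      finally show ?thesis .
    qed
    ultimately show ?thesis unfolding X_def by (simp add: add.assoc)
  qed
  have "0 \<le> C" unfolding C_def using KB KR \<alpha> \<beta> by (intro add_nonneg_nonneg mult_nonneg_nonneg) auto
  with key have "step_bounds S s A b C" unfolding step_bounds_def by blast
  then show ?thesis ..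
qed

definition laplace_symbol :: "complex \<Rightarrow> real^'d \<Rightarrow> complex" where
  "laplace_symbol \<kappa> \<xi> = \<kappa> * complex_of_real (- 4 * pi\<^sup>2 * (norm \<xi>)\<^sup>2)"

lemma Lhat_symbol: "Lhat \<Omega> \<kappa> f \<xi> = laplace_symbol \<kappa> \<xi> * fourier \<Omega> f \<xi>"
  by (simp add: Lhat_def laplace_symbol_def)

lemma laplace_symbol_measurable: "laplace_symbol \<kappa> \<in> borel_measurable (freq_measure \<Omega> :: (real^'d) measure)"
  by (intro freq_borel_measurable borel_measurable_continuous_onI) (auto simp: laplace_symbol_def[abs_def] intro!: continuous_intros)

lemma sum_norms_sq_int:
  fixes F :: "nat \<Rightarrow> 'a \<Rightarrow> complex"
  assumes "\<And>k. k < s \<Longrightarrow> F k \<in> sq_int M"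
  shows "(\<lambda>x. complex_of_real (\<Sum>k<s. cmod (F k x))) \<in> sq_int M"
    "sq_norm M (\<lambda>x. complex_of_real (\<Sum>k<s. cmod (F k x))) \<le> (\<Sum>k<s. sq_norm M (F k))"
proof -
  have "(\<lambda>x. complex_of_real (\<Sum>k<s. cmod (F k x))) \<in> borel_measurable M"
    using sq_int_measurable[OF assms] unfolding of_real_sum
    by (intro borel_measurable_sum borel_measurable_norm measurable_compose[OF borel_measurable_norm]) auto
  note D = sq_norm_dominated[OF this, of "{..<s}" F "\<lambda>_. 1"]
  have nn: "cmod (complex_of_real (\<Sum>k<s. cmod (F k x))) = (\<Sum>k<s. 1 * cmod (F k x))" for x
    unfolding norm_of_real by (simp add: sum_nonneg)
  have ae: "AE x in M. cmod (complex_of_real (\<Sum>k<s. cmod (F k x))) \<le> (\<Sum>k<s. 1 * cmod (F k x))"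
    by (intro AE_I2) (simp only: nn order_refl)
  have "F k \<in> sq_int M" "(0::real) \<le> 1" if "k \<in> {..<s}" for k using assms that by auto
  note D' = D[OF finite_lessThan this ae]
  show "(\<lambda>x. complex_of_real (\<Sum>k<s. cmod (F k x))) \<in> sq_int M" by (rule D'(1))
  have "sq_norm M (\<lambda>x. complex_of_real (\<Sum>k<s. cmod (F k x))) \<le> (\<Sum>k<s. 1 * sq_norm M (F k))" by (rule D'(2))
  then show "sq_norm M (\<lambda>x. complex_of_real (\<Sum>k<s. cmod (F k x))) \<le> (\<Sum>k<s. sq_norm M (F k))" by simp
qed

text \<open>The shape taken by all stage and update bounds: a starting error, two sums over the
  stages and one further defect.\<close>

lemma sq_norm_dominated4:
  fixes F Q :: "nat \<Rightarrow> 'a \<Rightarrow> complex"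
  assumes "f \<in> borel_measurable M" "e \<in> sq_int M" "\<And>k. k < s \<Longrightarrow> F k \<in> sq_int M" "\<And>k. k < s \<Longrightarrow> Q k \<in> sq_int M" "q \<in> sq_int M"
    and c: "0 \<le> c0" "0 \<le> c1" "0 \<le> c2" "0 \<le> c3"
    and le: "AE x in M. cmod (f x) \<le> c0 * cmod (e x) + c1 * (\<Sum>k<s. cmod (F k x)) + c2 * (\<Sum>k<s. cmod (Q k x)) + c3 * cmod (q x)"
  shows "f \<in> sq_int M"
    "sq_norm M f \<le> c0 * sq_norm M e + c1 * (\<Sum>k<s. sq_norm M (F k)) + c2 * (\<Sum>k<s. sq_norm M (Q k)) + c3 * sq_norm M q"
proof -
  let ?F = "\<lambda>x. complex_of_real (\<Sum>k<s. cmod (F k x))" and ?Q = "\<lambda>x. complex_of_real (\<Sum>k<s. cmod (Q k x))"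
  have F: "?F \<in> sq_int M" "sq_norm M ?F \<le> (\<Sum>k<s. sq_norm M (F k))" by (rule sum_norms_sq_int(1)[OF assms(3)], assumption) (rule sum_norms_sq_int(2)[OF assms(3)])
  have Q: "?Q \<in> sq_int M" "sq_norm M ?Q \<le> (\<Sum>k<s. sq_norm M (Q k))" by (rule sum_norms_sq_int(1)[OF assms(4)], assumption) (rule sum_norms_sq_int(2)[OF assms(4)])
  let ?g = "\<lambda>k. [e, ?F, ?Q, q] ! k" and ?c = "\<lambda>k. [c0, c1, c2, c3] ! k"
  have four: "{..<4::nat} = {0, 1, 2, 3}" by auto
  have nn: "\<bar>\<Sum>k<s. cmod (H k x)\<bar> = (\<Sum>k<s. cmod (H k x))" for H :: "nat \<Rightarrow> 'a \<Rightarrow> complex" and x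
    by (intro abs_of_nonneg sum_nonneg) auto
  have g: "?g k \<in> sq_int M" "0 \<le> ?c k" if "k \<in> {..<4}" for k
    using that assms F Q unfolding four by (auto simp del: of_real_sum)
  have s4: "(\<Sum>k\<in>{..<4}. ?c k * h (?g k)) = c0 * h e + c1 * h ?F + c2 * h ?Q + c3 * h q" for h :: "('a \<Rightarrow> complex) \<Rightarrow> real"
    unfolding four by simp
  have "AE x in M. cmod (f x) \<le> (\<Sum>k\<in>{..<4}. ?c k * cmod (?g k x))"
    using le
  proof eventually_elim
    case (elim x)
    then show ?case unfolding s4[of "\<lambda>g. cmod (g x)"] norm_of_real nn .
  qed
  note D = sq_norm_dominated[OF assms(1) finite_lessThan g this]
  show "f \<in> sq_int M" by (rule D(1))
  have "sq_norm M f \<le> c0 * sq_norm M e + c1 * sq_norm M ?F + c2 * sq_norm M ?Q + c3 * sq_norm M q"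
    using D(2) unfolding s4[of "sq_norm M"] .
  also have "\<dots> \<le> c0 * sq_norm M e + c1 * (\<Sum>k<s. sq_norm M (F k)) + c2 * (\<Sum>k<s. sq_norm M (Q k)) + c3 * sq_norm M q"
    by (intro add_mono mult_left_mono F(2) Q(2) order_refl c)
  finally show "sq_norm M f \<le> c0 * sq_norm M e + c1 * (\<Sum>k<s. sq_norm M (F k)) + c2 * (\<Sum>k<s. sq_norm M (Q k)) + c3 * sq_norm M q" .
qed

text \<open>The parameter \<open>dummy\<close> only carries the dimension \<open>CARD('d)\<close>.\<close>

locale rk_method =
  fixes \<Omega> :: domain and \<sigma> :: real and \<kappa> :: complex and s :: nat and A :: "real Matrix.mat" and b :: "real Matrix.vec"
    and S :: "complex set" and C :: real and dummy :: "'d::finite itself"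
  assumes sigma: "\<sigma> > real CARD('d) / 2" and A: "A \<in> carrier_mat s s" and SI: "SI_stable_on S s A"
    and symbol: "\<And>h (\<xi> :: real^'d). 0 \<le> h \<Longrightarrow> complex_of_real h * laplace_symbol \<kappa> \<xi> \<in> S" and bounds: "step_bounds S s A b C"
begin

abbreviation H :: "(real^'d \<Rightarrow> complex) set" where "H \<equiv> Hspace \<Omega> \<sigma>"
abbreviation nrm :: "(real^'d \<Rightarrow> complex) \<Rightarrow> real" where "nrm \<equiv> Hnorm \<Omega> \<sigma>"
abbreviation sm :: "(real^'d) measure" where "sm \<equiv> sob_measure \<Omega> \<sigma>"
abbreviation \<nu> :: "(real^'d) measure" where "\<nu> \<equiv> freq_measure \<Omega>"
abbreviation four :: "(real^'d \<Rightarrow> complex) \<Rightarrow> real^'d \<Rightarrow> complex" where "four \<equiv> fourier \<Omega>"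

lemma C0: "0 \<le> C"
  by (rule bounds[unfolded step_bounds_def, THEN conjunct1])

lemma
  assumes "z \<in> S" "0 \<le> h" "\<forall>i<s. E i = e + z * (\<Sum>j<s. complex_of_real (A $$ (i, j)) * E j) + complex_of_real h * (\<Sum>j<s. complex_of_real (A $$ (i, j)) * F j) + Q i"
  shows stage_bound: "\<forall>i<s. cmod (E i) \<le> C * (cmod e + h * (\<Sum>k<s. cmod (F k)) + (\<Sum>k<s. cmod (Q k)))"
    and update_bound: "cmod (e + z * (\<Sum>i<s. complex_of_real (b $ i) * E i) + complex_of_real h * (\<Sum>i<s. complex_of_real (b $ i) * F i))
      \<le> cmod e + C * (h * (\<Sum>k<s. cmod (F k)) + (\<Sum>k<s. cmod (Q k)))"
proof -
  note B = bounds[unfolded step_bounds_def, THEN conjunct2, THEN bspec, OF assms(1), THEN spec, THEN mp, OF assms(2),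
      THEN spec, THEN spec, THEN spec, THEN spec, THEN mp, OF assms(3)]
  show "\<forall>i<s. cmod (E i) \<le> C * (cmod e + h * (\<Sum>k<s. cmod (F k)) + (\<Sum>k<s. cmod (Q k)))"
    "cmod (e + z * (\<Sum>i<s. complex_of_real (b $ i) * E i) + complex_of_real h * (\<Sum>i<s. complex_of_real (b $ i) * F i))
      \<le> cmod e + C * (h * (\<Sum>k<s. cmod (F k)) + (\<Sum>k<s. cmod (Q k)))"
    by (rule B[THEN conjunct1], rule B[THEN conjunct2])
qed

lemma H_L2: "f \<in> H \<Longrightarrow> f \<in> L2 \<Omega>"
  by (rule Hspace_L2)

lemma nrm_eq: "f \<in> H \<Longrightarrow> nrm f = sq_norm sm (four f)"
  by (rule Hnorm_eq[OF H_L2])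

text \<open>The weak form of the stage equations, with sources \<open>F\<close> and defects \<open>Q\<close>.\<close>

definition stage_eqs :: "real \<Rightarrow> (real^'d \<Rightarrow> complex) \<Rightarrow> (nat \<Rightarrow> real^'d \<Rightarrow> complex) \<Rightarrow> (nat \<Rightarrow> real^'d \<Rightarrow> complex) \<Rightarrow> (nat \<Rightarrow> real^'d \<Rightarrow> complex) \<Rightarrow> bool" where
  "stage_eqs h e E F Q \<longleftrightarrow> (\<forall>i<s. AE \<xi> in \<nu>. four (E i) \<xi> = four e \<xi> + complex_of_real h *
      (\<Sum>j<s. complex_of_real (A $$ (i, j)) * (Lhat \<Omega> \<kappa> (E j) \<xi> + four (F j) \<xi>)) + four (Q i) \<xi>)"

text \<open>One null set for all s stages, with the symbol of L separated from the sources as in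
  \<open>step_bounds\<close>.\<close>

lemma stage_eqs_AE:
  assumes "stage_eqs h e E F Q"
  shows "AE \<xi> in \<nu>. \<forall>i<s. four (E i) \<xi> = four e \<xi> + (complex_of_real h * laplace_symbol \<kappa> \<xi>) * (\<Sum>j<s. complex_of_real (A $$ (i, j)) * four (E j) \<xi>)
    + complex_of_real h * (\<Sum>j<s. complex_of_real (A $$ (i, j)) * four (F j) \<xi>) + four (Q i) \<xi>"
proof -
  have "AE \<xi> in \<nu>. \<forall>i\<in>{..<s}. four (E i) \<xi> = four e \<xi> + complex_of_real h *
      (\<Sum>j<s. complex_of_real (A $$ (i, j)) * (Lhat \<Omega> \<kappa> (E j) \<xi> + four (F j) \<xi>)) + four (Q i) \<xi>"
    using assms unfolding stage_eqs_def by (intro AE_finite_allI) auto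
  then show ?thesis
  proof eventually_elim
    case (elim \<xi>)
    have eq: "complex_of_real h * (\<Sum>j<s. complex_of_real (A $$ (i, j)) * (Lhat \<Omega> \<kappa> (E j) \<xi> + four (F j) \<xi>))
      = (complex_of_real h * laplace_symbol \<kappa> \<xi>) * (\<Sum>j<s. complex_of_real (A $$ (i, j)) * four (E j) \<xi>)
        + complex_of_real h * (\<Sum>j<s. complex_of_real (A $$ (i, j)) * four (F j) \<xi>)" for i
      by (simp add: Lhat_symbol distrib_left sum.distrib sum_distrib_left mult_ac)
    show ?case
    proof (intro allI impI)
      fix i assume i: "i < s"
      have "four (E i) \<xi> = four e \<xi> + complex_of_real h *
          (\<Sum>j<s. complex_of_real (A $$ (i, j)) * (Lhat \<Omega> \<kappa> (E j) \<xi> + four (F j) \<xi>)) + four (Q i) \<xi>"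
        by (rule bspec[OF elim]) (use i in simp)
      then show "four (E i) \<xi> = four e \<xi> + (complex_of_real h * laplace_symbol \<kappa> \<xi>) * (\<Sum>j<s. complex_of_real (A $$ (i, j)) * four (E j) \<xi>)
          + complex_of_real h * (\<Sum>j<s. complex_of_real (A $$ (i, j)) * four (F j) \<xi>) + four (Q i) \<xi>"
        unfolding eq[of i] by (simp only: add.assoc)
    qed
  qed
qed

lemma stage_estimate:
  assumes h: "0 \<le> h" and e: "e \<in> H" and E: "\<And>i. i < s \<Longrightarrow> E i \<in> H" and F: "\<And>i. i < s \<Longrightarrow> F i \<in> H" and Q: "\<And>i. i < s \<Longrightarrow> Q i \<in> H"
    and eqs: "stage_eqs h e E F Q" and i: "i < s"
  shows "nrm (E i) \<le> C * (nrm e + h * (\<Sum>k<s. nrm (F k)) + (\<Sum>k<s. nrm (Q k)))"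
proof -
  have "AE \<xi> in sm. cmod (four (E i) \<xi>) \<le> C * cmod (four e \<xi>) + (C * h) * (\<Sum>k<s. cmod (four (F k) \<xi>)) + C * (\<Sum>k<s. cmod (four (Q k) \<xi>)) + 0 * cmod (four e \<xi>)"
    unfolding AE_sob_measure using stage_eqs_AE[OF eqs]
  proof eventually_elim
    case (elim \<xi>)
    from stage_bound[OF symbol[OF h] h elim] i show ?case by (simp add: algebra_simps)
  qed
  from sq_norm_dominated4(2)[OF sq_int_measurable[OF Hspace_sq[OF E[OF i]]] Hspace_sq[OF e] Hspace_sq[OF F] Hspace_sq[OF Q] Hspace_sq[OF e] _ _ _ _ this]
  have "sq_norm sm (four (E i)) \<le> C * sq_norm sm (four e) + C * h * (\<Sum>k<s. sq_norm sm (four (F k))) + C * (\<Sum>k<s. sq_norm sm (four (Q k)))"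
    using C0 h by simp
  moreover have "(\<Sum>k<s. sq_norm sm (four (F k))) = (\<Sum>k<s. nrm (F k))" "(\<Sum>k<s. sq_norm sm (four (Q k))) = (\<Sum>k<s. nrm (Q k))"
    using F Q by (auto intro!: sum.cong simp: nrm_eq)
  ultimately show ?thesis using E[OF i] e by (simp add: nrm_eq[of "E i"] nrm_eq[of e] distrib_left mult.assoc)
qed

text \<open>\<open>g\<close> is a function of the frequency, not yet a transform. The lemma thus
  also shows that an update exists in H^\<sigma>, although L of a stage lies only in H^(\<sigma> -
  2).\<close>

lemma update_estimate:
  assumes h: "0 \<le> h" and e: "e \<in> H" and E: "\<And>i. i < s \<Longrightarrow> E i \<in> H" and F: "\<And>i. i < s \<Longrightarrow> F i \<in> H" and Q: "\<And>i. i < s \<Longrightarrow> Q i \<in> H"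
    and q: "q \<in> H" and g: "g \<in> borel_measurable \<nu>" and eqs: "stage_eqs h e E F Q"
    and upd: "AE \<xi> in \<nu>. g \<xi> = four e \<xi> + complex_of_real h * (\<Sum>i<s. complex_of_real (b $ i) * (Lhat \<Omega> \<kappa> (E i) \<xi> + four (F i) \<xi>)) + four q \<xi>"
  shows "g \<in> sq_int sm" "sq_norm sm g \<le> nrm e + C * (h * (\<Sum>k<s. nrm (F k)) + (\<Sum>k<s. nrm (Q k))) + nrm q"
proof -
  have ae: "AE \<xi> in sm. cmod (g \<xi>) \<le> 1 * cmod (four e \<xi>) + (C * h) * (\<Sum>k<s. cmod (four (F k) \<xi>)) + C * (\<Sum>k<s. cmod (four (Q k) \<xi>)) + 1 * cmod (four q \<xi>)"
    unfolding AE_sob_measure using stage_eqs_AE[OF eqs] upd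
  proof eventually_elim
    case (elim \<xi>)
    have "g \<xi> = (four e \<xi> + (complex_of_real h * laplace_symbol \<kappa> \<xi>) * (\<Sum>i<s. complex_of_real (b $ i) * four (E i) \<xi>)
        + complex_of_real h * (\<Sum>i<s. complex_of_real (b $ i) * four (F i) \<xi>)) + four q \<xi>"
      unfolding elim(2) by (simp add: Lhat_symbol distrib_left sum.distrib sum_distrib_left mult_ac)
    also have "cmod \<dots> \<le> (cmod (four e \<xi>) + C * (h * (\<Sum>k<s. cmod (four (F k) \<xi>)) + (\<Sum>k<s. cmod (four (Q k) \<xi>)))) + cmod (four q \<xi>)"
      by (intro order_trans[OF norm_triangle_ineq add_right_mono] update_bound[OF symbol[OF h] h elim(1)])
    finally show ?case by (simp add: algebra_simps)
  qed
  have gm: "g \<in> borel_measurable sm" using g by (simp add: sob_measurable)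
  note D = sq_norm_dominated4[OF gm Hspace_sq[OF e] Hspace_sq[OF F] Hspace_sq[OF Q] Hspace_sq[OF q] _ _ _ _ ae]
  show "g \<in> sq_int sm" by (rule D(1)) (use C0 h in auto)
  have "sq_norm sm g \<le> sq_norm sm (four e) + C * h * (\<Sum>k<s. sq_norm sm (four (F k))) + C * (\<Sum>k<s. sq_norm sm (four (Q k))) + sq_norm sm (four q)"
    using D(2) C0 h by simp
  moreover have "(\<Sum>k<s. sq_norm sm (four (F k))) = (\<Sum>k<s. nrm (F k))" "(\<Sum>k<s. sq_norm sm (four (Q k))) = (\<Sum>k<s. nrm (Q k))"
    using F Q by (auto intro!: sum.cong simp: nrm_eq)
  ultimately show "sq_norm sm g \<le> nrm e + C * (h * (\<Sum>k<s. nrm (F k)) + (\<Sum>k<s. nrm (Q k))) + nrm q"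
    using e q by (simp add: nrm_eq[of e] nrm_eq[of q] distrib_left mult.assoc)
qed

lemma fourier_zero: "AE \<xi> in \<nu>. four (\<lambda>_. 0) \<xi> = 0"
  using fourier_diff[OF Hspace_L2[OF Hspace_zero] Hspace_L2[OF Hspace_zero]] by simp

text \<open>With the sources fixed, the system decouples over frequencies and is solved by the
  inverse matrix there; the pointwise stage bound gives square integrability, and
  \<open>Hspace_synth\<close> returns to functions.\<close>

lemma linear_stages:
  assumes h: "0 \<le> h" and v: "v \<in> H" and F: "\<And>i. i < s \<Longrightarrow> F i \<in> H"
  shows "\<exists>E. (\<forall>i<s. E i \<in> H) \<and> stage_eqs h v E F (\<lambda>_ _. 0)"
proof -
  let ?z = "\<lambda>\<xi>. complex_of_real h * laplace_symbol \<kappa> \<xi>"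
  define y where "y j \<xi> = four v \<xi> + complex_of_real h * (\<Sum>k<s. complex_of_real (A $$ (j, k)) * four (F k) \<xi>)" for j \<xi>
  define g where "g i \<xi> = (\<Sum>j<s. stab_inverse s A (?z \<xi>) $$ (i, j) * y j \<xi>)" for i \<xi>
  have fm: "four (F k) \<in> borel_measurable \<nu>" if "k < s" for k by (rule fourier_measurable[OF Hspace_L2[OF F[OF that]]])
  have vm: "four v \<in> borel_measurable \<nu>" by (rule fourier_measurable[OF Hspace_L2[OF v]])
  have ym: "y j \<in> borel_measurable \<nu>" for j
    unfolding y_def[abs_def] by (intro borel_measurable_add borel_measurable_times borel_measurable_sum vm fm) auto
  \<comment> \<open>Continuity of the inverse along S, composed with the continuous symbol, is what
    makes the solution measurable in the frequency.\<close>
  have Bm: "(\<lambda>\<xi>. stab_inverse s A (?z \<xi>) $$ (i, j)) \<in> borel_measurable \<nu>" if "i < s" "j < s" for i j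
  proof -
    have "continuous_on UNIV (\<lambda>\<xi>::real^'d. ?z \<xi>)" unfolding laplace_symbol_def by (intro continuous_intros)
    moreover have "range (\<lambda>\<xi>::real^'d. ?z \<xi>) \<subseteq> S" using symbol[OF h] by auto
    ultimately have "continuous_on UNIV (\<lambda>\<xi>::real^'d. stab_inverse s A (?z \<xi>) $$ (i, j))"
      using continuous_on_compose2[OF continuous_on_stab_inverse[OF A SI that], of UNIV "\<lambda>\<xi>::real^'d. ?z \<xi>"] by blast
    then show ?thesis by (intro freq_borel_measurable borel_measurable_continuous_onI)
  qed
  have gm: "g i \<in> borel_measurable sm" if "i < s" for i
    unfolding sob_measurable g_def[abs_def] using that by (intro borel_measurable_sum borel_measurable_times Bm ym) auto
  have inv: "invertible_mat (stab_matrix s A (?z \<xi>))" for \<xi> :: "real^'d" using SI symbol[OF h, of \<xi>] unfolding SI_stable_on_def by blast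
  have geq: "\<forall>i<s. g i \<xi> = y i \<xi> + ?z \<xi> * (\<Sum>j<s. complex_of_real (A $$ (i, j)) * g j \<xi>)" for \<xi>
  proof -
    have "\<forall>i<s. g i \<xi> = (\<Sum>j<s. stab_inverse s A (?z \<xi>) $$ (i, j) * y j \<xi>)"
      by (intro allI impI) (rule g_def)
    from iffD2[OF stab_solve[OF A inv] this] show ?thesis .
  qed
  have "\<exists>E\<in>H. AE \<xi> in \<nu>. four E \<xi> = g i \<xi>" if i: "i < s" for i
  proof -
    have "AE \<xi> in sm. cmod (g i \<xi>) \<le> C * cmod (four v \<xi>) + (C * h) * (\<Sum>k<s. cmod (four (F k) \<xi>)) + 0 * (\<Sum>k<s. cmod (four (F k) \<xi>)) + 0 * cmod (four v \<xi>)"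
    proof (rule AE_I2)
      fix \<xi>
      have "\<forall>i<s. g i \<xi> = four v \<xi> + ?z \<xi> * (\<Sum>j<s. complex_of_real (A $$ (i, j)) * g j \<xi>) + complex_of_real h * (\<Sum>j<s. complex_of_real (A $$ (i, j)) * four (F j) \<xi>) + 0"
      proof (intro allI impI)
        fix i assume "i < s"
        with geq[of \<xi>] have "g i \<xi> = y i \<xi> + ?z \<xi> * (\<Sum>j<s. complex_of_real (A $$ (i, j)) * g j \<xi>)" by blast
        then show "g i \<xi> = four v \<xi> + ?z \<xi> * (\<Sum>j<s. complex_of_real (A $$ (i, j)) * g j \<xi>) + complex_of_real h * (\<Sum>j<s. complex_of_real (A $$ (i, j)) * four (F j) \<xi>) + 0"
          by (simp only: y_def add_ac add_0_left)
      qed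
      from stage_bound[OF symbol[OF h] h this] i
      show "cmod (g i \<xi>) \<le> C * cmod (four v \<xi>) + (C * h) * (\<Sum>k<s. cmod (four (F k) \<xi>)) + 0 * (\<Sum>k<s. cmod (four (F k) \<xi>)) + 0 * cmod (four v \<xi>)"
        by (simp add: algebra_simps)
    qed
    from sq_norm_dominated4(1)[OF gm[OF i] Hspace_sq[OF v] Hspace_sq[OF F] Hspace_sq[OF F] Hspace_sq[OF v] _ _ _ _ this] C0 h
    have "g i \<in> sq_int sm" by simp
    from Hspace_synth[OF sigma this] show ?thesis by blast
  qed
  then obtain E where E: "\<And>i. i < s \<Longrightarrow> E i \<in> H" "\<And>i. i < s \<Longrightarrow> AE \<xi> in \<nu>. four (E i) \<xi> = g i \<xi>" by metis
  have all: "AE \<xi> in \<nu>. \<forall>i\<in>{..<s}. four (E i) \<xi> = g i \<xi>" using E(2) by (intro AE_finite_allI) auto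
  have "stage_eqs h v E F (\<lambda>_ _. 0)" unfolding stage_eqs_def
  proof (intro allI impI)
    fix i assume i: "i < s"
    show "AE \<xi> in \<nu>. four (E i) \<xi> = four v \<xi> + complex_of_real h *
      (\<Sum>j<s. complex_of_real (A $$ (i, j)) * (Lhat \<Omega> \<kappa> (E j) \<xi> + four (F j) \<xi>)) + four (\<lambda>_. 0) \<xi>"
      using all fourier_zero
    proof eventually_elim
      case (elim \<xi>)
      have "g i \<xi> = four v \<xi> + complex_of_real h * (\<Sum>k<s. complex_of_real (A $$ (i, k)) * four (F k) \<xi>) + ?z \<xi> * (\<Sum>j<s. complex_of_real (A $$ (i, j)) * g j \<xi>)"
        using geq[of \<xi>] i unfolding y_def by blast
      also have "(\<Sum>j<s. complex_of_real (A $$ (i, j)) * g j \<xi>) = (\<Sum>j<s. complex_of_real (A $$ (i, j)) * four (E j) \<xi>)"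
        using elim(1) by simp
      finally show ?case using elim i by (simp add: Lhat_symbol distrib_left sum.distrib sum_distrib_left mult_ac)
    qed
  qed
  with E(1) show ?thesis by blast
qed

section \<open>The stages as a fixed point\<close>

definition alg_const :: real where
  "alg_const = 2 * 2 powr \<sigma> * sob_const \<sigma> \<Omega> TYPE('d)"

lemma alg_const_nonneg: "0 \<le> alg_const"
  by (simp add: alg_const_def sob_const_nonneg)

lemma H_mult: "f \<in> H \<Longrightarrow> g \<in> H \<Longrightarrow> (\<lambda>x. f x * g x) \<in> H"
  by (rule Hspace_mult(1)[OF sigma])

lemma nrm_mult: "f \<in> H \<Longrightarrow> g \<in> H \<Longrightarrow> nrm (\<lambda>x. f x * g x) \<le> alg_const * nrm f * nrm g"
  unfolding alg_const_def by (rule Hspace_mult(2)[OF sigma])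

lemma stage_eqs_diff:
  assumes e: "e \<in> H" "e' \<in> H" and E: "\<And>i. i < s \<Longrightarrow> E i \<in> H" "\<And>i. i < s \<Longrightarrow> E' i \<in> H"
    and F: "\<And>i. i < s \<Longrightarrow> F i \<in> H" "\<And>i. i < s \<Longrightarrow> F' i \<in> H" and Q: "\<And>i. i < s \<Longrightarrow> Q i \<in> H" "\<And>i. i < s \<Longrightarrow> Q' i \<in> H"
    and eqs: "stage_eqs h e E F Q" "stage_eqs h e' E' F' Q'"
  shows "stage_eqs h (\<lambda>x. e x - e' x) (\<lambda>i x. E i x - E' i x) (\<lambda>i x. F i x - F' i x) (\<lambda>i x. Q i x - Q' i x)"
  unfolding stage_eqs_def
proof (intro allI impI)
  fix i assume i: "i < s"
  note fd = fourier_diff[OF Hspace_L2 Hspace_L2]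
  have 1: "AE \<xi> in \<nu>. \<forall>j\<in>{..<s}. four (\<lambda>x. E j x - E' j x) \<xi> = four (E j) \<xi> - four (E' j) \<xi>"
    using E by (intro AE_finite_allI fd) auto
  have 2: "AE \<xi> in \<nu>. \<forall>j\<in>{..<s}. four (\<lambda>x. F j x - F' j x) \<xi> = four (F j) \<xi> - four (F' j) \<xi>"
    using F by (intro AE_finite_allI fd) auto
  from eqs have 3: "AE \<xi> in \<nu>. four (E i) \<xi> = four e \<xi> + complex_of_real h *
      (\<Sum>j<s. complex_of_real (A $$ (i, j)) * (Lhat \<Omega> \<kappa> (E j) \<xi> + four (F j) \<xi>)) + four (Q i) \<xi>"
    "AE \<xi> in \<nu>. four (E' i) \<xi> = four e' \<xi> + complex_of_real h *
      (\<Sum>j<s. complex_of_real (A $$ (i, j)) * (Lhat \<Omega> \<kappa> (E' j) \<xi> + four (F' j) \<xi>)) + four (Q' i) \<xi>"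
    using i unfolding stage_eqs_def by blast+
  show "AE \<xi> in \<nu>. four (\<lambda>x. E i x - E' i x) \<xi> = four (\<lambda>x. e x - e' x) \<xi> + complex_of_real h *
      (\<Sum>j<s. complex_of_real (A $$ (i, j)) * (Lhat \<Omega> \<kappa> (\<lambda>x. E j x - E' j x) \<xi> + four (\<lambda>x. F j x - F' j x) \<xi>)) + four (\<lambda>x. Q i x - Q' i x) \<xi>"
    using 1 2 3 fd[OF e] fd[OF Q(1)[OF i] Q(2)[OF i]]
  proof eventually_elim
    case (elim \<xi>)
    have "(\<Sum>j<s. complex_of_real (A $$ (i, j)) * (Lhat \<Omega> \<kappa> (\<lambda>x. E j x - E' j x) \<xi> + four (\<lambda>x. F j x - F' j x) \<xi>))
        = (\<Sum>j<s. complex_of_real (A $$ (i, j)) * (Lhat \<Omega> \<kappa> (E j) \<xi> + four (F j) \<xi>) - complex_of_real (A $$ (i, j)) * (Lhat \<Omega> \<kappa> (E' j) \<xi> + four (F' j) \<xi>))"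
    proof (intro sum.cong refl)
      fix j assume j: "j \<in> {..<s}"
      show "complex_of_real (A $$ (i, j)) * (Lhat \<Omega> \<kappa> (\<lambda>x. E j x - E' j x) \<xi> + four (\<lambda>x. F j x - F' j x) \<xi>)
        = complex_of_real (A $$ (i, j)) * (Lhat \<Omega> \<kappa> (E j) \<xi> + four (F j) \<xi>) - complex_of_real (A $$ (i, j)) * (Lhat \<Omega> \<kappa> (E' j) \<xi> + four (F' j) \<xi>)"
        unfolding Lhat_symbol bspec[OF elim(1) j] bspec[OF elim(2) j] by (simp add: algebra_simps)
    qed
    moreover have "four (\<lambda>x. E i x - E' i x) \<xi> = four (E i) \<xi> - four (E' i) \<xi>" by (rule bspec[OF elim(1)]) (use i in simp)
    ultimately show ?case by (simp only: elim(3,4,5,6) sum_subtractf) (simp add: right_diff_distrib)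
  qed
qed

text \<open>The transform of the zero function vanishes only almost everywhere, so the zero defect
  is added and removed up to null sets.\<close>

lemma solves_stages_iff:
  "solves_stages \<Omega> \<sigma> \<kappa> s A h v \<gamma> U \<longleftrightarrow> (\<forall>i<s. U i \<in> H) \<and> stage_eqs h v U (\<lambda>j x. \<gamma> j x * U j x) (\<lambda>_ _. 0)"
proof -
  have "(AE \<xi> in \<nu>. X \<xi> = Y \<xi>) \<longleftrightarrow> (AE \<xi> in \<nu>. X \<xi> = Y \<xi> + four (\<lambda>_. 0) \<xi>)" for X Y
  proof
    assume "AE \<xi> in \<nu>. X \<xi> = Y \<xi>"
    then show "AE \<xi> in \<nu>. X \<xi> = Y \<xi> + four (\<lambda>_. 0) \<xi>" using fourier_zero by eventually_elim simp
  next
    assume "AE \<xi> in \<nu>. X \<xi> = Y \<xi> + four (\<lambda>_. 0) \<xi>"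
    then show "AE \<xi> in \<nu>. X \<xi> = Y \<xi>" using fourier_zero by eventually_elim simp
  qed
  then show ?thesis unfolding solves_stages_def stage_eqs_def by simp
qed

definition stage_dist :: "(nat \<Rightarrow> real^'d \<Rightarrow> complex) \<Rightarrow> (nat \<Rightarrow> real^'d \<Rightarrow> complex) \<Rightarrow> real" where
  "stage_dist U W = (\<Sum>k<s. Hdist \<Omega> \<sigma> (U k) (W k))"

lemma stage_dist_nonneg: "0 \<le> stage_dist U W"
  unfolding stage_dist_def by (intro sum_nonneg) simp

lemma stage_contraction:
  assumes h: "0 \<le> h" and v: "v \<in> H" and \<gamma>: "\<And>k. k < s \<Longrightarrow> \<gamma> k \<in> H" "\<And>k. k < s \<Longrightarrow> nrm (\<gamma> k) \<le> G"
    and U: "\<And>i. i < s \<Longrightarrow> U i \<in> H" "\<And>i. i < s \<Longrightarrow> U' i \<in> H" and E: "\<And>i. i < s \<Longrightarrow> E i \<in> H" "\<And>i. i < s \<Longrightarrow> E' i \<in> H"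
    and eqs: "stage_eqs h v E (\<lambda>j x. \<gamma> j x * U j x) (\<lambda>_ _. 0)" "stage_eqs h v E' (\<lambda>j x. \<gamma> j x * U' j x) (\<lambda>_ _. 0)"
    and small: "real s * (C * (h * (alg_const * G))) \<le> 1 / 2"
  shows "stage_dist E E' \<le> stage_dist U U' / 2"
proof -
  let ?F = "\<lambda>j x. \<gamma> j x * U j x - \<gamma> j x * U' j x"
  have F: "?F k \<in> H" if "k < s" for k using that \<gamma> U by (intro Hspace_diff H_mult) auto
  have Fn: "nrm (?F k) \<le> alg_const * G * Hdist \<Omega> \<sigma> (U k) (U' k)" if k: "k < s" for k
  proof -
    have "nrm (?F k) = nrm (\<lambda>x. \<gamma> k x * (U k x - U' k x))" by (simp add: right_diff_distrib)
    also have "\<dots> \<le> alg_const * nrm (\<gamma> k) * nrm (\<lambda>x. U k x - U' k x)" using k \<gamma> U by (intro nrm_mult Hspace_diff) auto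
    also have "\<dots> \<le> alg_const * G * nrm (\<lambda>x. U k x - U' k x)"
      using \<gamma>(2)[OF k] by (intro mult_right_mono mult_left_mono alg_const_nonneg) auto
    finally show ?thesis by (simp add: Hdist_def)
  qed
  have d: "stage_eqs h (\<lambda>_. 0) (\<lambda>i x. E i x - E' i x) ?F (\<lambda>_ _. 0)"
    using stage_eqs_diff[OF v v E(1) E(2) _ _ _ _ eqs] \<gamma> U H_mult by simp
  have "Hdist \<Omega> \<sigma> (E i) (E' i) \<le> C * (h * (alg_const * G * stage_dist U U'))" if i: "i < s" for i
  proof -
    have "Hdist \<Omega> \<sigma> (E i) (E' i) \<le> C * (nrm (\<lambda>_. 0) + h * (\<Sum>k<s. nrm (?F k)) + (\<Sum>k<s. nrm (\<lambda>_. 0)))"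
      unfolding Hdist_def by (rule stage_estimate[OF h Hspace_zero _ F Hspace_zero d i]) (use E in \<open>auto intro: Hspace_diff\<close>)
    also have "\<dots> = C * (h * (\<Sum>k<s. nrm (?F k)))" by simp
    also have "\<dots> \<le> C * (h * (\<Sum>k<s. alg_const * G * Hdist \<Omega> \<sigma> (U k) (U' k)))"
      using C0 h by (intro mult_left_mono sum_mono Fn) auto
    finally show ?thesis by (simp add: stage_dist_def sum_distrib_left)
  qed
  then have "stage_dist E E' \<le> (\<Sum>i<s. C * (h * (alg_const * G * stage_dist U U')))"
    unfolding stage_dist_def[of E] by (intro sum_mono) auto
  also have "\<dots> = (real s * (C * (h * (alg_const * G)))) * stage_dist U U'" by simp
  also have "\<dots> \<le> (1 / 2) * stage_dist U U'" by (intro mult_right_mono small stage_dist_nonneg)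
  finally show ?thesis by simp
qed

text \<open>Banach's iteration carried out with the pseudodistance \<open>stage_dist\<close>. Its
  limit is a fixed point up to null sets only, so the products with \<gamma> have to be exchanged at
  the end.\<close>

lemma stages_exist:
  assumes h: "0 \<le> h" and v: "v \<in> H" and \<gamma>: "\<And>k. k < s \<Longrightarrow> \<gamma> k \<in> H" "\<And>k. k < s \<Longrightarrow> nrm (\<gamma> k) \<le> G"
    and small: "real s * (C * (h * (alg_const * G))) \<le> 1 / 2"
  shows "\<exists>U. solves_stages \<Omega> \<sigma> \<kappa> s A h v \<gamma> U"
proof -
  let ?P = "\<lambda>U E. (\<forall>i<s. E i \<in> H) \<and> stage_eqs h v E (\<lambda>j x. \<gamma> j x * U j x) (\<lambda>_ _. 0)"
  define \<Phi> where "\<Phi> U = (SOME E. ?P U E)" for U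
  have \<Phi>: "?P U (\<Phi> U)" if "\<forall>i<s. U i \<in> H" for U
  proof -
    have "(\<lambda>x. \<gamma> j x * U j x) \<in> H" if "j < s" for j using \<open>\<forall>i<s. U i \<in> H\<close> \<gamma>(1) that by (blast intro: H_mult)
    from someI_ex[OF linear_stages[OF h v this]] show ?thesis unfolding \<Phi>_def .
  qed
  have contr: "stage_dist (\<Phi> U) (\<Phi> U') \<le> stage_dist U U' / 2" if "\<forall>i<s. U i \<in> H" "\<forall>i<s. U' i \<in> H" for U U'
  proof -
    note P = \<Phi>[OF that(1)] and P' = \<Phi>[OF that(2)]
    show ?thesis
    proof (rule stage_contraction[where \<gamma>=\<gamma> and G=G and U=U and U'=U', OF h v _ _ _ _ _ _ _ _ small])
      show "\<gamma> k \<in> H" "nrm (\<gamma> k) \<le> G" if "k < s" for k by (rule \<gamma>(1)[OF that], rule \<gamma>(2)[OF that])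
      show "U i \<in> H" "U' i \<in> H" if "i < s" for i using \<open>\<forall>i<s. U i \<in> H\<close> \<open>\<forall>i<s. U' i \<in> H\<close> that by blast+
      show "\<Phi> U i \<in> H" "\<Phi> U' i \<in> H" if "i < s" for i using P P' that by blast+
    qed (rule P[THEN conjunct2], rule P'[THEN conjunct2])
  qed
  define V where "V n = (\<Phi> ^^ n) (\<lambda>_ _. 0)" for n
  have VH: "\<forall>i<s. V n i \<in> H" for n
    unfolding V_def by (induction n) (use \<Phi> in auto)
  have VS: "V (Suc n) = \<Phi> (V n)" for n by (simp add: V_def)
  define d where "d = stage_dist (V 1) (V 0)"
  have d0: "0 \<le> d" by (simp add: d_def stage_dist_nonneg)
  have step: "stage_dist (V (Suc n)) (V n) \<le> d * (1/2) ^ n" for n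
  proof (induction n)
    case 0 then show ?case by (simp add: d_def)
  next
    case (Suc n)
    have "stage_dist (V (Suc (Suc n))) (V (Suc n)) \<le> stage_dist (V (Suc n)) (V n) / 2"
      unfolding VS[of "Suc n"] VS[of n] by (rule contr) (use VH in \<open>auto simp flip: VS\<close>)
    with Suc show ?case by simp
  qed
  have comp: "Hdist \<Omega> \<sigma> (U k) (W k) \<le> stage_dist U W" if "k < s" for U W k
    unfolding stage_dist_def using that by (intro member_le_sum[of k "{..<s}" "\<lambda>k. Hdist \<Omega> \<sigma> (U k) (W k)"]) auto
  \<comment> \<open>The exact partial sum of the geometric series, rather than its upper bound, so
    that the induction on p closes.\<close>
  have far: "Hdist \<Omega> \<sigma> (V (n + p) k) (V n k) \<le> 2 * d * ((1/2) ^ n - (1/2) ^ (n + p))" if k: "k < s" for n p k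
  proof (induction p)
    case 0
    have "Hdist \<Omega> \<sigma> (V n k) (V n k) = 0" by (simp add: Hdist_def)
    then show ?case by simp
  next
    case (Suc p)
    have "Hdist \<Omega> \<sigma> (V (n + Suc p) k) (V n k) \<le> Hdist \<Omega> \<sigma> (V (Suc (n + p)) k) (V (n + p) k) + Hdist \<Omega> \<sigma> (V (n + p) k) (V n k)"
      using VH k by (auto intro: Hdist_triangle)
    also have "\<dots> \<le> d * (1/2) ^ (n + p) + 2 * d * ((1/2) ^ n - (1/2) ^ (n + p))"
      using Suc order_trans[OF comp[OF k] step[of "n + p"]] by (intro add_mono) auto
    finally show ?case by (simp add: algebra_simps)
  qed
  have "\<exists>w\<in>H. (\<lambda>n. Hdist \<Omega> \<sigma> (V n k) w) \<longlonglongrightarrow> 0" if k: "k < s" for k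
  proof (rule Hspace_complete[OF sigma])
    show "V n k \<in> H" for n using VH k by blast
    fix e :: real assume e: "e > 0"
    have "(\<lambda>n. 2 * d * (1/2::real) ^ n) \<longlonglongrightarrow> 2 * d * 0" by (intro tendsto_mult_left LIMSEQ_power_zero) simp
    then have "eventually (\<lambda>n. 2 * d * (1/2::real) ^ n < e) sequentially" using e by (intro order_tendstoD(2)) auto
    then obtain n0 where n0: "\<And>n. n \<ge> n0 \<Longrightarrow> 2 * d * (1/2) ^ n < e" unfolding eventually_sequentially by blast
    have le: "Hdist \<Omega> \<sigma> (V m k) (V n k) < e" if "n \<ge> n0" "n \<le> m" for m n
    proof -
      obtain p where m: "m = n + p" using \<open>n \<le> m\<close> le_Suc_ex by blast
      have "Hdist \<Omega> \<sigma> (V m k) (V n k) \<le> 2 * d * ((1/2) ^ n - (1/2) ^ (n + p))" unfolding m by (rule far[OF k])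
      also have "\<dots> \<le> 2 * d * (1/2) ^ n" using d0 by (intro mult_left_mono) auto
      also have "\<dots> < e" by (rule n0[OF that(1)])
      finally show ?thesis .
    qed
    have "Hdist \<Omega> \<sigma> (V m k) (V n k) < e" if "m \<ge> n0" "n \<ge> n0" for m n
      using le[of n m] le[of m n] that Hdist_commute[of "V m k" \<Omega> \<sigma> "V n k"] VH k by (cases "n \<le> m") auto
    then show "\<exists>n0. \<forall>m\<ge>n0. \<forall>n\<ge>n0. Hdist \<Omega> \<sigma> (V m k) (V n k) < e" by blast
  qed
  then obtain W where W: "\<And>k. k < s \<Longrightarrow> W k \<in> H" "\<And>k. k < s \<Longrightarrow> (\<lambda>n. Hdist \<Omega> \<sigma> (V n k) (W k)) \<longlonglongrightarrow> 0" by metis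
  have limD: "(\<lambda>n. stage_dist (V n) W) \<longlonglongrightarrow> 0"
    unfolding stage_dist_def using W(2) by (intro tendsto_null_sum) auto
  have WH: "\<forall>i<s. W i \<in> H" using W by blast
  note E = \<Phi>[OF WH]
  have zero: "Hdist \<Omega> \<sigma> (\<Phi> W k) (W k) = 0" if k: "k < s" for k
  proof -
    have "Hdist \<Omega> \<sigma> (\<Phi> W k) (W k) \<le> stage_dist (V n) W / 2 + stage_dist (V (Suc n)) W" for n
    proof -
      have "Hdist \<Omega> \<sigma> (\<Phi> W k) (W k) \<le> Hdist \<Omega> \<sigma> (V (Suc n) k) (\<Phi> W k) + Hdist \<Omega> \<sigma> (V (Suc n) k) (W k)"
        using Hdist_triangle[of "\<Phi> W k" \<Omega> \<sigma> "V (Suc n) k" "W k"] Hdist_commute[of "\<Phi> W k" \<Omega> \<sigma> "V (Suc n) k"] E VH WH k by auto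
      also have "\<dots> \<le> stage_dist (V n) W / 2 + stage_dist (V (Suc n)) W"
        using order_trans[OF comp[OF k] contr[OF VH WH, of n]] comp[OF k, of "V (Suc n)" W] by (simp add: VS)
      finally show ?thesis .
    qed
    moreover have "(\<lambda>n. stage_dist (V n) W / 2 + stage_dist (V (Suc n)) W) \<longlonglongrightarrow> 0 / 2 + 0"
      by (intro tendsto_intros limD LIMSEQ_Suc[OF limD]) simp
    ultimately have "Hdist \<Omega> \<sigma> (\<Phi> W k) (W k) \<le> 0 / 2 + 0" by (intro LIMSEQ_le_const) auto
    then show ?thesis using Hdist_nonneg[of \<Omega> \<sigma> "\<Phi> W k" "W k"] by linarith
  qed
  \<comment> \<open>\<open>\<Phi> W\<close> solves the equations with the products \<gamma> W by
    construction; since it equals \<open>W\<close> almost everywhere, these may be replaced by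
    \<gamma> \<open>\<Phi> W\<close>.\<close>
  have prod: "AE \<xi> in \<nu>. four (\<lambda>x. \<gamma> k x * \<Phi> W k x) \<xi> = four (\<lambda>x. \<gamma> k x * W k x) \<xi>" if k: "k < s" for k
  proof -
    have "ae_eq \<Omega> (\<Phi> W k) (W k)"
      using zero[OF k] Hdist_eq_0_iff[of "\<Phi> W k" \<Omega> \<sigma> "W k"] ae_eq_iff_fourier[of "\<Phi> W k" \<Omega> "W k"] E WH k Hspace_L2 by blast
    then have "AE x in space_measure \<Omega>. \<gamma> k x * \<Phi> W k x = \<gamma> k x * W k x"
      unfolding ae_eq_def by eventually_elim simp
    then show ?thesis using E WH k \<gamma> by (intro fourier_cong_AE H_L2 H_mult) auto
  qed
  have all: "AE \<xi> in \<nu>. \<forall>k\<in>{..<s}. four (\<lambda>x. \<gamma> k x * \<Phi> W k x) \<xi> = four (\<lambda>x. \<gamma> k x * W k x) \<xi>"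
    using prod by (intro AE_finite_allI) auto
  have "stage_eqs h v (\<Phi> W) (\<lambda>j x. \<gamma> j x * \<Phi> W j x) (\<lambda>_ _. 0)"
    unfolding stage_eqs_def
  proof (intro allI impI)
    fix i assume i: "i < s"
    from E i have "AE \<xi> in \<nu>. four (\<Phi> W i) \<xi> = four v \<xi> + complex_of_real h *
        (\<Sum>j<s. complex_of_real (A $$ (i, j)) * (Lhat \<Omega> \<kappa> (\<Phi> W j) \<xi> + four (\<lambda>x. \<gamma> j x * W j x) \<xi>)) + four (\<lambda>_. 0) \<xi>"
      unfolding stage_eqs_def by blast
    then show "AE \<xi> in \<nu>. four (\<Phi> W i) \<xi> = four v \<xi> + complex_of_real h *
        (\<Sum>j<s. complex_of_real (A $$ (i, j)) * (Lhat \<Omega> \<kappa> (\<Phi> W j) \<xi> + four (\<lambda>x. \<gamma> j x * \<Phi> W j x) \<xi>)) + four (\<lambda>_. 0) \<xi>"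
      using all by eventually_elim simp
  qed
  then show ?thesis using E unfolding solves_stages_iff by blast
qed

text \<open>Two solutions are both fixed points of the contraction, so their distance is at most
  half of itself. Any solution admits an update because the update bound puts its prescribed
  transform in weighted L2.\<close>

lemma step_well_definedI:
  assumes h: "0 \<le> h" and v: "v \<in> H" and \<gamma>: "\<And>k. k < s \<Longrightarrow> \<gamma> k \<in> H" "\<And>k. k < s \<Longrightarrow> nrm (\<gamma> k) \<le> G"
    and small: "real s * (C * (h * (alg_const * G))) \<le> 1 / 2"
  shows "step_well_defined \<Omega> \<sigma> \<kappa> s A b h v \<gamma>"
  unfolding step_well_defined_def
proof (intro conjI allI impI)
  show "\<exists>U. solves_stages \<Omega> \<sigma> \<kappa> s A h v \<gamma> U" by (rule stages_exist[OF assms])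
  fix U assume "solves_stages \<Omega> \<sigma> \<kappa> s A h v \<gamma> U"
  then have U: "\<And>i. i < s \<Longrightarrow> U i \<in> H" "stage_eqs h v U (\<lambda>j x. \<gamma> j x * U j x) (\<lambda>_ _. 0)" by (auto simp: solves_stages_iff)
  let ?g = "\<lambda>\<xi>. four v \<xi> + complex_of_real h * (\<Sum>i<s. complex_of_real (b $ i) * (Lhat \<Omega> \<kappa> (U i) \<xi> + four (\<lambda>x. \<gamma> i x * U i x) \<xi>))"
  have F: "(\<lambda>x. \<gamma> i x * U i x) \<in> H" if "i < s" for i using that \<gamma> U by (auto intro: H_mult)
  have "?g \<in> borel_measurable \<nu>" unfolding Lhat_symbol
    using U F by (intro borel_measurable_add borel_measurable_times borel_measurable_sum laplace_symbol_measurable fourier_measurable H_L2 v) auto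
  note gm = this
  have upd: "AE \<xi> in \<nu>. ?g \<xi> = ?g \<xi> + four (\<lambda>_. 0) \<xi>" using fourier_zero by eventually_elim simp
  have "?g \<in> sq_int sm" by (rule update_estimate(1)[OF h v _ _ _ Hspace_zero gm U(2) upd]) (use U F in simp_all)
  from Hspace_synth[OF sigma this] show "\<exists>w. is_update \<Omega> \<sigma> \<kappa> s b h v \<gamma> U w" unfolding is_update_def by blast
next
  fix U U' i assume UU: "solves_stages \<Omega> \<sigma> \<kappa> s A h v \<gamma> U \<and> solves_stages \<Omega> \<sigma> \<kappa> s A h v \<gamma> U'" and i: "i < s"
  then have U: "\<And>i. i < s \<Longrightarrow> U i \<in> H" "\<And>i. i < s \<Longrightarrow> U' i \<in> H"
    and eqs: "stage_eqs h v U (\<lambda>j x. \<gamma> j x * U j x) (\<lambda>_ _. 0)" "stage_eqs h v U' (\<lambda>j x. \<gamma> j x * U' j x) (\<lambda>_ _. 0)"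
    by (auto simp: solves_stages_iff)
  have "stage_dist U U' \<le> stage_dist U U' / 2" by (rule stage_contraction[OF h v \<gamma> U U eqs small])
  then have "stage_dist U U' \<le> 0" by simp
  moreover have "Hdist \<Omega> \<sigma> (U i) (U' i) \<le> stage_dist U U'"
    unfolding stage_dist_def using i by (intro member_le_sum[of i "{..<s}" "\<lambda>k. Hdist \<Omega> \<sigma> (U k) (U' k)"]) auto
  ultimately have "Hdist \<Omega> \<sigma> (U i) (U' i) = 0" using Hdist_nonneg[of \<Omega> \<sigma> "U i" "U' i"] by linarith
  then show "ae_eq \<Omega> (U i) (U' i)"
    using Hdist_eq_0_iff[OF U(1)[OF i] U(2)[OF i]] ae_eq_iff_fourier[OF Hspace_L2[OF U(1)[OF i]] Hspace_L2[OF U(2)[OF i]]] by blast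
qed

lemma next_u_props:
  assumes "step_well_defined \<Omega> \<sigma> \<kappa> s A b h v \<gamma>"
  obtains U where "solves_stages \<Omega> \<sigma> \<kappa> s A h v \<gamma> U" "is_update \<Omega> \<sigma> \<kappa> s b h v \<gamma> U (next_u \<Omega> \<sigma> \<kappa> s A b h v \<gamma>)"
proof -
  have "\<exists>w U. solves_stages \<Omega> \<sigma> \<kappa> s A h v \<gamma> U \<and> is_update \<Omega> \<sigma> \<kappa> s b h v \<gamma> U w"
    using assms unfolding step_well_defined_def by blast
  from someI_ex[OF this] show thesis using that unfolding next_u_def by blast
qed

end

section \<open>The error estimate\<close>

text \<open>The square of the symbol is at most a constant times the weight of exponent 2, which is
  the difference between the two weights.\<close>

lemma Lhat_sq_int:
  fixes f :: "real^'d \<Rightarrow> complex"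
  assumes f: "f \<in> Hspace \<Omega> \<sigma>"
  shows "Lhat \<Omega> \<kappa> f \<in> sq_int (sob_measure \<Omega> (\<sigma> - 2))"
proof (rule sq_intI_nn)
  have [measurable]: "fourier \<Omega> f \<in> borel_measurable (freq_measure \<Omega>)" by (rule fourier_measurable[OF Hspace_L2[OF f]])
  have "Lhat \<Omega> \<kappa> f \<in> borel_measurable (freq_measure \<Omega>)"
    unfolding Lhat_symbol[abs_def] by (intro borel_measurable_times laplace_symbol_measurable) simp
  note Lm = this
  then show "Lhat \<Omega> \<kappa> f \<in> borel_measurable (sob_measure \<Omega> (\<sigma> - 2))" by (simp add: sob_measurable)
  note [measurable] = Lm
  define K where "K = cmod \<kappa> * (4 * pi\<^sup>2)"
  have K: "0 \<le> K" by (simp add: K_def)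
  have le: "sob_weight (\<sigma> - 2) \<xi> * (cmod (Lhat \<Omega> \<kappa> f \<xi>))\<^sup>2 \<le> K\<^sup>2 * (sob_weight \<sigma> \<xi> * (cmod (fourier \<Omega> f \<xi>))\<^sup>2)" for \<xi> :: "real^'d"
  proof -
    have L: "cmod (laplace_symbol \<kappa> \<xi>) = K * (norm \<xi>)\<^sup>2"
      by (simp add: laplace_symbol_def K_def norm_mult norm_power)
    have "(K * (norm \<xi>)\<^sup>2)\<^sup>2 \<le> (K * (1 + (norm \<xi>)\<^sup>2))\<^sup>2" using K by (intro power_mono mult_left_mono) auto
    also have "\<dots> = K\<^sup>2 * sob_weight 2 \<xi>" by (simp add: sob_weight_def power_mult_distrib powr_numeral add_pos_nonneg)
    finally have "sob_weight (\<sigma> - 2) \<xi> * (K * (norm \<xi>)\<^sup>2)\<^sup>2 \<le> sob_weight (\<sigma> - 2) \<xi> * (K\<^sup>2 * sob_weight 2 \<xi>)"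
      by (rule mult_left_mono) simp
    also have "\<dots> = K\<^sup>2 * (sob_weight (\<sigma> - 2) \<xi> * sob_weight 2 \<xi>)" by simp
    also have "\<dots> = K\<^sup>2 * sob_weight \<sigma> \<xi>" unfolding sob_weight_mult by simp
    finally have "sob_weight (\<sigma> - 2) \<xi> * (K * (norm \<xi>)\<^sup>2)\<^sup>2 * (cmod (fourier \<Omega> f \<xi>))\<^sup>2 \<le> K\<^sup>2 * sob_weight \<sigma> \<xi> * (cmod (fourier \<Omega> f \<xi>))\<^sup>2"
      by (rule mult_right_mono) simp
    then show ?thesis unfolding Lhat_symbol norm_mult L by (simp add: power_mult_distrib mult_ac)
  qed
  have "(\<integral>\<^sup>+\<xi>. ennreal ((cmod (Lhat \<Omega> \<kappa> f \<xi>))\<^sup>2) \<partial>sob_measure \<Omega> (\<sigma> - 2))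
      = (\<integral>\<^sup>+\<xi>. ennreal (sob_weight (\<sigma> - 2) \<xi> * (cmod (Lhat \<Omega> \<kappa> f \<xi>))\<^sup>2) \<partial>freq_measure \<Omega>)"
    unfolding sob_measure_def by (subst nn_integral_density) (auto simp: ennreal_mult)
  also have "\<dots> \<le> (\<integral>\<^sup>+\<xi>. ennreal (K\<^sup>2) * ennreal (sob_weight \<sigma> \<xi> * (cmod (fourier \<Omega> f \<xi>))\<^sup>2) \<partial>freq_measure \<Omega>)"
    using le by (intro nn_integral_mono) (simp flip: ennreal_mult add: ennreal_leI)
  also have "\<dots> = ennreal (K\<^sup>2) * (\<integral>\<^sup>+\<xi>. ennreal ((cmod (fourier \<Omega> f \<xi>))\<^sup>2) \<partial>sob_measure \<Omega> \<sigma>)"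
    unfolding sob_measure_def by (subst nn_integral_density, simp, simp, subst nn_integral_cmult) (auto simp: ennreal_mult)
  also have "\<dots> < \<infinity>" unfolding nn_integral_sq_norm[OF Hspace_sq[OF f]] by (simp flip: ennreal_mult)
  finally show "(\<integral>\<^sup>+\<xi>. ennreal ((cmod (Lhat \<Omega> \<kappa> f \<xi>))\<^sup>2) \<partial>sob_measure \<Omega> (\<sigma> - 2)) < \<infinity>" .
qed

text \<open>The derivatives with respect to the norms of \<open>H\<^sup>\<sigma>\<close> and \<open>H\<^bsup>\<sigma>-2\<^esup>\<close> agree.\<close>

lemma solution_derivative:
  fixes u :: "real \<Rightarrow> real^'d \<Rightarrow> complex"
  assumes sigma: "\<sigma> > real CARD('d) / 2" and sol: "solves_equation \<Omega> \<sigma> \<kappa> N I u" and N: "N (u t) \<in> Hspace \<Omega> \<sigma>"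
    and d: "has_Hderivative_on \<Omega> \<sigma> I u u'" and u': "u' t \<in> Hspace \<Omega> \<sigma>" and I: "open I" and t: "t \<in> I"
  shows "AE \<xi> in freq_measure \<Omega>. fourier \<Omega> (u' t) \<xi> = Lhat \<Omega> \<kappa> (u t) \<xi> + fourier \<Omega> (\<lambda>x. N (u t) x * u t x) \<xi>"
proof -
  let ?M = "sob_measure \<Omega> (\<sigma> - 2) :: (real^'d) measure"
  let ?G = "\<lambda>\<xi>. Lhat \<Omega> \<kappa> (u t) \<xi> + fourier \<Omega> (\<lambda>x. N (u t) x * u t x) \<xi>"
  let ?Q = "\<lambda>t' \<xi>. (fourier \<Omega> (u t') \<xi> - fourier \<Omega> (u t) \<xi>) / complex_of_real (t' - t)"
  have uH: "\<And>t. t \<in> I \<Longrightarrow> u t \<in> Hspace \<Omega> \<sigma>"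
    and lim: "((\<lambda>t'. Hhat_norm \<Omega> (\<sigma> - 2) (\<lambda>\<xi>. ?Q t' \<xi> - ?G \<xi>)) \<longlongrightarrow> 0) (at t within I)"
    using sol t unfolding solves_equation_def by blast+
  have lim2: "((\<lambda>t'. Hdist \<Omega> \<sigma> (\<lambda>x. (u t' x - u t x) / complex_of_real (t' - t)) (u' t)) \<longlongrightarrow> 0) (at t within I)"
    using d t unfolding has_Hderivative_on_def by blast
  have sq: "fourier \<Omega> f \<in> sq_int ?M" if "f \<in> Hspace \<Omega> \<sigma>" for f
    by (rule sq_norm_sob_mono(1)[OF _ Hspace_sq[OF that]]) simp
  have G: "?G \<in> sq_int ?M"
    by (intro sq_int_add(1) Lhat_sq_int sq Hspace_mult(1)[OF sigma] N uH t)
  have P: "fourier \<Omega> (u' t) \<in> sq_int ?M" by (rule sq[OF u'])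
  have Q: "?Q t' \<in> sq_int ?M" if "t' \<in> I" for t'
    using sq_int_cmult(1)[OF sq_int_diff(1)[OF sq[OF uH[OF that]] sq[OF uH[OF t]]], of "1 / complex_of_real (t' - t)"] by simp
  have dist: "sq_norm ?M (\<lambda>\<xi>. ?Q t' \<xi> - fourier \<Omega> (u' t) \<xi>) \<le> Hdist \<Omega> \<sigma> (\<lambda>x. (u t' x - u t x) / complex_of_real (t' - t)) (u' t)"
    if t': "t' \<in> I" for t'
  proof -
    let ?q = "\<lambda>x. (u t' x - u t x) / complex_of_real (t' - t)"
    have qH: "?q \<in> Hspace \<Omega> \<sigma>" by (intro Hspace_divide Hspace_diff uH t t')
    have "AE \<xi> in freq_measure \<Omega>. fourier \<Omega> ?q \<xi> = ?Q t' \<xi>"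
      using fourier_linear[OF Hspace_L2[OF uH[OF t']] Hspace_L2[OF uH[OF t]], of "1 / complex_of_real (t' - t)" "- 1 / complex_of_real (t' - t)"]
      by (simp add: diff_divide_distrib)
    then have "sq_norm ?M (\<lambda>\<xi>. ?Q t' \<xi> - fourier \<Omega> (u' t) \<xi>) = sq_norm ?M (\<lambda>\<xi>. fourier \<Omega> ?q \<xi> - fourier \<Omega> (u' t) \<xi>)"
      using sq_int_measurable[OF sq_int_diff(1)[OF Q[OF t'] P]] sq_int_measurable[OF sq_int_diff(1)[OF sq[OF qH] P]]
      by (intro sq_int_cong_AE(2)) (auto simp: AE_sob_measure)
    also have "\<dots> \<le> sq_norm (sob_measure \<Omega> \<sigma>) (\<lambda>\<xi>. fourier \<Omega> ?q \<xi> - fourier \<Omega> (u' t) \<xi>)"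
      by (rule sq_norm_sob_mono(2)[OF _ sq_int_diff(1)[OF Hspace_sq[OF qH] Hspace_sq[OF u']]]) simp
    also have "\<dots> = Hdist \<Omega> \<sigma> ?q (u' t)" by (rule Hdist_eq_sq_norm[OF qH u', symmetric])
    finally show ?thesis .
  qed
  have ev: "eventually (\<lambda>t'. t' \<in> I) (at t within I)" by (simp add: eventually_at_filter)
  have "((\<lambda>t'. Hdist \<Omega> \<sigma> (\<lambda>x. (u t' x - u t x) / complex_of_real (t' - t)) (u' t) + Hhat_norm \<Omega> (\<sigma> - 2) (\<lambda>\<xi>. ?Q t' \<xi> - ?G \<xi>)) \<longlongrightarrow> 0 + 0) (at t within I)"
    by (intro tendsto_add lim lim2)
  moreover have "eventually (\<lambda>t'. sq_norm ?M (\<lambda>\<xi>. fourier \<Omega> (u' t) \<xi> - ?G \<xi>)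
      \<le> Hdist \<Omega> \<sigma> (\<lambda>x. (u t' x - u t x) / complex_of_real (t' - t)) (u' t) + Hhat_norm \<Omega> (\<sigma> - 2) (\<lambda>\<xi>. ?Q t' \<xi> - ?G \<xi>)) (at t within I)"
    using ev
  proof eventually_elim
    case (elim t')
    have "sq_norm ?M (\<lambda>\<xi>. fourier \<Omega> (u' t) \<xi> - ?G \<xi>)
        \<le> sq_norm ?M (\<lambda>\<xi>. fourier \<Omega> (u' t) \<xi> - ?Q t' \<xi>) + sq_norm ?M (\<lambda>\<xi>. ?Q t' \<xi> - ?G \<xi>)"
      by (rule sq_norm_triangle_diff[OF P Q[OF elim] G])
    moreover have "sq_norm ?M (\<lambda>\<xi>. ?Q t' \<xi> - ?G \<xi>) = Hhat_norm \<Omega> (\<sigma> - 2) (\<lambda>\<xi>. ?Q t' \<xi> - ?G \<xi>)"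
      using sq_int_measurable[OF sq_int_diff(1)[OF Q[OF elim] G]] unfolding sob_measurable by (rule Hhat_norm_sq_norm[symmetric])
    ultimately show ?case using dist[OF elim] unfolding sq_norm_minus_commute[of _ "fourier \<Omega> (u' t)"] by linarith
  qed
  moreover have "at t within I \<noteq> bot" unfolding at_within_open[OF t I] by simp
  ultimately have "sq_norm ?M (\<lambda>\<xi>. fourier \<Omega> (u' t) \<xi> - ?G \<xi>) \<le> 0 + 0"
    by (intro tendsto_lowerbound)
  then have "sq_norm ?M (\<lambda>\<xi>. fourier \<Omega> (u' t) \<xi> - ?G \<xi>) = 0" using sq_norm_nonneg[of ?M "\<lambda>\<xi>. fourier \<Omega> (u' t) \<xi> - ?G \<xi>"] by linarith
  then have "AE \<xi> in ?M. fourier \<Omega> (u' t) \<xi> - ?G \<xi> = 0" using sq_norm_eq_0_iff[OF sq_int_diff(1)[OF P G]] by blast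
  then show ?thesis unfolding AE_sob_measure by eventually_elim simp
qed

text \<open>J is a set of times on which all constants hold. \<open>Ku\<close>, \<open>Kw\<close>
  and \<open>Kn\<close> bound u, its derivative of order s + 1 and the derivative of order s of
  N(u). \<Gamma> leaves room 1 above N(u) for the computed potentials, and \<Lambda> is a Lipschitz
  constant on a ball that contains everything within distance 1 of the solution.\<close>

locale error_analysis = rk_method \<Omega> \<sigma> \<kappa> s A b S C dummy
  for \<Omega> :: domain and \<sigma> :: real and \<kappa> :: complex and s :: nat and A :: "real Matrix.mat" and b :: "real Matrix.vec"
    and S :: "complex set" and C :: real and dummy :: "'d::finite itself" +
  fixes N :: "(real^'d \<Rightarrow> complex) \<Rightarrow> real^'d \<Rightarrow> complex" and c :: "real Matrix.vec"
    and D :: "complex Matrix.mat" and \<Theta> :: "complex Matrix.vec"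
    and I J :: "real set" and w wN :: "nat \<Rightarrow> real \<Rightarrow> real^'d \<Rightarrow> complex"
    and Ku Kw Kn \<Gamma> \<Lambda> KD \<delta> :: real
  assumes colloc: "collocation s A b c" and nodes: "\<And>i. i < s \<Longrightarrow> 0 \<le> c $ i \<and> c $ i \<le> 1" and s1: "s \<ge> 1"
    and D: "D \<in> carrier_mat s s" and consistent: "consistent_step s c D \<Theta>"
    and decay: "\<And>k i j. i < s \<Longrightarrow> j < s \<Longrightarrow> cmod ((D ^\<^sub>m k) $$ (i, j)) \<le> KD * \<delta> ^ k"
    and KD: "0 \<le> KD" and \<delta>: "0 < \<delta>" "\<delta> < 1"
    and N_H: "\<And>v. v \<in> Hspace \<Omega> \<sigma> \<Longrightarrow> N v \<in> Hspace \<Omega> \<sigma>" and JI: "J \<subseteq> I"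
    and w_H: "\<And>j t. j \<le> Suc s \<Longrightarrow> t \<in> I \<Longrightarrow> w j t \<in> Hspace \<Omega> \<sigma>"
    and w_deriv: "\<And>j. j \<le> s \<Longrightarrow> has_Hderivative_on \<Omega> \<sigma> I (w j) (w (Suc j))"
    and wN_H: "\<And>j t. j \<le> s \<Longrightarrow> t \<in> I \<Longrightarrow> wN j t \<in> Hspace \<Omega> \<sigma>"
    and wN_deriv: "\<And>j. j < s \<Longrightarrow> has_Hderivative_on \<Omega> \<sigma> I (wN j) (wN (Suc j))"
    and wN_0: "\<And>t. wN 0 t = N (w 0 t)"
    and eqn: "\<And>t. t \<in> I \<Longrightarrow> AE \<xi> in freq_measure \<Omega>. fourier \<Omega> (w 1 t) \<xi> = Lhat \<Omega> \<kappa> (w 0 t) \<xi> + fourier \<Omega> (\<lambda>x. N (w 0 t) x * w 0 t x) \<xi>"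
    and Ku: "\<And>t. t \<in> J \<Longrightarrow> Hnorm \<Omega> \<sigma> (w 0 t) \<le> Ku" and Kw: "\<And>t. t \<in> J \<Longrightarrow> Hnorm \<Omega> \<sigma> (w (Suc s) t) \<le> Kw"
    and Kn: "\<And>t. t \<in> J \<Longrightarrow> Hnorm \<Omega> \<sigma> (wN s t) \<le> Kn" and \<Gamma>: "\<And>t. t \<in> J \<Longrightarrow> Hnorm \<Omega> \<sigma> (N (w 0 t)) + 1 \<le> \<Gamma>"
    and \<Lambda>: "\<And>v v'. v \<in> Hspace \<Omega> \<sigma> \<Longrightarrow> v' \<in> Hspace \<Omega> \<sigma> \<Longrightarrow> Hnorm \<Omega> \<sigma> v \<le> Ku + 1 \<Longrightarrow> Hnorm \<Omega> \<sigma> v' \<le> Ku + 1 \<Longrightarrow>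
      Hdist \<Omega> \<sigma> (N v) (N v') \<le> \<Lambda> * Hdist \<Omega> \<sigma> v v'"
    and nonneg: "0 \<le> Ku" "0 \<le> Kw" "0 \<le> Kn" "0 \<le> \<Gamma>" "0 \<le> \<Lambda>"
begin

abbreviation u :: "real \<Rightarrow> real^'d \<Rightarrow> complex" where "u \<equiv> w 0"

section \<open>The exact solution as a perturbed Runge-Kutta solution, and one step of the
  error\<close>

definition quad_defect :: "real \<Rightarrow> real \<Rightarrow> real \<Rightarrow> (nat \<Rightarrow> real) \<Rightarrow> real^'d \<Rightarrow> complex" where
  "quad_defect h t y a = (\<lambda>x. u (t + y * h) x - u t x - complex_of_real h * (\<Sum>j<s. complex_of_real (a j) * w 1 (t + c $ j * h) x))"

lemma node_J: "i < s \<Longrightarrow> 0 \<le> h \<Longrightarrow> {t..t + h} \<subseteq> J \<Longrightarrow> t + c $ i * h \<in> J"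
  using nodes[of i] mult_right_mono[of "c $ i" 1 h] by auto

lemma u_H: "t \<in> J \<Longrightarrow> u t \<in> H"
  using w_H JI by blast

lemma quad_defect_H:
  assumes "{t..t + h} \<subseteq> J" "0 \<le> h" "0 \<le> y" "y \<le> 1" "\<And>q. q < s \<Longrightarrow> (\<Sum>j<s. a j * (c $ j) ^ q) = y ^ Suc q / real (Suc q)"
  shows "quad_defect h t y a \<in> H" "nrm (quad_defect h t y a) \<le> Kw * h ^ Suc s * (1 + (\<Sum>j<s. \<bar>a j\<bar>))"
proof -
  note Q = quadrature_defect[of s I w \<Omega> \<sigma> J Kw t h y "\<lambda>j. c $ j" a, OF w_H w_deriv JI Kw assms(1,2,3,4) nodes assms(5)]
  show "quad_defect h t y a \<in> H" unfolding quad_defect_def by (rule Q(1))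
  show "nrm (quad_defect h t y a) \<le> Kw * h ^ Suc s * (1 + (\<Sum>j<s. \<bar>a j\<bar>))" unfolding quad_defect_def by (rule Q(2))
qed

text \<open>The equation replaces the time derivatives in the quadrature formula by L u + N(u) u, so
  the values of u at the nodes satisfy the stage equations up to the defect.\<close>

lemma quad_defect_eq:
  assumes h: "0 \<le> h" and J: "{t..t + h} \<subseteq> J" and y: "0 \<le> y" "y \<le> 1"
    and mom: "\<And>q. q < s \<Longrightarrow> (\<Sum>j<s. a j * (c $ j) ^ q) = y ^ Suc q / real (Suc q)"
  shows "AE \<xi> in \<nu>. four (u (t + y * h)) \<xi> = four (u t) \<xi> + complex_of_real h *
      (\<Sum>j<s. complex_of_real (a j) * (Lhat \<Omega> \<kappa> (u (t + c $ j * h)) \<xi> + four (\<lambda>x. N (u (t + c $ j * h)) x * u (t + c $ j * h) x) \<xi>))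
      + four (quad_defect h t y a) \<xi>"
proof -
  let ?W = "\<lambda>x. \<Sum>j<s. complex_of_real (a j) * w 1 (t + c $ j * h) x"
  have w1: "w 1 (t + c $ j * h) \<in> H" if "j < s" for j
    using w_H[of 1] node_J[OF that h J] JI s1 by auto
  have yJ: "t + y * h \<in> J" "t \<in> J" using J h y mult_right_mono[of y 1 h] by auto
  have W: "?W \<in> H" by (intro Hspace_sum Hspace_cmult w1) auto
  have Wf: "AE \<xi> in \<nu>. four ?W \<xi> = (\<Sum>j<s. complex_of_real (a j) * four (w 1 (t + c $ j * h)) \<xi>)"
    by (rule fourier_sum[OF finite_lessThan]) (use w1 in simp)
  have "AE \<xi> in \<nu>. four (quad_defect h t y a) \<xi> = four (\<lambda>x. u (t + y * h) x - u t x) \<xi> - four (\<lambda>x. complex_of_real h * ?W x) \<xi>"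
    unfolding quad_defect_def by (intro fourier_diff H_L2 Hspace_diff u_H yJ Hspace_cmult W)
  moreover have "AE \<xi> in \<nu>. four (\<lambda>x. u (t + y * h) x - u t x) \<xi> = four (u (t + y * h)) \<xi> - four (u t) \<xi>"
    by (intro fourier_diff H_L2 u_H yJ)
  moreover have "AE \<xi> in \<nu>. four (\<lambda>x. complex_of_real h * ?W x) \<xi> = complex_of_real h * four ?W \<xi>"
    using fourier_linear[OF H_L2[OF W] H_L2[OF W], of "complex_of_real h" 0] by simp
  moreover have "AE \<xi> in \<nu>. \<forall>j\<in>{..<s}. four (w 1 (t + c $ j * h)) \<xi> = Lhat \<Omega> \<kappa> (u (t + c $ j * h)) \<xi> + four (\<lambda>x. N (u (t + c $ j * h)) x * u (t + c $ j * h) x) \<xi>"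
    using eqn node_J[OF _ h J] JI by (intro AE_finite_allI) auto
  ultimately show ?thesis using Wf
  proof eventually_elim
    case (elim \<xi>)
    have "(\<Sum>j<s. complex_of_real (a j) * four (w 1 (t + c $ j * h)) \<xi>) = (\<Sum>j<s. complex_of_real (a j) * (Lhat \<Omega> \<kappa> (u (t + c $ j * h)) \<xi> + four (\<lambda>x. N (u (t + c $ j * h)) x * u (t + c $ j * h) x) \<xi>))"
      using elim(4) by simp
    with elim(1-3,5) show ?case by (simp only:) simp
  qed
qed

definition row_const :: real where
  "row_const = 1 + (\<Sum>i<s. \<Sum>j<s. \<bar>A $$ (i, j)\<bar>) + (\<Sum>j<s. \<bar>b $ j\<bar>)"

text \<open>Read off from \<open>one_step\<close> after elimination of the stage errors: C times the
  bound of the source errors, C times that of the stage defects, and the defect of the update, each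
  divided by h and by the total \<open>T\<close> of the errors where these factors occur.\<close>

definition step_const :: real where
  "step_const = C * (alg_const * (real s * Ku + \<Gamma> * (2 * (real s * C) * (1 + real s * (Kw * row_const) + alg_const * (real s * Ku)))))
     + C * (real s * (Kw * row_const)) + Kw * row_const"

lemma row_const: "i < s \<Longrightarrow> 1 + (\<Sum>j<s. \<bar>A $$ (i, j)\<bar>) \<le> row_const" "1 + (\<Sum>j<s. \<bar>b $ j\<bar>) \<le> row_const" "0 \<le> row_const"
proof -
  have nn: "0 \<le> (\<Sum>i<s. \<Sum>j<s. \<bar>A $$ (i, j)\<bar>)" "0 \<le> (\<Sum>j<s. \<bar>b $ j\<bar>)" by (intro sum_nonneg abs_ge_zero)+
  show "1 + (\<Sum>j<s. \<bar>A $$ (i, j)\<bar>) \<le> row_const" if "i < s"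
  proof -
    have "(\<Sum>j<s. \<bar>A $$ (i, j)\<bar>) \<le> (\<Sum>i<s. \<Sum>j<s. \<bar>A $$ (i, j)\<bar>)"
      using that by (intro member_le_sum[of i "{..<s}" "\<lambda>i. \<Sum>j<s. \<bar>A $$ (i, j)\<bar>"]) (auto intro: sum_nonneg)
    then show ?thesis using nn unfolding row_const_def by linarith
  qed
  show "1 + (\<Sum>j<s. \<bar>b $ j\<bar>) \<le> row_const" "0 \<le> row_const" using nn by (auto simp: row_const_def)
qed

lemma step_const_nonneg: "0 \<le> step_const"
  unfolding step_const_def
  by (intro add_nonneg_nonneg mult_nonneg_nonneg C0 nonneg alg_const_nonneg row_const(3)) auto

lemma moments_A: "i < s \<Longrightarrow> q < s \<Longrightarrow> (\<Sum>j<s. A $$ (i, j) * (c $ j) ^ q) = (c $ i) ^ Suc q / real (Suc q)"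
  using collocation_moments(1)[OF colloc] nodes by blast

lemma moments_b: "q < s \<Longrightarrow> (\<Sum>j<s. b $ j * (c $ j) ^ q) = 1 ^ Suc q / real (Suc q)"
  using collocation_moments(2)[OF colloc] nodes by simp

text \<open>Stage errors X are bounded by source errors Y, and these again by X; the loop is closed
  by \<open>small\<close>, which lets half of X be absorbed. All that is added to the old error then
  carries a factor h.\<close>

lemma one_step:
  assumes h: "0 \<le> h" "h \<le> 1" and J: "{t..t + h} \<subseteq> J" and v: "v \<in> H"
    and \<gamma>: "\<And>k. k < s \<Longrightarrow> \<gamma> k \<in> H" "\<And>k. k < s \<Longrightarrow> nrm (\<gamma> k) \<le> \<Gamma>"
    and G: "\<And>k. k < s \<Longrightarrow> Hdist \<Omega> \<sigma> (N (u (t + c $ k * h))) (\<gamma> k) \<le> G" "0 \<le> G"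
    and small: "real s * (C * (h * (alg_const * \<Gamma>))) \<le> 1 / 2"
  shows "step_well_defined \<Omega> \<sigma> \<kappa> s A b h v \<gamma>" "next_u \<Omega> \<sigma> \<kappa> s A b h v \<gamma> \<in> H"
    "Hdist \<Omega> \<sigma> (u (t + h)) (next_u \<Omega> \<sigma> \<kappa> s A b h v \<gamma>) \<le> Hdist \<Omega> \<sigma> (u t) v + h * (step_const * (Hdist \<Omega> \<sigma> (u t) v + G + h ^ s))"
proof -
  show wd: "step_well_defined \<Omega> \<sigma> \<kappa> s A b h v \<gamma>" by (rule step_well_definedI[OF h(1) v \<gamma> small])
  let ?v' = "next_u \<Omega> \<sigma> \<kappa> s A b h v \<gamma>"
  obtain U where st: "solves_stages \<Omega> \<sigma> \<kappa> s A h v \<gamma> U" and up: "is_update \<Omega> \<sigma> \<kappa> s b h v \<gamma> U ?v'"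
    by (rule next_u_props[OF wd])
  have U: "\<And>i. i < s \<Longrightarrow> U i \<in> H" and eqU: "stage_eqs h v U (\<lambda>j x. \<gamma> j x * U j x) (\<lambda>_ _. 0)"
    using st by (auto simp: solves_stages_iff)
  show v': "?v' \<in> H" using up by (simp add: is_update_def)
  define y where "y i = u (t + c $ i * h)" for i
  have yJ: "t + c $ i * h \<in> J" if "i < s" for i by (rule node_J[OF that h(1) J])
  have tJ: "t \<in> J" "t + h \<in> J" using J h by auto
  have yH: "y i \<in> H" and NyH: "N (y i) \<in> H" if "i < s" for i using u_H[OF yJ[OF that]] N_H by (simp_all add: y_def)
  define Q where "Q i = quad_defect h t (c $ i) (\<lambda>j. A $$ (i, j))" for i
  define q where "q = quad_defect h t 1 (\<lambda>j. b $ j)"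
  have QH: "Q i \<in> H" and Qn: "nrm (Q i) \<le> Kw * row_const * h ^ Suc s" if i: "i < s" for i
  proof -
    note QQ = quad_defect_H[OF J h(1) _ _ moments_A[OF i]]
    show "Q i \<in> H" unfolding Q_def by (rule QQ(1)) (use nodes[OF i] in auto)
    have "nrm (Q i) \<le> Kw * h ^ Suc s * (1 + (\<Sum>j<s. \<bar>A $$ (i, j)\<bar>))" unfolding Q_def by (rule QQ(2)) (use nodes[OF i] in auto)
    also have "\<dots> \<le> Kw * h ^ Suc s * row_const" using h nonneg by (intro mult_left_mono row_const(1) i) auto
    finally show "nrm (Q i) \<le> Kw * row_const * h ^ Suc s" by (simp add: mult_ac)
  qed
  have qH: "q \<in> H" and qn: "nrm q \<le> Kw * row_const * h ^ Suc s"
  proof -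
    note QQ = quad_defect_H[OF J h(1) _ _ moments_b]
    show "q \<in> H" unfolding q_def by (rule QQ(1)) auto
    have "nrm q \<le> Kw * h ^ Suc s * (1 + (\<Sum>j<s. \<bar>b $ j\<bar>))" unfolding q_def by (rule QQ(2)) auto
    also have "\<dots> \<le> Kw * h ^ Suc s * row_const" using h nonneg by (intro mult_left_mono row_const(2)) auto
    finally show "nrm q \<le> Kw * row_const * h ^ Suc s" by (simp add: mult_ac)
  qed
  have eqy: "stage_eqs h (u t) y (\<lambda>j x. N (y j) x * y j x) Q"
    unfolding stage_eqs_def
  proof (intro allI impI)
    fix i assume i: "i < s"
    show "AE \<xi> in \<nu>. four (y i) \<xi> = four (u t) \<xi> + complex_of_real h *
        (\<Sum>j<s. complex_of_real (A $$ (i, j)) * (Lhat \<Omega> \<kappa> (y j) \<xi> + four (\<lambda>x. N (y j) x * y j x) \<xi>)) + four (Q i) \<xi>"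
      unfolding y_def Q_def by (rule quad_defect_eq[OF h(1) J _ _ moments_A[OF i]]) (use nodes[OF i] in auto)
  qed
  define e where "e = (\<lambda>x. u t x - v x)"
  define E where "E = (\<lambda>i x. y i x - U i x)"
  define F where "F = (\<lambda>i x. N (y i) x * y i x - \<gamma> i x * U i x)"
  have eH: "e \<in> H" unfolding e_def by (intro Hspace_diff u_H tJ v)
  have EH: "E i \<in> H" and FH: "F i \<in> H" if "i < s" for i
    using that yH NyH U \<gamma> by (auto simp: E_def F_def intro!: Hspace_diff H_mult)
  have eqs: "stage_eqs h e E F Q"
  proof -
    have "stage_eqs h (\<lambda>x. u t x - v x) (\<lambda>i x. y i x - U i x) (\<lambda>i x. N (y i) x * y i x - \<gamma> i x * U i x) (\<lambda>i x. Q i x - 0)"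
      by (rule stage_eqs_diff[OF _ _ _ _ _ _ _ _ eqy eqU]) (use u_H tJ v yH U NyH \<gamma> QH in \<open>auto intro: H_mult\<close>)
    then show ?thesis by (simp add: e_def E_def F_def)
  qed
  define X where "X = (\<Sum>k<s. nrm (E k))"
  define Y where "Y = (\<Sum>k<s. nrm (F k))"
  define Z where "Z = (\<Sum>k<s. nrm (Q k))"
  define a where "a = alg_const"
  define K where "K = Kw * row_const"
  have pos: "0 \<le> a" "0 \<le> K" "0 \<le> X" "0 \<le> Y" "0 \<le> Z" "0 \<le> h ^ s"
    using h alg_const_nonneg nonneg row_const(3) by (auto simp: a_def K_def X_def Y_def Z_def intro: sum_nonneg)
  \<comment> \<open>Splitting N(y) y - \<gamma> U as (N(y) - \<gamma>) y + \<gamma> (y - U) uses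
    only the bounds of the exact solution and of \<gamma>; no bound of the computed stages U is
    required.\<close>
  have Fn: "nrm (F k) \<le> a * (G * Ku + \<Gamma> * nrm (E k))" if k: "k < s" for k
  proof -
    have "F k = (\<lambda>x. (N (y k) x - \<gamma> k x) * y k x + \<gamma> k x * E k x)" by (rule ext) (simp add: F_def E_def algebra_simps)
    then have "nrm (F k) \<le> nrm (\<lambda>x. (N (y k) x - \<gamma> k x) * y k x) + nrm (\<lambda>x. \<gamma> k x * E k x)"
      using Hnorm_triangle[OF H_mult[OF Hspace_diff[OF NyH[OF k] \<gamma>(1)[OF k]] yH[OF k]] H_mult[OF \<gamma>(1)[OF k] EH[OF k]]] by simp
    also have "\<dots> \<le> a * nrm (\<lambda>x. N (y k) x - \<gamma> k x) * nrm (y k) + a * nrm (\<gamma> k) * nrm (E k)"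
      unfolding a_def using k by (intro add_mono nrm_mult Hspace_diff NyH \<gamma> yH EH)
    also have "\<dots> \<le> a * G * Ku + a * \<Gamma> * nrm (E k)"
      using G(1)[OF k] Ku[OF yJ[OF k]] \<gamma>(2)[OF k] pos G(2)
      by (intro add_mono mult_mono) (auto simp: Hdist_def y_def nonneg)
    finally show ?thesis by (simp add: algebra_simps)
  qed
  have Yle: "Y \<le> a * (real s * G * Ku + \<Gamma> * X)"
  proof -
    have "Y \<le> (\<Sum>k<s. a * (G * Ku + \<Gamma> * nrm (E k)))" unfolding Y_def by (intro sum_mono Fn) simp
    also have "\<dots> = a * (real s * G * Ku + \<Gamma> * X)"
      by (simp add: X_def sum_distrib_left sum.distrib distrib_left mult_ac)
    finally show ?thesis .
  qed
  have Zle: "Z \<le> real s * K * h ^ Suc s"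
  proof -
    have "Z \<le> (\<Sum>k<s. Kw * row_const * h ^ Suc s)" unfolding Z_def by (intro sum_mono Qn) simp
    then show ?thesis by (simp add: K_def mult_ac)
  qed
  have Xle: "X \<le> real s * C * (nrm e + h * Y + Z)"
  proof -
    have "X \<le> (\<Sum>i<s. C * (nrm e + h * Y + Z))" unfolding X_def Y_def Z_def
      by (intro sum_mono stage_estimate[OF h(1) eH EH FH QH eqs]) auto
    then show ?thesis by simp
  qed
  \<comment> \<open>The three sources of error in one quantity, so that each of X, Y and Z can be
    bounded by a multiple of it.\<close>
  define T where "T = nrm e + G + h ^ s"
  have ne: "0 \<le> nrm e" by simp
  have T: "0 \<le> T" "nrm e \<le> T" "G \<le> T" "h ^ s \<le> T" unfolding T_def using G(2) pos(6) ne by linarith+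
  have Z1: "Z \<le> h * (real s * K * T)" 
  proof -
    have "real s * K * h ^ Suc s = h * (real s * K * h ^ s)" by simp
    also have "\<dots> \<le> h * (real s * K * T)" using h pos T by (intro mult_left_mono) auto
    finally show ?thesis using Zle by linarith
  qed
  have hle: "h * x \<le> x" if "0 \<le> x" for x using h that by (simp add: mult_left_le_one_le)
  have X1: "X \<le> 2 * (real s * C) * ((1 + real s * K + a * (real s * Ku)) * T)"
  proof -
    have "h * Y \<le> h * (a * (real s * G * Ku + \<Gamma> * X))" using h by (intro mult_left_mono Yle)
    also have "\<dots> = h * (a * (real s * Ku) * G) + h * (a * \<Gamma>) * X" by (simp add: algebra_simps)
    also have "\<dots> \<le> a * (real s * Ku) * T + h * (a * \<Gamma>) * X"
    proof (intro add_mono order_refl)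
      have "h * (a * (real s * Ku) * G) \<le> a * (real s * Ku) * G" using pos nonneg G(2) by (intro hle mult_nonneg_nonneg) auto
      also have "\<dots> \<le> a * (real s * Ku) * T" using pos nonneg T by (intro mult_left_mono) auto
      finally show "h * (a * (real s * Ku) * G) \<le> a * (real s * Ku) * T" .
    qed
    finally have hY: "h * Y \<le> a * (real s * Ku) * T + h * (a * \<Gamma>) * X" .
    have "Z \<le> real s * K * T" using Z1 hle[of "real s * K * T"] pos T by (auto intro: order_trans)
    then have "nrm e + h * Y + Z \<le> (1 + real s * K + a * (real s * Ku)) * T + h * (a * \<Gamma>) * X"
      using hY T(2) by (simp add: algebra_simps)
    then have "real s * C * (nrm e + h * Y + Z) \<le> real s * C * ((1 + real s * K + a * (real s * Ku)) * T + h * (a * \<Gamma>) * X)"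
      using C0 by (intro mult_left_mono) auto
    also have "\<dots> = real s * C * ((1 + real s * K + a * (real s * Ku)) * T) + (real s * (C * (h * (a * \<Gamma>)))) * X" by (simp add: algebra_simps)
    \<comment> \<open>By \<open>small\<close> the coefficient of X on the right is at most
      1/2.\<close>
    also have "\<dots> \<le> real s * C * ((1 + real s * K + a * (real s * Ku)) * T) + (1 / 2) * X"
      using small unfolding a_def by (intro add_left_mono mult_right_mono pos(3))
    finally show ?thesis using Xle by linarith
  qed
  have Y1: "Y \<le> a * (real s * Ku + \<Gamma> * (2 * (real s * C) * (1 + real s * K + a * (real s * Ku)))) * T"
  proof -
    have "Y \<le> a * (real s * G * Ku + \<Gamma> * X)" by (rule Yle)
    also have "\<dots> \<le> a * (real s * T * Ku + \<Gamma> * (2 * (real s * C) * ((1 + real s * K + a * (real s * Ku)) * T)))"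
      by (intro mult_left_mono add_mono mult_right_mono X1 T(3) nonneg pos(1)) simp
    also have "\<dots> = a * (real s * Ku + \<Gamma> * (2 * (real s * C) * (1 + real s * K + a * (real s * Ku)))) * T"
      by (simp add: algebra_simps)
    finally show ?thesis .
  qed
  let ?g = "\<lambda>\<xi>. four (u (t + h)) \<xi> - four ?v' \<xi>"
  have gm: "?g \<in> borel_measurable \<nu>" using u_H[OF tJ(2)] v' by (intro borel_measurable_diff fourier_measurable H_L2)
  \<comment> \<open>Here \<open>q\<close> is the quadrature defect over the whole step, that is, at
    y = 1 with weights b.\<close>
  have upd: "AE \<xi> in \<nu>. ?g \<xi> = four e \<xi> + complex_of_real h * (\<Sum>i<s. complex_of_real (b $ i) * (Lhat \<Omega> \<kappa> (E i) \<xi> + four (F i) \<xi>)) + four q \<xi>"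
  proof -
    have 1: "AE \<xi> in \<nu>. four (u (t + 1 * h)) \<xi> = four (u t) \<xi> + complex_of_real h *
        (\<Sum>j<s. complex_of_real (b $ j) * (Lhat \<Omega> \<kappa> (y j) \<xi> + four (\<lambda>x. N (y j) x * y j x) \<xi>)) + four q \<xi>"
      unfolding y_def q_def by (rule quad_defect_eq[OF h(1) J _ _ moments_b]) auto
    have 2: "AE \<xi> in \<nu>. four ?v' \<xi> = four v \<xi> + complex_of_real h *
        (\<Sum>i<s. complex_of_real (b $ i) * (Lhat \<Omega> \<kappa> (U i) \<xi> + four (\<lambda>x. \<gamma> i x * U i x) \<xi>))"
      using up by (simp add: is_update_def)
    have 3: "AE \<xi> in \<nu>. four e \<xi> = four (u t) \<xi> - four v \<xi>" unfolding e_def by (intro fourier_diff H_L2 u_H tJ v)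
    have 4: "AE \<xi> in \<nu>. \<forall>i\<in>{..<s}. four (E i) \<xi> = four (y i) \<xi> - four (U i) \<xi>"
      unfolding E_def using yH U by (intro AE_finite_allI fourier_diff H_L2) auto
    have 5: "AE \<xi> in \<nu>. \<forall>i\<in>{..<s}. four (F i) \<xi> = four (\<lambda>x. N (y i) x * y i x) \<xi> - four (\<lambda>x. \<gamma> i x * U i x) \<xi>"
      unfolding F_def using yH U NyH \<gamma> by (intro AE_finite_allI fourier_diff H_L2 H_mult) auto
    show ?thesis using 1 2 3 4 5
    proof eventually_elim
      case (elim \<xi>)
      have "(\<Sum>i<s. complex_of_real (b $ i) * (Lhat \<Omega> \<kappa> (E i) \<xi> + four (F i) \<xi>))
          = (\<Sum>i<s. complex_of_real (b $ i) * (Lhat \<Omega> \<kappa> (y i) \<xi> + four (\<lambda>x. N (y i) x * y i x) \<xi>)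
              - complex_of_real (b $ i) * (Lhat \<Omega> \<kappa> (U i) \<xi> + four (\<lambda>x. \<gamma> i x * U i x) \<xi>))"
      proof (intro sum.cong refl)
        fix i assume i: "i \<in> {..<s}"
        show "complex_of_real (b $ i) * (Lhat \<Omega> \<kappa> (E i) \<xi> + four (F i) \<xi>)
            = complex_of_real (b $ i) * (Lhat \<Omega> \<kappa> (y i) \<xi> + four (\<lambda>x. N (y i) x * y i x) \<xi>)
              - complex_of_real (b $ i) * (Lhat \<Omega> \<kappa> (U i) \<xi> + four (\<lambda>x. \<gamma> i x * U i x) \<xi>)"
          unfolding Lhat_symbol bspec[OF elim(4) i] bspec[OF elim(5) i] by (simp add: algebra_simps)
      qed
      then show ?case unfolding sum_subtractf using elim(1,2,3) by (simp add: right_diff_distrib)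
    qed
  qed
  note est = update_estimate[OF h(1) eH EH FH QH qH gm eqs upd]
  have "Hdist \<Omega> \<sigma> (u (t + h)) ?v' = sq_norm sm ?g" by (rule Hdist_eq_sq_norm[OF u_H[OF tJ(2)] v'])
  also have "\<dots> \<le> nrm e + C * (h * Y + Z) + nrm q" unfolding Y_def Z_def by (rule est(2))
  also have "\<dots> \<le> nrm e + C * (h * (a * (real s * Ku + \<Gamma> * (2 * (real s * C) * (1 + real s * K + a * (real s * Ku)))) * T) + h * (real s * K * T)) + h * (K * T)"
  proof (intro add_mono mult_left_mono order_refl Y1 Z1 C0 h(1))
    have "nrm q \<le> h * (K * h ^ s)" using qn by (simp add: K_def mult_ac)
    also have "\<dots> \<le> h * (K * T)" using h pos T by (intro mult_left_mono) auto
    finally show "nrm q \<le> h * (K * T)" .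
  qed
  also have "\<dots> = nrm e + h * (step_const * T)"
    unfolding step_const_def a_def[symmetric] K_def[symmetric] by (simp add: algebra_simps)
  finally show "Hdist \<Omega> \<sigma> (u (t + h)) ?v' \<le> Hdist \<Omega> \<sigma> (u t) v + h * (step_const * (Hdist \<Omega> \<sigma> (u t) v + G + h ^ s))"
    by (simp add: T_def e_def Hdist_def)
qed

section \<open>The error of the potentials\<close>

lemma Theta_moment: "i < s \<Longrightarrow> q < s \<Longrightarrow>
    complex_of_real (c $ i) ^ q = (\<Sum>j<s. D $$ (i, j) * complex_of_real (c $ j - 1) ^ q) + (if q = 0 then \<Theta> $ i else 0)"
  by (rule consistent_step_moments[OF consistent D])

text \<open>The Lipschitz error of N(u_n) weighted by \<open>\<Theta>\<close>, plus the
  extrapolation defect of the exact values.\<close>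

definition extrap_const :: real where
  "extrap_const = (\<Sum>i<s. cmod (\<Theta> $ i)) * \<Lambda> + Kn * (1 + (\<Sum>i<s. \<Sum>j<s. cmod (D $$ (i, j))))"

definition gamma_const :: real where
  "gamma_const = real s * KD * (1 + extrap_const / (1 - \<delta>))"

lemma extrap_const_nonneg: "0 \<le> extrap_const"
  unfolding extrap_const_def by (intro add_nonneg_nonneg mult_nonneg_nonneg nonneg sum_nonneg) auto

lemma gamma_const_nonneg: "0 \<le> gamma_const"
  unfolding gamma_const_def using extrap_const_nonneg \<delta> KD by (intro mult_nonneg_nonneg add_nonneg_nonneg divide_nonneg_nonneg) auto

lemma next_gamma_H:
  assumes "v \<in> H" "\<And>j. j < s \<Longrightarrow> \<gamma> j \<in> H"
  shows "next_gamma s D \<Theta> N v \<gamma> i \<in> H"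
  unfolding next_gamma_def using assms by (intro Hspace_add Hspace_sum Hspace_cmult N_H) auto

text \<open>
  The differences between the exact values of \<open>N(u)\<close> and \<open>\<Gamma>\<^bsub>n-1\<^esub>\<close> satisfy a linear recursion with the
  power bounded matrix \<open>D\<close>; consistency makes its right-hand side small.
\<close>

lemma gamma_error:
  assumes h: "0 \<le> h" and J: "\<And>n. n < m \<Longrightarrow> {real n * h - h..real n * h + h} \<subseteq> J" and J0: "{- h..h} \<subseteq> J"
    and v: "\<And>n. n < m \<Longrightarrow> v n \<in> H" "\<And>n. n < m \<Longrightarrow> Hdist \<Omega> \<sigma> (u (real n * h)) (v n) \<le> B" and B: "0 \<le> B" "B \<le> 1"
    and \<gamma>0: "\<And>i. i < s \<Longrightarrow> \<gamma> 0 i \<in> H" "\<And>i. i < s \<Longrightarrow> Hdist \<Omega> \<sigma> (N (u (- h + c $ i * h))) (\<gamma> 0 i) \<le> g" and g: "0 \<le> g"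
    and \<gamma>: "\<And>n. n < m \<Longrightarrow> \<gamma> (Suc n) = next_gamma s D \<Theta> N (v n) (\<gamma> n)"
    and n: "n \<le> m" and i: "i < s"
  shows "\<gamma> n i \<in> H" "Hdist \<Omega> \<sigma> (N (u (real n * h + (c $ i - 1) * h))) (\<gamma> n i) \<le> gamma_const * (g + B + h ^ s)"
proof -
  have \<gamma>H: "\<gamma> n i \<in> H" if "n \<le> m" "i < s" for n i
    using that
  proof (induction n arbitrary: i)
    case 0 then show ?case using \<gamma>0 by simp
  next
    case (Suc n)
    then show ?case using \<gamma>[of n] v by (simp add: next_gamma_H)
  qed
  show "\<gamma> n i \<in> H" by (rule \<gamma>H[OF n i])
  have J': "real n * h + (c $ i - 1) * h \<in> J" if n: "n \<le> m" and i: "i < s" for n i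
  proof -
    have ch: "0 \<le> c $ i * h" "c $ i * h \<le> h" using nodes[OF i] h mult_right_mono[of "c $ i" 1 h] by auto
    show ?thesis
    proof (cases n)
      case 0 then show ?thesis using J0 ch by (auto simp: algebra_simps)
    next
      case (Suc k)
      then have "real n * h + (c $ i - 1) * h \<in> {real k * h - h..real k * h + h}" using ch h by (auto simp: algebra_simps)
      then show ?thesis using J[of k] n Suc by auto
    qed
  qed
  define G where "G n i = (\<lambda>x. wN 0 (real n * h + (c $ i - 1) * h) x - \<gamma> n i x)" for n i
  \<comment> \<open>The residual of the exact values of N(u) in the recursion, small of order h^s by
    consistency; \<open>R\<close> adds the error made by evaluating N at v n.\<close>
  define P where "P n i = (\<lambda>x. wN 0 (real n * h + c $ i * h) x - (\<Sum>j<s. D $$ (i, j) * wN 0 (real n * h + (c $ j - 1) * h) x) - \<Theta> $ i * wN 0 (real n * h) x)" for n i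
  define R where "R n i = (\<lambda>x. P n i x + \<Theta> $ i * (N (u (real n * h)) x - N (v n) x))" for n i
  have GH: "G n i \<in> H" if "n \<le> m" "i < s" for n i
    unfolding G_def wN_0 using that by (intro Hspace_diff N_H u_H J' \<gamma>H)
  have tJ: "real n * h \<in> J" if "n < m" for n using J[OF that] h by auto
  have PH: "P n i \<in> H" and Pn: "nrm (P n i) \<le> Kn * h ^ s * (1 + (\<Sum>i<s. \<Sum>j<s. cmod (D $$ (i, j))))"
    if n: "n < m" and i: "i < s" for n i
  proof -
    note X = extrapolation_defect[of s I wN \<Omega> \<sigma> J Kn "real n * h" h "c $ i" "\<lambda>j. c $ j" "\<lambda>j. D $$ (i, j)" "\<Theta> $ i",
      OF wN_H wN_deriv JI Kn J[OF n] h _ _ nodes s1 Theta_moment[OF i]]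
    show "P n i \<in> H" unfolding P_def by (rule X(1)) (use nodes[OF i] in auto)
    have "nrm (P n i) \<le> Kn * h ^ s * (1 + (\<Sum>j<s. cmod (D $$ (i, j))))" unfolding P_def by (rule X(2)) (use nodes[OF i] in auto)
    also have "\<dots> \<le> Kn * h ^ s * (1 + (\<Sum>i<s. \<Sum>j<s. cmod (D $$ (i, j))))"
      using h nonneg i by (intro mult_left_mono add_left_mono member_le_sum[of i "{..<s}" "\<lambda>i. \<Sum>j<s. cmod (D $$ (i, j))"]) (auto intro: sum_nonneg)
    finally show "nrm (P n i) \<le> Kn * h ^ s * (1 + (\<Sum>i<s. \<Sum>j<s. cmod (D $$ (i, j))))" .
  qed
  have dN: "(\<lambda>x. N (u (real n * h)) x - N (v n) x) \<in> H" if "n < m" for n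
    using that by (intro Hspace_diff N_H u_H tJ v)
  have RH: "R n i \<in> H" if "n < m" "i < s" for n i
    unfolding R_def using that by (intro Hspace_add PH Hspace_cmult dN)
  have Rn: "nrm (R n i) \<le> extrap_const * (B + h ^ s)" if n: "n < m" and i: "i < s" for n i
  proof -
    \<comment> \<open>B <= 1 keeps the computed solution in the ball where \<Lambda> is
      valid.\<close>
    have vn: "nrm (v n) \<le> Ku + 1"
      using Hnorm_le_Hdist[OF v(1)[OF n] u_H[OF tJ[OF n]]] v(2)[OF n] B Ku[OF tJ[OF n]] Hdist_commute[OF v(1)[OF n] u_H[OF tJ[OF n]]] by linarith
    have "Hdist \<Omega> \<sigma> (N (u (real n * h))) (N (v n)) \<le> \<Lambda> * Hdist \<Omega> \<sigma> (u (real n * h)) (v n)"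
      by (rule \<Lambda>[OF u_H[OF tJ[OF n]] v(1)[OF n] _ vn]) (use Ku[OF tJ[OF n]] in simp)
    also have "\<dots> \<le> \<Lambda> * B" by (intro mult_left_mono v n nonneg)
    finally have L: "nrm (\<lambda>x. N (u (real n * h)) x - N (v n) x) \<le> \<Lambda> * B" by (simp add: Hdist_def)
    have \<Theta>: "cmod (\<Theta> $ i) \<le> (\<Sum>i<s. cmod (\<Theta> $ i))" using i by (intro member_le_sum) auto
    have "nrm (R n i) \<le> nrm (P n i) + nrm (\<lambda>x. \<Theta> $ i * (N (u (real n * h)) x - N (v n) x))"
      unfolding R_def by (intro Hnorm_triangle PH Hspace_cmult dN n i)
    also have "\<dots> \<le> Kn * h ^ s * (1 + (\<Sum>i<s. \<Sum>j<s. cmod (D $$ (i, j)))) + (\<Sum>i<s. cmod (\<Theta> $ i)) * (\<Lambda> * B)"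
    proof (intro add_mono Pn n i)
      have "nrm (\<lambda>x. \<Theta> $ i * (N (u (real n * h)) x - N (v n) x)) = cmod (\<Theta> $ i) * nrm (\<lambda>x. N (u (real n * h)) x - N (v n) x)"
        by (rule Hnorm_cmult[OF dN[OF n]])
      also have "\<dots> \<le> (\<Sum>i<s. cmod (\<Theta> $ i)) * (\<Lambda> * B)" by (intro mult_mono \<Theta> L) (auto intro: sum_nonneg)
      finally show "nrm (\<lambda>x. \<Theta> $ i * (N (u (real n * h)) x - N (v n) x)) \<le> (\<Sum>i<s. cmod (\<Theta> $ i)) * (\<Lambda> * B)" .
    qed
    also have "\<dots> \<le> extrap_const * (B + h ^ s)"
    proof -
      let ?a = "(\<Sum>i<s. cmod (\<Theta> $ i)) * \<Lambda>" and ?b = "Kn * (1 + (\<Sum>i<s. \<Sum>j<s. cmod (D $$ (i, j))))"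
      have "0 \<le> ?a" by (intro mult_nonneg_nonneg nonneg sum_nonneg) simp
      moreover have "0 \<le> ?b" by (intro add_nonneg_nonneg mult_nonneg_nonneg nonneg sum_nonneg) simp_all
      ultimately have ab: "0 \<le> ?a" "0 \<le> ?b" .
      have "extrap_const * (B + h ^ s) = ?a * B + ?b * h ^ s + (?a * h ^ s + ?b * B)" by (simp add: extrap_const_def algebra_simps)
      moreover have "0 \<le> ?a * h ^ s + ?b * B" by (intro add_nonneg_nonneg mult_nonneg_nonneg[OF ab(1)] mult_nonneg_nonneg[OF ab(2)] B(1) zero_le_power h)
      ultimately show ?thesis by (simp add: mult_ac)
    qed
    finally show ?thesis .
  qed
  have rec: "G (Suc n) i = (\<lambda>x. (\<Sum>j<s. D $$ (i, j) * G n j x) + R n i x)" if "n < m" "i < s" for n i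
  proof (rule ext)
    fix x
    have t: "real (Suc n) * h + (c $ i - 1) * h = real n * h + c $ i * h" by (simp add: algebra_simps)
    show "G (Suc n) i x = (\<Sum>j<s. D $$ (i, j) * G n j x) + R n i x"
      unfolding G_def R_def P_def \<gamma>[OF that(1)] next_gamma_def t by (simp add: right_diff_distrib sum_subtractf wN_0)
  qed
  have g0: "nrm (G 0 i) \<le> g" if "i < s" for i
  proof -
    have "real 0 * h + (c $ i - 1) * h = - h + c $ i * h" by (simp add: algebra_simps)
    then show ?thesis using \<gamma>0(2)[OF that] by (simp add: G_def Hdist_def wN_0)
  qed
  have r0: "0 \<le> extrap_const * (B + h ^ s)" using extrap_const_nonneg B h by (intro mult_nonneg_nonneg) auto
  have "nrm (G n i) \<le> real s * KD * (g + extrap_const * (B + h ^ s) / (1 - \<delta>))"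
    by (rule power_decay_recursion[OF D decay \<delta> KD GH RH rec g0 Rn g r0 n i])
  also have "\<dots> = (real s * KD) * (g + extrap_const / (1 - \<delta>) * (B + h ^ s))" by simp
  also have "\<dots> \<le> (real s * KD) * ((1 + extrap_const / (1 - \<delta>)) * (g + B + h ^ s))"
  proof (intro mult_left_mono)
    define \<rho> where "\<rho> = extrap_const / (1 - \<delta>)"
    have "0 \<le> \<rho> * g" "0 \<le> B + h ^ s" unfolding \<rho>_def using extrap_const_nonneg \<delta> g B h by auto
    then show "g + extrap_const / (1 - \<delta>) * (B + h ^ s) \<le> (1 + extrap_const / (1 - \<delta>)) * (g + B + h ^ s)"
      unfolding \<rho>_def[symmetric] by (simp add: algebra_simps)
  qed (use KD in auto)
  finally show "Hdist \<Omega> \<sigma> (N (u (real n * h + (c $ i - 1) * h))) (\<gamma> n i) \<le> gamma_const * (g + B + h ^ s)"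
    by (simp add: gamma_const_def G_def Hdist_def wN_0)
qed

section \<open>Discrete Gronwall inequality and induction over the steps\<close>

text \<open>The product collects the error of u_n and its feedback through the potentials; the
  summand 1 makes the constant positive, as demanded of C in the theorem.\<close>

definition growth_const :: real where
  "growth_const = 1 + step_const * (1 + gamma_const)"

text \<open>A majorant of the errors of u_n, with q standing for the initial error of the potentials
  plus h^s. Being nondecreasing, its latest value dominates all earlier errors, which is the input
  of \<open>gamma_error\<close>.\<close>

primrec error_bound :: "real \<Rightarrow> real \<Rightarrow> real \<Rightarrow> nat \<Rightarrow> real" where
  "error_bound h q E 0 = E"
| "error_bound h q E (Suc n) = (1 + growth_const * h) * error_bound h q E n + growth_const * h * q"

lemma growth_const: "1 \<le> growth_const"
  using step_const_nonneg gamma_const_nonneg by (simp add: growth_const_def)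

lemma error_bound_nonneg: "0 \<le> h \<Longrightarrow> 0 \<le> q \<Longrightarrow> 0 \<le> E \<Longrightarrow> 0 \<le> error_bound h q E n"
  using growth_const by (induction n) auto

lemma error_bound_mono:
  assumes "0 \<le> h" "0 \<le> q" "0 \<le> E" "k \<le> n"
  shows "error_bound h q E k \<le> error_bound h q E n"
proof (rule lift_Suc_mono_le[OF _ assms(4)])
  fix n
  have "0 \<le> growth_const * h * error_bound h q E n" "0 \<le> growth_const * h * q"
    using growth_const error_bound_nonneg[OF assms(1-3)] assms by simp_all
  then show "error_bound h q E n \<le> error_bound h q E (Suc n)" by (simp add: algebra_simps)
qed

text \<open>Induction with 1 + x <= exp x for the old error and 1 <= exp for the new contribution,
  which leaves a factor linear in n h.\<close>

lemma error_bound_exp: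
  assumes "0 \<le> h" "0 \<le> q" "0 \<le> E"
  shows "error_bound h q E n \<le> exp (growth_const * real n * h) * (E + growth_const * real n * h * q)"
proof (induction n)
  case 0 then show ?case by simp
next
  case (Suc n)
  let ?k = "growth_const * h" and ?r = "E + growth_const * real n * h * q"
  have k: "0 \<le> ?k" and r: "0 \<le> ?r" using assms growth_const by simp_all
  have "error_bound h q E (Suc n) \<le> exp ?k * (exp (growth_const * real n * h) * ?r) + ?k * q"
    using Suc error_bound_nonneg[OF assms, of n] k exp_ge_add_one_self[of ?k] by (simp add: mult_mono)
  also have "\<dots> = exp (growth_const * real (Suc n) * h) * ?r + ?k * q" by (simp add: exp_add[symmetric] algebra_simps)
  also have "\<dots> \<le> exp (growth_const * real (Suc n) * h) * ?r + exp (growth_const * real (Suc n) * h) * (?k * q)"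
  proof (intro add_left_mono)
    have "1 \<le> exp (growth_const * real (Suc n) * h)" using assms growth_const by simp
    then show "?k * q \<le> exp (growth_const * real (Suc n) * h) * (?k * q)" 
      using mult_right_mono[OF _ mult_nonneg_nonneg[OF k assms(2)]] by fastforce
  qed
  also have "\<dots> = exp (growth_const * real (Suc n) * h) * (E + growth_const * real (Suc n) * h * q)" by (simp add: algebra_simps)
  finally show ?case .
qed

text \<open>The bootstrap: \<open>B\<close> <= 1 keeps u_n in the Lipschitz ball and
  \<open>GB\<close> keeps the potentials below \<Gamma>, so one more step is possible and obeys the
  same majorant. \<open>K\<close> carries the factor 1 + T because the linear factor n h of the
  Gronwall bound is at most T.\<close>

lemma convergence:
  fixes h T E g :: real and v0 :: "real^'d \<Rightarrow> complex" and \<gamma>0 :: "nat \<Rightarrow> real^'d \<Rightarrow> complex"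
  defines "un \<equiv> method_u \<Omega> \<sigma> \<kappa> N s A b D \<Theta> h v0 \<gamma>0" and "gn \<equiv> method_gamma_prev \<Omega> \<sigma> \<kappa> N s A b D \<Theta> h v0 \<gamma>0"
    and "K \<equiv> growth_const * (1 + T)"
  defines "B \<equiv> exp (K * T) * (E + K * (g + h ^ s))"
  assumes h: "0 \<le> h" "h \<le> 1" and T: "0 \<le> T" and J: "{- h..T + h} \<subseteq> J" and v0: "v0 \<in> H" "Hdist \<Omega> \<sigma> (u 0) v0 \<le> E"
    and \<gamma>0: "\<And>i. i < s \<Longrightarrow> \<gamma>0 i \<in> H" "\<And>i. i < s \<Longrightarrow> Hdist \<Omega> \<sigma> (N (u (- h + c $ i * h))) (\<gamma>0 i) \<le> g" and g: "0 \<le> g"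
    and small: "real s * (C * (h * (alg_const * \<Gamma>))) \<le> 1 / 2" and B: "B \<le> 1" and GB: "gamma_const * (g + B + h ^ s) \<le> 1"
    and n: "real n * h \<le> T"
  shows "method_well_defined_at \<Omega> \<sigma> \<kappa> N s A b D \<Theta> h v0 \<gamma>0 n"
    "i < s \<Longrightarrow> gn n i \<in> H" "i < s \<Longrightarrow> Hdist \<Omega> \<sigma> (N (u (real n * h + (c $ i - 1) * h))) (gn n i) \<le> gamma_const * (g + B + h ^ s)"
    "un n \<in> H" "k \<le> n \<Longrightarrow> Hdist \<Omega> \<sigma> (u (real k * h)) (un k) \<le> exp (K * real n * h) * (E + K * (g + h ^ s))"
proof -
  have rec: "un 0 = v0" "gn 0 = \<gamma>0" "gn (Suc n) = next_gamma s D \<Theta> N (un n) (gn n)"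
    "un (Suc n) = next_u \<Omega> \<sigma> \<kappa> s A b h (un n) (gn (Suc n))" for n
    by (simp_all add: un_def gn_def method_u_def method_gamma_prev_def Let_def split: prod.splits)
  have E: "0 \<le> E" using v0(2) Hdist_nonneg order_trans by blast
  have q: "0 \<le> g + h ^ s" using g h by simp
  have K: "0 \<le> K" "growth_const \<le> K" "growth_const * T \<le> K" using growth_const T by (auto simp: K_def algebra_simps)
  let ?a = "error_bound h (g + h ^ s) E"
  have a0: "0 \<le> ?a n" for n by (rule error_bound_nonneg[OF h(1) q E])
  have aexp: "?a n \<le> exp (K * real n * h) * (E + K * (g + h ^ s))" if n: "real n * h \<le> T" for n
  proof -
    have "?a n \<le> exp (growth_const * real n * h) * (E + growth_const * real n * h * (g + h ^ s))"
      by (rule error_bound_exp[OF h(1) q E])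
    also have "\<dots> \<le> exp (K * real n * h) * (E + K * (g + h ^ s))"
    proof (intro mult_mono add_left_mono mult_right_mono q)
      show "exp (growth_const * real n * h) \<le> exp (K * real n * h)" using K h by (simp add: mult_right_mono)
      have "growth_const * real n * h \<le> growth_const * T" using n growth_const by (simp add: mult.assoc mult_left_mono)
      with K show "growth_const * real n * h \<le> K" by linarith
      show "0 \<le> E + growth_const * real n * h * (g + h ^ s)" using E q growth_const h by simp
    qed (use K in simp_all)
    finally show ?thesis .
  qed
  have aB: "?a n \<le> B" if n: "real n * h \<le> T" for n
  proof -
    have "exp (K * real n * h) * (E + K * (g + h ^ s)) \<le> B"
      unfolding B_def using n K E q by (intro mult_right_mono) (auto simp: mult.assoc intro: mult_left_mono)
    with aexp[OF n] show ?thesis by linarith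
  qed
  have Jn: "{real n * h - h..real n * h + h} \<subseteq> J" if "real n * h \<le> T" for n
  proof -
    have "0 \<le> real n * h" using h by simp
    then have "{real n * h - h..real n * h + h} \<subseteq> {- h..T + h}" using that by auto
    with J show ?thesis by blast
  qed
  have J0: "{- h..h} \<subseteq> J" using Jn[of 0] T by simp
  have le: "real k * h \<le> T" if "k \<le> n" "real n * h \<le> T" for k n
    using mult_right_mono[of "real k" "real n" h] that h by simp
  \<comment> \<open>The index p may reach Suc n: this is \<open>\<Gamma>\<^sub>n\<close>, which
    depends on u_0, ..., u_n only, so it is available before u_(n+1).\<close>
  have gam: "gn p i \<in> H" "Hdist \<Omega> \<sigma> (N (u (real p * h + (c $ i - 1) * h))) (gn p i) \<le> gamma_const * (g + ?a n + h ^ s)"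
    if n: "real n * h \<le> T" and un: "\<forall>k\<le>n. un k \<in> H \<and> Hdist \<Omega> \<sigma> (u (real k * h)) (un k) \<le> ?a k" and p: "p \<le> Suc n" and i: "i < s" for n p i
  proof -
    have un': "un k \<in> H" "Hdist \<Omega> \<sigma> (u (real k * h)) (un k) \<le> ?a n" "{real k * h - h..real k * h + h} \<subseteq> J" if "k < Suc n" for k
    proof -
      from un that have un'': "un k \<in> H" "Hdist \<Omega> \<sigma> (u (real k * h)) (un k) \<le> ?a k" by auto
      show "un k \<in> H" by (rule un''(1))
      show "Hdist \<Omega> \<sigma> (u (real k * h)) (un k) \<le> ?a n" using un''(2) error_bound_mono[OF h(1) q E, of k n] that by simp
      show "{real k * h - h..real k * h + h} \<subseteq> J" using Jn[OF le[OF _ n]] that by simp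
    qed
    have a1: "?a n \<le> 1" using aB[OF n] B by linarith
    have \<gamma>0': "\<And>i. i < s \<Longrightarrow> gn 0 i \<in> H" "\<And>i. i < s \<Longrightarrow> Hdist \<Omega> \<sigma> (N (u (- h + c $ i * h))) (gn 0 i) \<le> g" using \<gamma>0 rec(2) by simp_all
    note GE = gamma_error[OF h(1) un'(3) J0 un'(1) un'(2) a0 a1 \<gamma>0' g rec(3) p i]
    show "gn p i \<in> H" by (rule GE(1))
    show "Hdist \<Omega> \<sigma> (N (u (real p * h + (c $ i - 1) * h))) (gn p i) \<le> gamma_const * (g + ?a n + h ^ s)" by (rule GE(2))
  qed
  have gamB: "gamma_const * (g + ?a n + h ^ s) \<le> gamma_const * (g + B + h ^ s)" if "real n * h \<le> T" for n
    using aB[OF that] by (intro mult_left_mono gamma_const_nonneg) simp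
  have step: "step_well_defined \<Omega> \<sigma> \<kappa> s A b h (un n) (gn (Suc n))" "un (Suc n) \<in> H" "Hdist \<Omega> \<sigma> (u (real (Suc n) * h)) (un (Suc n)) \<le> ?a (Suc n)"
    if n: "real n * h \<le> T" and un: "\<forall>k\<le>n. un k \<in> H \<and> Hdist \<Omega> \<sigma> (u (real k * h)) (un k) \<le> ?a k" for n
  proof -
    let ?G = "gamma_const * (g + ?a n + h ^ s)"
    have Jt: "{real n * h..real n * h + h} \<subseteq> J" using Jn[OF n] h by (auto simp: subset_iff)
    have unH: "un n \<in> H" and une: "Hdist \<Omega> \<sigma> (u (real n * h)) (un n) \<le> ?a n" using un by auto
    have t: "real (Suc n) * h + (c $ i - 1) * h = real n * h + c $ i * h" for i by (simp add: algebra_simps)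
    have G: "Hdist \<Omega> \<sigma> (N (u (real n * h + c $ i * h))) (gn (Suc n) i) \<le> ?G" if "i < s" for i
      using gam(2)[OF n un order_refl that] unfolding t .
    have G0: "0 \<le> ?G" using gamma_const_nonneg g a0[of n] h by simp
    have gH: "gn (Suc n) i \<in> H" if "i < s" for i by (rule gam(1)[OF n un order_refl that])
    have gG: "nrm (gn (Suc n) i) \<le> \<Gamma>" if i: "i < s" for i
    proof -
      have y: "real n * h + c $ i * h \<in> J" by (rule node_J[OF i h(1) Jt])
      have NH: "N (u (real n * h + c $ i * h)) \<in> H" by (rule N_H[OF u_H[OF y]])
      show ?thesis
        using Hnorm_le_Hdist[OF gH[OF i] NH] G[OF i] Hdist_commute[OF gH[OF i] NH] \<Gamma>[OF y] gamB[OF n] GB by linarith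
    qed
    note O = one_step[OF h Jt unH gH gG G G0 small]
    show "step_well_defined \<Omega> \<sigma> \<kappa> s A b h (un n) (gn (Suc n))" by (rule O(1))
    show "un (Suc n) \<in> H" unfolding rec(4) by (rule O(2))
    have "Hdist \<Omega> \<sigma> (u (real (Suc n) * h)) (un (Suc n)) = Hdist \<Omega> \<sigma> (u (real n * h + h)) (un (Suc n))" by (simp add: algebra_simps)
    also have "\<dots> \<le> Hdist \<Omega> \<sigma> (u (real n * h)) (un n) + h * (step_const * (Hdist \<Omega> \<sigma> (u (real n * h)) (un n) + ?G + h ^ s))"
      unfolding rec(4) by (rule O(3))
    also have "\<dots> \<le> ?a n + h * (step_const * (?a n + ?G + h ^ s))"
      by (intro add_mono[OF une] mult_left_mono[OF _ h(1)] mult_left_mono[OF _ step_const_nonneg] add_right_mono une)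
    also have "\<dots> \<le> ?a n + h * (growth_const * (?a n + (g + h ^ s)))"
    proof (intro add_left_mono mult_left_mono h(1))
      have "step_const * (?a n + ?G + h ^ s) \<le> step_const * (1 + gamma_const) * (?a n + (g + h ^ s))"
      proof -
        have "?a n + ?G + h ^ s \<le> (1 + gamma_const) * (?a n + (g + h ^ s))" using g by (simp add: algebra_simps)
        from mult_left_mono[OF this step_const_nonneg] show ?thesis by (simp add: mult.assoc)
      qed
      also have "\<dots> \<le> growth_const * (?a n + (g + h ^ s))"
        using q a0[of n] by (intro mult_right_mono) (auto simp: growth_const_def)
      finally show "step_const * (?a n + ?G + h ^ s) \<le> growth_const * (?a n + (g + h ^ s))" .
    qed
    also have "\<dots> = ?a (Suc n)" by (simp add: algebra_simps)
    finally show "Hdist \<Omega> \<sigma> (u (real (Suc n) * h)) (un (Suc n)) \<le> ?a (Suc n)" .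
  qed
  \<comment> \<open>Strong induction, since the potentials of a step depend on all earlier values of
    u.\<close>
  have main: "\<forall>k\<le>n. un k \<in> H \<and> Hdist \<Omega> \<sigma> (u (real k * h)) (un k) \<le> ?a k" if "real n * h \<le> T" for n
    using that
  proof (induction n)
    case 0 then show ?case using v0 rec(1) by simp
  next
    case (Suc n)
    have n: "real n * h \<le> T" by (rule le[OF _ Suc.prems]) simp
    from step(2,3)[OF n Suc.IH[OF n]] Suc.IH[OF n] show ?case by (auto simp: le_Suc_eq)
  qed
  show "method_well_defined_at \<Omega> \<sigma> \<kappa> N s A b D \<Theta> h v0 \<gamma>0 n"
    unfolding method_well_defined_at_def using step(1)[OF n main[OF n]] unfolding un_def gn_def .
  show "gn n i \<in> H" if "i < s" by (rule gam(1)[OF n main[OF n] _ that]) simp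
  show "Hdist \<Omega> \<sigma> (N (u (real n * h + (c $ i - 1) * h))) (gn n i) \<le> gamma_const * (g + B + h ^ s)" if "i < s"
    by (rule order_trans[OF gam(2)[OF n main[OF n] _ that] gamB[OF n]]) simp
  show "un n \<in> H" using main[OF n] by simp
  show "Hdist \<Omega> \<sigma> (u (real k * h)) (un k) \<le> exp (K * real n * h) * (E + K * (g + h ^ s))" if "k \<le> n"
    using main[OF n] that error_bound_mono[OF h(1) q E that] aexp[OF n] by (meson order_trans)
qed

end

section \<open>Choice of the constants and conclusion\<close>

theorem theorem3p1:
  fixes \<Omega> :: domain
    and \<sigma> :: real
    and \<kappa> :: complex
    and N :: "(real^'d \<Rightarrow> complex) \<Rightarrow> (real^'d \<Rightarrow> complex)"
    and u_init :: "real^'d \<Rightarrow> complex"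
    and u :: "real \<Rightarrow> real^'d \<Rightarrow> complex"
    and Tmin Tmax :: ereal
    and T r M m :: real
    and V :: "(real^'d \<Rightarrow> complex) set"
    and s :: nat
    and A :: "real Matrix.mat"
    and b c :: "real Matrix.vec"
    and D :: "complex Matrix.mat"
    and \<Theta> :: "complex Matrix.vec"
  assumes sigma: "\<sigma> > real CARD('d) / 2"
    and N_maps: "\<forall>v \<in> Hspace \<Omega> \<sigma>. N v \<in> Hspace \<Omega> \<sigma>"
    and N_bounded: "\<forall>B. Hbounded \<Omega> \<sigma> B \<longrightarrow> Hbounded \<Omega> \<sigma> (N ` B)"
    and N_lipschitz: "\<forall>B. Hbounded \<Omega> \<sigma> B \<longrightarrow>
          (\<exists>K. \<forall>v\<in>B. \<forall>w\<in>B. Hdist \<Omega> \<sigma> (N v) (N w) \<le> K * Hdist \<Omega> \<sigma> v w)"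
    and u_init: "u_init \<in> Hspace \<Omega> \<sigma>"
    and interval: "Tmin < 0" "0 < Tmax"
    and solution: "solves_equation \<Omega> \<sigma> \<kappa> N (einterval Tmin Tmax) u"
    and initial: "ae_eq \<Omega> (u 0) u_init"
    and s: "s \<ge> 1"
    and u_regular: "Hck \<Omega> \<sigma> (einterval Tmin Tmax) (s + 2) u"
    and Nu_regular: "Hck \<Omega> \<sigma> (einterval Tmin Tmax) s (\<lambda>t. N (u t))"
    and T: "0 < T" "ereal T < Tmax"
    and r: "r > 0"
    and V_def: "V = {(\<lambda>x. u t x + v x) | t v. t \<in> {0..T} \<and> v \<in> Hspace \<Omega> \<sigma> \<and> Hnorm \<Omega> \<sigma> v \<le> r}"
    and M: "M > 0" "\<forall>t\<in>{0..T}. Hnorm \<Omega> \<sigma> (N (u t)) \<le> M"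
    and m: "m > 0" "\<forall>v\<in>V. Hnorm \<Omega> \<sigma> (N v) < M + m"
    and colloc: "collocation s A b c"
    and nodes: "\<forall>i<s. 0 \<le> c $ i \<and> c $ i \<le> 1" "\<forall>i<s. \<forall>j<i. c $ j < c $ i"
    and D: "D \<in> carrier_mat s s"
    and Theta: "\<Theta> \<in> carrier_vec s"
    and strong: "strongly_stable D"
    and consistent: "consistent_step s c D \<Theta>"
    and RK_stable: "(\<kappa> = \<i> \<and> I_hat_stable s A b) \<or> (\<kappa> = 1 \<and> A_hat_stable s A b)"
  shows "\<exists>C>0. \<exists>h0. 0 < h0 \<and> h0 < T \<and> (\<exists>U. Hneighbourhood \<Omega> \<sigma> u_init U \<and> (\<exists>\<eta>>0.
    \<forall>v0\<in>U. \<forall>h. 0 < h \<and> h < h0 \<longrightarrow> (\<forall>\<gamma>0 :: nat \<Rightarrow> real^'d \<Rightarrow> complex.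
      (\<forall>i<s. \<gamma>0 i \<in> Hspace \<Omega> \<sigma>) \<longrightarrow>
      Max ((\<lambda>i. Hdist \<Omega> \<sigma> (\<gamma>0 i) (N (u (- h + c $ i * h)))) ` {..<s}) < \<eta> \<longrightarrow>
      (\<forall>n. real n * h \<le> T \<longrightarrow>
        method_well_defined_at \<Omega> \<sigma> \<kappa> N s A b D \<Theta> h v0 \<gamma>0 n \<and>
        (\<forall>i<s. Hnorm \<Omega> \<sigma> (method_gamma_prev \<Omega> \<sigma> \<kappa> N s A b D \<Theta> h v0 \<gamma>0 n i) \<le> M + m) \<and>
        Max ((\<lambda>k. Hdist \<Omega> \<sigma> (u (real k * h)) (method_u \<Omega> \<sigma> \<kappa> N s A b D \<Theta> h v0 \<gamma>0 k)) ` {..n})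
          \<le> exp (C * real n * h) * (Hdist \<Omega> \<sigma> u_init v0 +
               C * (Max ((\<lambda>i. Hdist \<Omega> \<sigma> (N (u (- h + c $ i * h))) (\<gamma>0 i)) ` {..<s}) + h ^ s))))))"
proof -
  let ?I = "einterval Tmin Tmax"
  have T_in: "{0..T} \<subseteq> ?I"
  proof
    fix t assume "t \<in> {0..T}"
    then have "0 \<le> ereal t" "ereal t \<le> ereal T" by simp_all
    with interval(1) T(2) show "t \<in> ?I" unfolding einterval_iff by (blast intro: less_le_trans le_less_trans)
  qed
  have cA: "A \<in> carrier_mat s s" using colloc by (simp add: collocation_def)
  \<comment> \<open>The symbol of i \<Delta> is imaginary and that of \<Delta> is nonpositive, so h
    times it stays in the region of the corresponding stability notion.\<close>
  obtain S where stab: "stable_on S s A b" "S_stable_on S s A b" "SI_stable_on S s A"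
    and symbol: "\<And>h (\<xi> :: real^'d). 0 \<le> h \<Longrightarrow> complex_of_real h * laplace_symbol \<kappa> \<xi> \<in> S"
    using RK_stable
  proof
    assume I: "\<kappa> = \<i> \<and> I_hat_stable s A b"
    have "complex_of_real h * laplace_symbol \<kappa> \<xi> \<in> {z. Re z = 0}" for h and \<xi> :: "real^'d"
      using I by (simp add: laplace_symbol_def)
    with I show thesis unfolding I_hat_stable_def by (intro that[of "{z. Re z = 0}"]) auto
  next
    assume A: "\<kappa> = 1 \<and> A_hat_stable s A b"
    have "complex_of_real h * laplace_symbol \<kappa> \<xi> \<in> {z. Re z \<le> 0}" if "0 \<le> h" for h and \<xi> :: "real^'d"
      using A that by (simp add: laplace_symbol_def)
    with A show thesis unfolding A_hat_stable_def by (intro that[of "{z. Re z \<le> 0}"]) auto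
  qed
  obtain Cs where bounds: "step_bounds S s A b Cs" using step_bounds_exist[OF cA stab] by blast
  have Cs: "0 \<le> Cs" by (rule bounds[unfolded step_bounds_def, THEN conjunct1])
  obtain w where w: "w 0 = u" "\<And>j t. j \<le> s + 2 \<Longrightarrow> t \<in> ?I \<Longrightarrow> w j t \<in> Hspace \<Omega> \<sigma>"
      "\<And>j. j < s + 2 \<Longrightarrow> has_Hderivative_on \<Omega> \<sigma> ?I (w j) (w (Suc j))" "\<And>j. j \<le> s + 2 \<Longrightarrow> Hcontinuous_on \<Omega> \<sigma> ?I (w j)"
    using u_regular unfolding Hck_def by blast
  obtain wN where wN: "wN 0 = (\<lambda>t. N (u t))" "\<And>j t. j \<le> s \<Longrightarrow> t \<in> ?I \<Longrightarrow> wN j t \<in> Hspace \<Omega> \<sigma>"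
      "\<And>j. j < s \<Longrightarrow> has_Hderivative_on \<Omega> \<sigma> ?I (wN j) (wN (Suc j))" "\<And>j. j \<le> s \<Longrightarrow> Hcontinuous_on \<Omega> \<sigma> ?I (wN j)"
    using Nu_regular[unfolded Hck_def] by (elim exE conjE) simp
  have uH: "u t \<in> Hspace \<Omega> \<sigma>" if "t \<in> ?I" for t using w(2)[of 0 t] that by (simp add: w(1))
  have NuH: "N (u t) \<in> Hspace \<Omega> \<sigma>" if "t \<in> ?I" for t using N_maps uH[OF that] by blast
  \<comment> \<open>The interval [0, T] has to be enlarged on both sides: the initial potentials
    refer to times down to -h, and a step starting at nh <= T ends as late as T + h.\<close>
  obtain \<rho> where \<rho>: "0 < \<rho>" "{- \<rho>..T + \<rho>} \<subseteq> ?I"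
  proof -
    have "0 \<in> ?I" "T \<in> ?I" using T_in T by auto
    then obtain e1 e2 where e: "0 < e1" "cball 0 e1 \<subseteq> ?I" "0 < e2" "cball T e2 \<subseteq> ?I"
      using open_einterval[of Tmin Tmax] unfolding open_contains_cball by blast
    have "- min e1 e2 \<in> cball 0 e1" "T + min e1 e2 \<in> cball T e2" using e by (auto simp: dist_real_def)
    then have "- min e1 e2 \<in> ?I" "T + min e1 e2 \<in> ?I" using e by blast+
    then have ends: "Tmin < ereal (- min e1 e2)" "ereal (T + min e1 e2) < Tmax" unfolding einterval_iff by blast+
    have "{- min e1 e2..T + min e1 e2} \<subseteq> ?I"
    proof
      fix t assume "t \<in> {- min e1 e2..T + min e1 e2}"
      then have "ereal (- min e1 e2) \<le> ereal t" "ereal t \<le> ereal (T + min e1 e2)" by simp_all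
      with ends show "t \<in> ?I" unfolding einterval_iff by (blast intro: less_le_trans le_less_trans)
    qed
    then show thesis using e by (intro that[of "min e1 e2"]) auto
  qed
  let ?J = "{- \<rho>..T + \<rho>}"
  have cJ: "compact ?J" by simp
  obtain Ku where Ku: "0 \<le> Ku" "\<And>t. t \<in> ?J \<Longrightarrow> Hnorm \<Omega> \<sigma> (w 0 t) \<le> Ku"
    by (rule Hcontinuous_bounded[OF w(4) w(2) cJ \<rho>(2), of 0]) auto
  obtain Kw where Kw: "0 \<le> Kw" "\<And>t. t \<in> ?J \<Longrightarrow> Hnorm \<Omega> \<sigma> (w (Suc s) t) \<le> Kw"
    by (rule Hcontinuous_bounded[OF w(4) w(2) cJ \<rho>(2), of "Suc s"]) auto
  obtain Kn where Kn: "0 \<le> Kn" "\<And>t. t \<in> ?J \<Longrightarrow> Hnorm \<Omega> \<sigma> (wN s t) \<le> Kn"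
    by (rule Hcontinuous_bounded[OF wN(4) wN(2) cJ \<rho>(2), of s]) auto
  obtain K\<gamma> where K\<gamma>: "0 \<le> K\<gamma>" "\<And>t. t \<in> ?J \<Longrightarrow> Hnorm \<Omega> \<sigma> (wN 0 t) \<le> K\<gamma>"
    by (rule Hcontinuous_bounded[OF wN(4) wN(2) cJ \<rho>(2), of 0]) auto
  obtain \<Lambda> where \<Lambda>: "0 \<le> \<Lambda>" "\<And>v v'. v \<in> Hspace \<Omega> \<sigma> \<Longrightarrow> v' \<in> Hspace \<Omega> \<sigma> \<Longrightarrow> Hnorm \<Omega> \<sigma> v \<le> Ku + 1 \<Longrightarrow> Hnorm \<Omega> \<sigma> v' \<le> Ku + 1 \<Longrightarrow>
      Hdist \<Omega> \<sigma> (N v) (N v') \<le> \<Lambda> * Hdist \<Omega> \<sigma> v v'"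
  proof -
    \<comment> \<open>Radius \<open>Ku\<close> + 1 covers the solution on the enlarged interval and
      everything at distance at most 1 from it.\<close>
    let ?B = "{v \<in> Hspace \<Omega> \<sigma>. Hnorm \<Omega> \<sigma> v \<le> Ku + 1}"
    have "Hbounded \<Omega> \<sigma> ?B" unfolding Hbounded_def by auto
    then obtain K where K: "\<forall>v\<in>?B. \<forall>w\<in>?B. Hdist \<Omega> \<sigma> (N v) (N w) \<le> K * Hdist \<Omega> \<sigma> v w" using N_lipschitz by blast
    have "Hdist \<Omega> \<sigma> (N v) (N v') \<le> max 0 K * Hdist \<Omega> \<sigma> v v'"
      if "v \<in> Hspace \<Omega> \<sigma>" "v' \<in> Hspace \<Omega> \<sigma>" "Hnorm \<Omega> \<sigma> v \<le> Ku + 1" "Hnorm \<Omega> \<sigma> v' \<le> Ku + 1" for v v'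
    proof -
      have "Hdist \<Omega> \<sigma> (N v) (N v') \<le> K * Hdist \<Omega> \<sigma> v v'" using K that by blast
      also have "\<dots> \<le> max 0 K * Hdist \<Omega> \<sigma> v v'" by (intro mult_right_mono) auto
      finally show ?thesis .
    qed
    then show thesis by (intro that[of "max 0 K"]) auto
  qed
  \<comment> \<open>For n = 0 the potentials are compared with N(u) at negative times, where the
    bound M is not given; continuity at 0 costs m/2, and the other half of m remains for the
    error.\<close>
  obtain \<rho>1 where \<rho>1: "0 < \<rho>1" "\<And>t. t \<in> ?I \<Longrightarrow> \<bar>t\<bar> < \<rho>1 \<Longrightarrow> Hnorm \<Omega> \<sigma> (N (u t)) \<le> M + m / 2"
  proof -
    have c: "continuous_on ?I (\<lambda>t. Hnorm \<Omega> \<sigma> (wN 0 t))" by (rule Hcontinuous_norm[OF wN(4) wN(2)]) auto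
    have 0: "0 \<in> ?I" using T_in T by auto
    obtain d where d: "d > 0" "\<forall>t\<in>?I. dist t 0 < d \<longrightarrow> dist (Hnorm \<Omega> \<sigma> (wN 0 t)) (Hnorm \<Omega> \<sigma> (wN 0 0)) < m / 2"
      using c[unfolded continuous_on_iff] 0 m(1) half_gt_zero by blast
    have M0: "Hnorm \<Omega> \<sigma> (wN 0 0) \<le> M" using M(2) T by (auto simp: wN(1))
    show thesis
    proof (rule that[OF d(1)])
      fix t assume t: "t \<in> ?I" "\<bar>t\<bar> < d"
      then have "\<bar>Hnorm \<Omega> \<sigma> (wN 0 t) - Hnorm \<Omega> \<sigma> (wN 0 0)\<bar> < m / 2" using d(2) by (auto simp: dist_real_def)
      with M0 show "Hnorm \<Omega> \<sigma> (N (u t)) \<le> M + m / 2" unfolding wN(1) by linarith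
    qed
  qed
  obtain KD \<delta> where KD: "0 < KD" "0 < \<delta>" "\<delta> < 1" "\<forall>k. \<forall>i<s. \<forall>j<s. cmod ((D ^\<^sub>m k) $$ (i, j)) \<le> KD * \<delta> ^ k"
    using spectral_radius_power_decay[OF D s] strong unfolding strongly_stable_def by blast
  define \<Gamma> where "\<Gamma> = K\<gamma> + 1"
  have eqn: "AE \<xi> in freq_measure \<Omega>. fourier \<Omega> (w 1 t) \<xi> = Lhat \<Omega> \<kappa> (w 0 t) \<xi> + fourier \<Omega> (\<lambda>x. N (w 0 t) x * w 0 t x) \<xi>"
    if t: "t \<in> ?I" for t
  proof -
    have "has_Hderivative_on \<Omega> \<sigma> ?I u (w 1)" using w(3)[of 0] by (simp add: w(1))
    moreover have "w 1 t \<in> Hspace \<Omega> \<sigma>" using w(2)[OF _ t] by simp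
    ultimately show ?thesis
      unfolding w(1) by (rule solution_derivative[OF sigma solution NuH[OF t] _ _ open_einterval t])
  qed
  interpret error_analysis \<Omega> \<sigma> \<kappa> s A b S Cs "TYPE('d)" N c D \<Theta> ?I ?J w wN Ku Kw Kn \<Gamma> \<Lambda> KD \<delta>
  proof unfold_locales
    show "real CARD('d) / 2 < \<sigma>" "A \<in> carrier_mat s s" "SI_stable_on S s A" "step_bounds S s A b Cs" by fact+
    show "complex_of_real h * laplace_symbol \<kappa> \<xi> \<in> S" if "0 \<le> h" for h and \<xi> :: "real^'d" by (rule symbol[OF that])
    show "collocation s A b c" "1 \<le> s" "D \<in> carrier_mat s s" "consistent_step s c D \<Theta>" "0 < \<delta>" "\<delta> < 1" by fact+
    show "0 \<le> c $ i \<and> c $ i \<le> 1" if "i < s" for i using nodes(1) that by blast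
    show "cmod ((D ^\<^sub>m k) $$ (i, j)) \<le> KD * \<delta> ^ k" if "i < s" "j < s" for k i j using KD(4) that by blast
    show "0 \<le> KD" "0 \<le> Ku" "0 \<le> Kw" "0 \<le> Kn" "0 \<le> \<Gamma>" "0 \<le> \<Lambda>" using KD Ku Kw Kn K\<gamma> \<Lambda> by (auto simp: \<Gamma>_def)
    show "N v \<in> Hspace \<Omega> \<sigma>" if "v \<in> Hspace \<Omega> \<sigma>" for v using N_maps that by blast
    show "?J \<subseteq> ?I" by (rule \<rho>(2))
    show "w j t \<in> Hspace \<Omega> \<sigma>" if "j \<le> Suc s" "t \<in> ?I" for j t using w(2)[OF _ that(2)] that(1) by simp
    show "has_Hderivative_on \<Omega> \<sigma> ?I (w j) (w (Suc j))" if "j \<le> s" for j using w(3) that by simp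
    show "wN 0 t = N (w 0 t)" for t by (simp add: wN(1) w(1))
    show "Hnorm \<Omega> \<sigma> (N (w 0 t)) + 1 \<le> \<Gamma>" if "t \<in> ?J" for t using K\<gamma>(2)[OF that] by (simp add: \<Gamma>_def wN(1) w(1))
  qed (fact wN(2) wN(3) eqn Ku(2) Kw(2) Kn(2) \<Lambda>(2))+
  define K where "K = growth_const * (1 + T)"
  \<comment> \<open>If the initial errors and h^s are at most d, then E + K (g + h^s) <= (1 + 2 K)
    d, so the error of u stays below \<open>B1\<close> times d.\<close>
  define B1 where "B1 = exp (K * T) * (1 + 2 * K)"
  define P where "P = real s * (Cs * (alg_const * \<Gamma>))"
  \<comment> \<open>One number serves as radius of the neighbourhood, as \<eta> and as bound for h.
    In 2 + \<open>B1\<close> the 2 stands for g and h^s; the minimum ensures both the bootstrap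
    bound 1 and the margin m/2 for the potentials.\<close>
  define d where "d = min 1 (m / 2) / ((1 + gamma_const) * (2 + B1))"
  have K: "0 < K" using growth_const T unfolding K_def by (intro mult_pos_pos) auto
  have B1: "0 \<le> B1" using K by (simp add: B1_def)
  have P: "0 \<le> P" unfolding P_def by (intro mult_nonneg_nonneg Cs alg_const_nonneg nonneg(4)) simp
  have den: "0 < (1 + gamma_const) * (2 + B1)" using gamma_const_nonneg B1 by (intro mult_pos_pos) auto
  have d0: "0 < d" using m(1) den by (simp add: d_def)
  have dd: "(1 + gamma_const) * (2 + B1) * d = min 1 (m / 2)" unfolding d_def using den by (metis less_irrefl nonzero_mult_div_cancel_left times_divide_eq_right)
  have d1: "(2 + B1) * d \<le> 1" "gamma_const * ((2 + B1) * d) \<le> min 1 (m / 2)"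
  proof -
    have pos: "0 \<le> (2 + B1) * d" "0 \<le> gamma_const * ((2 + B1) * d)" using B1 d0 gamma_const_nonneg by simp_all
    have "(2 + B1) * d + gamma_const * ((2 + B1) * d) = min 1 (m / 2)" using dd by (simp add: algebra_simps)
    with pos show "(2 + B1) * d \<le> 1" "gamma_const * ((2 + B1) * d) \<le> min 1 (m / 2)" by linarith+
  qed
  have "2 * d \<le> (2 + B1) * d" using B1 d0 by (intro mult_right_mono) auto
  with d1(1) have d2: "d \<le> 1" using d0 by linarith
  have Bd: "B1 * d \<le> 1" using d1(1) d0 by (simp add: algebra_simps)
  \<comment> \<open>In turn: h^s <= d, times stay in the enlarged interval, times before 0 stay
    where N(u) <= M + m/2, h0 < T, and h P <= 1/2 for the contraction.\<close>
  define h0 where "h0 = Min {d, \<rho>, \<rho>1, T / 2, 1 / (2 * (P + 1))}"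
  have h0: "0 < h0" "h0 < T" using d0 \<rho> \<rho>1 T P unfolding h0_def by (auto simp: min_less_iff_disj)
  let ?U = "{g \<in> Hspace \<Omega> \<sigma>. Hdist \<Omega> \<sigma> g u_init < d}"
  have nbh: "Hneighbourhood \<Omega> \<sigma> u_init ?U" unfolding Hneighbourhood_def using d0 by auto
  have estimate: "method_well_defined_at \<Omega> \<sigma> \<kappa> N s A b D \<Theta> h v0 \<gamma>0 n \<and>
        (\<forall>i<s. Hnorm \<Omega> \<sigma> (method_gamma_prev \<Omega> \<sigma> \<kappa> N s A b D \<Theta> h v0 \<gamma>0 n i) \<le> M + m) \<and>
        Max ((\<lambda>k. Hdist \<Omega> \<sigma> (u (real k * h)) (method_u \<Omega> \<sigma> \<kappa> N s A b D \<Theta> h v0 \<gamma>0 k)) ` {..n})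
          \<le> exp (K * real n * h) * (Hdist \<Omega> \<sigma> u_init v0 +
               K * (Max ((\<lambda>i. Hdist \<Omega> \<sigma> (N (u (- h + c $ i * h))) (\<gamma>0 i)) ` {..<s}) + h ^ s))"
    if v0: "v0 \<in> ?U" and h: "0 < h" "h < h0" and \<gamma>0: "\<forall>i<s. \<gamma>0 i \<in> Hspace \<Omega> \<sigma>"
      and g: "Max ((\<lambda>i. Hdist \<Omega> \<sigma> (\<gamma>0 i) (N (u (- h + c $ i * h)))) ` {..<s}) < d" and n: "real n * h \<le> T" for v0 h \<gamma>0 n
  proof -
    let ?g = "Max ((\<lambda>i. Hdist \<Omega> \<sigma> (N (u (- h + c $ i * h))) (\<gamma>0 i)) ` {..<s})"
    let ?E = "Hdist \<Omega> \<sigma> u_init v0"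
    have hs: "h < d" "h < \<rho>" "h < \<rho>1" "h < 1 / (2 * (P + 1))" using h(2) unfolding h0_def by simp_all
    have h1: "h \<le> 1" using hs d2 by linarith
    have hd: "h ^ s \<le> d" using power_decreasing[of 1 s h] s h h1 hs by simp
    have J: "{- h..T + h} \<subseteq> ?J" using hs by auto
    have init: "u 0 \<in> Hspace \<Omega> \<sigma>" by (rule uH) (use T_in T in auto)
    have E: "Hdist \<Omega> \<sigma> (w 0 0) v0 \<le> ?E"
    proof -
      have "Hdist \<Omega> \<sigma> (u 0) u_init = 0"
        using initial ae_eq_iff_fourier[OF Hspace_L2[OF init] Hspace_L2[OF u_init]] Hdist_eq_0_iff[OF init u_init] by blast
      with Hdist_triangle[OF init u_init, of v0] v0 show ?thesis by (simp add: w(1))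
    qed
    have Ed: "?E \<le> d" using v0 Hdist_commute[OF u_init, of v0] by simp
    have pre: "N (u (- h + c $ i * h)) \<in> Hspace \<Omega> \<sigma>" if "i < s" for i
    proof -
      have "c $ i * h \<le> 1 * h" "0 \<le> c $ i * h" using nodes(1) that h by (auto intro: mult_right_mono)
      then have "- h + c $ i * h \<in> ?J" using hs T by auto
      then show ?thesis using NuH \<rho>(2) by blast
    qed
    \<comment> \<open>The hypothesis and the conclusion take the distance in opposite orders;
      symmetry of \<open>Hdist\<close> needs both arguments in H^\<sigma>.\<close>
    have geq: "?g = Max ((\<lambda>i. Hdist \<Omega> \<sigma> (\<gamma>0 i) (N (u (- h + c $ i * h)))) ` {..<s})"
      using pre \<gamma>0 by (intro arg_cong[where f=Max] image_cong refl Hdist_commute) auto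
    have gd: "?g \<le> d" using g geq by simp
    have gi: "Hdist \<Omega> \<sigma> (N (w 0 (- h + c $ i * h))) (\<gamma>0 i) \<le> ?g" if "i < s" for i
      unfolding w(1) using that by (intro Max_ge) auto
    have g0: "0 \<le> ?g" by (rule order_trans[OF Hdist_nonneg gi[of 0]]) (use s in simp)
    have B: "exp (K * T) * (?E + K * (?g + h ^ s)) \<le> B1 * d"
    proof -
      have "?E + K * (?g + h ^ s) \<le> d + K * (d + d)" using Ed gd hd K by (intro add_mono mult_left_mono) auto
      also have "\<dots> = (1 + 2 * K) * d" by (simp add: algebra_simps)
      finally show ?thesis unfolding B1_def mult.assoc by (rule mult_left_mono) simp
    qed
    have GB: "gamma_const * (?g + exp (K * T) * (?E + K * (?g + h ^ s)) + h ^ s) \<le> min 1 (m / 2)"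
    proof -
      have "gamma_const * (?g + exp (K * T) * (?E + K * (?g + h ^ s)) + h ^ s) \<le> gamma_const * (d + B1 * d + d)"
        using gd hd B gamma_const_nonneg by (intro mult_left_mono add_mono) auto
      with d1(2) show ?thesis by (simp add: algebra_simps)
    qed
    have small: "real s * (Cs * (h * (alg_const * \<Gamma>))) \<le> 1 / 2"
    proof -
      have "h * (2 * (P + 1)) \<le> 1" using hs(4) P by (simp add: field_simps)
      then have "P * h \<le> 1 / 2" using h by (simp add: algebra_simps)
      then show ?thesis by (simp add: P_def mult_ac)
    qed
    have v0H: "v0 \<in> Hspace \<Omega> \<sigma>" using v0 by simp
    have hyp: "exp (K * T) * (?E + K * (?g + h ^ s)) \<le> 1"
      "gamma_const * (?g + exp (K * T) * (?E + K * (?g + h ^ s)) + h ^ s) \<le> 1" using B Bd GB by linarith+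
    have \<gamma>0': "\<gamma>0 i \<in> Hspace \<Omega> \<sigma>" if "i < s" for i using \<gamma>0 that by blast
    note conv' = convergence[where h=h and T=T and E="?E" and g="?g" and ?v0.0=v0 and ?\<gamma>0.0=\<gamma>0 and n=n, folded K_def,
      OF less_imp_le[OF h(1)] h1 less_imp_le[OF T(1)] J v0H E \<gamma>0' gi g0 small hyp n]
    have wd: "method_well_defined_at \<Omega> \<sigma> \<kappa> N s A b D \<Theta> h v0 \<gamma>0 n" by (rule conv'(1)) simp_all
    have gam: "Hnorm \<Omega> \<sigma> (method_gamma_prev \<Omega> \<sigma> \<kappa> N s A b D \<Theta> h v0 \<gamma>0 n i) \<le> M + m" if i: "i < s" for i
    proof -
      let ?t = "real n * h + (c $ i - 1) * h" and ?y = "method_gamma_prev \<Omega> \<sigma> \<kappa> N s A b D \<Theta> h v0 \<gamma>0 n i"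
      have yH: "?y \<in> Hspace \<Omega> \<sigma>" by (rule conv'(2)) (use i in simp_all)
      have "Hdist \<Omega> \<sigma> (N (w 0 ?t)) ?y \<le> gamma_const * (?g + exp (K * T) * (?E + K * (?g + h ^ s)) + h ^ s)"
        by (rule conv'(3)) (use i in simp_all)
      then have D: "Hdist \<Omega> \<sigma> (N (u ?t)) ?y \<le> m / 2" using GB unfolding w(1) by linarith
      have ch: "0 \<le> c $ i * h" "c $ i * h \<le> 1 * h" using nodes(1) i h by (auto intro: mult_right_mono)
      have nh: "0 \<le> real n * h" using h by simp
      have tb: "- h \<le> ?t" "?t \<le> T" using ch nh n by (simp_all add: left_diff_distrib)
      then have tI: "?t \<in> ?I" using \<rho>(2) hs \<rho>(1) by auto
      have "Hnorm \<Omega> \<sigma> (N (u ?t)) \<le> M + m / 2"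
      \<comment> \<open>For n = 0 the time may be negative, and then it exceeds -h, hence lies
        within \<rho>1 of 0; otherwise M applies directly.\<close>
      proof (cases "0 \<le> ?t")
        case True
        with tb have "?t \<in> {0..T}" by simp
        with M(2) have "Hnorm \<Omega> \<sigma> (N (u ?t)) \<le> M" by blast
        with m(1) show ?thesis by linarith
      next
        case False
        with tb hs(3) show ?thesis by (intro \<rho>1(2) tI) simp
      qed
      with Hnorm_le_Hdist[OF yH NuH[OF tI]] Hdist_commute[OF yH NuH[OF tI]] D show ?thesis by linarith
    qed
    have err: "Hdist \<Omega> \<sigma> (u (real k * h)) (method_u \<Omega> \<sigma> \<kappa> N s A b D \<Theta> h v0 \<gamma>0 k) \<le> exp (K * real n * h) * (?E + K * (?g + h ^ s))"
      if "k \<le> n" for k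
      using conv'(5)[of k] that unfolding w(1) by simp
    show ?thesis using wd gam err by (auto intro!: Max.boundedI)
  qed
  show ?thesis
    by (rule exI[of _ K], rule conjI[OF K], rule exI[of _ h0], rule conjI[OF h0(1)], rule conjI[OF h0(2)],
        rule exI[of _ ?U], rule conjI[OF nbh], rule exI[of _ d], rule conjI[OF d0],
        rule ballI, rule allI, rule impI, erule conjE, rule allI, rule impI, rule impI, rule allI, rule impI)
      (rule estimate; assumption)
qed

end
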